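(* Consider the fast–slow system $x'=f(x,y,\epsilon)$, $y'=\epsilon g(x,y,\epsilon)$ with $x\in\mathbb R^n$, $y\in\mathbb R$. Assume there exist $\rho\in\mathbb N$, $\epsilon_0>0$ and, for every $\epsilon\in[0,\epsilon_0]$, sets in $\mathbb R^{n+1}$: - $\mathcal S_\epsilon^j$ ($j=0,\dots,\rho$): a fast-saddle-type block such that $(\mathcal F_\epsilon^{j-1},\mathcal S_\epsilon^j)$ is a covering-exchange pair with time $T^{j-1}>0$ and with fast-exit face $\mathcal F_\epsilon^j$; - $\mathcal F_\epsilon^j$ ($j=0,\dots,\rho$): a fast-exit face of $\mathcal S_\epsilon^j$, where $\mathcal F_\epsilon^{-1}$ is identified with $\mathcal F_\epsilon^\rho$. Then: 1. For $\epsilon\in(0,\epsilon_0]$ the system admits a periodic orbit $\{\Gamma_\epsilon(t)\mid t\in\mathbb R\}$ with a sequence of positive numbers $0<t_f^0<t_s^1<t_f^1<\cdots<t_f^\rho<t_s^0\equiv T_\epsilon<\infty$ such that $\Gamma_\epsilon(T_\epsilon)=\Gamma_\epsilon(0)\in\mathcal F_\epsilon^0$; $\Gamma_\epsilon([t_f^j,t_s^{j+1}])\subset\mathcal S_\epsilon^{j+1}$ and $\Gamma_\epsilon(t_s^{j+1})\in\mathcal F_\epsilon^{j+1}$ for $j=0,\dots,\rho-1$; and $\Gamma_\epsilon([t_f^\rho,T_\epsilon])\subset\mathcal S_\epsilon^0$. 2. For $\epsilon=0$ the system admits a collection of heteroclinic orbits $\{\Gamma^j=\{x_{y_j}(t)\}_{t\in\mathbb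 R}\}_{j=0}^\rho$ (orbits of $x'=f(x,y_j,0)$, $y=y_j$ fixed) with $\lim_{t\to-\infty}x_{y_j}(t)=p_j\in\mathcal S_0^j$, $f(p_j,y_j,0)=0$ for $j=0,\dots,\rho$; $\lim_{t\to+\infty}x_{y_j}(t)=q_j\in\mathcal S_0^{j+1}$, $f(q_j,y_j,0)=0$ for $j=0,\dots,\rho-1$; $\lim_{t\to+\infty}x_{y_\rho}(t)=q_\rho\in\mathcal S_0^0$, $f(q_\rho,y_\rho,0)=0$; and $\Gamma^j\cap\mathcal F_0^j\ne\emptyset$ for $j=0,\dots,\rho$. These orbits bridge the $1$-dimensional normally hyperbolic invariant manifolds (curves of equilibria) $S_0^j\subset\mathcal S_0^j$ and $S_0^{j+1}\subset\mathcal S_0^{j+1}$ for $j=0,\dots,\rho-1$, and $S_0^\rho\subset\mathcal S_0^\rho$ and $S_0^0\subset\mathcal S_0^0$ for $j=\rho$.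
   Context: Standing: $f,g$ are $C^r$ with $f=f_0+\sum_{i=1}^m\epsilon^if_i+o(\epsilon^m)$, $g=g_0+\sum_{i=1}^m\epsilon^ig_i+o(\epsilon^m)$, $f_0,g_0\not\equiv0$; $\varphi_\epsilon$ is the flow. In item 2, "$p_j\in\mathcal S_0^j$" means $(p_j,y_j)\in\mathcal S_0^j$, similarly for $q_j$. h-sets and covering: $B_m$ is the open unit ball of $\mathbb R^m$, $B_0=\{0\}$, $\partial B_0=\emptyset$. An h-set is a compact $N\subset\mathbb R^m$ with integers $u(N),s(N)\ge0$, $u(N)+s(N)=\dim N\le m$, and a homeomorphism $c_N:\mathbb R^{\dim N}\to\mathbb R^{u(N)}\times\mathbb R^{s(N)}$ with $c_N(N)=N_c:=\overline{B_{u(N)}}\times\overline{B_{s(N)}}$; $N_c^-=\partial B_{u(N)}\times\overline{B_{s(N)}}$, $N_c^+=\overline{B_{u(N)}}\times\partial B_{s(N)}$, $N^\pm=c_N^{-1}(N_c^\pm)$. If $u(N)=u(M)=u$ and $F:N\to\mathbb R^{\dim M}$ is continuous, $F_c=c_M\circ F\circ c_N^{-1}$, then $N\overset{F}{\Longrightarrow}M$ ($N$ $F$-covers $M$) means: there is a homotopy $h:[0,1]\times N_c\to\mathbb R^u\times\mathbb R^{s(M)}$ with $h_0=F_c$, $h([0,1],N_c^-)\cap M_c=\emptyset$, $h([0,1],N_c)\cap M_c^+=\emptyset$, and a map $A:\mathbb R^u\to\mathbb R^u$ with $h_1(p,q)=(A(p),0)$, $A(\partial B_u)\subset\mathbb R^u\setminus\overline{B_u}$,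 $\deg(A,\overline{B_u},0)\ne0$. Local form: by an affine change $x\leftrightarrow(a,b)\in\mathbb R^{u+s}$ ($u+s=n$) the system reads $a'=Aa+F_1(a,b,y,\epsilon)$, $b'=Bb+F_2(a,b,y,\epsilon)$, $y'=\epsilon g$, $\eta'=0$, $\epsilon=\eta\sigma$, $\sigma=\epsilon_0$, $\eta\in[0,1]$, $A$, $B$ diagonal with eigenvalues of positive, resp. negative real part; $0<\lambda_A<\mathrm{Re}\,\lambda$ on $\mathrm{Spec}(A)$ and $0>\mu_B>\mathrm{Re}\,\mu$ on $\mathrm{Spec}(B)$. Fast-saddle-type block (real eigenvalues $\mu_j^a>0,\mu_j^b<0$): for compact $W\subset\mathbb R^n$, a compact interval $K$ and numbers with $\delta_{i,j}^-<F_{i,j}<\delta_{i,j}^+$ on $W\times K\times[0,\epsilon_0]$, put $D_c=\prod[a_j^-,a_j^+]\times\prod[b_j^-,b_j^+]\times K$, $a_j^\pm=-\delta_{1,j}^\mp/\mu_j^a$, $b_j^\pm=-\delta_{2,j}^\pm/\mu_j^b$ (possibly with each interval enlarged at its ends by positive amounts); $D_c$, or $D=c_D^{-1}(D_c)$ in original coordinates, is a fast-saddle-type block if $D\subset W\times K$. Its fast-exit $D^{f,-}$ is the part of the boundary with some $a_j\in\{a_j^\pm\}$; its fast-entrance $D^{f,+}$ the part with some $b_j\in\{b_j^\pm\}$. Cone conditions on a block $M$: $\sigma_\bullet$ is the maximal singular value, $\sup$ over $M\times[0,\epsilon_0]$. With $\mathbb A_1^u=\partial_aF_1$, $\mathbb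 A_2^u=(\partial_bF_1\ \partial_yF_1\ \partial_\eta F_1)$, $\mathbb B_1^u=\partial_aF_2$, $\mathbb B_2^u=(\partial_bF_2\ \partial_yF_2\ \partial_\eta F_2)$, $g_1^u=\partial_ag$, $g_2^u=(\partial_bg\ \partial_yg\ \partial_\eta g)$, the unstable cone condition is $\lambda_A-(\sup\sigma_{\mathbb A_1^u}+\sup\sigma_{\mathbb A_2^u})>0$ and $\lambda_A+|\mu_B|-\{\sup\sigma_{\mathbb A_1^u}+\sup\sigma_{\mathbb A_2^u}+\sup\sigma_{\mathbb B_1^u}+\sup\sigma_{\mathbb B_2^u}+\sigma(\sup\sigma_{g_1^u}+\sup\sigma_{g_2^u})\}>0$. With $\mathbb A_1^s=\partial_bF_1$, $\mathbb A_2^s=(\partial_aF_1\ \partial_yF_1\ \partial_\eta F_1)$, $\mathbb B_1^s=\partial_bF_2$, $\mathbb B_2^s=(\partial_aF_2\ \partial_yF_2\ \partial_\eta F_2)$, $g_1^s=\partial_bg$, $g_2^s=(\partial_ag\ \partial_yg\ \partial_\eta g)$, the stable cone condition is $|\mu_B|-(\sup\sigma_{\mathbb B_1^s}+\sup\sigma_{\mathbb B_2^s})>0$ and $\lambda_A+|\mu_B|-\{\sup\sigma_{\mathbb A_1^s}+\sup\sigma_{\mathbb A_2^s}+\sup\sigma_{\mathbb B_1^s}+\sup\sigma_{\mathbb B_2^s}+\sigma(\sup\sigma_{g_1^s}+\sup\sigma_{g_2^s})\}>0$. Fast-exit face: for an $(n+1)$-dimensional h-set $M$ with $c_M(M)=\overline{B_1}\times\overline{B_s}\times[0,1]$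 ($u(M)=1$ in direction $a$, $s(M)=s+1$), a fast-exit face is an h-set $M^a$ with $u(M^a)=1$ (direction $y$), $s(M^a)=s$ and $c_M(M^a)=\{a\}\times\overline{B_s}\times K_0$, $a\in\partial B_1$, $K_0\subset(0,1)$ a compact interval. Covering-exchange pair $(N,M)$ (for fixed $\epsilon$, with time $T>0$ and fast-exit face $M^a$): $N$ is an h-set with $u(N)=1$ and: (CE1) $M$ is a fast-saddle-type block with coordinates $M_c=\overline{B_1}\times\overline{B_s}\times[0,1]\ni(a,b,y)$, $u(M)=1$; (CE2) the stable and unstable cone conditions hold in $M$; (CE3) for some $q\in\{\pm1\}$, $q\cdot g(x,y,\epsilon)>0$ in $M$; (CE4) $N\overset{\varphi_\epsilon(T,\cdot)}{\Longrightarrow}M$; (CE5) $M$ has a fast-exit face $M^a\subset M^{f,-}$ with $c_M(M^a)=\{a\}\times\overline{B_s}\times[y^-,y^+]$, $[y^-,y^+]\subset(0,1)$, such that $\sup\pi_y(\varphi_\epsilon(T,N)\cap M)<y^-$ if $q=+1$, and $\inf\pi_y(\varphi_\epsilon(T,N)\cap M)>y^+$ if $q=-1$. $S_0^j$ is the curve of equilibria of $x'=f(x,y,0),\,y'=0$ in $\mathcal S_0^j$ (a graph over $y$); it is normally hyperbolic if the linearization at each of its points has exactly one eigenvalue on the imaginary axis. *)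

theory Defs
  imports
    "HOL-Homology.Homology"
    "HOL-Analysis.Analysis"
    "HOL-Library.Landau_Symbols"
    "HOL-Computational_Algebra.Polynomial"
begin

section \<open>The fast--slow system and its flow\<close>

text \<open>Phase space is \<open>(real^'n) \<times> real\<close>, with points \<open>(x, y)\<close>.\<close>

definition fs_field ::
  "(real^'n \<Rightarrow> real \<Rightarrow> real \<Rightarrow> real^'n) \<Rightarrow> (real^'n \<Rightarrow> real \<Rightarrow> real \<Rightarrow> real) \<Rightarrow> real
    \<Rightarrow> (real^'n) \<times> real \<Rightarrow> (real^'n) \<times> real" where
  "fs_field f g \<epsilon> = (\<lambda>(x, y). (f x y \<epsilon>, \<epsilon> * g x y \<epsilon>))"

text \<open>\<open>Ck_on k f S\<close>: \<open>f\<close> is of class \<open>C\<^sup>k\<close> on the \<^emph>\<open>open\<close> set \<open>S\<close>.\<close>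

primrec Ck_on ::
  "nat \<Rightarrow> ('a::real_normed_vector \<Rightarrow> 'b::real_normed_vector) \<Rightarrow> 'a set \<Rightarrow> bool" where
  "Ck_on 0 f S \<longleftrightarrow> continuous_on S f"
| "Ck_on (Suc k) f S \<longleftrightarrow>
     (\<forall>x\<in>S. f differentiable (at x)) \<and> (\<forall>v. Ck_on k (\<lambda>x. frechet_derivative f (at x) v) S)"

definition solves ::
  "('a::real_normed_vector \<Rightarrow> 'a) \<Rightarrow> (real \<Rightarrow> 'a) \<Rightarrow> real set \<Rightarrow> bool" where
  "solves V \<Gamma> J \<longleftrightarrow> (\<forall>t\<in>J. (\<Gamma> has_vector_derivative V (\<Gamma> t)) (at t within J))"

text \<open>
  The flow is only local: the vector field need not be complete.  \<open>flow V t z\<close> is meaningful when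
  \<open>flow_defined V t z\<close> holds and solutions are unique, as they are for \<open>C\<^sup>1\<close> fields.
\<close>

definition flow_rel :: "('a::real_normed_vector \<Rightarrow> 'a) \<Rightarrow> real \<Rightarrow> 'a \<Rightarrow> 'a \<Rightarrow> bool" where
  "flow_rel V t z w \<longleftrightarrow> (\<exists>\<Gamma>. solves V \<Gamma> (closed_segment 0 t) \<and> \<Gamma> 0 = z \<and> \<Gamma> t = w)"

definition flow_defined :: "('a::real_normed_vector \<Rightarrow> 'a) \<Rightarrow> real \<Rightarrow> 'a \<Rightarrow> bool" where
  "flow_defined V t z \<longleftrightarrow> (\<exists>w. flow_rel V t z w)"

definition flow :: "('a::real_normed_vector \<Rightarrow> 'a) \<Rightarrow> real \<Rightarrow> 'a \<Rightarrow> 'a" where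
  "flow V t z = (THE w. flow_rel V t z w)"

definition periodic_orbit ::
  "('a::real_normed_vector \<Rightarrow> 'a) \<Rightarrow> (real \<Rightarrow> 'a) \<Rightarrow> real \<Rightarrow> bool" where
  "periodic_orbit V \<Gamma> P \<longleftrightarrow>
     solves V \<Gamma> UNIV \<and> 0 < P \<and> (\<forall>t. \<Gamma> (t + P) = \<Gamma> t) \<and> (\<exists>t. \<Gamma> t \<noteq> \<Gamma> 0)"


section \<open>h-sets and covering relations\<close>

text \<open>
  Since the dimensions \<open>u\<close> and \<open>s\<close> vary (and may be \<open>0\<close>), \<open>R\<^sup>m\<close> is represented
  by the carrier of the library space \<open>Euclidean_space m\<close>, i.e. by the real sequences vanishing
  from index \<open>m\<close> on.  The topology is that of the function type.  With the definitions below
  \<open>ecball 0 = espace 0\<close> is a single point and \<open>esphere 0 = {}\<close>.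
\<close>

definition espace :: "nat \<Rightarrow> (nat \<Rightarrow> real) set" where
  "espace m = topspace (Euclidean_space m)"

definition enorm :: "nat \<Rightarrow> (nat \<Rightarrow> real) \<Rightarrow> real" where
  "enorm m p = sqrt (\<Sum>i<m. (p i)\<^sup>2)"

definition ecball :: "nat \<Rightarrow> (nat \<Rightarrow> real) set" where
  "ecball m = {p \<in> espace m. enorm m p \<le> 1}"

definition esphere :: "nat \<Rightarrow> (nat \<Rightarrow> real) set" where
  "esphere m = {p \<in> espace m. enorm m p = 1}"

text \<open>
  An h-set of dimension \<open>d = u + s\<close> in a space of dimension \<open>m \<ge> d\<close>.  The chart is a homeomorphism
  onto \<open>R\<^sup>u \<times> R\<^sup>s\<close> of a copy of \<open>R\<^sup>d\<close> containing the set; this copy, \<open>h_amb\<close>, is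
  the whole space when \<open>d = m\<close>.
\<close>

type_synonym hmodel = "(nat \<Rightarrow> real) \<times> (nat \<Rightarrow> real)"

record 'm hset =
  h_set :: "'m set"
  h_u :: nat
  h_s :: nat
  h_amb :: "'m set"
  h_chart :: "'m \<Rightarrow> hmodel"

definition h_space :: "('m, 'z) hset_scheme \<Rightarrow> hmodel set" where
  "h_space N = espace (h_u N) \<times> espace (h_s N)"

definition h_model :: "('m, 'z) hset_scheme \<Rightarrow> hmodel set" where
  "h_model N = ecball (h_u N) \<times> ecball (h_s N)"

definition h_model_minus :: "('m, 'z) hset_scheme \<Rightarrow> hmodel set" where
  "h_model_minus N = esphere (h_u N) \<times> ecball (h_s N)"

definition h_model_plus :: "('m, 'z) hset_scheme \<Rightarrow> hmodel set" where
  "h_model_plus N = ecball (h_u N) \<times> esphere (h_s N)"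

definition is_hset :: "('m::euclidean_space, 'z) hset_scheme \<Rightarrow> bool" where
  "is_hset N \<longleftrightarrow>
     compact (h_set N) \<and> h_set N \<subseteq> h_amb N \<and>
     h_u N + h_s N \<le> DIM('m) \<and>
     (h_u N + h_s N = DIM('m) \<longrightarrow> h_amb N = UNIV) \<and>
     (\<exists>d. homeomorphism (h_amb N) (h_space N) (h_chart N) d) \<and>
     h_chart N ` h_set N = h_model N"

text \<open>
  The degree \<open>deg (A, closed unit ball of R\<^sup>u, 0)\<close> of a map without zeros on the unit sphere: the
  library has the Brouwer degree of self-maps of spheres, and the degree of \<open>A\<close> over the ball is
  the degree of \<open>A / |A|\<close> on the boundary sphere \<open>nsphere (u - 1)\<close>.  For \<open>u = 0\<close> the
  boundary is empty, \<open>A\<close> is the identity of a point, and the degree is \<open>1\<close>.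
\<close>

definition ball_degree :: "nat \<Rightarrow> ((nat \<Rightarrow> real) \<Rightarrow> nat \<Rightarrow> real) \<Rightarrow> int" where
  "ball_degree u A =
     (if u = 0 then 1 else Brouwer_degree2 (u - 1) (\<lambda>p i. A p i / enorm u (A p)))"

definition covers ::
  "('m::euclidean_space, 'z) hset_scheme \<Rightarrow> ('m \<Rightarrow> 'k) \<Rightarrow> ('k::euclidean_space, 'w) hset_scheme \<Rightarrow> bool"
  where
  "covers N F M \<longleftrightarrow>
     is_hset N \<and> is_hset M \<and> h_u N = h_u M \<and>
     continuous_on (h_set N) F \<and> F ` h_set N \<subseteq> h_amb M \<and>
     (\<exists>(h :: real \<times> hmodel \<Rightarrow> hmodel) A.
        continuous_on ({0..1} \<times> h_model N) h \<and>
        h ` ({0..1} \<times> h_model N) \<subseteq> h_space M \<and>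
        (\<forall>p \<in> h_model N. h (0, p) = h_chart M (F (inv_into (h_amb N) (h_chart N) p))) \<and>
        h ` ({0..1} \<times> h_model_minus N) \<inter> h_model M = {} \<and>
        h ` ({0..1} \<times> h_model N) \<inter> h_model_plus M = {} \<and>
        continuous_on (espace (h_u N)) A \<and>
        A ` espace (h_u N) \<subseteq> espace (h_u N) \<and>
        (\<forall>(p, q) \<in> h_model N. h (1, (p, q)) = (A p, (\<lambda>_. 0))) \<and>
        A ` esphere (h_u N) \<subseteq> espace (h_u N) - ecball (h_u N) \<and>
        ball_degree (h_u N) A \<noteq> 0)"


section \<open>Fast-saddle-type blocks\<close>

text \<open>
  The affine change of fast variables is \<open>x = b_origin + b_frame *v z\<close>.  The splitting
  \<open>z = (a, b)\<close> is given by the set \<open>b_unst\<close> of unstable indices: \<open>a\<close> consists of the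
  \<open>z $ i\<close> with \<open>i \<in> b_unst\<close>, and \<open>b\<close> of the others (possibly none).  \<open>b_eig\<close> collects the
  diagonals of both \<open>A\<close> and \<open>B\<close>; \<open>b_lo, b_hi\<close> collect the bounds
  \<open>a\<^sub>j\<^sup>-, a\<^sub>j\<^sup>+, b\<^sub>j\<^sup>-, b\<^sub>j\<^sup>+\<close>, and \<open>K = [b_ylo, b_yhi]\<close>.
\<close>

record 'n fs_block =
  b_origin :: "real^'n"
  b_frame :: "real^'n^'n"
  b_unst :: "'n set"
  b_eig :: "real^'n"
  b_lo :: "real^'n"
  b_hi :: "real^'n"
  b_ylo :: real
  b_yhi :: real

definition fast_pos :: "('n, 'z) fs_block_scheme \<Rightarrow> real^'n \<Rightarrow> real^'n" where
  "fast_pos D z = b_origin D + b_frame D *v z"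

definition fast_coord :: "('n, 'z) fs_block_scheme \<Rightarrow> real^'n \<Rightarrow> real^'n" where
  "fast_coord D x = matrix_inv (b_frame D) *v (x - b_origin D)"

definition block_box :: "('n, 'z) fs_block_scheme \<Rightarrow> (real^'n) set" where
  "block_box D = {z. \<forall>i. b_lo D $ i \<le> z $ i \<and> z $ i \<le> b_hi D $ i}"

definition block_set :: "('n, 'z) fs_block_scheme \<Rightarrow> ((real^'n) \<times> real) set" where
  "block_set D = {(fast_pos D z, y) | z y. z \<in> block_box D \<and> y \<in> {b_ylo D..b_yhi D}}"

definition fast_exit :: "('n, 'z) fs_block_scheme \<Rightarrow> ((real^'n) \<times> real) set" where
  "fast_exit D = {(fast_pos D z, y) | z y. z \<in> block_box D \<and> y \<in> {b_ylo D..b_yhi D} \<and>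
     (\<exists>i \<in> b_unst D. z $ i = b_lo D $ i \<or> z $ i = b_hi D $ i)}"

text \<open>The remainder \<open>(F\<^sub>1, F\<^sub>2)\<close> in \<open>a' = A a + F\<^sub>1, b' = B b + F\<^sub>2\<close>, in local coordinates.\<close>

definition remainder ::
  "(real^'n \<Rightarrow> real \<Rightarrow> real \<Rightarrow> real^'n) \<Rightarrow> ('n, 'z) fs_block_scheme
    \<Rightarrow> real^'n \<Rightarrow> real \<Rightarrow> real \<Rightarrow> real^'n" where
  "remainder f D z y \<epsilon> =
     matrix_inv (b_frame D) *v f (fast_pos D z) y \<epsilon> - (\<chi> i. b_eig D $ i * z $ i)"

text \<open>
  The inequalities for \<open>b_lo, b_hi\<close> say that the intervals
  \<open>[- \<delta>\<^sup>+ / \<mu>\<^sup>a, - \<delta>\<^sup>- / \<mu>\<^sup>a]\<close> and \<open>[- \<delta>\<^sup>- / \<mu>\<^sup>b, - \<delta>\<^sup>+ / \<mu>\<^sup>b]\<close> are taken as they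
  are or enlarged at their ends.
\<close>

definition fast_saddle_block ::
  "(real^'n \<Rightarrow> real \<Rightarrow> real \<Rightarrow> real^'n) \<Rightarrow> real \<Rightarrow> ('n, 'z) fs_block_scheme \<Rightarrow> bool" where
  "fast_saddle_block f \<epsilon>0 D \<longleftrightarrow>
     invertible (b_frame D) \<and>
     (\<forall>i. if i \<in> b_unst D then b_eig D $ i > 0 else b_eig D $ i < 0) \<and>
     b_ylo D < b_yhi D \<and>
     (\<exists>W (\<delta>m::real^'n) (\<delta>p::real^'n).
        compact W \<and>
        (\<forall>x\<in>W. \<forall>y\<in>{b_ylo D..b_yhi D}. \<forall>\<epsilon>\<in>{0..\<epsilon>0}. \<forall>i.
           \<delta>m $ i < remainder f D (fast_coord D x) y \<epsilon> $ i \<and>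
           remainder f D (fast_coord D x) y \<epsilon> $ i < \<delta>p $ i) \<and>
        (\<forall>i\<in>b_unst D. b_lo D $ i \<le> - \<delta>p $ i / b_eig D $ i \<and> - \<delta>m $ i / b_eig D $ i \<le> b_hi D $ i) \<and>
        (\<forall>i. i \<notin> b_unst D \<longrightarrow>
           b_lo D $ i \<le> - \<delta>m $ i / b_eig D $ i \<and> - \<delta>p $ i / b_eig D $ i \<le> b_hi D $ i) \<and>
        block_set D \<subseteq> W \<times> {b_ylo D..b_yhi D})"


section \<open>Cone conditions\<close>

text \<open>The variables \<open>(a, b)\<close>, \<open>y\<close> and \<open>\<eta>\<close> of the extended local system.\<close>

datatype 'n var = Fast 'n | Slow | Eta

instance var :: (finite) finite
proof
  have "(UNIV :: 'a var set) = insert Slow (insert Eta (range Fast))"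
    by (auto intro: var.exhaust)
  then show "finite (UNIV :: 'a var set)"
    by (metis finite_code finite_imageI finite_insert)
qed

fun var_dir :: "'n var \<Rightarrow> (real^'n) \<times> real \<times> real" where
  "var_dir (Fast i) = (axis i 1, 0, 0)"
| "var_dir Slow = (0, 1, 0)"
| "var_dir Eta = (0, 0, 1)"

definition local_F ::
  "(real^'n \<Rightarrow> real \<Rightarrow> real \<Rightarrow> real^'n) \<Rightarrow> real \<Rightarrow> ('n, 'z) fs_block_scheme
    \<Rightarrow> (real^'n) \<times> real \<times> real \<Rightarrow> real^'n" where
  "local_F f \<sigma> D = (\<lambda>(z, y, \<eta>). remainder f D z y (\<eta> * \<sigma>))"

definition local_g ::
  "(real^'n \<Rightarrow> real \<Rightarrow> real \<Rightarrow> real) \<Rightarrow> real \<Rightarrow> ('n, 'z) fs_block_scheme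
    \<Rightarrow> (real^'n) \<times> real \<times> real \<Rightarrow> real" where
  "local_g g \<sigma> D = (\<lambda>(z, y, \<eta>). g (fast_pos D z) y (\<eta> * \<sigma>))"

text \<open>
  Blocks of the Jacobian with rows \<open>R\<close> and columns \<open>C\<close>.  All other entries are set to zero, which
  at most adds zero singular values.
\<close>

definition jac_F ::
  "(real^'n \<Rightarrow> real \<Rightarrow> real \<Rightarrow> real^'n) \<Rightarrow> real \<Rightarrow> ('n, 'z) fs_block_scheme
    \<Rightarrow> 'n set \<Rightarrow> 'n var set \<Rightarrow> (real^'n) \<times> real \<times> real \<Rightarrow> real^('n var)^'n" where
  "jac_F f \<sigma> D R C p = (\<chi> i v. if i \<in> R \<and> v \<in> C
     then frechet_derivative (local_F f \<sigma> D) (at p) (var_dir v) $ i else 0)"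

definition jac_g ::
  "(real^'n \<Rightarrow> real \<Rightarrow> real \<Rightarrow> real) \<Rightarrow> real \<Rightarrow> ('n, 'z) fs_block_scheme
    \<Rightarrow> 'n var set \<Rightarrow> (real^'n) \<times> real \<times> real \<Rightarrow> real^('n var)^1" where
  "jac_g g \<sigma> D C p = (\<chi> i v. if v \<in> C
     then frechet_derivative (local_g g \<sigma> D) (at p) (var_dir v) else 0)"

definition max_singular_value :: "real^'c^'r \<Rightarrow> real" where
  "max_singular_value M =
     Max {sqrt \<mu> | \<mu>. \<exists>v. v \<noteq> 0 \<and> (transpose M ** M) *v v = \<mu> *\<^sub>R v}"

text \<open>The block times the parameter range \<open>[0, \<epsilon>0]\<close>, written in the coordinates \<open>(z, y, \<eta>)\<close>.\<close>

definition local_dom :: "('n, 'z) fs_block_scheme \<Rightarrow> ((real^'n) \<times> real \<times> real) set" where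
  "local_dom D = {(z, y, \<eta>). (fast_pos D z, y) \<in> block_set D \<and> \<eta> \<in> {0..1}}"

definition sup_F ::
  "(real^'n \<Rightarrow> real \<Rightarrow> real \<Rightarrow> real^'n) \<Rightarrow> real \<Rightarrow> ('n, 'z) fs_block_scheme
    \<Rightarrow> 'n set \<Rightarrow> 'n var set \<Rightarrow> real" where
  "sup_F f \<sigma> D R C = (SUP p\<in>local_dom D. max_singular_value (jac_F f \<sigma> D R C p))"

definition sup_g ::
  "(real^'n \<Rightarrow> real \<Rightarrow> real \<Rightarrow> real) \<Rightarrow> real \<Rightarrow> ('n, 'z) fs_block_scheme
    \<Rightarrow> 'n var set \<Rightarrow> real" where
  "sup_g g \<sigma> D C = (SUP p\<in>local_dom D. max_singular_value (jac_g g \<sigma> D C p))"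

definition spectral_bounds :: "('n::finite, 'z) fs_block_scheme \<Rightarrow> real \<Rightarrow> real \<Rightarrow> bool" where
  "spectral_bounds D lA mB \<longleftrightarrow>
     0 < lA \<and> (\<forall>i\<in>b_unst D. lA < b_eig D $ i) \<and>
     mB < 0 \<and> (\<forall>i. i \<notin> b_unst D \<longrightarrow> b_eig D $ i < mB)"

definition unstable_cone_condition ::
  "(real^'n \<Rightarrow> real \<Rightarrow> real \<Rightarrow> real^'n) \<Rightarrow> (real^'n \<Rightarrow> real \<Rightarrow> real \<Rightarrow> real) \<Rightarrow> real
    \<Rightarrow> ('n, 'z) fs_block_scheme \<Rightarrow> real \<Rightarrow> real \<Rightarrow> bool" where
  "unstable_cone_condition f g \<sigma> D lA mB \<longleftrightarrow>
     (let U = b_unst D; C1 = Fast ` U; C2 = - C1;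
          A1 = sup_F f \<sigma> D U C1; A2 = sup_F f \<sigma> D U C2;
          B1 = sup_F f \<sigma> D (- U) C1; B2 = sup_F f \<sigma> D (- U) C2;
          g1 = sup_g g \<sigma> D C1; g2 = sup_g g \<sigma> D C2
      in lA - (A1 + A2) > 0 \<and>
         lA + \<bar>mB\<bar> - (A1 + A2 + B1 + B2 + \<sigma> * (g1 + g2)) > 0)"

definition stable_cone_condition ::
  "(real^'n \<Rightarrow> real \<Rightarrow> real \<Rightarrow> real^'n) \<Rightarrow> (real^'n \<Rightarrow> real \<Rightarrow> real \<Rightarrow> real) \<Rightarrow> real
    \<Rightarrow> ('n, 'z) fs_block_scheme \<Rightarrow> real \<Rightarrow> real \<Rightarrow> bool" where
  "stable_cone_condition f g \<sigma> D lA mB \<longleftrightarrow>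
     (let U = b_unst D; C1 = Fast ` (- U); C2 = - C1;
          A1 = sup_F f \<sigma> D U C1; A2 = sup_F f \<sigma> D U C2;
          B1 = sup_F f \<sigma> D (- U) C1; B2 = sup_F f \<sigma> D (- U) C2;
          g1 = sup_g g \<sigma> D C1; g2 = sup_g g \<sigma> D C2
      in \<bar>mB\<bar> - (B1 + B2) > 0 \<and>
         lA + \<bar>mB\<bar> - (A1 + A2 + B1 + B2 + \<sigma> * (g1 + g2)) > 0)"


section \<open>Covering-exchange pairs\<close>

text \<open>
  \<open>block_coords D \<kappa>\<close>: \<open>\<kappa>\<close> is a coordinate system \<open>(a, b, y)\<close> in which the block becomes
  \<open>closed ball of R\<^sup>u \<times> closed ball of R\<^sup>s \<times> [0, 1]\<close>.  It rescales the variables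
  \<open>a\<close>, \<open>b\<close> and \<open>y\<close> separately, the last one with its orientation.
\<close>

definition coord_subspace :: "'n set \<Rightarrow> (real^'n) set" where
  "coord_subspace I = {z. \<forall>i. i \<notin> I \<longrightarrow> z $ i = 0}"

definition coord_proj :: "'n set \<Rightarrow> real^'n \<Rightarrow> real^'n" where
  "coord_proj I z = (\<chi> i. if i \<in> I then z $ i else 0)"

definition block_coords ::
  "('n::finite, 'z) fs_block_scheme
    \<Rightarrow> ((real^'n) \<times> real \<Rightarrow> (nat \<Rightarrow> real) \<times> (nat \<Rightarrow> real) \<times> real) \<Rightarrow> bool" where
  "block_coords D \<kappa> \<longleftrightarrow>
     (\<exists>\<alpha> \<alpha>' \<beta> \<beta>' \<upsilon> \<upsilon>'.
        homeomorphism (coord_subspace (b_unst D)) (espace (card (b_unst D))) \<alpha> \<alpha>' \<and>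
        \<alpha> ` (coord_proj (b_unst D) ` block_box D) = ecball (card (b_unst D)) \<and>
        homeomorphism (coord_subspace (- b_unst D)) (espace (card (- b_unst D))) \<beta> \<beta>' \<and>
        \<beta> ` (coord_proj (- b_unst D) ` block_box D) = ecball (card (- b_unst D)) \<and>
        homeomorphism UNIV UNIV \<upsilon> \<upsilon>' \<and> strict_mono \<upsilon> \<and>
        \<upsilon> ` {b_ylo D..b_yhi D} = {0..1::real} \<and>
        (\<forall>x y. \<kappa> (x, y) = (\<alpha> (coord_proj (b_unst D) (fast_coord D x)),
                            \<beta> (coord_proj (- b_unst D) (fast_coord D x)), \<upsilon> y)))"

text \<open>
  As an h-set, the block has \<open>s(M) = s + 1\<close>; the stable factor \<open>closed ball of R\<^sup>s \<times> [0, 1]\<close> is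
  identified with the closed ball of \<open>R\<^sup>s\<^sup>+\<^sup>1\<close> by a homeomorphism \<open>\<psi>\<close>.
\<close>

definition cylinder_homeo :: "nat \<Rightarrow> ((nat \<Rightarrow> real) \<times> real \<Rightarrow> (nat \<Rightarrow> real)) \<Rightarrow> bool" where
  "cylinder_homeo s \<psi> \<longleftrightarrow>
     (\<exists>\<psi>'. homeomorphism (espace s \<times> UNIV) (espace (Suc s)) \<psi> \<psi>') \<and>
     \<psi> ` (ecball s \<times> {0..1}) = ecball (Suc s)"

definition block_hset ::
  "('n::finite, 'z) fs_block_scheme
    \<Rightarrow> ((real^'n) \<times> real \<Rightarrow> (nat \<Rightarrow> real) \<times> (nat \<Rightarrow> real) \<times> real)
    \<Rightarrow> ((nat \<Rightarrow> real) \<times> real \<Rightarrow> (nat \<Rightarrow> real)) \<Rightarrow> ((real^'n) \<times> real) hset" where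
  "block_hset D \<kappa> \<psi> =
     \<lparr>h_set = block_set D, h_u = card (b_unst D), h_s = Suc (card (- b_unst D)), h_amb = UNIV,
      h_chart = (\<lambda>w. case \<kappa> w of (a, b, y) \<Rightarrow> (a, \<psi> (b, y)))\<rparr>"

text \<open>
  \<open>is_exit_face D \<kappa> ym yp Ma\<close>: \<open>Ma\<close> is a fast-exit face of the block with \<open>K\<^sub>0 = [ym, yp]\<close>.  Its
  unstable coordinate is \<open>y\<close>, rescaled affinely from \<open>[ym, yp]\<close> to the closed unit ball
  \<open>[-1, 1]\<close> of \<open>R\<^sup>1\<close>, and its stable coordinate is \<open>b\<close>.
\<close>

definition is_exit_face ::
  "('n::finite, 'z) fs_block_scheme
    \<Rightarrow> ((real^'n) \<times> real \<Rightarrow> (nat \<Rightarrow> real) \<times> (nat \<Rightarrow> real) \<times> real)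
    \<Rightarrow> real \<Rightarrow> real \<Rightarrow> ((real^'n) \<times> real) hset \<Rightarrow> bool" where
  "is_exit_face D \<kappa> ym yp Ma \<longleftrightarrow>
     0 < ym \<and> ym < yp \<and> yp < 1 \<and>
     is_hset Ma \<and> h_u Ma = 1 \<and> h_s Ma = card (- b_unst D) \<and>
     h_set Ma \<subseteq> fast_exit D \<and>
     (\<exists>a \<in> esphere 1.
        h_set Ma = {w. \<kappa> w \<in> {a} \<times> ecball (card (- b_unst D)) \<times> {ym..yp}} \<and>
        h_amb Ma = {w. fst (\<kappa> w) = a} \<and>
        (\<forall>w \<in> h_amb Ma. h_chart Ma w =
           (case \<kappa> w of (_, b, y) \<Rightarrow> ((\<lambda>i. if i = 0 then (2 * y - ym - yp) / (yp - ym) else 0), b))))"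

text \<open>
  \<open>(N, M)\<close> is a covering-exchange pair for the given \<open>\<epsilon>\<close>, with time \<open>T\<close> and fast-exit face \<open>Ma\<close>.
  The conditions on \<open>\<pi>\<^sub>y\<close> refer to the \<open>y\<close>-coordinate of \<open>\<kappa>\<close>, which ranges over \<open>[0, 1]\<close> in the block.
\<close>

definition covering_exchange_pair ::
  "(real^'n::finite \<Rightarrow> real \<Rightarrow> real \<Rightarrow> real^'n) \<Rightarrow> (real^'n \<Rightarrow> real \<Rightarrow> real \<Rightarrow> real)
    \<Rightarrow> real \<Rightarrow> real \<Rightarrow> real \<Rightarrow> ((real^'n) \<times> real) hset \<Rightarrow> 'n fs_block
    \<Rightarrow> ((real^'n) \<times> real) hset \<Rightarrow> bool" where
  "covering_exchange_pair f g \<epsilon>0 \<epsilon> T N M Ma \<longleftrightarrow>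
     0 < T \<and> is_hset N \<and> h_u N = 1 \<and>
     fast_saddle_block f \<epsilon>0 M \<and> card (b_unst M) = 1 \<and>
     (\<exists>lA mB. spectral_bounds M lA mB \<and>
        unstable_cone_condition f g \<epsilon>0 M lA mB \<and> stable_cone_condition f g \<epsilon>0 M lA mB) \<and>
     (\<exists>\<kappa> \<psi> ym yp. \<exists>q \<in> {1, -1::real}.
        block_coords M \<kappa> \<and> cylinder_homeo (card (- b_unst M)) \<psi> \<and>
        (\<forall>(x, y) \<in> block_set M. q * g x y \<epsilon> > 0) \<and>
        (\<forall>w \<in> h_set N. flow_defined (fs_field f g \<epsilon>) T w) \<and>
        covers N (flow (fs_field f g \<epsilon>) T) (block_hset M \<kappa> \<psi>) \<and>
        is_exit_face M \<kappa> ym yp Ma \<and>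
        (let Y = (\<lambda>w. snd (snd (\<kappa> w))) ` (flow (fs_field f g \<epsilon>) T ` h_set N \<inter> block_set M)
         in (q = 1 \<longrightarrow> Sup Y < ym) \<and> (q = -1 \<longrightarrow> Inf Y > yp)))"


section \<open>Normally hyperbolic curves of equilibria\<close>

definition slow_curve ::
  "(real^'n \<Rightarrow> real \<Rightarrow> real \<Rightarrow> real^'n) \<Rightarrow> ('n, 'z) fs_block_scheme \<Rightarrow> ((real^'n) \<times> real) set" where
  "slow_curve f D = {(x, y) \<in> block_set D. f x y 0 = 0}"

fun state_dir :: "'n option \<Rightarrow> (real^'n) \<times> real" where
  "state_dir (Some i) = (axis i 1, 0)"
| "state_dir None = (0, 1)"

definition jacobian ::
  "((real^'n) \<times> real \<Rightarrow> (real^'n) \<times> real) \<Rightarrow> (real^'n) \<times> real \<Rightarrow> real^('n option)^('n option)" where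
  "jacobian V w = (\<chi> i j. frechet_derivative V (at w) (state_dir j) \<bullet> state_dir i)"

definition char_polynomial :: "real^'m^'m \<Rightarrow> complex poly" where
  "char_polynomial M = det (\<chi> i j. (if i = j then [:0, 1:] else 0) - [:complex_of_real (M $ i $ j):])"

text \<open>Eigenvalues are counted with algebraic multiplicity.\<close>

definition normally_hyperbolic_at ::
  "((real^'n) \<times> real \<Rightarrow> (real^'n) \<times> real) \<Rightarrow> (real^'n) \<times> real \<Rightarrow> bool" where
  "normally_hyperbolic_at V w \<longleftrightarrow>
     (let p = char_polynomial (jacobian V w)
      in (\<Sum>l | Re l = 0 \<and> poly p l = 0. Polynomial.order l p) = 1)"

text \<open>
  The equilibria of \<open>x' = f(x, y, 0), y' = 0\<close> in the block form a \<open>C\<^sup>1\<close> curve, a graph over the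
  \<open>y\<close>-interval of the block, which is normally hyperbolic.
\<close>

definition normally_hyperbolic_slow_curve ::
  "(real^'n \<Rightarrow> real \<Rightarrow> real \<Rightarrow> real^'n) \<Rightarrow> (real^'n \<Rightarrow> real \<Rightarrow> real \<Rightarrow> real)
    \<Rightarrow> ('n, 'z) fs_block_scheme \<Rightarrow> bool" where
  "normally_hyperbolic_slow_curve f g D \<longleftrightarrow>
     (\<exists>h. h C1_differentiable_on {b_ylo D..b_yhi D} \<and>
          slow_curve f D = (\<lambda>y. (h y, y)) ` {b_ylo D..b_yhi D}) \<and>
     (\<forall>w \<in> slow_curve f D. normally_hyperbolic_at (fs_field f g 0) w)"


section \<open>Cyclic indexing\<close>

definition cyc_pred :: "nat \<Rightarrow> nat \<Rightarrow> nat" where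
  "cyc_pred \<rho> j = (if j = 0 then \<rho> else j - 1)"

definition cyc_succ :: "nat \<Rightarrow> nat \<Rightarrow> nat" where
  "cyc_succ \<rho> j = (if j = \<rho> then 0 else j + 1)"

end

theory Submission
  imports Defs
begin

text \<open>
  Everything is reduced to the theorem of Poincare and Miranda.  Since all unstable dimensions are
  one, a covering relation \<open>N \<Longrightarrow> M\<close> followed by a function \<open>\<phi>\<close> on \<open>M\<close> that is \<open>-1\<close> and \<open>1\<close> on the
  two components of \<open>M\<^sup>-\<close> lifts to a continuous function of the unstable coordinate of \<open>N\<close> which has
  opposite signs at its ends, and a zero of this function is a point of \<open>N\<close> that is mapped into \<open>M\<close>
  with \<open>\<phi> = 0\<close>.

  For \<open>\<epsilon> > 0\<close> the slow variable drifts monotonically through a block, so one waits for a time \<open>t\<close>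
  and lets \<open>\<phi>\<close> compare the unstable coordinate at time \<open>t\<close> with its value on the exit face.  A point
  of every exit face and a waiting time in every block are then unknowns of a system of equations
  with the sign pattern of Poincare--Miranda, and a solution closes up to a periodic orbit.  No
  exit times are needed, as an orbit that passed through a fast-exit face cannot return to it.

  For \<open>\<epsilon> = 0\<close> the same argument gives, for every \<open>k\<close>, a point of the exit face whose backward orbit
  stays in its block and whose forward orbit stays in the next one after time \<open>T\<close>, both for the
  time \<open>k\<close>; compactness allows \<open>k = \<infinity>\<close>.  The cone conditions imply that two solutions in the block
  with the same slow variable separate exponentially unless their difference stays in the stable
  cone, where it decays.  Hence such a trapped orbit converges to the equilibrium, which exists by
  Poincare--Miranda, and the same estimate for the linearisation excludes imaginary eigenvalues.
\<close>

text \<open>The obstacle is that the flow is only local, while the equations have to be defined for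
  all values of the unknowns, also for those whose orbit would leave a block. In each block the
  local field is therefore composed with the retraction onto the box (\<open>lhat\<close>). The
  result agrees with the given field on the box, but is bounded and globally Lipschitz, so all its
  orbits exist. Beyond an unstable face it pushes outwards with a fixed minimal speed, and stable
  faces cannot be crossed outwards. Hence end conditions at the final time already confine the orbit
  to the box at all earlier times, and at a solution of the equations the orbit of
  \<open>lhat\<close> is one of the system itself. Opposite signs at the two ends of
  \<open>N\<close> come from the degree: in dimension one a nonzero degree means that
  \<open>A\<close> has opposite signs at -1 and 1. The separation of slow coordinates in a
  covering-exchange pair confines the waiting time between two positive bounds: before the first no
  orbit can have drifted to the exit face, after the second none can still be ahead of it.\<close>

section \<open>The theorem of Poincare and Miranda\<close>

lemma finite_box_convergent_subsequence:
  fixes X :: "nat \<Rightarrow> nat \<Rightarrow> real"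
  assumes "\<And>k i. X k i \<in> {0..1}"
  shows "\<exists>r l. strict_mono (r :: nat \<Rightarrow> nat) \<and> (\<forall>i<n. (\<lambda>k. X (r k) i) \<longlonglongrightarrow> l i)"
proof (induction n)
  case 0
  show ?case by (auto intro!: exI[of _ id] simp: strict_mono_id)
next
  case (Suc n)
  then obtain r l where r: "strict_mono r" "\<And>i. i < n \<Longrightarrow> (\<lambda>k. X (r k) i) \<longlonglongrightarrow> l i"
    by blast
  have "compact {0..1::real}" by simp
  then have sc: "seq_compact {0..1::real}" by (simp add: compact_imp_seq_compact)
  have "\<forall>k. X (r k) n \<in> {0..1}" using assms by blast
  with sc obtain l' r' where r': "strict_mono r'" "((\<lambda>k. X (r k) n) \<circ> r') \<longlonglongrightarrow> l'"
    unfolding seq_compact_def by (metis (no_types, lifting) )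
  have "strict_mono (r \<circ> r')" using r(1) r'(1) by (rule strict_mono_o)
  moreover have "(\<lambda>k. X ((r \<circ> r') k) i) \<longlonglongrightarrow> (l(n := l')) i" if "i < Suc n" for i
  proof (cases "i = n")
    case True
    then show ?thesis using r'(2) by (simp add: o_def)
  next
    case False
    then have "i < n" using that by simp
    then show ?thesis
      using LIMSEQ_subseq_LIMSEQ[OF r(2) r'(1)] by (simp add: o_def)
  qed
  ultimately show ?case by blast
qed

lemma tendsto_fun_componentwise:
  fixes f :: "'b \<Rightarrow> 'i \<Rightarrow> 'a::topological_space"
  shows "(f \<longlongrightarrow> l) F \<longleftrightarrow> (\<forall>i. ((\<lambda>c. f c i) \<longlongrightarrow> l i) F)"
  using limitin_componentwise[of "\<lambda>_. euclidean" "UNIV :: 'i set" f l F]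
  by (simp add: euclidean_product_topology)

text \<open>Kuhn's combinatorial lemma on the grid of mesh \<open>1 / Suc k\<close>, labelled by the
  signs of \<open>F\<close>, gives for every \<open>k\<close> one cell that has, for each coordinate
  \<open>i\<close>, a vertex with \<open>F x i \<le> 0\<close> and one with
  \<open>F x i \<ge> 0\<close>. Along a subsequence the cells shrink to a point, where all
  components vanish.\<close>

lemma poincare_miranda_cube:
  fixes F :: "(nat \<Rightarrow> real) \<Rightarrow> nat \<Rightarrow> real" and n :: nat
  defines "Q \<equiv> {x. (\<forall>i<n. x i \<in> {0..1}) \<and> (\<forall>i\<ge>n. x i = 0)}"
  assumes cont: "\<And>i. i < n \<Longrightarrow> continuous_on Q (\<lambda>x. F x i)"
    and lo: "\<And>x i. x \<in> Q \<Longrightarrow> i < n \<Longrightarrow> x i = 0 \<Longrightarrow> F x i \<le> 0"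
    and hi: "\<And>x i. x \<in> Q \<Longrightarrow> i < n \<Longrightarrow> x i = 1 \<Longrightarrow> F x i \<ge> 0"
  shows "\<exists>x\<in>Q. \<forall>i<n. F x i = 0"
proof -
  define pt :: "nat \<Rightarrow> (nat \<Rightarrow> nat) \<Rightarrow> nat \<Rightarrow> real"
    where "pt k x = (\<lambda>i. if i < n then real (x i) / real (Suc k) else 0)" for k x
  have ptQ: "pt k x \<in> Q" if "\<forall>i<n. x i \<le> Suc k" for k x
    using that by (auto simp: pt_def Q_def divide_le_eq_1)
  \<comment> \<open>Kuhn's lemma demands label 0 at \<open>x i = 0\<close> and label 1 at
    \<open>x i = Suc k\<close>, so these two faces are labelled by position, whatever the sign of
    \<open>F\<close>; there the hypotheses \<open>lo\<close> and \<open>hi\<close> supply the weak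
    inequality.\<close>
  define lab :: "nat \<Rightarrow> (nat \<Rightarrow> nat) \<Rightarrow> nat \<Rightarrow> nat"
    where "lab k x i = (if x i \<noteq> 0 \<and> (x i = Suc k \<or> F (pt k x) i > 0) then 1 else 0)" for k x i
  have "\<exists>q r s. (\<forall>i<n. q i < Suc k) \<and>
      (\<forall>i<n. (\<forall>j<n. q j \<le> r i j \<and> r i j \<le> q j + 1) \<and> (\<forall>j<n. q j \<le> s i j \<and> s i j \<le> q j + 1)
        \<and> F (pt k (r i)) i \<le> 0 \<and> F (pt k (s i)) i \<ge> 0)" for k
  proof -
    have "0 < Suc k" by simp
    obtain q where q: "\<forall>i<n. q i < Suc k"
      and rs: "\<forall>i<n. \<exists>r s. (\<forall>j<n. q j \<le> r j \<and> r j \<le> q j + 1) \<and>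
        (\<forall>j<n. q j \<le> s j \<and> s j \<le> q j + 1) \<and> lab k r i \<noteq> lab k s i"
      by (rule kuhn_lemma[of "Suc k" n "lab k"]) (auto simp: lab_def)
    have "\<exists>r s. (\<forall>j<n. q j \<le> r j \<and> r j \<le> q j + 1) \<and> (\<forall>j<n. q j \<le> s j \<and> s j \<le> q j + 1)
        \<and> F (pt k r) i \<le> 0 \<and> F (pt k s) i \<ge> 0" if i: "i < n" for i
    proof -
      have sgn: "(lab k x i = 0 \<longrightarrow> F (pt k x) i \<le> 0) \<and> (lab k x i \<noteq> 0 \<longrightarrow> F (pt k x) i \<ge> 0)"
        if "\<forall>j<n. q j \<le> x j \<and> x j \<le> q j + 1" for x
      proof -
        have "pt k x \<in> Q" using that q by (intro ptQ) (metis Suc_eq_plus1 Suc_leI le_trans)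
        moreover have "pt k x i = 0" if "x i = 0" using that by (simp add: pt_def)
        moreover have "pt k x i = 1" if "x i = Suc k" using that i by (simp add: pt_def)
        ultimately show ?thesis using lo[of "pt k x" i] hi[of "pt k x" i] i
          by (auto simp: lab_def split: if_splits)
      qed
      obtain r s where "\<forall>j<n. q j \<le> r j \<and> r j \<le> q j + 1" "\<forall>j<n. q j \<le> s j \<and> s j \<le> q j + 1"
        "lab k r i \<noteq> lab k s i" using rs i by blast
      moreover have "lab k x i \<in> {0, 1}" for x by (simp add: lab_def)
      ultimately have "(lab k r i = 0 \<and> lab k s i \<noteq> 0) \<or> (lab k s i = 0 \<and> lab k r i \<noteq> 0)"
        by (metis insert_iff singletonD)
      then show ?thesis
        using sgn[of r] sgn[of s] \<open>\<forall>j<n. q j \<le> r j \<and> r j \<le> q j + 1\<close>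
          \<open>\<forall>j<n. q j \<le> s j \<and> s j \<le> q j + 1\<close> by blast
    qed
    then have "\<forall>i. \<exists>r s. i < n \<longrightarrow> (\<forall>j<n. q j \<le> r j \<and> r j \<le> q j + 1) \<and>
        (\<forall>j<n. q j \<le> s j \<and> s j \<le> q j + 1) \<and> F (pt k r) i \<le> 0 \<and> F (pt k s) i \<ge> 0"
      by blast
    from choice[OF this] obtain r where
      "\<forall>i. \<exists>s. i < n \<longrightarrow> (\<forall>j<n. q j \<le> r i j \<and> r i j \<le> q j + 1) \<and>
        (\<forall>j<n. q j \<le> s j \<and> s j \<le> q j + 1) \<and> F (pt k (r i)) i \<le> 0 \<and> F (pt k s) i \<ge> 0"
      by blast
    from choice[OF this] obtain s where
      "\<forall>i. i < n \<longrightarrow> (\<forall>j<n. q j \<le> r i j \<and> r i j \<le> q j + 1) \<and>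
        (\<forall>j<n. q j \<le> s i j \<and> s i j \<le> q j + 1) \<and> F (pt k (r i)) i \<le> 0 \<and> F (pt k (s i)) i \<ge> 0"
      by blast
    then show ?thesis using q by blast
  qed
  then obtain q r s where q: "\<And>k i. i < n \<Longrightarrow> q k i < Suc k"
    and r: "\<And>k i j. i < n \<Longrightarrow> j < n \<Longrightarrow> q k j \<le> r k i j \<and> r k i j \<le> q k j + 1"
    and s: "\<And>k i j. i < n \<Longrightarrow> j < n \<Longrightarrow> q k j \<le> s k i j \<and> s k i j \<le> q k j + 1"
    and F: "\<And>k i. i < n \<Longrightarrow> F (pt k (r k i)) i \<le> 0 \<and> F (pt k (s k i)) i \<ge> 0"
    by metis
  have "pt k (q k) \<in> Q" for k by (rule ptQ) (use q in \<open>auto intro: less_imp_le\<close>)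
  then have "pt k (q k) i \<in> {0..1}" for k i by (cases "i < n") (auto simp: Q_def)
  from finite_box_convergent_subsequence[of "\<lambda>k. pt k (q k)", OF this] obtain \<rho> l0 where
    \<rho>: "strict_mono \<rho>" and l0: "\<And>i. i < n \<Longrightarrow> (\<lambda>k. pt (\<rho> k) (q (\<rho> k)) i) \<longlonglongrightarrow> l0 i"
    by blast
  define l where "l = (\<lambda>i. if i < n then l0 i else 0)"
  have lQ: "l \<in> Q"
  proof -
    have "l i \<in> {0..1}" if "i < n" for i
      using closed_sequentially[of "{0..1::real}", OF _ _ l0[OF that]] that
        \<open>\<And>k i. pt k (q k) i \<in> {0..1}\<close> by (simp add: l_def)
    then show ?thesis by (simp add: Q_def l_def)
  qed
  have conv: "(\<lambda>k. F (pt (\<rho> k) (x (\<rho> k))) i) \<longlonglongrightarrow> F l i"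
    if i: "i < n" and x: "\<And>k j. j < n \<Longrightarrow> q k j \<le> x k j \<and> x k j \<le> q k j + 1" for x i
  proof -
    have "(\<lambda>k. pt (\<rho> k) (x (\<rho> k)) j) \<longlonglongrightarrow> l j" for j
    proof (cases "j < n")
      case True
      have "(\<lambda>k. pt (\<rho> k) (x (\<rho> k)) j - pt (\<rho> k) (q (\<rho> k)) j) \<longlonglongrightarrow> 0"
      proof (rule Lim_null_comparison)
        show "(\<lambda>k. inverse (real (Suc (\<rho> k)))) \<longlonglongrightarrow> 0"
          using LIMSEQ_subseq_LIMSEQ[OF LIMSEQ_inverse_real_of_nat \<rho>] by (simp add: o_def)
        show "\<forall>\<^sub>F k in sequentially. norm (pt (\<rho> k) (x (\<rho> k)) j - pt (\<rho> k) (q (\<rho> k)) j)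
            \<le> inverse (real (Suc (\<rho> k)))"
        proof (rule always_eventually, rule allI)
          fix k
          have "q (\<rho> k) j \<le> x (\<rho> k) j" "x (\<rho> k) j \<le> q (\<rho> k) j + 1" using x[OF True, of "\<rho> k"] by auto
          then have "real (q (\<rho> k) j) \<le> real (x (\<rho> k) j)" "real (x (\<rho> k) j) \<le> real (q (\<rho> k) j) + 1"
            by linarith+
          then show "norm (pt (\<rho> k) (x (\<rho> k)) j - pt (\<rho> k) (q (\<rho> k)) j) \<le> inverse (real (Suc (\<rho> k)))"
            using True by (simp add: pt_def diff_divide_distrib[symmetric] divide_simps del: of_nat_Suc)
        qed
      qed
      from tendsto_add[OF this l0[OF True]] show ?thesis using True by (simp add: l_def)
    qed (simp add: pt_def l_def)
    then have lim: "(\<lambda>k. pt (\<rho> k) (x (\<rho> k))) \<longlonglongrightarrow> l"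
      by (simp add: tendsto_fun_componentwise)
    have "pt (\<rho> k) (x (\<rho> k)) \<in> Q" for k
      using x q by (intro ptQ) (metis Suc_eq_plus1 Suc_leI le_trans)
    then show ?thesis using cont[OF i] lim lQ
      by (auto simp: continuous_on_sequentially o_def)
  qed
  have "F l i = 0" if "i < n" for i
  proof -
    have "F l i \<le> 0" by (rule LIMSEQ_le_const2[OF conv[OF that, of "\<lambda>k. r k i"]]) (use r F that in auto)
    moreover have "F l i \<ge> 0"
      by (rule LIMSEQ_le_const[OF conv[OF that, of "\<lambda>k. s k i"]]) (use s F that in auto)
    ultimately show ?thesis by simp
  qed
  then show ?thesis using lQ by blast
qed

text \<open>Affine rescaling of the cube along an enumeration of \<open>J\<close>. With an arbitrary
  finite index set the unknowns of a chain can be labelled by block and role instead of being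
  numbered.\<close>

theorem poincare_miranda:
  fixes F :: "('i \<Rightarrow> real) \<Rightarrow> 'i \<Rightarrow> real" and l u :: "'i \<Rightarrow> real" and J :: "'i set"
  defines "Q \<equiv> {x. \<forall>i\<in>J. x i \<in> {l i..u i}}"
  assumes "finite J" and lu: "\<And>i. i \<in> J \<Longrightarrow> l i < u i"
    and cont: "\<And>i. i \<in> J \<Longrightarrow> continuous_on Q (\<lambda>x. F x i)"
    and lo: "\<And>x i. x \<in> Q \<Longrightarrow> i \<in> J \<Longrightarrow> x i = l i \<Longrightarrow> F x i \<le> 0"
    and hi: "\<And>x i. x \<in> Q \<Longrightarrow> i \<in> J \<Longrightarrow> x i = u i \<Longrightarrow> F x i \<ge> 0"
  shows "\<exists>x\<in>Q. \<forall>i\<in>J. F x i = 0"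
proof -
  obtain e where e: "bij_betw e {..<card J} J"
    using \<open>finite J\<close> bij_betw_from_nat_into_finite by blast
  define e' where "e' = inv_into {..<card J} e"
  have e': "e' i < card J" "e (e' i) = i" if "i \<in> J" for i
    using that bij_betw_inv_into_right[OF e that] bij_betwE[OF bij_betw_inv_into[OF e]]
    unfolding e'_def by blast+
  have eJ: "e k \<in> J" if "k < card J" for k using e that bij_betwE by blast
  have e'e: "e' (e k) = k" if "k < card J" for k
    using bij_betw_inv_into_left[OF e] that by (simp add: e'_def)
  define X where "X t = (\<lambda>i. l i + (u i - l i) * t (e' i))" for t :: "nat \<Rightarrow> real"
  let ?C = "{t. (\<forall>k<card J. t k \<in> {0..1}) \<and> (\<forall>k\<ge>card J. t k = 0)} :: (nat \<Rightarrow> real) set"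
  have XQ: "X t \<in> Q" if "t \<in> ?C" for t
  proof -
    have "X t i \<in> {l i..u i}" if "i \<in> J" for i
    proof -
      have "0 \<le> t (e' i)" "t (e' i) \<le> 1" using \<open>t \<in> ?C\<close> e'[OF that] by auto
      moreover have "0 \<le> u i - l i" using lu[OF that] by simp
      ultimately have "(u i - l i) * t (e' i) \<le> (u i - l i) * 1" "(u i - l i) * 0 \<le> (u i - l i) * t (e' i)"
        by (auto intro: mult_left_mono simp del: mult_zero_right mult_1_right)
      from this[THEN add_left_mono, of "l i"] show ?thesis by (simp add: X_def)
    qed
    then show ?thesis by (simp add: Q_def)
  qed
  have "\<exists>t\<in>?C. \<forall>k<card J. F (X t) (e k) = 0"
  proof (rule poincare_miranda_cube)
    fix k assume k: "k < card J"
    have "continuous_on ?C X" unfolding X_def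
      by (intro continuous_on_coordinatewise_then_product continuous_intros
          continuous_on_product_then_coordinatewise[OF continuous_on_id])
    then show "continuous_on ?C (\<lambda>t. F (X t) (e k))"
      by (rule continuous_on_compose2[OF cont[OF eJ[OF k]]]) (use XQ in blast)
  next
    fix t k assume *: "t \<in> ?C" "k < card J" "t k = 0"
    then have "X t (e k) = l (e k)" by (simp add: X_def e'e)
    then show "F (X t) (e k) \<le> 0" using lo[OF XQ[OF *(1)] eJ[OF *(2)]] by simp
  next
    fix t k assume *: "t \<in> ?C" "k < card J" "t k = 1"
    then have "X t (e k) = u (e k)" by (simp add: X_def e'e)
    then show "F (X t) (e k) \<ge> 0" using hi[OF XQ[OF *(1)] eJ[OF *(2)]] by simp
  qed
  then obtain t where "t \<in> ?C" "\<forall>k<card J. F (X t) (e k) = 0" by blast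
  then have t: "t \<in> ?C" "\<And>k. k < card J \<Longrightarrow> F (X t) (e k) = 0" by blast+
  have "F (X t) i = 0" if "i \<in> J" for i using t(2)[OF e'(1)[OF that]] e'(2)[OF that] by simp
  then show ?thesis using XQ[OF t(1)] by blast
qed

section \<open>Ordinary differential equations: comparison, uniqueness, existence, barriers\<close>

lemma within_deriv_nonpos_imp_le:
  fixes \<phi> :: "real \<Rightarrow> real"
  assumes "a \<le> b"
    and der: "\<And>t. t \<in> {a..b} \<Longrightarrow> (\<phi> has_real_derivative \<phi>' t) (at t within {a..b})"
    and "\<And>t. t \<in> {a..b} \<Longrightarrow> \<phi>' t \<le> 0"
  shows "\<phi> b \<le> \<phi> a"
proof (cases "a = b")
  case False
  then have "a < b" using \<open>a \<le> b\<close> by simp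
  from mvt_simple[OF this, of \<phi> "\<lambda>t h. \<phi>' t * h"] obtain t where "t \<in> {a<..<b}" "\<phi> b - \<phi> a = \<phi>' t * (b - a)"
    using der unfolding has_field_derivative_def by auto
  moreover have "\<phi>' t * (b - a) \<le> 0" using assms(3)[of t] \<open>t \<in> {a<..<b}\<close> \<open>a < b\<close>
    by (simp add: mult_nonpos_nonneg)
  ultimately show ?thesis by linarith
qed simp

text \<open>The squared norm times \<open>exp (- 2 * L * t)\<close> is nonincreasing. The square is
  used because the norm itself need not be differentiable at a zero of \<delta>.\<close>

lemma gronwall_norm:
  fixes \<delta> :: "real \<Rightarrow> 'a::real_inner"
  assumes "0 \<le> T"
    and der: "\<And>t. t \<in> {0..T} \<Longrightarrow> (\<delta> has_vector_derivative \<delta>' t) (at t within {0..T})"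
    and bd: "\<And>t. t \<in> {0..T} \<Longrightarrow> norm (\<delta>' t) \<le> L * norm (\<delta> t)"
  shows "norm (\<delta> T) \<le> exp (L * T) * norm (\<delta> 0)"
proof -
  define \<phi> where "\<phi> t = (\<delta> t \<bullet> \<delta> t) * exp (- 2 * L * t)" for t
  have "\<phi> T \<le> \<phi> 0"
  proof (rule within_deriv_nonpos_imp_le[OF \<open>0 \<le> T\<close>])
    fix t assume t: "t \<in> {0..T}"
    have "(\<delta> has_derivative (\<lambda>h. h *\<^sub>R \<delta>' t)) (at t within {0..T})"
      using der[OF t] by (simp add: has_vector_derivative_def)
    then show "(\<phi> has_real_derivative (2 * (\<delta> t \<bullet> \<delta>' t) - 2 * L * (\<delta> t \<bullet> \<delta> t)) * exp (- 2 * L * t)) (at t within {0..T})"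
      unfolding \<phi>_def has_field_derivative_def
      by (auto intro!: derivative_eq_intros simp: algebra_simps inner_commute)
    have "\<delta> t \<bullet> \<delta>' t \<le> norm (\<delta> t) * norm (\<delta>' t)" by (rule norm_cauchy_schwarz)
    also have "\<dots> \<le> norm (\<delta> t) * (L * norm (\<delta> t))" using bd[OF t] by (intro mult_left_mono) auto
    finally have "\<delta> t \<bullet> \<delta>' t \<le> L * (\<delta> t \<bullet> \<delta> t)"
      by (simp add: dot_square_norm power2_eq_square mult_ac)
    then show "(2 * (\<delta> t \<bullet> \<delta>' t) - 2 * L * (\<delta> t \<bullet> \<delta> t)) * exp (- 2 * L * t) \<le> 0"
      by (intro mult_nonpos_nonneg) auto
  qed
  then have "(norm (\<delta> T))\<^sup>2 * exp (- 2 * L * T) \<le> (norm (\<delta> 0))\<^sup>2"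
    by (simp add: \<phi>_def dot_square_norm)
  then have "(norm (\<delta> T))\<^sup>2 * exp (- 2 * L * T) * exp (2 * L * T) \<le> (norm (\<delta> 0))\<^sup>2 * exp (2 * L * T)"
    by (intro mult_right_mono) auto
  moreover have "exp (- 2 * L * T) * exp (2 * L * T) = 1" by (simp flip: exp_add)
  moreover have "exp (2 * L * T) = (exp (L * T))\<^sup>2" by (simp add: exp_double[symmetric] mult.assoc)
  ultimately have "(norm (\<delta> T))\<^sup>2 \<le> (exp (L * T) * norm (\<delta> 0))\<^sup>2"
    by (metis (no_types, lifting) mult.assoc mult.commute mult_1 power_mult_distrib)
  then show ?thesis by (rule power2_le_imp_le) simp
qed

lemma solves_dist_le:
  fixes V :: "'a::real_inner \<Rightarrow> 'a"
  assumes "0 \<le> T" "solves V x {0..T}" "solves V y {0..T}"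
    and L: "\<And>s t. s \<in> {0..T} \<Longrightarrow> norm (V (x s) - V (y s)) \<le> L * norm (x s - y s)"
  shows "norm (x T - y T) \<le> exp (L * T) * norm (x 0 - y 0)"
proof (rule gronwall_norm[of T "\<lambda>t. x t - y t" "\<lambda>t. V (x t) - V (y t)"])
  fix t assume "t \<in> {0..T}"
  then show "((\<lambda>t. x t - y t) has_vector_derivative V (x t) - V (y t)) (at t within {0..T})"
    using assms(2,3) unfolding solves_def by (intro has_vector_derivative_diff) blast+
qed (use assms in auto)

lemma solves_subset: "solves V x S \<Longrightarrow> R \<subseteq> S \<Longrightarrow> solves V x R"
  unfolding solves_def by (blast intro: has_vector_derivative_within_subset)

lemma solves_transform:
  assumes "\<And>t. t \<in> S \<Longrightarrow> y t = x t" "solves V x S"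
  shows "solves V y S"
  unfolding solves_def
proof
  fix t assume t: "t \<in> S"
  then have "(x has_vector_derivative V (x t)) (at t within S)" using assms(2) by (simp add: solves_def)
  with t assms(1) have "(y has_vector_derivative V (x t)) (at t within S)"
    by (intro has_vector_derivative_transform[of t S y x]) auto
  then show "(y has_vector_derivative V (y t)) (at t within S)" using assms(1)[OF t] by simp
qed

lemma solves_shift:
  assumes "solves V x S"
  shows "solves V (\<lambda>t. x (t + c)) ((\<lambda>t. t - c) ` S)"
  unfolding solves_def
proof
  fix t assume "t \<in> (\<lambda>t. t - c) ` S"
  then have "t + c \<in> S" by auto
  then have "(x has_vector_derivative V (x (t + c))) (at (t + c) within S)" using assms by (auto simp: solves_def)
  moreover have "(\<lambda>t. t + c) ` (\<lambda>t. t - c) ` S = S" by (auto simp: image_iff)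
  ultimately have "((x \<circ> (\<lambda>t. t + c)) has_vector_derivative 1 *\<^sub>R V (x (t + c))) (at t within (\<lambda>t. t - c) ` S)"
    by (intro vector_diff_chain_within) (auto intro!: derivative_eq_intros)
  then show "((\<lambda>t. x (t + c)) has_vector_derivative V (x (t + c))) (at t within (\<lambda>t. t - c) ` S)"
    by (simp add: o_def)
qed

lemma solves_reverse:
  assumes "solves V x S"
  shows "solves (\<lambda>z. - V z) (\<lambda>t. x (- t)) (uminus ` S)"
  unfolding solves_def
proof
  fix t assume "t \<in> uminus ` S"
  then have "- t \<in> S" by auto
  then have "(x has_vector_derivative V (x (- t))) (at (- t) within uminus ` uminus ` S)"
    using assms by (auto simp: solves_def image_image)
  then have "((x \<circ> uminus) has_vector_derivative (-1) *\<^sub>R V (x (- t))) (at t within uminus ` S)"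
    by (intro vector_diff_chain_within) (auto intro!: derivative_eq_intros)
  then show "((\<lambda>t. x (- t)) has_vector_derivative - V (x (- t))) (at t within uminus ` S)"
    by (simp add: o_def)
qed

lemma solves_union:
  assumes "solves V x S" "solves V x R" "closed S" "closed R"
  shows "solves V x (S \<union> R)"
proof -
  \<comment> \<open>Off a closed set the filter \<open>at t within Q\<close> is trivial and every
    value is a derivative. So both derivatives exist at every \<open>t\<close> and can be joined
    over the union.\<close>
  have *: "(x has_vector_derivative V (x t)) (at t within Q)" if "solves V x Q" "closed Q" for t Q
  proof (cases "t \<in> Q")
    case False
    then have "at t within Q = bot"
      using \<open>closed Q\<close> by (metis closed_limpt trivial_limit_within)
    then show ?thesis by (simp add: has_vector_derivative_def has_derivative_def bounded_linear_scaleR_left)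
  qed (use that in \<open>auto simp: solves_def\<close>)
  show ?thesis
    unfolding solves_def
  proof
    fix t
    show "(x has_vector_derivative V (x t)) (at t within S \<union> R)"
      using *[OF assms(1,3), of t] *[OF assms(2,4), of t]
        filterlim_sup[of _ _ "at t within S" "at t within R"]
      unfolding has_vector_derivative_def has_derivative_within at_within_union[symmetric] by blast
  qed
qed

lemma solves_continuous_on: "solves V x S \<Longrightarrow> continuous_on S x"
  unfolding solves_def continuous_on_eq_continuous_within
  by (blast intro: has_vector_derivative_continuous)

text \<open>The Lipschitz condition is only local, but two solutions on \<open>{0..T}\<close> lie in
  the convex hull of their images, which is compact and convex, and there one constant
  serves.\<close>

lemma solves_unique:
  fixes V :: "'a::euclidean_space \<Rightarrow> 'a"
  assumes lip: "\<And>K. compact K \<Longrightarrow> convex K \<Longrightarrow> \<exists>L. \<forall>z\<in>K. \<forall>w\<in>K. norm (V z - V w) \<le> L * norm (z - w)"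
    and "0 \<le> T" "solves V x {0..T}" "solves V y {0..T}" "x 0 = y 0"
  shows "x T = y T"
proof -
  let ?K = "convex hull (x ` {0..T} \<union> y ` {0..T})"
  have "compact ?K"
    by (intro compact_convex_hull compact_Un compact_continuous_image solves_continuous_on[OF assms(3)]
        solves_continuous_on[OF assms(4)]) auto
  with lip obtain L where L: "\<forall>z\<in>?K. \<forall>w\<in>?K. norm (V z - V w) \<le> L * norm (z - w)"
    using convex_convex_hull by blast
  have "x s \<in> ?K" "y s \<in> ?K" if "s \<in> {0..T}" for s
    using that by (auto intro!: hull_inc)
  then have "norm (x T - y T) \<le> exp (L * T) * norm (x 0 - y 0)"
    using L by (intro solves_dist_le[OF assms(2,3,4)]) blast
  then show ?thesis using assms(5) by simp
qed

lemma closed_segment_0_nonneg: "0 \<le> (t::real) \<Longrightarrow> closed_segment 0 t = {0..t}"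
  by (simp add: closed_segment_eq_real_ivl)

text \<open>\<open>flow\<close> is a definite description, so its value can be identified only after
  uniqueness of solutions is known.\<close>

lemma flow_eqI:
  fixes V :: "'a::euclidean_space \<Rightarrow> 'a"
  assumes lip: "\<And>K. compact K \<Longrightarrow> convex K \<Longrightarrow> \<exists>L. \<forall>z\<in>K. \<forall>w\<in>K. norm (V z - V w) \<le> L * norm (z - w)"
    and "0 \<le> T" "flow_defined V T z"
  shows "\<exists>x. solves V x {0..T} \<and> x 0 = z \<and> x T = flow V T z"
proof -
  obtain w where w: "flow_rel V T z w" using assms(3) by (auto simp: flow_defined_def)
  have "w' = w" if "flow_rel V T z w'" for w'
    using that w solves_unique[OF lip \<open>0 \<le> T\<close>] \<open>0 \<le> T\<close>
    by (auto simp: flow_rel_def closed_segment_0_nonneg)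
  then have "flow V T z = w" unfolding flow_def using w by blast
  then show ?thesis using w \<open>0 \<le> T\<close> by (auto simp: flow_rel_def closed_segment_0_nonneg)
qed

text \<open>
  Picard iteration converges on the whole half-line at once in the weighted norm
  \<open>sup exp (- K t) |x t|\<close>, so the weighted solution is a fixed point in the space of bounded
  continuous functions.
\<close>

lemma exists_solution:
  fixes V :: "'a::euclidean_space \<Rightarrow> 'a"
  assumes L: "\<And>z w. norm (V z - V w) \<le> L * norm (z - w)" and B: "\<And>z. norm (V z) \<le> B"
  shows "\<exists>x. x 0 = x0 \<and> solves V x {0..}"
proof -
  have "0 \<le> B" using B[of 0] norm_ge_zero order_trans by blast
  have "0 \<le> L" using L[of "SOME i. i \<in> Basis" 0] norm_ge_zero[of "V (SOME i. i \<in> Basis) - V 0"]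
    by (metis SOME_Basis diff_zero mult.right_neutral norm_Basis order_trans)
  \<comment> \<open>With this weight the Picard map contracts by the factor \<open>L / K\<close>,
    which is at most 1/2; the added 1 keeps \<open>K\<close> positive when
    \<open>L = 0\<close>.\<close>
  define K where "K = 2 * L + 1"
  have "K > 0" "L \<le> K / 2" using \<open>0 \<le> L\<close> by (auto simp: K_def)
  have contV: "continuous_on UNIV V"
    by (rule lipschitz_on_continuous_on[of L]) (use L \<open>0 \<le> L\<close> in \<open>auto simp: lipschitz_on_def dist_norm\<close>)
  define I where "I u s = integral {0..s} (\<lambda>r. V (exp (K * r) *\<^sub>R u r))" for u :: "real \<Rightarrow> 'a" and s
  have contI: "continuous_on {0..} (\<lambda>r. V (exp (K * r) *\<^sub>R u r))" if "continuous_on UNIV u" for u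
    by (intro continuous_on_compose2[OF contV] continuous_intros continuous_on_subset[OF that]) auto
  have intI: "(\<lambda>r. V (exp (K * r) *\<^sub>R u r)) integrable_on {0..s}" if "continuous_on UNIV u" for u s
    by (rule integrable_continuous_real) (rule continuous_on_subset[OF contI[OF that]], auto)
  have derI: "(I u has_vector_derivative V (exp (K * s) *\<^sub>R u s)) (at s within {0..t})"
    if "continuous_on UNIV u" "s \<in> {0..t}" for u s t
    unfolding I_def
    by (rule integral_has_vector_derivative) (use that in \<open>auto intro: continuous_on_subset[OF contI]\<close>)
  have contI': "continuous_on {0..} (I u)" if "continuous_on UNIV u" for u
  proof -
    have "continuous (at s within {0..}) (I u)" if "s \<ge> 0" for s
    proof -
      have "continuous (at s within {0..s+1}) (I u)"
        by (rule has_vector_derivative_continuous[OF derI[OF \<open>continuous_on UNIV u\<close>]]) (use that in auto)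
      moreover have "at s within {0..} = at s within {0..s+1}"
        by (rule at_within_nhd[of s "{..<s+1}"]) auto
      ultimately show ?thesis by simp
    qed
    then show ?thesis by (simp add: continuous_on_eq_continuous_within)
  qed
  have bdI: "norm (I u s) \<le> B * s" if "continuous_on UNIV u" "0 \<le> s" for u s
  proof -
    have "continuous_on {0..s} (\<lambda>r. V (exp (K * r) *\<^sub>R u r))"
      by (rule continuous_on_subset[OF contI[OF that(1)]]) auto
    from integral_bound[OF \<open>0 \<le> s\<close> this, of B] B show ?thesis by (simp add: I_def)
  qed
  \<comment> \<open>Bounded continuous functions live on the whole line, so the weighted Picard map
    is continued to negative times by its value at 0, through \<open>max s 0\<close>.\<close>
  define P where "P u s = exp (- (K * max s 0)) *\<^sub>R (x0 + I u (max s 0))" for u s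
  have contP: "continuous_on UNIV (P u)" if "continuous_on UNIV u" for u
    unfolding P_def
    by (intro continuous_intros continuous_on_compose2[OF contI'[OF that]]) auto
  have bdP: "norm (P u s) \<le> norm x0 + B / K" if "continuous_on UNIV u" for u and s :: real
  proof -
    let ?s = "max s 0"
    have "norm (P u s) = exp (- (K * ?s)) * norm (x0 + I u ?s)" by (simp add: P_def)
    also have "\<dots> \<le> exp (- (K * ?s)) * (norm x0 + B * ?s)"
      using bdI[OF that, of ?s] norm_triangle_ineq[of x0 "I u ?s"] by (intro mult_left_mono) auto
    also have "\<dots> = exp (- (K * ?s)) * norm x0 + B / K * (exp (- (K * ?s)) * (K * ?s))"
      using \<open>K > 0\<close> by (simp add: field_simps)
    also have "\<dots> \<le> 1 * norm x0 + B / K * 1"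
    proof (intro add_mono mult_right_mono mult_left_mono)
      show "exp (- (K * ?s)) \<le> 1" using \<open>K > 0\<close> by simp
      have "K * ?s \<le> exp (K * ?s)" using exp_ge_add_one_self[of "K * ?s"] by linarith
      then show "exp (- (K * ?s)) * (K * ?s) \<le> 1" by (simp add: exp_minus field_simps)
    qed (use \<open>K > 0\<close> \<open>0 \<le> B\<close> in auto)
    finally show ?thesis by simp
  qed
  have Pbc: "P u \<in> bcontfun" if "continuous_on UNIV u" for u
    by (rule bcontfun_normI[OF contP[OF that] bdP[OF that]])
  define PP where "PP w = Bcontfun (P (apply_bcontfun w))" for w :: "real \<Rightarrow>\<^sub>C 'a"
  have PP: "apply_bcontfun (PP w) = P (apply_bcontfun w)" for w
    unfolding PP_def by (rule Bcontfun_inverse) (rule Pbc, simp)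
  have "dist (PP v) (PP w) \<le> 1/2 * dist v w" for v w
  proof (rule dist_bound)
    fix s :: real
    let ?s = "max s 0" and ?v = "apply_bcontfun v" and ?w = "apply_bcontfun w"
    have c: "continuous_on UNIV ?v" "continuous_on UNIV ?w" by auto
    have expint: "((\<lambda>r. exp (K * r)) has_integral (exp (K * ?s) / K - exp (K * 0) / K)) {0..?s}"
      by (rule fundamental_theorem_of_calculus)
        (use \<open>K > 0\<close> in \<open>auto intro!: derivative_eq_intros simp flip: has_real_derivative_iff_has_vector_derivative\<close>)
    have "norm (I ?v ?s - I ?w ?s)
        = norm (integral {0..?s} (\<lambda>r. V (exp (K * r) *\<^sub>R ?v r) - V (exp (K * r) *\<^sub>R ?w r)))"
      unfolding I_def by (simp add: integral_diff intI c)
    also have "\<dots> \<le> integral {0..?s} (\<lambda>r. (L * dist v w) * exp (K * r))"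
    proof (rule integral_norm_bound_integral)
      fix r
      have "norm (V (exp (K * r) *\<^sub>R ?v r) - V (exp (K * r) *\<^sub>R ?w r))
          \<le> L * norm (exp (K * r) *\<^sub>R (?v r - ?w r))" using L by (simp add: scaleR_right_diff_distrib)
      also have "\<dots> = L * (exp (K * r) * dist (?v r) (?w r))" by (simp add: dist_norm)
      also have "\<dots> \<le> L * (exp (K * r) * dist v w)"
        using dist_bounded[of v r w] \<open>0 \<le> L\<close> by (intro mult_left_mono) auto
      finally show "norm (V (exp (K * r) *\<^sub>R ?v r) - V (exp (K * r) *\<^sub>R ?w r)) \<le> L * dist v w * exp (K * r)"
        by (simp add: mult_ac)
    next
      show "(\<lambda>r. V (exp (K * r) *\<^sub>R ?v r) - V (exp (K * r) *\<^sub>R ?w r)) integrable_on {0..?s}"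
        by (intro integrable_diff intI c)
      show "(\<lambda>r. L * dist v w * exp (K * r)) integrable_on {0..?s}"
        by (intro integrable_continuous_real continuous_intros)
    qed
    also have "\<dots> = L * dist v w * (exp (K * ?s) / K - 1 / K)"
      using expint by (simp add: integral_unique)
    also have "\<dots> \<le> L * dist v w * (exp (K * ?s) / K)"
      using \<open>0 \<le> L\<close> \<open>K > 0\<close> by (intro mult_left_mono) auto
    finally have *: "norm (I ?v ?s - I ?w ?s) \<le> L * dist v w * (exp (K * ?s) / K)" .
    have "dist (P ?v s) (P ?w s) = exp (- (K * ?s)) * norm (I ?v ?s - I ?w ?s)"
      unfolding P_def dist_norm by (simp flip: scaleR_right_diff_distrib)
    also have "\<dots> \<le> exp (- (K * ?s)) * (L * dist v w * (exp (K * ?s) / K))"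
      by (intro mult_left_mono *) auto
    also have "\<dots> = (L / K) * dist v w" using exp_minus_inverse[of "K * ?s"] by (simp add: field_simps exp_minus)
    also have "\<dots> \<le> 1 / 2 * dist v w"
      using \<open>L \<le> K / 2\<close> \<open>K > 0\<close> by (intro mult_right_mono) (auto simp: field_simps)
    finally show "dist (apply_bcontfun (PP v) s) (apply_bcontfun (PP w) s) \<le> 1 / 2 * dist v w"
      by (simp add: PP)
  qed
  then obtain w where w: "PP w = w" using banach_fix_type[of "1/2" PP] by auto
  define u where "u = apply_bcontfun w"
  have u: "u s = P u s" "continuous_on UNIV u" for s using w PP[of w] by (auto simp: u_def)
  define x where "x t = x0 + I u t" for t
  have xu: "x t = exp (K * t) *\<^sub>R u t" if "t \<ge> 0" for t
    using that u(1)[of t] by (simp add: x_def P_def exp_minus_inverse)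
  have "solves V x {0..}"
    unfolding solves_def
  proof
    fix t :: real assume "t \<in> {0..}"
    then have t: "t \<ge> 0" by simp
    have "(x has_vector_derivative V (x t)) (at t within {0..t+1})"
    proof -
      have "(I u has_vector_derivative V (x t)) (at t within {0..t+1})"
        using derI[OF u(2), of t "t+1"] t by (simp add: xu)
      then show ?thesis unfolding x_def[abs_def] has_vector_derivative_def
        by (auto intro!: derivative_eq_intros)
    qed
    moreover have "at t within {0..} = at t within {0..t+1}"
      by (rule at_within_nhd[of t "{..<t+1}"]) auto
    ultimately show "(x has_vector_derivative V (x t)) (at t within {0..})" by simp
  qed
  moreover have "x 0 = x0" by (simp add: x_def I_def)
  ultimately show ?thesis by blast
qed

text \<open>Gronwall's inequality makes solutions Lipschitz in the initial point with constant
  \<open>exp (L * t)\<close>, so joint continuity follows by splitting off the change of the initial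
  point.\<close>

lemma exists_semiflow:
  fixes V :: "'a::euclidean_space \<Rightarrow> 'a"
  assumes L: "\<And>z w. norm (V z - V w) \<le> L * norm (z - w)" and B: "\<And>z. norm (V z) \<le> B"
  shows "\<exists>\<Phi>. (\<forall>z. \<Phi> 0 z = z) \<and> (\<forall>z. solves V (\<lambda>t. \<Phi> t z) {0..}) \<and>
    continuous_on ({0..} \<times> UNIV) (\<lambda>(t, z). \<Phi> t z)"
proof -
  obtain x where x: "\<And>z. x z 0 = z" "\<And>z. solves V (x z) {0..}"
    using exists_solution[OF assms] by metis
  have dist: "norm (x z t - x w t) \<le> exp (L * t) * norm (z - w)" if "t \<ge> 0" for z w t
    using solves_dist_le[OF that solves_subset[OF x(2)] solves_subset[OF x(2)], of z w L] L
    by (simp add: x(1))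
  have "continuous_on ({0..} \<times> UNIV) (\<lambda>(t, z). x z t)"
    unfolding continuous_on_sequentially
  proof (intro allI ballI impI, elim conjE)
    fix X :: "nat \<Rightarrow> real \<times> 'a" and a assume a: "a \<in> {0..} \<times> (UNIV :: 'a set)"
      and X: "\<forall>n. X n \<in> {0..} \<times> (UNIV :: 'a set)" "X \<longlonglongrightarrow> a"
    obtain t z where tz: "a = (t, z)" by force
    define T Z where "T n = fst (X n)" and "Z n = snd (X n)" for n :: nat
    have T: "T n \<ge> 0" "t \<ge> 0" "T \<longlonglongrightarrow> t" "Z \<longlonglongrightarrow> z" for n :: nat
      using X a tendsto_fst[OF X(2)] tendsto_snd[OF X(2)] by (auto simp: T_def[abs_def] Z_def[abs_def] mem_Times_iff tz)
    have "(\<lambda>n. x z (T n)) \<longlonglongrightarrow> x z t"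
      using solves_continuous_on[OF x(2)[of z]] T unfolding continuous_on_sequentially o_def by auto
    moreover have "(\<lambda>n. x (Z n) (T n) - x z (T n)) \<longlonglongrightarrow> 0"
    proof (rule Lim_null_comparison)
      show "\<forall>\<^sub>F n in sequentially. norm (x (Z n) (T n) - x z (T n)) \<le> exp (L * T n) * norm (Z n - z)"
        using dist T by auto
      have "(\<lambda>n. exp (L * T n) * norm (Z n - z)) \<longlonglongrightarrow> exp (L * t) * norm (z - z)"
        by (intro tendsto_intros T)
      then show "(\<lambda>n. exp (L * T n) * norm (Z n - z)) \<longlonglongrightarrow> 0" by simp
    qed
    ultimately have "(\<lambda>n. (x (Z n) (T n) - x z (T n)) + x z (T n)) \<longlonglongrightarrow> 0 + x z t"
      by (intro tendsto_add)
    then show "((\<lambda>(t, z). x z t) \<circ> X) \<longlonglongrightarrow> (\<lambda>(t, z). x z t) a"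
      by (simp add: o_def tz T_def Z_def case_prod_beta)
  qed
  then show ?thesis using x by (intro exI[of _ "\<lambda>t z. x z t"]) auto
qed

text \<open>At the last time with \<open>u \<ge> h\<close> the value is exactly \<open>h\<close> by
  the intermediate value theorem, and the positive derivative there gives later times above
  \<open>h\<close>. The derivative is asked for at level \<open>h\<close> only, which is the form
  needed for a barrier at a face of a box.\<close>

lemma stays_above_level:
  fixes u :: "real \<Rightarrow> real"
  assumes "a \<le> b" "u a \<ge> h" and cont: "continuous_on {a..b} u"
    and up: "\<And>t. t \<in> {a..<b} \<Longrightarrow> u t = h \<Longrightarrow>
      \<exists>d>0. (u has_real_derivative d) (at t within {a..b})"
  shows "u b \<ge> h"
proof (rule ccontr)
  assume "\<not> u b \<ge> h"
  define R where "R = {t \<in> {a..b}. u t \<ge> h}"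
  have "closed R" unfolding R_def
    using continuous_on_closed_Collect_le[OF continuous_on_const cont, of h] by simp
  have "a \<in> R" "bdd_above R" using assms(1,2) by (auto simp: R_def)
  define s where "s = Sup R"
  have "s \<in> R" unfolding s_def
    by (rule closed_contains_Sup) (use \<open>closed R\<close> \<open>bdd_above R\<close> \<open>a \<in> R\<close> in auto)
  have above: "t \<le> s" if "t \<in> {a..b}" "u t \<ge> h" for t
    unfolding s_def by (rule cSup_upper) (use that \<open>bdd_above R\<close> in \<open>auto simp: R_def\<close>)
  have s: "a \<le> s" "s < b" "u s \<ge> h"
    using \<open>s \<in> R\<close> \<open>\<not> u b \<ge> h\<close> by (auto simp: R_def less_le)
  have "u s = h"
  proof -
    have "\<exists>t\<ge>s. t \<le> b \<and> u t = h"
      by (rule IVT2') (use s \<open>\<not> u b \<ge> h\<close> in \<open>auto intro: continuous_on_subset[OF cont]\<close>)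
    then obtain t where "t \<ge> s" "t \<le> b" "u t = h" by blast
    with above[of t] s(1) have "t = s" by simp
    with \<open>u t = h\<close> show ?thesis by simp
  qed
  then obtain d where "d > 0" "(u has_real_derivative d) (at s within {a..b})"
    using up[of s] s by auto
  from has_real_derivative_pos_inc_right[OF this(2,1)] obtain e where e: "e > 0"
    "\<And>k. k > 0 \<Longrightarrow> s + k \<in> {a..b} \<Longrightarrow> k < e \<Longrightarrow> u s < u (s + k)" by auto
  define k where "k = min (e / 2) (b - s)"
  have k: "k > 0" "k < e" "s + k \<in> {a..b}" using e(1) s by (auto simp: k_def)
  then have "u (s + k) \<ge> h" using e(2)[of k] s(3) by simp
  then show False using above[OF k(3)] k(1) by simp
qed

section \<open>Covering relations with one unstable direction\<close>

definition line_pt :: "real \<Rightarrow> nat \<Rightarrow> real" where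
  "line_pt p = (\<lambda>i. if i = 0 then p else 0)"

lemma line_pt_0 [simp]: "line_pt p 0 = p"
  by (simp add: line_pt_def)

lemma enorm_1 [simp]: "enorm (Suc 0) x = \<bar>x 0\<bar>"
  by (simp add: enorm_def)

lemma espace_iff: "x \<in> espace m \<longleftrightarrow> (\<forall>i\<ge>m. x i = 0)"
  by (simp add: espace_def topspace_Euclidean_space)

lemma line_pt_espace [simp]: "line_pt p \<in> espace (Suc 0)"
  by (simp add: espace_iff line_pt_def)

lemma espace_1_eq: "x \<in> espace (Suc 0) \<Longrightarrow> x = line_pt (x 0)"
  by (auto simp: espace_iff line_pt_def fun_eq_iff)

lemma line_pt_ecball [simp]: "line_pt p \<in> ecball (Suc 0) \<longleftrightarrow> \<bar>p\<bar> \<le> 1"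
  by (simp add: ecball_def)

lemma line_pt_esphere [simp]: "line_pt p \<in> esphere (Suc 0) \<longleftrightarrow> \<bar>p\<bar> = 1"
  by (simp add: esphere_def)

lemma continuous_on_line_pt [continuous_intros]:
  "continuous_on S f \<Longrightarrow> continuous_on S (\<lambda>x. line_pt (f x))"
  unfolding line_pt_def
proof (intro continuous_on_coordinatewise_then_product)
  fix i :: nat assume "continuous_on S f"
  then show "continuous_on S (\<lambda>x. if i = 0 then f x else 0)" by (cases "i = 0") simp_all
qed

lemma continuous_on_apply_coord:
  fixes f :: "'a::topological_space \<Rightarrow> 'i \<Rightarrow> 'b::topological_space"
  shows "continuous_on S f \<Longrightarrow> continuous_on S (\<lambda>x. f x i)"
  by (rule continuous_on_product_then_coordinatewise)

lemma continuous_on_enorm [continuous_intros]: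
  "continuous_on S f \<Longrightarrow> continuous_on S (\<lambda>x. enorm m (f x))"
  unfolding enorm_def
  by (intro continuous_on_real_sqrt continuous_on_sum continuous_on_power) (rule continuous_on_apply_coord)

text \<open>\<open>nsphere 0\<close> consists of two points. If \<open>A\<close> had the same sign
  at both, the normalised map would be constant and its degree 0.\<close>

lemma ball_degree_1_opposite:
  assumes A: "A ` espace 1 \<subseteq> espace 1" "A ` esphere 1 \<subseteq> espace 1 - ecball 1"
    and deg: "ball_degree 1 A \<noteq> 0"
  shows "\<bar>A (line_pt 1) 0\<bar> > 1" "\<bar>A (line_pt (-1)) 0\<bar> > 1"
    "sgn (A (line_pt (-1)) 0) = - sgn (A (line_pt 1) 0)"
proof -
  have out: "\<bar>A (line_pt p) 0\<bar> > 1" if "\<bar>p\<bar> = 1" for p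
  proof -
    have "line_pt p \<in> esphere 1" using that by simp
    then have "A (line_pt p) \<in> espace 1 - ecball 1" using A(2) by blast
    then show ?thesis by (auto simp: ecball_def)
  qed
  show a: "\<bar>A (line_pt 1) 0\<bar> > 1" "\<bar>A (line_pt (-1)) 0\<bar> > 1" by (rule out, simp)+
  show "sgn (A (line_pt (-1)) 0) = - sgn (A (line_pt 1) 0)"
  proof (rule ccontr)
    assume "\<not> ?thesis"
    then have s: "sgn (A (line_pt (-1)) 0) = sgn (A (line_pt 1) 0)"
      using a by (auto simp: sgn_if split: if_splits)
    have "A p i / enorm 1 (A p) = line_pt (sgn (A (line_pt 1) 0)) i"
      if "p \<in> topspace (nsphere 0)" for p i
    proof -
      have "p \<in> espace 1" "(p 0)\<^sup>2 = 1"
        using that by (auto simp: nsphere_def espace_def)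
      then have "p = line_pt 1 \<or> p = line_pt (-1)"
        using espace_1_eq[of p] by (auto simp: power2_eq_1_iff)
      moreover have "A p \<in> espace 1" using A(1) \<open>p \<in> espace 1\<close> by blast
      ultimately show ?thesis using s a
        by (auto simp: espace_iff line_pt_def sgn_if field_simps split: if_splits)
    qed
    then have "Brouwer_degree2 0 (\<lambda>p i. A p i / enorm 1 (A p))
        = Brouwer_degree2 0 (\<lambda>_. line_pt (sgn (A (line_pt 1) 0)))"
      by (intro Brouwer_degree2_eq) (auto simp: fun_eq_iff)
    then show False using deg by (simp add: ball_degree_def Brouwer_degree2_const)
  qed
qed

text \<open>The covering of the circle by the line, with period 2 and with the phase for which -1
  and 1 both go to the base point 1; it wraps \<open>[-1, 1]\<close> once around the circle.\<close>

definition collapse :: "real \<Rightarrow> complex" where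
  "collapse x = exp (\<i> * of_real (pi * (1 + x)))"

lemma collapse_eq_iff: "collapse x = collapse y \<longleftrightarrow> (\<exists>n::int. x = y + 2 * of_int n)"
proof -
  have "collapse x = collapse y \<longleftrightarrow> (\<exists>n::int. pi * (1 + x) = pi * (1 + y) + 2 * of_int n * pi)"
    unfolding collapse_def exp_eq by (simp add: complex_eq_iff mult.commute)
  moreover have "pi * (1 + x) = pi * (1 + y) + 2 * of_int n * pi \<longleftrightarrow> x = y + 2 * of_int n" for n :: int
  proof -
    have "pi * (1 + y) + 2 * of_int n * pi = pi * (1 + (y + 2 * of_int n))" by (simp add: algebra_simps)
    then show ?thesis by simp
  qed
  ultimately show ?thesis by (simp only:)
qed

lemma collapse_ends [simp]: "collapse 1 = 1" "collapse (- 1) = 1"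
  by (simp_all add: collapse_def)

lemma continuous_on_collapse [continuous_intros]:
  "continuous_on S f \<Longrightarrow> continuous_on S (\<lambda>x. collapse (f x))"
  unfolding collapse_def by (intro continuous_intros)

text \<open>A nonvanishing map on a contractible set has a continuous logarithm. Modulus one makes
  the logarithm purely imaginary, and \<open>Im (g k) / pi - 1\<close> undoes the normalisation of
  \<open>collapse\<close>.\<close>

lemma collapse_lift:
  fixes \<Theta> :: "'a::real_normed_vector \<Rightarrow> complex"
  assumes "continuous_on K \<Theta>" "convex K" "\<And>k. k \<in> K \<Longrightarrow> norm (\<Theta> k) = 1"
  obtains r where "continuous_on K r" "\<And>k. k \<in> K \<Longrightarrow> \<Theta> k = collapse (r k)"
proof -
  obtain g where g: "continuous_on K g" "\<And>k. k \<in> K \<Longrightarrow> \<Theta> k = exp (g k)"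
    using continuous_logarithm_on_contractible[OF assms(1) convex_imp_contractible[OF assms(2)]]
      assms(3) by (metis norm_zero zero_neq_one)
  show thesis
  proof (rule that[of "\<lambda>k. Im (g k) / pi - 1"])
    show "continuous_on K (\<lambda>k. Im (g k) / pi - 1)" by (intro continuous_intros g(1)) simp
    fix k assume k: "k \<in> K"
    then have "Re (g k) = 0" using g(2) assms(3) by (metis exp_eq_one_iff norm_exp_eq_Re)
    then have "g k = \<i> * of_real (Im (g k))" by (simp add: complex_eq_iff)
    then have "\<Theta> k = exp (\<i> * of_real (Im (g k)))" using g(2)[OF k] by simp
    then show "\<Theta> k = collapse (Im (g k) / pi - 1)"
      by (simp add: collapse_def)
  qed
qed

text \<open>Two lifts of the same circle-valued map differ by a deck transformation: their
  difference is continuous with values in the even integers, hence constant on a connected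
  set.\<close>

lemma continuous_integral_offset_constant:
  fixes f g :: "'a::topological_space \<Rightarrow> real"
  assumes "connected S" "continuous_on S f" "continuous_on S g"
    and "\<And>x. x \<in> S \<Longrightarrow> collapse (f x) = collapse (g x)"
  obtains n :: int where "\<And>x. x \<in> S \<Longrightarrow> f x = g x + 2 * of_int n"
proof -
  have int: "\<exists>n::int. f x - g x = 2 * of_int n" if "x \<in> S" for x
    using assms(4)[OF that] by (auto simp: collapse_eq_iff)
  have "(\<lambda>x. f x - g x) constant_on S"
  proof (rule continuous_discrete_range_constant[OF assms(1)])
    show "continuous_on S (\<lambda>x. f x - g x)" by (intro continuous_intros assms)
    fix x assume "x \<in> S"
    have "1 \<le> norm ((f y - g y) - (f x - g x))" if "y \<in> S" "f y - g y \<noteq> f x - g x" for y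
    proof -
      obtain m n :: int where "f y - g y = 2 * of_int m" "f x - g x = 2 * of_int n"
        using int \<open>x \<in> S\<close> \<open>y \<in> S\<close> by metis
      moreover have "\<bar>m - n\<bar> \<ge> 1" using calculation that(2) by auto
      then have "\<bar>real_of_int (m - n)\<bar> \<ge> 1" by linarith
      ultimately show ?thesis by simp
    qed
    then show "\<exists>e>0. \<forall>y. y \<in> S \<and> f y - g y \<noteq> f x - g x \<longrightarrow> e \<le> norm ((f y - g y) - (f x - g x))"
      by (intro exI[of _ 1]) auto
  qed
  then obtain c where c: "\<And>x. x \<in> S \<Longrightarrow> f x - g x = c" by (auto simp: constant_on_def)
  show thesis
  proof (cases "S = {}")
    case False
    then obtain x where "x \<in> S" by blast
    with int obtain n :: int where "f x - g x = 2 * of_int n" by blast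
    then have "f y = g y + 2 * of_int n" if "y \<in> S" for y using c[OF that] c[OF \<open>x \<in> S\<close>] by simp
    then show thesis using that by blast
  qed (use that in blast)
qed

text \<open>
  \<open>M\<close> is collapsed onto a circle along the level sets of \<open>\<phi>\<close>, and the complement of \<open>M\<close> onto the
  base point.  Along the homotopy of the covering relation this stays continuous, since the
  homotopy avoids \<open>M\<^sup>+\<close>.  The lift to the real line then has the same boundary values as for the
  linear model \<open>(A p, 0)\<close>, so it crosses \<open>[-1, 1]\<close>.
\<close>

lemma covering_lift:
  fixes N :: "('m::euclidean_space, 'z) hset_scheme" and M :: "('k::euclidean_space, 'w) hset_scheme"
    and \<phi> :: "'k \<times> 'c::real_normed_vector \<Rightarrow> real" and \<omega> :: "'b::real_normed_vector \<Rightarrow> nat \<Rightarrow> real"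
  defines "pos \<equiv> \<lambda>p b. inv_into (h_amb N) (h_chart N) (line_pt p, \<omega> b)"
  assumes cov: "covers N G M" and u: "h_u M = 1" and amb: "h_amb M = UNIV"
    and B: "convex B" "B \<noteq> {}" "continuous_on B \<omega>" "\<omega> ` B \<subseteq> ecball (h_s N)"
    and C: "convex C" "C \<noteq> {}"
    and \<phi>: "continuous_on (UNIV \<times> C) \<phi>" "\<And>w c. c \<in> C \<Longrightarrow> \<bar>\<phi> (w, c)\<bar> \<le> 1"
    and \<tau>: "\<tau> = 1 \<or> \<tau> = -1"
    and face: "\<And>w c. w \<in> h_set M \<Longrightarrow> c \<in> C \<Longrightarrow> \<bar>fst (h_chart M w) 0\<bar> = 1 \<Longrightarrow>
      \<phi> (w, c) = \<tau> * fst (h_chart M w) 0"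
  obtains \<sigma> \<Lambda> where "\<sigma> = 1 \<or> \<sigma> = (-1::real)" "continuous_on ({-1..1} \<times> B \<times> C) \<Lambda>"
    "\<And>b c. b \<in> B \<Longrightarrow> c \<in> C \<Longrightarrow> \<Lambda> (1, b, c) = \<sigma> \<and> \<Lambda> (-1, b, c) = - \<sigma>"
    "\<And>p b c. p \<in> {-1..1} \<Longrightarrow> b \<in> B \<Longrightarrow> c \<in> C \<Longrightarrow> \<bar>\<Lambda> (p, b, c)\<bar> < 1 \<Longrightarrow>
      G (pos p b) \<in> h_set M \<and> \<phi> (G (pos p b), c) = \<Lambda> (p, b, c)"
proof -
  have hN: "is_hset N" "is_hset M" "h_u N = 1" using cov u by (auto simp: covers_def)
  obtain h :: "real \<times> hmodel \<Rightarrow> hmodel" and A where h: "continuous_on ({0..1} \<times> h_model N) h" "h ` ({0..1} \<times> h_model N) \<subseteq> h_space M"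
      "\<forall>p \<in> h_model N. h (0, p) = h_chart M (G (inv_into (h_amb N) (h_chart N) p))"
      "h ` ({0..1} \<times> h_model_minus N) \<inter> h_model M = {}"
      "h ` ({0..1} \<times> h_model N) \<inter> h_model_plus M = {}"
    and A: "continuous_on (espace 1) A" "A ` espace 1 \<subseteq> espace 1"
      "\<forall>(p, q) \<in> h_model N. h (1, (p, q)) = (A p, (\<lambda>_. 0))"
      "A ` esphere 1 \<subseteq> espace 1 - ecball 1" "ball_degree 1 A \<noteq> 0"
    using cov unfolding covers_def hN(3) by (elim conjE exE) (rule that; assumption)
  note opp = ball_degree_1_opposite[OF A(2,4,5)]
  obtain d where d: "homeomorphism UNIV (h_space M) (h_chart M) d"
    using hN(2) amb by (auto simp: is_hset_def)
  have dch: "d (h_chart M w) = w" for w using d by (simp add: homeomorphism_def)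
  have chd: "h_chart M (d m) = m" if "m \<in> h_space M" for m using d that by (simp add: homeomorphism_def)
  have chM: "h_chart M ` h_set M = h_model M" using hN(2) by (simp add: is_hset_def)
  define K where "K = {0..1::real} \<times> {-1..1::real} \<times> B \<times> C"
  define H where "H = (\<lambda>(t, p, b, c :: 'c). h (t, (line_pt p, \<omega> b)))"
  have model: "(line_pt p, \<omega> b) \<in> h_model N" if "p \<in> {-1..1}" "b \<in> B" for p b
    using that B(4) hN(3) by (auto simp: h_model_def)
  have "continuous_on K (\<lambda>k. fst (snd (snd k)))"
    by (intro continuous_on_fst continuous_on_snd continuous_on_id)
  then have "continuous_on K (\<lambda>k. \<omega> (fst (snd (snd k))))"
    by (rule continuous_on_compose2[OF B(3)]) (auto simp: K_def)
  moreover have "continuous_on K (\<lambda>k. line_pt (fst (snd k)))"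
    by (intro continuous_on_line_pt continuous_on_fst continuous_on_snd continuous_on_id)
  ultimately have "continuous_on K (\<lambda>k. (fst k, (line_pt (fst (snd k)), \<omega> (fst (snd (snd k))))))"
    by (intro continuous_on_Pair continuous_on_fst continuous_on_id)
  then have cH: "continuous_on K H" unfolding H_def case_prod_beta
    by (rule continuous_on_compose2[OF h(1)]) (auto simp: K_def model)
  have HK: "H k \<in> h_space M" "H k \<notin> h_model_plus M" if "k \<in> K" for k
  proof -
    obtain t p b c where k: "k = (t, p, b, c)" by (metis surj_pair)
    have "(t, (line_pt p, \<omega> b)) \<in> {0..1} \<times> h_model N" using that model by (auto simp: k K_def)
    then have "H k \<in> h ` ({0..1} \<times> h_model N)" unfolding k H_def prod.case by (rule imageI)
    then show "H k \<in> h_space M" "H k \<notin> h_model_plus M" using h(2,5) by blast+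
  qed
  define \<phi>' where "\<phi>' = (\<lambda>k. \<phi> (d (H k), snd (snd (snd k))))"
  have c\<phi>: "continuous_on K \<phi>'" unfolding \<phi>'_def
  proof (rule continuous_on_compose2[OF \<phi>(1)])
    have "continuous_on K (\<lambda>k. d (H k))"
      by (rule continuous_on_compose2[OF homeomorphism_cont2[OF d] cH]) (use HK in blast)
    then show "continuous_on K (\<lambda>k. (d (H k), snd (snd (snd k))))"
      by (intro continuous_on_Pair continuous_on_snd continuous_on_id)
  qed (auto simp: K_def)
  \<comment> \<open>\<open>K1\<close> is where the homotopy lies in \<open>M\<close>, and
    \<open>K2\<close> where it lies outside the interior of \<open>M\<close>. Both are closed. On
    the overlap the image is on the boundary, and since the homotopy avoids \<open>M\<^sup>+\<close>
    it is on the exit part, where \<open>face\<close> prescribes \<phi>.\<close>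
  define K1 where "K1 = {k \<in> K. \<bar>fst (H k) 0\<bar> \<le> 1 \<and> enorm (h_s M) (snd (H k)) \<le> 1}"
  define K2 where "K2 = {k \<in> K. \<bar>fst (H k) 0\<bar> \<ge> 1 \<or> enorm (h_s M) (snd (H k)) \<ge> 1}"
  have K12: "K1 \<union> K2 = K" by (auto simp: K1_def K2_def)
  have K1_iff: "k \<in> K1 \<longleftrightarrow> H k \<in> h_model M" if "k \<in> K" for k
    using HK(1)[OF that] that u by (auto simp: K1_def h_model_def h_space_def ecball_def mem_Times_iff)
  have in_M: "d (H k) \<in> h_set M" if "k \<in> K1" for k
  proof -
    have "H k \<in> h_chart M ` h_set M" using that K1_iff K12 chM by blast
    then show ?thesis using dch by auto
  qed
  have "continuous_on K (\<lambda>k. fst (H k) 0)"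
    by (rule continuous_on_apply_coord) (intro continuous_on_fst cH)
  then have c12: "continuous_on K (\<lambda>k. \<bar>fst (H k) 0\<bar>)" "continuous_on K (\<lambda>k. enorm (h_s M) (snd (H k)))"
    by (intro continuous_on_rabs continuous_on_enorm continuous_on_snd cH, assumption?)+
  have closed1: "closedin (top_of_set K) K1"
  proof -
    have "closedin (top_of_set K) (K \<inter> (\<lambda>k. \<bar>fst (H k) 0\<bar>) -` {..1} \<inter> (K \<inter> (\<lambda>k. enorm (h_s M) (snd (H k))) -` {..1}))"
      by (intro closedin_Int continuous_closedin_preimage c12) auto
    moreover have "\<dots> = K1" by (auto simp: K1_def)
    ultimately show ?thesis by simp
  qed
  have closed2: "closedin (top_of_set K) K2"
  proof -
    have "closedin (top_of_set K) (K \<inter> (\<lambda>k. \<bar>fst (H k) 0\<bar>) -` {1..} \<union> (K \<inter> (\<lambda>k. enorm (h_s M) (snd (H k))) -` {1..}))"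
      by (intro closedin_Un continuous_closedin_preimage c12) auto
    moreover have "\<dots> = K2" by (auto simp: K2_def)
    ultimately show ?thesis by simp
  qed
  have face': "\<bar>fst (H k) 0\<bar> = 1 \<and> \<phi>' k = \<tau> * fst (H k) 0" if "k \<in> K1" "k \<in> K2" for k
  proof -
    have "k \<in> K" using that by (simp add: K1_def)
    have "H k \<in> h_model M" using that K1_iff \<open>k \<in> K\<close> by blast
    then have "enorm (h_s M) (snd (H k)) \<noteq> 1" using HK(2)[OF \<open>k \<in> K\<close>]
      by (auto simp: h_model_def h_model_plus_def ecball_def esphere_def mem_Times_iff)
    then have *: "\<bar>fst (H k) 0\<bar> = 1" using that by (auto simp: K1_def K2_def)
    then have "\<phi>' k = \<tau> * fst (H k) 0"
      using face[OF in_M[OF that(1)], of "snd (snd (snd k))"] chd[OF HK(1)[OF \<open>k \<in> K\<close>]] \<open>k \<in> K\<close>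
      by (auto simp: \<phi>'_def K_def)
    with * show ?thesis by blast
  qed
  have \<tau>end: "collapse (\<tau> * x) = 1" if "\<bar>x\<bar> = 1" for x
    using \<tau> that by (auto simp: abs_if split: if_splits)
  define \<Theta> where "\<Theta> k = (if k \<in> K1 then collapse (\<phi>' k) else 1)" for k
  have c\<Theta>: "continuous_on K \<Theta>"
  proof -
    have "continuous_on (K1 \<union> K2) (\<lambda>k. if k \<in> K1 then collapse (\<phi>' k) else 1)"
    proof (rule continuous_on_cases_local)
      show "closedin (top_of_set (K1 \<union> K2)) K1" "closedin (top_of_set (K1 \<union> K2)) K2"
        using closed1 closed2 K12 by simp_all
      show "continuous_on K1 (\<lambda>k. collapse (\<phi>' k))"
        by (intro continuous_on_collapse continuous_on_subset[OF c\<phi>]) (auto simp: K1_def)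
      show "continuous_on K2 (\<lambda>k. 1 :: complex)" by (rule continuous_on_const)
      show "collapse (\<phi>' k) = 1" if "k \<in> K1 \<and> \<not> k \<in> K1 \<or> k \<in> K2 \<and> k \<in> K1" for k
        using face'[of k] \<tau>end[of "fst (H k) 0"] that by auto
    qed
    then show ?thesis using K12 by (simp add: \<Theta>_def[abs_def])
  qed
  have "convex K" unfolding K_def by (intro convex_Times B C convex_real_interval)
  then obtain r where r: "continuous_on K r" "\<And>k. k \<in> K \<Longrightarrow> \<Theta> k = collapse (r k)"
    by (rule collapse_lift[OF c\<Theta>]) (auto simp: \<Theta>_def collapse_def)
  define a where "a p = A (line_pt p) 0" for p
  have ca: "continuous_on {-1..1} a" unfolding a_def
    by (rule continuous_on_apply_coord, rule continuous_on_compose2[OF A(1)]) (auto intro: continuous_on_line_pt continuous_on_id)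
  have H1: "H (1, p, b, c) = (A (line_pt p), \<lambda>_. 0)" if "p \<in> {-1..1}" "b \<in> B" for p b c
    using A(3) model[OF that] by (auto simp: H_def)
  have K1_1: "(1, p, b, c) \<in> K1 \<longleftrightarrow> \<bar>a p\<bar> \<le> 1" if "(1, p, b, c) \<in> K" for p b c
    using that H1[of p b c] by (auto simp: K1_def K_def a_def enorm_def)
  define S1 where "S1 = {-1..1::real} \<times> B \<times> C"
  have "connected S1" unfolding S1_def by (intro convex_connected convex_Times B C convex_real_interval)
  \<comment> \<open>An explicit lift at homotopy time 1. There the map is \<open>(A p, 0)\<close>,
    so \<open>M\<close> can be left only through the unstable coordinate, and beyond an end the
    value that \<phi> has at this end is kept.\<close>
  define \<psi> where "\<psi> = (\<lambda>(p, b, c). if \<bar>a p\<bar> \<le> 1 then \<phi>' (1, p, b, c) else \<tau> * sgn (a p))"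
  have c\<psi>: "continuous_on S1 \<psi>"
  proof -
    let ?R1 = "{x \<in> S1. \<bar>a (fst x)\<bar> \<le> 1}" and ?R2 = "{x \<in> S1. \<bar>a (fst x)\<bar> \<ge> 1}"
    have cS: "continuous_on S1 (\<lambda>x. \<bar>a (fst x)\<bar>)"
      by (intro continuous_intros continuous_on_compose2[OF ca]) (auto simp: S1_def)
    have R12: "?R1 \<union> ?R2 = S1" by auto
    have "continuous_on (?R1 \<union> ?R2) (\<lambda>x. if \<bar>a (fst x)\<bar> \<le> 1 then \<phi>' (1, x) else \<tau> * sgn (a (fst x)))"
    proof (rule continuous_on_cases_local)
      show "closedin (top_of_set (?R1 \<union> ?R2)) ?R1"
      proof -
        have "S1 \<inter> (\<lambda>x. \<bar>a (fst x)\<bar>) -` {..1} = ?R1" by auto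
        then show ?thesis using continuous_closedin_preimage[OF cS, of "{..1}"] unfolding R12 by simp
      qed
      show "closedin (top_of_set (?R1 \<union> ?R2)) ?R2"
      proof -
        have "S1 \<inter> (\<lambda>x. \<bar>a (fst x)\<bar>) -` {1..} = ?R2" by auto
        then show ?thesis using continuous_closedin_preimage[OF cS, of "{1..}"] unfolding R12 by simp
      qed
      show "continuous_on ?R1 (\<lambda>x. \<phi>' (1, x))"
        by (rule continuous_on_compose2[OF c\<phi>]) (auto intro!: continuous_intros simp: S1_def K_def)
      show "continuous_on ?R2 (\<lambda>x. \<tau> * sgn (a (fst x)))"
        by (intro continuous_intros continuous_on_compose2[OF ca]) (auto simp: S1_def)
      show "\<phi>' (1, x) = \<tau> * sgn (a (fst x))"
        if x: "x \<in> ?R1 \<and> \<not> \<bar>a (fst x)\<bar> \<le> 1 \<or> x \<in> ?R2 \<and> \<bar>a (fst x)\<bar> \<le> 1" for x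
      proof -
        obtain p b c where pbc: "x = (p, b, c)" by (metis surj_pair)
        have "\<bar>a p\<bar> = 1" "(1, p, b, c) \<in> K" using x by (auto simp: pbc S1_def K_def)
        moreover have "H (1, p, b, c) = (A (line_pt p), \<lambda>_. 0)"
          using calculation H1 by (auto simp: K_def)
        moreover have "(1, p, b, c) \<in> K1" "(1, p, b, c) \<in> K2"
          using calculation K1_1[of p b c] by (auto simp: K2_def a_def)
        ultimately have "\<phi>' (1, p, b, c) = \<tau> * a p" using face'[of "(1, p, b, c)"] by (simp add: a_def)
        with \<open>\<bar>a p\<bar> = 1\<close> show ?thesis by (auto simp: pbc abs_if sgn_if split: if_splits)
      qed
    qed
    moreover have "\<psi> = (\<lambda>x. if \<bar>a (fst x)\<bar> \<le> 1 then \<phi>' (1, x) else \<tau> * sgn (a (fst x)))"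
      by (auto simp: \<psi>_def fun_eq_iff)
    ultimately show ?thesis unfolding R12 by simp
  qed
  have cr1: "continuous_on S1 (\<lambda>x. r (1, x))"
    by (rule continuous_on_compose2[OF r(1)]) (auto intro!: continuous_intros simp: S1_def K_def)
  have "collapse (r (1, x)) = collapse (\<psi> x)" if "x \<in> S1" for x
  proof -
    obtain p b c where pbc: "x = (p, b, c)" by (metis surj_pair)
    have K: "(1, p, b, c) \<in> K" using that by (auto simp: pbc S1_def K_def)
    show ?thesis
    proof (cases "\<bar>a p\<bar> \<le> 1")
      case True
      then show ?thesis using r(2)[OF K] K1_1[OF K] by (simp add: pbc \<psi>_def \<Theta>_def)
    next
      case False
      then have "collapse (\<psi> x) = 1" using \<tau>end[of "sgn (a p)"] by (auto simp: pbc \<psi>_def sgn_if)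
      then show ?thesis using r(2)[OF K] K1_1[OF K] False by (simp add: pbc \<Theta>_def)
    qed
  qed
  from continuous_integral_offset_constant[OF \<open>connected S1\<close> cr1 c\<psi> this]
  obtain n :: int where n: "\<And>x. x \<in> S1 \<Longrightarrow> r (1, x) = \<psi> x + 2 * of_int n" by blast
  define \<sigma> where "\<sigma> = \<tau> * sgn (a 1)"
  have \<sigma>: "\<sigma> = 1 \<or> \<sigma> = -1" using \<tau> opp(1) by (auto simp: \<sigma>_def a_def sgn_if)
  have \<psi>1: "\<psi> (p, b, c) = p * \<sigma>" if "p = 1 \<or> p = -1" for p b c
    using that opp unfolding \<psi>_def \<sigma>_def a_def by auto
  \<comment> \<open>On \<open>\<bar>p\<bar> = 1\<close> the homotopy avoids \<open>M\<close>, so the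
    lift takes odd integer values and is constant in the homotopy time. Its value is read off at
    time 1, where the opposite signs of \<open>A\<close> give \<open>p * \<sigma>\<close>, up to the
    deck transformation \<open>n\<close>.\<close>
  have edge: "r (t, p, b, c) = p * \<sigma> + 2 * of_int n"
    if p: "p = 1 \<or> p = -1" and tbc: "t \<in> {0..1}" "b \<in> B" "c \<in> C" for t p b c
  proof -
    let ?E = "{0..1::real} \<times> {p} \<times> B \<times> C"
    have E1: "connected ?E" by (intro convex_connected convex_Times B C convex_real_interval convex_singleton)
    have E2: "continuous_on ?E r" by (rule continuous_on_subset[OF r(1)]) (use p in \<open>auto simp: K_def\<close>)
    have E3: "collapse (r x) = collapse 1" if "x \<in> ?E" for x
    proof -
      have "x \<in> K" using that p by (auto simp: K_def)
      moreover have "H x \<notin> h_model M"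
      proof -
        obtain t p' b c where "x = (t, p', b, c)" by (metis surj_pair)
        then have x: "x = (t, p, b, c)" "t \<in> {0..1}" "b \<in> B" using that by auto
        have "(t, (line_pt p, \<omega> b)) \<in> {0..1} \<times> h_model_minus N"
          using x p B(4) hN(3) by (auto simp: h_model_minus_def)
        then have "H x \<in> h ` ({0..1} \<times> h_model_minus N)" unfolding x(1) H_def prod.case by (rule imageI)
        then show ?thesis using h(4) by blast
      qed
      ultimately show ?thesis using r(2)[of x] K1_iff by (simp add: \<Theta>_def)
    qed
    from continuous_integral_offset_constant[OF E1 E2 continuous_on_const E3]
    obtain m :: int where m: "\<And>x. x \<in> ?E \<Longrightarrow> r x = 1 + 2 * of_int m" by blast
    have "r (t, p, b, c) = r (1, p, b, c)" using m tbc by simp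
    also have "\<dots> = p * \<sigma> + 2 * of_int n" using n[of "(p, b, c)"] \<psi>1[OF p] p tbc by (auto simp: S1_def)
    finally show ?thesis .
  qed
  \<comment> \<open>The lift at time 0, that is, for the map \<open>G\<close> itself, moved by the
    deck transformation that normalises its ends to \<sigma> and -\<sigma>.\<close>
  define \<Lambda> where "\<Lambda> x = r (0, x) - 2 * of_int n" for x
  show thesis
  proof (rule that[OF \<sigma>])
    show "continuous_on ({-1..1} \<times> B \<times> C) \<Lambda>" unfolding \<Lambda>_def
      by (intro continuous_intros continuous_on_compose2[OF r(1)]) (auto simp: K_def)
    show "\<Lambda> (1, b, c) = \<sigma> \<and> \<Lambda> (-1, b, c) = - \<sigma>" if "b \<in> B" "c \<in> C" for b c
      using edge[of 1 0 b c] edge[of "-1" 0 b c] that by (simp add: \<Lambda>_def)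
    fix p b c assume pbc: "p \<in> {-1..1}" "b \<in> B" "c \<in> C" and small: "\<bar>\<Lambda> (p, b, c)\<bar> < 1"
    let ?k = "(0, p, b, c)"
    have K: "?k \<in> K" using pbc by (simp add: K_def)
    have "collapse (r ?k) = collapse (\<Lambda> (p, b, c))"
      unfolding collapse_eq_iff \<Lambda>_def by (intro exI[of _ n]) simp
    then have \<Theta>k: "\<Theta> ?k = collapse (\<Lambda> (p, b, c))" using r(2)[OF K] by simp
    \<comment> \<open>Outside \<open>M\<close> the circle value is the base point, so \<Lambda>
      would be an odd integer, which \<open>\<bar>\<Lambda> (p, b, c)\<bar> < 1\<close>
      excludes.\<close>
    have "?k \<in> K1"
    proof (rule ccontr)
      assume "?k \<notin> K1"
      then have "collapse (\<Lambda> (p, b, c)) = collapse 1" using \<Theta>k by (simp add: \<Theta>_def)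
      then obtain m :: int where "\<Lambda> (p, b, c) = 1 + 2 * of_int m" unfolding collapse_eq_iff by blast
      then have "\<bar>1 + 2 * real_of_int m\<bar> < 1" using small by simp
      then have "2 * m < 0 \<and> -2 < 2 * m" by linarith
      then show False by presburger
    qed
    have eq: "d (H ?k) = G (pos p b)" using bspec[OF h(3) model[OF pbc(1,2)]] dch by (simp add: H_def pos_def)
    have "collapse (\<phi>' ?k) = collapse (\<Lambda> (p, b, c))" using \<Theta>k \<open>?k \<in> K1\<close> by (simp add: \<Theta>_def)
    then obtain m :: int where m: "\<phi>' ?k = \<Lambda> (p, b, c) + 2 * of_int m" by (auto simp: collapse_eq_iff)
    have "\<bar>\<phi>' ?k\<bar> \<le> 1" using \<phi>(2)[OF pbc(3)] by (simp add: \<phi>'_def)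
    then have "\<bar>2 * real_of_int m\<bar> < 2" using m small by linarith
    then have "m = 0" by linarith
    then have "\<phi> (G (pos p b), c) = \<Lambda> (p, b, c)" using m eq by (simp add: \<phi>'_def)
    then show "G (pos p b) \<in> h_set M \<and> \<phi> (G (pos p b), c) = \<Lambda> (p, b, c)"
      using in_M[OF \<open>?k \<in> K1\<close>] eq by simp
  qed
qed

section \<open>Smooth functions and retractions onto boxes\<close>

lemma Ck_on_imp_continuous_on: "Ck_on k h S \<Longrightarrow> continuous_on S h"
proof (cases k)
  case (Suc k')
  assume "Ck_on k h S"
  then have "h differentiable_on S"
    using Suc by (simp add: differentiable_on_def differentiable_at_withinI)
  then show ?thesis by (rule differentiable_imp_continuous_on)
qed simp

lemma Ck_on_imp_differentiable:
  assumes "Ck_on k h S" "1 \<le> k" "x \<in> S"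
  shows "(h has_derivative frechet_derivative h (at x)) (at x)"
proof -
  obtain k' where "k = Suc k'" using assms(2) by (cases k) auto
  then show ?thesis using assms(1,3) by (simp add: frechet_derivative_works[symmetric])
qed

lemma Ck_on_imp_continuous_derivative:
  "Ck_on k h S \<Longrightarrow> 1 \<le> k \<Longrightarrow> continuous_on S (\<lambda>x. frechet_derivative h (at x) v)"
proof -
  assume "Ck_on k h S" "1 \<le> k"
  then obtain k' where "Ck_on k' (\<lambda>x. frechet_derivative h (at x) v) S" by (cases k) auto
  then show ?thesis by (rule Ck_on_imp_continuous_on)
qed

text \<open>\<open>Ck_on\<close> yields continuity of each directional derivative, so the operator
  norm is bounded by a sum of bounds for the derivatives along the basis vectors; convexity of
  \<open>K\<close> then gives the mean value inequality.\<close>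

lemma Ck_on_lipschitz:
  fixes h :: "'a::euclidean_space \<Rightarrow> 'b::real_normed_vector"
  assumes h: "Ck_on k h S" "1 \<le> k" and K: "compact K" "convex K" "K \<subseteq> S"
  shows "\<exists>L\<ge>0. \<forall>z\<in>K. \<forall>w\<in>K. norm (h z - h w) \<le> L * norm (z - w)"
proof -
  have "\<exists>M. \<forall>x\<in>K. norm (frechet_derivative h (at x) b) \<le> M" for b
  proof -
    have "compact ((\<lambda>x. frechet_derivative h (at x) b) ` K)"
      using Ck_on_imp_continuous_derivative[OF h] K by (intro compact_continuous_image) (auto intro: continuous_on_subset)
    then have "bounded ((\<lambda>x. frechet_derivative h (at x) b) ` K)" by (rule compact_imp_bounded)
    then show ?thesis by (simp add: bounded_iff)
  qed
  then obtain M where M: "\<And>b x. x \<in> K \<Longrightarrow> norm (frechet_derivative h (at x) b) \<le> M b" by metis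
  define L where "L = (\<Sum>b\<in>Basis. \<bar>M b\<bar>)"
  have "norm (h z - h w) \<le> L * norm (z - w)" if "z \<in> K" "w \<in> K" for z w
  proof (rule differentiable_bound[OF K(2) _ _ that])
    fix x assume x: "x \<in> K"
    show der: "(h has_derivative frechet_derivative h (at x)) (at x within K)"
      using Ck_on_imp_differentiable[OF h subsetD[OF K(3) x]] by (rule has_derivative_at_withinI)
    let ?h = "frechet_derivative h (at x)"
    have lin: "linear ?h" using der has_derivative_linear by blast
    show "onorm ?h \<le> L"
    proof (rule onorm_le)
      fix v :: 'a
      have "?h v = ?h (\<Sum>b\<in>Basis. (v \<bullet> b) *\<^sub>R b)" by (simp add: euclidean_representation)
      also have "\<dots> = (\<Sum>b\<in>Basis. (v \<bullet> b) *\<^sub>R ?h b)"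
        by (simp add: linear_sum[OF lin] linear_scale[OF lin])
      finally have "norm (?h v) \<le> (\<Sum>b\<in>Basis. norm ((v \<bullet> b) *\<^sub>R ?h b))" by (metis norm_sum)
      also have "\<dots> \<le> (\<Sum>b\<in>Basis. \<bar>M b\<bar> * norm v)"
      proof (rule sum_mono)
        fix b :: 'a assume "b \<in> Basis"
        then have "\<bar>v \<bullet> b\<bar> \<le> norm v" by (rule Basis_le_norm)
        moreover have "norm (?h b) \<le> \<bar>M b\<bar>" using M[OF x, of b] by linarith
        ultimately show "norm ((v \<bullet> b) *\<^sub>R ?h b) \<le> \<bar>M b\<bar> * norm v"
          by (simp add: mult.commute mult_mono)
      qed
      finally show "norm (?h v) \<le> L * norm v" by (simp add: L_def sum_distrib_right)
    qed
  qed
  moreover have "L \<ge> 0" by (simp add: L_def sum_nonneg)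
  ultimately show ?thesis by blast
qed

definition clamp_real :: "real \<Rightarrow> real \<Rightarrow> real \<Rightarrow> real" where
  "clamp_real l h x = max l (min h x)"

lemma clamp_real_dist: "\<bar>clamp_real l h x - clamp_real l h y\<bar> \<le> \<bar>x - y\<bar>"
  by (auto simp: clamp_real_def max_def min_def abs_if)

lemma clamp_real_in: "l \<le> h \<Longrightarrow> clamp_real l h x \<in> {l..h}"
  by (auto simp: clamp_real_def)

lemma clamp_real_id: "x \<in> {l..h} \<Longrightarrow> clamp_real l h x = x"
  by (auto simp: clamp_real_def)

lemma clamp_real_ge: "l \<le> h \<Longrightarrow> h \<le> x \<Longrightarrow> clamp_real l h x = h"
  by (auto simp: clamp_real_def)

lemma clamp_real_le: "x \<le> l \<Longrightarrow> clamp_real l h x = l"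
  by (auto simp: clamp_real_def)

definition clamp_cart :: "real^'n \<Rightarrow> real^'n \<Rightarrow> real^'n \<Rightarrow> real^'n" where
  "clamp_cart l h z = (\<chi> i. clamp_real (l $ i) (h $ i) (z $ i))"

lemma clamp_cart_nth [simp]: "clamp_cart l h z $ i = clamp_real (l $ i) (h $ i) (z $ i)"
  by (simp add: clamp_cart_def)

lemma clamp_cart_dist: "norm (clamp_cart l h z - clamp_cart l h w) \<le> norm (z - w)"
  by (rule norm_le_componentwise_cart) (simp add: clamp_real_dist)

section \<open>Components of solutions\<close>

lemma solves_component:
  fixes l :: "'a::real_normed_vector \<Rightarrow> real"
  assumes "solves V \<gamma> S" "bounded_linear l" "t \<in> S"
  shows "((\<lambda>t. l (\<gamma> t)) has_real_derivative l (V (\<gamma> t))) (at t within S)"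
  using bounded_linear.has_vector_derivative[OF assms(2), of \<gamma> "V (\<gamma> t)" "at t within S"] assms
  by (simp add: solves_def has_real_derivative_iff_has_vector_derivative)

lemma component_stays_above:
  fixes l :: "'a::real_normed_vector \<Rightarrow> real"
  assumes sol: "solves V \<gamma> {0..}" and l: "bounded_linear l" and st: "0 \<le> s" "s \<le> t"
    and up: "\<And>z. l z = h \<Longrightarrow> 0 < l (V z)" and start: "h \<le> l (\<gamma> s)"
  shows "h \<le> l (\<gamma> t)"
proof (rule stays_above_level[where u = "\<lambda>t. l (\<gamma> t)", OF st(2) start])
  have sol': "solves V \<gamma> {s..t}" by (rule solves_subset[OF sol]) (use st in auto)
  show "continuous_on {s..t} (\<lambda>t. l (\<gamma> t))"
    using solves_component[OF sol' l] by (intro DERIV_continuous_on) blast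
  show "\<exists>d>0. ((\<lambda>t. l (\<gamma> t)) has_real_derivative d) (at r within {s..t})"
    if "r \<in> {s..<t}" "l (\<gamma> r) = h" for r
    using solves_component[OF sol' l, of r] up[OF that(2)] that(1) by auto
qed

lemma component_growth:
  fixes l :: "'a::real_normed_vector \<Rightarrow> real"
  assumes sol: "solves V \<gamma> {0..}" and l: "bounded_linear l" and st: "0 \<le> s" "s \<le> t"
    and up: "\<And>r. s \<le> r \<Longrightarrow> r \<le> t \<Longrightarrow> c \<le> l (V (\<gamma> r))"
  shows "l (\<gamma> s) + c * (t - s) \<le> l (\<gamma> t)"
proof -
  have sol': "solves V \<gamma> {s..t}" by (rule solves_subset[OF sol]) (use st in auto)
  have "c * t - l (\<gamma> t) \<le> c * s - l (\<gamma> s)"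
  proof (rule within_deriv_nonpos_imp_le[OF st(2)])
    fix r assume "r \<in> {s..t}"
    then show "((\<lambda>t. c * t - l (\<gamma> t)) has_real_derivative c - l (V (\<gamma> r))) (at r within {s..t})"
      using solves_component[OF sol' l] by (auto intro!: derivative_eq_intros)
    show "c - l (V (\<gamma> r)) \<le> 0" using up[of r] \<open>r \<in> {s..t}\<close> by simp
  qed
  then show ?thesis by (simp add: algebra_simps)
qed

text \<open>A half-space in which the field points further inwards with speed at least
  \<open>c\<close> is never left, so this speed applies at all later times.\<close>

lemma component_pushed_out:
  fixes l :: "'a::real_normed_vector \<Rightarrow> real"
  assumes sol: "solves V \<gamma> {0..}" and l: "bounded_linear l" and st: "0 \<le> s" "s \<le> t"
    and up: "\<And>z. h \<le> l z \<Longrightarrow> c \<le> l (V z)" and "0 < c" and start: "h \<le> l (\<gamma> s)"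
  shows "l (\<gamma> s) + c * (t - s) \<le> l (\<gamma> t)"
proof (rule component_growth[OF sol l st])
  fix r assume "s \<le> r" "r \<le> t"
  have "h \<le> l (\<gamma> r)"
  proof (rule component_stays_above[OF sol l st(1) \<open>s \<le> r\<close> _ start])
    show "0 < l (V z)" if "l z = h" for z using up[of z] \<open>0 < c\<close> that by simp
  qed
  then show "c \<le> l (V (\<gamma> r))" by (rule up)
qed

section \<open>The local system of a block\<close>

definition lpos :: "('n::finite, 'z) fs_block_scheme \<Rightarrow> (real^'n) \<times> real \<Rightarrow> (real^'n) \<times> real" where
  "lpos D = (\<lambda>(z, y). (fast_pos D z, y))"

definition lcoord :: "('n::finite, 'z) fs_block_scheme \<Rightarrow> (real^'n) \<times> real \<Rightarrow> (real^'n) \<times> real" where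
  "lcoord D = (\<lambda>(x, y). (fast_coord D x, y))"

definition lbox :: "('n::finite, 'z) fs_block_scheme \<Rightarrow> ((real^'n) \<times> real) set" where
  "lbox D = block_box D \<times> {b_ylo D..b_yhi D}"

definition lclamp :: "('n::finite, 'z) fs_block_scheme \<Rightarrow> (real^'n) \<times> real \<Rightarrow> (real^'n) \<times> real" where
  "lclamp D = (\<lambda>(z, y). (clamp_cart (b_lo D) (b_hi D) z, clamp_real (b_ylo D) (b_yhi D) y))"

definition lfield ::
  "(real^'n \<Rightarrow> real \<Rightarrow> real \<Rightarrow> real^'n) \<Rightarrow> (real^'n \<Rightarrow> real \<Rightarrow> real \<Rightarrow> real) \<Rightarrow> real
    \<Rightarrow> ('n::finite, 'z) fs_block_scheme \<Rightarrow> (real^'n) \<times> real \<Rightarrow> (real^'n) \<times> real" where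
  "lfield f g \<epsilon> D = (\<lambda>(z, y). (matrix_inv (b_frame D) *v f (fast_pos D z) y \<epsilon>, \<epsilon> * g (fast_pos D z) y \<epsilon>))"

lemma block_set_eq: "block_set D = lpos D ` lbox D"
  by (auto simp: block_set_def lpos_def lbox_def)

lemma lbox_eq: "lbox D = cbox (b_lo D, b_ylo D) (b_hi D, b_yhi D)"
  by (auto simp: lbox_def block_box_def cbox_Pair_eq interval_cbox_cart mem_box_cart)

lemma lbox_compact [simp]: "compact (lbox D)" and lbox_convex [simp]: "convex (lbox D)"
  by (simp_all add: lbox_eq)

lemma lclamp_dist: "norm (lclamp D v - lclamp D w) \<le> norm (v - w)"
proof -
  obtain z y z' y' where [simp]: "v = (z, y)" "w = (z', y')" by (metis surj_pair)
  have "(norm (clamp_cart (b_lo D) (b_hi D) z - clamp_cart (b_lo D) (b_hi D) z'))\<^sup>2 \<le> (norm (z - z'))\<^sup>2"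
    by (intro power_mono clamp_cart_dist norm_ge_zero)
  moreover have "\<bar>clamp_real (b_ylo D) (b_yhi D) y - clamp_real (b_ylo D) (b_yhi D) y'\<bar>\<^sup>2 \<le> \<bar>y - y'\<bar>\<^sup>2"
    by (intro power_mono clamp_real_dist abs_ge_zero)
  ultimately show ?thesis by (simp add: lclamp_def norm_Pair add_mono)
qed

lemma lclamp_id: "v \<in> lbox D \<Longrightarrow> lclamp D v = v"
  by (auto simp: lclamp_def lbox_def block_box_def clamp_real_id vec_eq_iff)

lemma continuous_on_fast_pos [continuous_intros]:
  "continuous_on S h \<Longrightarrow> continuous_on S (\<lambda>x. fast_pos D (h x))"
  unfolding fast_pos_def
  by (intro continuous_on_add continuous_on_const bounded_linear.continuous_on[OF matrix_vector_mul_bounded_linear])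

lemma continuous_on_fast_coord [continuous_intros]:
  "continuous_on S h \<Longrightarrow> continuous_on S (\<lambda>x. fast_coord D (h x))"
  unfolding fast_coord_def
  by (intro continuous_on_diff continuous_on_const bounded_linear.continuous_on[OF matrix_vector_mul_bounded_linear])

locale fs_system =
  fixes f :: "real^'n::finite \<Rightarrow> real \<Rightarrow> real \<Rightarrow> real^'n"
    and g :: "real^'n \<Rightarrow> real \<Rightarrow> real \<Rightarrow> real"
    and r :: nat and \<epsilon>0 :: real and I :: "real set"
  assumes r: "1 \<le> r" and \<epsilon>0: "0 < \<epsilon>0" and I: "open I" "{0..\<epsilon>0} \<subseteq> I"
    and Ck_f: "Ck_on r (\<lambda>(x, y, \<epsilon>). f x y \<epsilon>) (UNIV \<times> UNIV \<times> I)"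
    and Ck_g: "Ck_on r (\<lambda>(x, y, \<epsilon>). g x y \<epsilon>) (UNIV \<times> UNIV \<times> I)"
begin

lemma field_lipschitz:
  assumes "compact K" "convex K" "\<epsilon> \<in> {0..\<epsilon>0}"
  shows "\<exists>L\<ge>0. \<forall>z\<in>K. \<forall>w\<in>K. norm (fs_field f g \<epsilon> z - fs_field f g \<epsilon> w) \<le> L * norm (z - w)"
proof -
  let ?e = "\<lambda>z::(real^'n) \<times> real. (fst z, snd z, \<epsilon>)"
  have K: "compact (?e ` K)" "convex (?e ` K)" "?e ` K \<subseteq> UNIV \<times> UNIV \<times> I"
  proof -
    show "compact (?e ` K)"
      by (intro compact_continuous_image assms continuous_on_Pair continuous_on_fst continuous_on_snd
          continuous_on_id continuous_on_const)
    have eq: "?e ` K = (\<lambda>v. (0, 0, \<epsilon>) + v) ` ((\<lambda>z. (fst z, snd z, 0)) ` K)" by (auto simp: image_image)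
    have lin: "linear (\<lambda>z::(real^'n) \<times> real. (fst z, snd z, 0::real))" by (rule linearI) auto
    show "convex (?e ` K)"
      unfolding eq by (rule convex_translation[OF convex_linear_image[OF lin assms(2)]])
    show "?e ` K \<subseteq> UNIV \<times> UNIV \<times> I" using I assms(3) by auto
  qed
  have e: "norm (?e z - ?e w) = norm (z - w)" for z w by (cases z; cases w) (simp add: norm_Pair)
  have L1: "\<exists>L\<ge>0. \<forall>z\<in>K. \<forall>w\<in>K. norm (f (fst z) (snd z) \<epsilon> - f (fst w) (snd w) \<epsilon>) \<le> L * norm (z - w)"
  proof -
    obtain L where L: "L \<ge> 0" "\<And>z w. z \<in> ?e ` K \<Longrightarrow> w \<in> ?e ` K \<Longrightarrow>
        norm ((\<lambda>(x, y, \<epsilon>). f x y \<epsilon>) z - (\<lambda>(x, y, \<epsilon>). f x y \<epsilon>) w) \<le> L * norm (z - w)"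
      using Ck_on_lipschitz[OF Ck_f r K] by blast
    have "norm (f (fst z) (snd z) \<epsilon> - f (fst w) (snd w) \<epsilon>) \<le> L * norm (z - w)" if "z \<in> K" "w \<in> K" for z w
      using L(2)[OF imageI[OF that(1)] imageI[OF that(2)]] unfolding e prod.case .
    then show ?thesis using L(1) by blast
  qed
  then obtain L1 where L1: "L1 \<ge> 0" "\<And>z w. z \<in> K \<Longrightarrow> w \<in> K \<Longrightarrow>
      norm (f (fst z) (snd z) \<epsilon> - f (fst w) (snd w) \<epsilon>) \<le> L1 * norm (z - w)" by blast
  have L2: "\<exists>L\<ge>0. \<forall>z\<in>K. \<forall>w\<in>K. norm (g (fst z) (snd z) \<epsilon> - g (fst w) (snd w) \<epsilon>) \<le> L * norm (z - w)"
  proof -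
    obtain L where L: "L \<ge> 0" "\<And>z w. z \<in> ?e ` K \<Longrightarrow> w \<in> ?e ` K \<Longrightarrow>
        norm ((\<lambda>(x, y, \<epsilon>). g x y \<epsilon>) z - (\<lambda>(x, y, \<epsilon>). g x y \<epsilon>) w) \<le> L * norm (z - w)"
      using Ck_on_lipschitz[OF Ck_g r K] by blast
    have "norm (g (fst z) (snd z) \<epsilon> - g (fst w) (snd w) \<epsilon>) \<le> L * norm (z - w)" if "z \<in> K" "w \<in> K" for z w
      using L(2)[OF imageI[OF that(1)] imageI[OF that(2)]] unfolding e prod.case .
    then show ?thesis using L(1) by blast
  qed
  then obtain L2 where L2: "L2 \<ge> 0" "\<And>z w. z \<in> K \<Longrightarrow> w \<in> K \<Longrightarrow>
      norm (g (fst z) (snd z) \<epsilon> - g (fst w) (snd w) \<epsilon>) \<le> L2 * norm (z - w)" by blast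
  have "norm (fs_field f g \<epsilon> z - fs_field f g \<epsilon> w) \<le> (L1 + \<epsilon> * L2) * norm (z - w)"
    if "z \<in> K" "w \<in> K" for z w
  proof -
    have "fs_field f g \<epsilon> z - fs_field f g \<epsilon> w = (f (fst z) (snd z) \<epsilon> - f (fst w) (snd w) \<epsilon>,
        \<epsilon> * (g (fst z) (snd z) \<epsilon> - g (fst w) (snd w) \<epsilon>))"
      by (simp add: fs_field_def case_prod_beta algebra_simps)
    also have "norm \<dots> \<le> norm (f (fst z) (snd z) \<epsilon> - f (fst w) (snd w) \<epsilon>)
        + norm (\<epsilon> * (g (fst z) (snd z) \<epsilon> - g (fst w) (snd w) \<epsilon>))" by (rule norm_Pair_le)
    also have "\<dots> \<le> L1 * norm (z - w) + \<epsilon> * (L2 * norm (z - w))"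
      using L1(2)[OF that] L2(2)[OF that] assms(3)
      by (intro add_mono) (auto simp: abs_mult intro!: mult_left_mono)
    finally show ?thesis by (simp add: algebra_simps)
  qed
  moreover have "L1 + \<epsilon> * L2 \<ge> 0" using L1(1) L2(1) assms(3) by simp
  ultimately show ?thesis by blast
qed

lemma field_lipschitz':
  assumes "\<epsilon> \<in> {0..\<epsilon>0}" "compact K" "convex K"
  shows "\<exists>L. \<forall>z\<in>K. \<forall>w\<in>K. norm (fs_field f g \<epsilon> z - fs_field f g \<epsilon> w) \<le> L * norm (z - w)"
  using field_lipschitz[OF assms(2,3,1)] by blast

end

lemma linear_lipschitz:
  fixes l :: "'a::euclidean_space \<Rightarrow> 'b::real_normed_vector"
  assumes "linear l"
  obtains C where "C \<ge> 0" "\<And>v. norm (l v) \<le> C * norm v"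
  using linear_bounded_pos[OF assms] by (metis less_imp_le)

locale fs_block_at = fs_system f g r \<epsilon>0 I
  for f :: "real^'n::finite \<Rightarrow> real \<Rightarrow> real \<Rightarrow> real^'n" and g r \<epsilon>0 I +
  fixes D :: "'n fs_block" and \<epsilon> :: real
  assumes \<epsilon>: "\<epsilon> \<in> {0..\<epsilon>0}" and block: "fast_saddle_block f \<epsilon>0 D" and box_ne: "block_box D \<noteq> {}"
begin

lemma frame_inverse [simp]: "matrix_inv (b_frame D) *v (b_frame D *v z) = z"
    "b_frame D *v (matrix_inv (b_frame D) *v z) = z"
proof -
  have "\<exists>A'. b_frame D ** A' = mat 1 \<and> A' ** b_frame D = mat 1"
    using block by (simp add: fast_saddle_block_def invertible_def)
  from someI_ex[OF this] show "matrix_inv (b_frame D) *v (b_frame D *v z) = z"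
    "b_frame D *v (matrix_inv (b_frame D) *v z) = z"
    by (simp_all add: matrix_vector_mul_assoc matrix_inv_def)
qed

lemma fast_coord_pos [simp]: "fast_coord D (fast_pos D z) = z" "fast_pos D (fast_coord D x) = x"
  by (simp_all add: fast_coord_def fast_pos_def)

lemma lcoord_lpos [simp]: "lcoord D (lpos D v) = v" "lpos D (lcoord D w) = w"
  by (simp_all add: lcoord_def lpos_def case_prod_beta)

lemma mem_block_set_iff: "w \<in> block_set D \<longleftrightarrow> lcoord D w \<in> lbox D"
proof
  assume "lcoord D w \<in> lbox D"
  then have "lpos D (lcoord D w) \<in> block_set D" unfolding block_set_eq by blast
  then show "w \<in> block_set D" by simp
qed (auto simp: block_set_eq)

lemma lo_le_hi: "b_lo D $ i \<le> b_hi D $ i" "b_ylo D < b_yhi D"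
proof -
  obtain z where "z \<in> block_box D" using box_ne by blast
  then have "b_lo D $ i \<le> z $ i" "z $ i \<le> b_hi D $ i" by (auto simp: block_box_def)
  then show "b_lo D $ i \<le> b_hi D $ i" by (rule order_trans)
  show "b_ylo D < b_yhi D" using block by (simp add: fast_saddle_block_def)
qed

lemma lclamp_in: "lclamp D v \<in> lbox D"
  using lo_le_hi clamp_real_in[OF lo_le_hi(1)] clamp_real_in[of "b_ylo D" "b_yhi D" "snd v"]
  by (simp add: lclamp_def lbox_def block_box_def case_prod_beta)

text \<open>The local field composed with the retraction onto the box. It coincides with the local
  field on the box and has complete forward and backward semiflows; beyond a face, its component
  normal to that face keeps the sign that it has on the face.\<close>

definition lhat :: "(real^'n) \<times> real \<Rightarrow> (real^'n) \<times> real" where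
  "lhat v = lfield f g \<epsilon> D (lclamp D v)"

lemma lfield_eq: "lfield f g \<epsilon> D v = (matrix_inv (b_frame D) *v fst (fs_field f g \<epsilon> (lpos D v)), snd (fs_field f g \<epsilon> (lpos D v)))"
  by (simp add: lfield_def fs_field_def lpos_def case_prod_beta)

lemma lfield_lipschitz:
  obtains L where "\<And>v w. v \<in> lbox D \<Longrightarrow> w \<in> lbox D \<Longrightarrow>
    norm (lfield f g \<epsilon> D v - lfield f g \<epsilon> D w) \<le> L * norm (v - w)" "L \<ge> 0"
proof -
  have lp: "lpos D v = (b_origin D, 0) + (b_frame D *v fst v, snd v)" for v
    by (simp add: lpos_def fast_pos_def case_prod_beta)
  have lin: "linear (\<lambda>v :: (real^'n) \<times> real. (b_frame D *v fst v, snd v))"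
    by (rule linearI) (auto simp: matrix_vector_right_distrib matrix_vector_mult_scaleR)
  then have blin: "bounded_linear (\<lambda>v :: (real^'n) \<times> real. (b_frame D *v fst v, snd v))" by (simp add: linear_conv_bounded_linear)
  have lin2: "linear (\<lambda>v :: (real^'n) \<times> real. (matrix_inv (b_frame D) *v fst v, snd v))"
    by (rule linearI) (auto simp: matrix_vector_right_distrib matrix_vector_mult_scaleR)
  obtain C1 where C1: "C1 \<ge> 0" "\<And>v :: (real^'n) \<times> real. norm (b_frame D *v fst v, snd v) \<le> C1 * norm v"
    using linear_lipschitz[OF lin] by blast
  obtain C2 where C2: "C2 \<ge> 0" "\<And>v :: (real^'n) \<times> real. norm (matrix_inv (b_frame D) *v fst v, snd v) \<le> C2 * norm v"
    using linear_lipschitz[OF lin2] by blast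
  have "block_set D = (+) (b_origin D, 0) ` (\<lambda>v. (b_frame D *v fst v, snd v)) ` lbox D"
    by (simp add: block_set_eq image_image lp[abs_def])
  moreover have "compact ((\<lambda>v. (b_frame D *v fst v, snd v)) ` lbox D)"
    by (rule compact_continuous_image[OF linear_continuous_on[OF blin] lbox_compact])
  ultimately have "compact (block_set D)" "convex (block_set D)"
    by (simp_all add: compact_translation convex_translation convex_linear_image[OF lin])
  from field_lipschitz[OF this \<epsilon>] obtain L where L: "L \<ge> 0" "\<And>v w. v \<in> block_set D \<Longrightarrow> w \<in> block_set D \<Longrightarrow>
    norm (fs_field f g \<epsilon> v - fs_field f g \<epsilon> w) \<le> L * norm (v - w)" by blast
  show thesis
  proof (rule that)
    fix v w assume vw: "v \<in> lbox D" "w \<in> lbox D"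
    let ?F = "fs_field f g \<epsilon>"
    have "lfield f g \<epsilon> D v - lfield f g \<epsilon> D w = (matrix_inv (b_frame D) *v fst (?F (lpos D v) - ?F (lpos D w)), snd (?F (lpos D v) - ?F (lpos D w)))"
      by (simp add: lfield_eq matrix_vector_mult_diff_distrib)
    then have "norm (lfield f g \<epsilon> D v - lfield f g \<epsilon> D w) \<le> C2 * norm (?F (lpos D v) - ?F (lpos D w))"
      using C2(2)[of "?F (lpos D v) - ?F (lpos D w)"] by simp
    also have "\<dots> \<le> C2 * (L * norm (lpos D v - lpos D w))"
      using vw by (intro mult_left_mono L C2) (auto simp: block_set_eq)
    also have "lpos D v - lpos D w = (b_frame D *v fst (v - w), snd (v - w))"
      by (simp add: lp matrix_vector_mult_diff_distrib)
    also have "C2 * (L * norm \<dots>) \<le> C2 * (L * (C1 * norm (v - w)))"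
      by (intro mult_left_mono C1 C2 L)
    finally show "norm (lfield f g \<epsilon> D v - lfield f g \<epsilon> D w) \<le> (C2 * L * C1) * norm (v - w)"
      by (simp add: mult.assoc)
  qed (use C1 C2 L in simp)
qed

lemma lhat_lipschitz_bounded:
  obtains L B where "\<And>v w. norm (lhat v - lhat w) \<le> L * norm (v - w)" "\<And>v. norm (lhat v) \<le> B"
proof -
  obtain L where L: "\<And>v w. v \<in> lbox D \<Longrightarrow> w \<in> lbox D \<Longrightarrow>
    norm (lfield f g \<epsilon> D v - lfield f g \<epsilon> D w) \<le> L * norm (v - w)" "L \<ge> 0" using lfield_lipschitz by blast
  have 1: "norm (lhat v - lhat w) \<le> L * norm (v - w)" for v w
    using L(1)[OF lclamp_in lclamp_in, of v w] mult_left_mono[OF lclamp_dist[of D v w] L(2)]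
    by (simp add: lhat_def)
  obtain R where R: "\<And>v. v \<in> lbox D \<Longrightarrow> norm v \<le> R"
    using compact_imp_bounded[OF lbox_compact[of D]] by (auto simp: bounded_iff)
  have "norm (lhat v) \<le> norm (lhat 0) + L * (2 * R)" for v
  proof -
    have "norm (lclamp D v - lclamp D 0) \<le> 2 * R"
      using norm_triangle_ineq4[of "lclamp D v" "lclamp D 0"] R[OF lclamp_in, of v] R[OF lclamp_in, of 0] by linarith
    then have "L * norm (lclamp D v - lclamp D 0) \<le> L * (2 * R)" by (rule mult_left_mono[OF _ L(2)])
    then have "norm (lhat v - lhat 0) \<le> L * (2 * R)"
      using L(1)[OF lclamp_in lclamp_in, of v 0] unfolding lhat_def by linarith
    then show ?thesis using norm_triangle_sub[of "lhat v" "lhat 0"] by linarith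
  qed
  with 1 show thesis using that by blast
qed

definition lflow :: "real \<Rightarrow> (real^'n) \<times> real \<Rightarrow> (real^'n) \<times> real" where
  "lflow = (SOME \<Phi>. (\<forall>z. \<Phi> 0 z = z) \<and> (\<forall>z. solves lhat (\<lambda>t. \<Phi> t z) {0..}) \<and>
    continuous_on ({0..} \<times> UNIV) (\<lambda>(t, z). \<Phi> t z))"

text \<open>Backward orbits, as forward orbits of \<open>- lhat\<close>:
  \<open>exists_semiflow\<close> speaks of nonnegative times only.\<close>

definition lrev :: "real \<Rightarrow> (real^'n) \<times> real \<Rightarrow> (real^'n) \<times> real" where
  "lrev = (SOME \<Phi>. (\<forall>z. \<Phi> 0 z = z) \<and> (\<forall>z. solves (\<lambda>v. - lhat v) (\<lambda>t. \<Phi> t z) {0..}) \<and>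
    continuous_on ({0..} \<times> UNIV) (\<lambda>(t, z). \<Phi> t z))"

lemma lflow: "lflow 0 z = z" "solves lhat (\<lambda>t. lflow t z) {0..}"
    "continuous_on ({0..} \<times> UNIV) (\<lambda>(t, z). lflow t z)"
proof -
  have "\<exists>\<Phi>. (\<forall>z. \<Phi> 0 z = z) \<and> (\<forall>z. solves lhat (\<lambda>t. \<Phi> t z) {0..}) \<and>
      continuous_on ({0..} \<times> UNIV) (\<lambda>(t, z). \<Phi> t z)"
    by (rule lhat_lipschitz_bounded) (rule exists_semiflow)
  from someI_ex[OF this] show "lflow 0 z = z" "solves lhat (\<lambda>t. lflow t z) {0..}"
    "continuous_on ({0..} \<times> UNIV) (\<lambda>(t, z). lflow t z)" unfolding lflow_def by blast+
qed

lemma lrev: "lrev 0 z = z" "solves (\<lambda>v. - lhat v) (\<lambda>t. lrev t z) {0..}"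
    "continuous_on ({0..} \<times> UNIV) (\<lambda>(t, z). lrev t z)"
proof -
  have "\<exists>\<Phi>. (\<forall>z. \<Phi> 0 z = z) \<and> (\<forall>z. solves (\<lambda>v. - lhat v) (\<lambda>t. \<Phi> t z) {0..}) \<and>
      continuous_on ({0..} \<times> UNIV) (\<lambda>(t, z). \<Phi> t z)"
  proof (rule lhat_lipschitz_bounded)
    fix L B assume "\<And>v w. norm (lhat v - lhat w) \<le> L * norm (v - w)" "\<And>v. norm (lhat v) \<le> B"
    then have "\<And>v w. norm (- lhat v - - lhat w) \<le> L * norm (v - w)" "\<And>v. norm (- lhat v) \<le> B"
      by (simp_all add: norm_minus_commute)
    then show ?thesis by (rule exists_semiflow)
  qed
  from someI_ex[OF this] show "lrev 0 z = z" "solves (\<lambda>v. - lhat v) (\<lambda>t. lrev t z) {0..}"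
    "continuous_on ({0..} \<times> UNIV) (\<lambda>(t, z). lrev t z)" unfolding lrev_def by blast+
qed

lemma continuous_on_lhat: "continuous_on S lhat"
proof -
  obtain L B where "\<And>v w. norm (lhat v - lhat w) \<le> L * norm (v - w)" using lhat_lipschitz_bounded by metis
  then have "norm (lhat v - lhat w) \<le> \<bar>L\<bar> * norm (v - w)" for v w
    by (meson abs_ge_self mult_right_mono norm_ge_zero order_trans)
  then have "\<bar>L\<bar>-lipschitz_on S lhat" by (auto simp: lipschitz_on_def dist_norm)
  then show ?thesis by (rule lipschitz_on_continuous_on)
qed

lemma lfield_component: "fst (lfield f g \<epsilon> D (z, y)) $ i = b_eig D $ i * z $ i + remainder f D z y \<epsilon> $ i"
  by (simp add: lfield_def remainder_def)

text \<open>The ends of the block are placed so that the linear term outweighs the remainder: at the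
  upper unstable end \<open>b_eig * b_hi \<ge> - \<delta>m\<close>, while the remainder exceeds
  \<open>\<delta>m\<close>. Strictness comes from the strict bounds on the remainder; negative
  eigenvalues reverse the signs.\<close>

lemma face_sign:
  assumes v: "v \<in> lbox D"
  shows "fst v $ i = b_hi D $ i \<Longrightarrow> i \<in> b_unst D \<Longrightarrow> 0 < fst (lfield f g \<epsilon> D v) $ i"
    and "fst v $ i = b_lo D $ i \<Longrightarrow> i \<in> b_unst D \<Longrightarrow> fst (lfield f g \<epsilon> D v) $ i < 0"
    and "fst v $ i = b_hi D $ i \<Longrightarrow> i \<notin> b_unst D \<Longrightarrow> fst (lfield f g \<epsilon> D v) $ i < 0"
    and "fst v $ i = b_lo D $ i \<Longrightarrow> i \<notin> b_unst D \<Longrightarrow> 0 < fst (lfield f g \<epsilon> D v) $ i"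
proof -
  obtain W and \<delta>m \<delta>p :: "real^'n" where W: "\<forall>x\<in>W. \<forall>y\<in>{b_ylo D..b_yhi D}. \<forall>\<epsilon>\<in>{0..\<epsilon>0}. \<forall>i.
           \<delta>m $ i < remainder f D (fast_coord D x) y \<epsilon> $ i \<and> remainder f D (fast_coord D x) y \<epsilon> $ i < \<delta>p $ i"
      and hi0: "\<forall>i\<in>b_unst D. b_lo D $ i \<le> - \<delta>p $ i / b_eig D $ i \<and> - \<delta>m $ i / b_eig D $ i \<le> b_hi D $ i"
      and lo0: "\<forall>i. i \<notin> b_unst D \<longrightarrow> b_lo D $ i \<le> - \<delta>m $ i / b_eig D $ i \<and> - \<delta>p $ i / b_eig D $ i \<le> b_hi D $ i"
      and sub: "block_set D \<subseteq> W \<times> {b_ylo D..b_yhi D}"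
    using block unfolding fast_saddle_block_def by (elim conjE exE) (rule that; assumption)
  note hi = bspec[OF hi0] and lo = mp[OF spec[OF lo0]]
  have "if i \<in> b_unst D then 0 < b_eig D $ i else b_eig D $ i < 0"
    using block unfolding fast_saddle_block_def by (elim conjE) (erule spec)
  then have eig: "i \<in> b_unst D \<Longrightarrow> 0 < b_eig D $ i" "i \<notin> b_unst D \<Longrightarrow> b_eig D $ i < 0"
    by simp_all
  obtain z y where zy: "v = (z, y)" by force
  have "(fast_pos D z, y) \<in> block_set D" using v unfolding block_set_eq zy lpos_def by force
  then have R: "\<delta>m $ i < remainder f D z y \<epsilon> $ i" "remainder f D z y \<epsilon> $ i < \<delta>p $ i"
  proof -
    have "fast_pos D z \<in> W" "y \<in> {b_ylo D..b_yhi D}" using \<open>(fast_pos D z, y) \<in> block_set D\<close> sub by blast+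
    from W[rule_format, OF this \<epsilon>, of i] show "\<delta>m $ i < remainder f D z y \<epsilon> $ i" "remainder f D z y \<epsilon> $ i < \<delta>p $ i"
      by simp_all
  qed
  have comp: "fst (lfield f g \<epsilon> D v) $ i = z $ i * b_eig D $ i + remainder f D z y \<epsilon> $ i"
    by (simp add: zy lfield_component mult.commute)
  have hi': "b_lo D $ i * b_eig D $ i \<le> - \<delta>p $ i" "- \<delta>m $ i \<le> b_hi D $ i * b_eig D $ i" if "i \<in> b_unst D"
    using hi[OF that] unfolding pos_le_divide_eq[OF eig(1)[OF that]] pos_divide_le_eq[OF eig(1)[OF that]] by blast+
  have lo': "- \<delta>m $ i \<le> b_lo D $ i * b_eig D $ i" "b_hi D $ i * b_eig D $ i \<le> - \<delta>p $ i" if "i \<notin> b_unst D"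
    using lo[OF that] unfolding neg_le_divide_eq[OF eig(2)[OF that]] neg_divide_le_eq[OF eig(2)[OF that]] by blast+
  have fz: "fst v = z" by (simp add: zy)
  show "0 < fst (lfield f g \<epsilon> D v) $ i" if "fst v $ i = b_hi D $ i" "i \<in> b_unst D"
    using hi'(2)[OF that(2)] R that(1) unfolding comp fz by simp
  show "fst (lfield f g \<epsilon> D v) $ i < 0" if "fst v $ i = b_lo D $ i" "i \<in> b_unst D"
    using hi'(1)[OF that(2)] R that(1) unfolding comp fz by simp
  show "fst (lfield f g \<epsilon> D v) $ i < 0" if "fst v $ i = b_hi D $ i" "i \<notin> b_unst D"
    using lo'(2)[OF that(2)] R that(1) unfolding comp fz by simp
  show "0 < fst (lfield f g \<epsilon> D v) $ i" if "fst v $ i = b_lo D $ i" "i \<notin> b_unst D"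
    using lo'(1)[OF that(2)] R that(1) unfolding comp fz by simp
qed

end

lemma bounded_linear_fst_nth: "bounded_linear (\<lambda>v :: (real^'n::finite) \<times> 'b::real_normed_vector. fst v $ i)"
  using bounded_linear_compose[OF bounded_linear_vec_nth bounded_linear_fst] .

context fs_block_at
begin

lemma lclamp_idem [simp]: "lclamp D (lclamp D v) = lclamp D v"
  by (rule lclamp_id[OF lclamp_in])

lemma lhat_lclamp: "lhat v = lhat (lclamp D v)"
  by (simp add: lhat_def)

lemma lhat_eq: "v \<in> lbox D \<Longrightarrow> lhat v = lfield f g \<epsilon> D v"
  by (simp add: lhat_def lclamp_id)

lemma fst_lclamp_nth: "fst (lclamp D v) $ i = clamp_real (b_lo D $ i) (b_hi D $ i) (fst v $ i)"
  by (simp add: lclamp_def case_prod_beta)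

text \<open>The positive minimum over the compact part of the box in \<open>K\<close> serves for all
  points that retract into \<open>K\<close>, because \<open>lhat\<close> sees a point only through
  its retraction.\<close>

lemma uniform_speed:
  assumes K: "closed K" and l: "bounded_linear l"
    and pos: "\<And>v. v \<in> lbox D \<Longrightarrow> v \<in> K \<Longrightarrow> 0 < (l (lfield f g \<epsilon> D v) :: real)"
  shows "\<exists>c>0. \<forall>v. lclamp D v \<in> K \<longrightarrow> c \<le> l (lhat v)"
proof (cases "lbox D \<inter> K = {}")
  case True
  then show ?thesis using lclamp_in by (intro exI[of _ 1]) auto
next
  case False
  have "compact (lbox D \<inter> K)" using K by (intro compact_Int_closed lbox_compact)
  moreover have "continuous_on (lbox D \<inter> K) (\<lambda>v. l (lhat v))"
    by (rule bounded_linear.continuous_on[OF l continuous_on_lhat])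
  ultimately obtain v where v: "v \<in> lbox D \<inter> K" "\<And>w. w \<in> lbox D \<inter> K \<Longrightarrow> l (lhat v) \<le> l (lhat w)"
    using continuous_attains_inf[OF _ False] by blast
  have "0 < l (lhat v)" using pos[of v] v(1) by (simp add: lhat_eq)
  moreover have "l (lhat v) \<le> l (lhat w)" if "lclamp D w \<in> K" for w
    using v(2)[of "lclamp D w"] lclamp_in[of w] that lhat_lclamp[of w] by simp
  ultimately show ?thesis by blast
qed

lemma lhat_unstable:
  assumes "i \<in> b_unst D"
  shows "\<exists>c>0. \<forall>v. (b_hi D $ i \<le> fst v $ i \<longrightarrow> c \<le> fst (lhat v) $ i) \<and>
    (fst v $ i \<le> b_lo D $ i \<longrightarrow> c \<le> - fst (lhat v) $ i)"
proof -
  have cl: "closed {v :: (real^'n) \<times> real. fst v $ i = h}" for h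
    by (intro closed_Collect_eq continuous_intros)
  obtain c1 where c1: "c1 > 0" "\<And>v. fst (lclamp D v) $ i = b_hi D $ i \<Longrightarrow> c1 \<le> fst (lhat v) $ i"
    using uniform_speed[OF cl bounded_linear_fst_nth, of "b_hi D $ i" i] face_sign(1) assms by auto
  obtain c2 where c2: "c2 > 0" "\<And>v. fst (lclamp D v) $ i = b_lo D $ i \<Longrightarrow> c2 \<le> - fst (lhat v) $ i"
    using uniform_speed[OF cl bounded_linear_minus[OF bounded_linear_fst_nth], of "b_lo D $ i" i] face_sign(2) assms by auto
  show ?thesis
  proof (intro exI[of _ "min c1 c2"] conjI allI impI)
    show "0 < min c1 c2" using c1 c2 by simp
    show "min c1 c2 \<le> fst (lhat v) $ i" if "b_hi D $ i \<le> fst v $ i" for v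
      using c1(2)[of v] clamp_real_ge[OF lo_le_hi(1) that] by (simp add: fst_lclamp_nth)
    show "min c1 c2 \<le> - fst (lhat v) $ i" if "fst v $ i \<le> b_lo D $ i" for v
      using c2(2)[of v] clamp_real_le[OF that] by (simp add: fst_lclamp_nth)
  qed
qed

lemma lhat_stable:
  assumes "i \<notin> b_unst D"
  shows "b_hi D $ i \<le> fst v $ i \<Longrightarrow> fst (lhat v) $ i < 0"
    and "fst v $ i \<le> b_lo D $ i \<Longrightarrow> 0 < fst (lhat v) $ i"
  using face_sign(3)[OF lclamp_in _ assms, of v] face_sign(4)[OF lclamp_in _ assms, of v]
    clamp_real_ge[OF lo_le_hi(1)[of i], of "fst v $ i"] clamp_real_le[of "fst v $ i" "b_lo D $ i" "b_hi D $ i"]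
  by (simp_all add: fst_lclamp_nth lhat_def)

text \<open>Beyond an unstable face the retraction lies on that face, so the normal component keeps
  its sign and a minimal speed. The speed does not depend on the orbit, which lets one cut-off width
  serve for all orbits in \<open>transition\<close>.\<close>

lemma lflow_unstable_exit:
  assumes "i \<in> b_unst D"
  shows "\<exists>c>0. \<forall>z s t. 0 \<le> s \<longrightarrow> s \<le> t \<longrightarrow>
    (b_hi D $ i \<le> fst (lflow s z) $ i \<longrightarrow> b_hi D $ i + c * (t - s) \<le> fst (lflow t z) $ i) \<and>
    (fst (lflow s z) $ i \<le> b_lo D $ i \<longrightarrow> fst (lflow t z) $ i \<le> b_lo D $ i - c * (t - s))"
proof -
  obtain c where c: "c > 0" "\<And>v. b_hi D $ i \<le> fst v $ i \<Longrightarrow> c \<le> fst (lhat v) $ i"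
    "\<And>v. fst v $ i \<le> b_lo D $ i \<Longrightarrow> c \<le> - fst (lhat v) $ i"
    using lhat_unstable[OF assms] by auto
  show ?thesis
  proof (intro exI[of _ c] conjI allI impI c(1))
    fix z and s t :: real assume st: "0 \<le> s" "s \<le> t"
    show "b_hi D $ i + c * (t - s) \<le> fst (lflow t z) $ i" if "b_hi D $ i \<le> fst (lflow s z) $ i"
      using component_pushed_out[OF lflow(2) bounded_linear_fst_nth st _ c(1) that] c(2) that by fastforce
    show "fst (lflow t z) $ i \<le> b_lo D $ i - c * (t - s)" if "fst (lflow s z) $ i \<le> b_lo D $ i"
      using component_pushed_out[OF lflow(2) bounded_linear_minus[OF bounded_linear_fst_nth] st _ c(1),
          of "- b_lo D $ i" i z] c(3) that by fastforce
  qed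
qed

lemma lflow_stable_in:
  assumes "i \<notin> b_unst D" "0 \<le> t" "b_lo D $ i \<le> fst z $ i" "fst z $ i \<le> b_hi D $ i"
  shows "b_lo D $ i \<le> fst (lflow t z) $ i" "fst (lflow t z) $ i \<le> b_hi D $ i"
proof -
  show "b_lo D $ i \<le> fst (lflow t z) $ i"
    by (rule component_stays_above[OF lflow(2) bounded_linear_fst_nth order_refl assms(2)])
      (use lhat_stable(2)[OF assms(1)] assms(3) in \<open>auto simp: lflow(1)\<close>)
  have "- b_hi D $ i \<le> - fst (lflow t z) $ i"
    by (rule component_stays_above[OF lflow(2) bounded_linear_minus[OF bounded_linear_fst_nth] order_refl assms(2)])
      (use lhat_stable(1)[OF assms(1)] assms(4) in \<open>auto simp: lflow(1)\<close>)
  then show "fst (lflow t z) $ i \<le> b_hi D $ i" by simp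
qed

text \<open>Under time reversal the stable directions repel. Weak inequalities suffice for
  \<open>backward_stay\<close>, which compares with a level strictly inside the interval.\<close>

lemma lrev_stable_exit:
  assumes "i \<notin> b_unst D" "0 \<le> s" "s \<le> t"
  shows "b_hi D $ i \<le> fst (lrev s z) $ i \<Longrightarrow> b_hi D $ i \<le> fst (lrev t z) $ i"
    and "fst (lrev s z) $ i \<le> b_lo D $ i \<Longrightarrow> fst (lrev t z) $ i \<le> b_lo D $ i"
proof -
  show "b_hi D $ i \<le> fst (lrev t z) $ i" if "b_hi D $ i \<le> fst (lrev s z) $ i"
    by (rule component_stays_above[OF lrev(2) bounded_linear_fst_nth assms(2,3) _ that])
      (use lhat_stable(1)[OF assms(1)] in auto)
  have "- b_lo D $ i \<le> - fst (lrev t z) $ i" if "fst (lrev s z) $ i \<le> b_lo D $ i"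
    by (rule component_stays_above[OF lrev(2) bounded_linear_minus[OF bounded_linear_fst_nth] assms(2,3)])
      (use lhat_stable(2)[OF assms(1)] that in auto)
  then show "fst (lrev s z) $ i \<le> b_lo D $ i \<Longrightarrow> fst (lrev t z) $ i \<le> b_lo D $ i" by simp
qed

lemma lrev_unstable_in:
  assumes "i \<in> b_unst D" "0 \<le> t" "b_lo D $ i \<le> fst z $ i" "fst z $ i \<le> b_hi D $ i"
  shows "b_lo D $ i \<le> fst (lrev t z) $ i" "fst (lrev t z) $ i \<le> b_hi D $ i"
proof -
  obtain c where c: "c > 0" "\<And>v. b_hi D $ i \<le> fst v $ i \<Longrightarrow> c \<le> fst (lhat v) $ i"
    "\<And>v. fst v $ i \<le> b_lo D $ i \<Longrightarrow> c \<le> - fst (lhat v) $ i"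
    using lhat_unstable[OF assms(1)] by auto
  have lo: "0 < fst (- lhat v) $ i" if "fst v $ i = b_lo D $ i" for v using c(1) c(3)[of v] that by simp
  have hi: "0 < - fst (- lhat v) $ i" if "- fst v $ i = - b_hi D $ i" for v using c(1) c(2)[of v] that by simp
  show "b_lo D $ i \<le> fst (lrev t z) $ i"
    by (rule component_stays_above[OF lrev(2) bounded_linear_fst_nth order_refl assms(2) lo])
      (simp_all add: lrev(1) assms)
  have "- b_hi D $ i \<le> - fst (lrev t z) $ i"
    by (rule component_stays_above[OF lrev(2) bounded_linear_minus[OF bounded_linear_fst_nth] order_refl assms(2) hi])
      (simp_all add: lrev(1) assms)
  then show "fst (lrev t z) $ i \<le> b_hi D $ i" by simp
qed

lemma snd_lfield: "snd (lfield f g \<epsilon> D v) = \<epsilon> * g (fast_pos D (fst v)) (snd v) \<epsilon>"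
  by (simp add: lfield_def case_prod_beta)

lemma lflow_slow_const:
  assumes "\<epsilon> = 0" "0 \<le> t"
  shows "snd (lflow t z) = snd z" "snd (lrev t z) = snd z"
proof -
  have s: "snd (lhat v) = 0" for v by (simp only: lhat_def snd_lfield) (simp only: assms(1) mult_zero_left)
  have bl: "bounded_linear (\<lambda>v. - snd v :: real)" by (rule bounded_linear_minus[OF bounded_linear_snd])
  show "snd (lflow t z) = snd z"
    using component_growth[OF lflow(2)[of z] bounded_linear_snd order_refl assms(2), of 0]
      component_growth[OF lflow(2)[of z] bl order_refl assms(2), of 0] s by (simp add: lflow(1))
  show "snd (lrev t z) = snd z"
    using component_growth[OF lrev(2)[of z] bounded_linear_snd order_refl assms(2), of 0]
      component_growth[OF lrev(2)[of z] bl order_refl assms(2), of 0] s by (simp add: lrev(1))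
qed

text \<open>The lower speed is a minimum of \<open>\<epsilon> * q * g\<close> over the compact
  block, the upper one a bound of \<open>lhat\<close>; the factor \<open>q\<close> makes the drift
  positive whichever way the slow variable moves.\<close>

lemma lflow_slow_drift:
  assumes "0 < \<epsilon>" and q: "q = 1 \<or> q = (-1::real)"
    and g: "\<And>x y. (x, y) \<in> block_set D \<Longrightarrow> 0 < q * g x y \<epsilon>"
  shows "\<exists>c>0. \<exists>C>0. \<forall>z s t. 0 \<le> s \<longrightarrow> s \<le> t \<longrightarrow>
    c * (t - s) \<le> q * (snd (lflow t z) - snd (lflow s z)) \<and> q * (snd (lflow t z) - snd (lflow s z)) \<le> C * (t - s)"
proof -
  have bl: "bounded_linear (\<lambda>v :: (real^'n) \<times> real. q * snd v)" by (intro bounded_linear_mult_const bounded_linear_const_mult bounded_linear_snd)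
  have bl': "bounded_linear (\<lambda>v :: (real^'n) \<times> real. - (q * snd v))" by (rule bounded_linear_minus[OF bl])
  have "0 < q * snd (lfield f g \<epsilon> D v)" if "v \<in> lbox D" for v
  proof -
    have "lpos D v \<in> block_set D" using that by (auto simp: block_set_eq)
    then have "0 < \<epsilon> * (q * g (fast_pos D (fst v)) (snd v) \<epsilon>)"
      using g[of "fast_pos D (fst v)" "snd v"] assms(1) by (simp add: lpos_def case_prod_beta)
    then show ?thesis by (simp add: snd_lfield mult_ac)
  qed
  then obtain c where c: "c > 0" "\<And>v. c \<le> q * snd (lhat v)"
    using uniform_speed[OF closed_UNIV bl] by auto
  obtain B where B: "\<And>v. norm (lhat v) \<le> B" using lhat_lipschitz_bounded by metis
  have C: "q * snd (lhat v) \<le> B" for v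
  proof -
    have "q * snd (lhat v) \<le> \<bar>snd (lhat v)\<bar>" using q by auto
    also have "\<dots> \<le> norm (lhat v)" using norm_snd_le[of "snd (lhat v)" "fst (lhat v)"] by simp
    finally show ?thesis using B[of v] by linarith
  qed
  have "B > 0" using c(1) c(2)[of 0] C[of 0] by linarith
  show ?thesis
  proof (rule exI[of _ c], rule conjI[OF c(1)], rule exI[of _ B], intro conjI allI impI \<open>B > 0\<close>)
    fix z and s t :: real assume st: "0 \<le> s" "s \<le> t"
    show "c * (t - s) \<le> q * (snd (lflow t z) - snd (lflow s z))"
      using component_growth[OF lflow(2)[of z] bl st c(2)] by (simp add: algebra_simps)
    have "- (q * snd (lflow s z)) + (- B) * (t - s) \<le> - (q * snd (lflow t z))"
      by (rule component_growth[OF lflow(2)[of z] bl' st]) (use C in simp)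
    then show "q * (snd (lflow t z) - snd (lflow s z)) \<le> B * (t - s)" by (simp add: algebra_simps)
  qed
qed

lemma lpos_has_derivative:
  assumes "(\<gamma> has_vector_derivative v) F"
  shows "((\<lambda>t. lpos D (\<gamma> t)) has_vector_derivative (b_frame D *v fst v, snd v)) F"
proof -
  have bl: "bounded_linear (\<lambda>v :: (real^'n) \<times> real. (b_frame D *v fst v, snd v))"
    by (intro bounded_linear_Pair bounded_linear_snd
        bounded_linear_compose[OF matrix_vector_mul_bounded_linear bounded_linear_fst])
  have "((\<lambda>t. (b_origin D, 0) + (b_frame D *v fst (\<gamma> t), snd (\<gamma> t))) has_vector_derivative 0 + (b_frame D *v fst v, snd v)) F"
    by (intro has_vector_derivative_add has_vector_derivative_const bounded_linear.has_vector_derivative[OF bl assms])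
  then show ?thesis by (simp add: lpos_def fast_pos_def case_prod_beta)
qed

lemma lpos_lhat: "v \<in> lbox D \<Longrightarrow> (b_frame D *v fst (lhat v), snd (lhat v)) = fs_field f g \<epsilon> (lpos D v)"
  by (simp add: lhat_eq lfield_eq)

lemma lpos_solves:
  assumes "solves lhat \<gamma> S" "\<And>t. t \<in> S \<Longrightarrow> \<gamma> t \<in> lbox D"
  shows "solves (fs_field f g \<epsilon>) (\<lambda>t. lpos D (\<gamma> t)) S"
  unfolding solves_def
proof
  fix t assume t: "t \<in> S"
  have "(\<gamma> has_vector_derivative lhat (\<gamma> t)) (at t within S)" using assms(1) t by (simp add: solves_def)
  from lpos_has_derivative[OF this]
  show "((\<lambda>t. lpos D (\<gamma> t)) has_vector_derivative fs_field f g \<epsilon> (lpos D (\<gamma> t))) (at t within S)"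
    by (simp only: lpos_lhat[OF assms(2)[OF t]])
qed

lemma lpos_solves_rev:
  assumes "solves (\<lambda>v. - lhat v) \<gamma> S" "\<And>t. t \<in> S \<Longrightarrow> \<gamma> t \<in> lbox D"
  shows "solves (\<lambda>w. - fs_field f g \<epsilon> w) (\<lambda>t. lpos D (\<gamma> t)) S"
  unfolding solves_def
proof
  fix t assume t: "t \<in> S"
  have "(\<gamma> has_vector_derivative - lhat (\<gamma> t)) (at t within S)" using assms(1) t by (simp add: solves_def)
  from lpos_has_derivative[OF this] lpos_lhat[OF assms(2)[OF t]]
  show "((\<lambda>t. lpos D (\<gamma> t)) has_vector_derivative - fs_field f g \<epsilon> (lpos D (\<gamma> t))) (at t within S)"
    by (simp add: linear_neg[OF matrix_vector_mul_linear] prod_eq_iff flip: lpos_lhat[OF assms(2)[OF t]])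
qed

end

section \<open>Charts of blocks and exit faces\<close>

text \<open>An injective continuous function on an interval is strictly monotone, so the extreme
  values -1 and 1 are taken at the ends only.\<close>

lemma continuous_inj_interval_ends:
  fixes a :: "real \<Rightarrow> real"
  assumes cont: "continuous_on {l..h} a" and inj: "inj_on a {l..h}" and img: "a ` {l..h} = {-1..1}"
  shows "\<exists>\<tau>. (\<tau> = 1 \<or> \<tau> = -1) \<and> (\<forall>x\<in>{l..h}. \<bar>a x\<bar> = 1 \<longrightarrow> x = h \<and> a x = \<tau> \<or> x = l \<and> a x = - \<tau>)"
proof -
  have "l \<le> h" using img by (cases "l \<le> h") auto
  have end1: "x = l \<or> x = h" if x: "x \<in> {l..h}" "\<bar>a x\<bar> = 1" for x
  proof (rule ccontr)
    assume "\<not> ?thesis"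
    then have "l < x" "x < h" using x by auto
    from continuous_inj_imp_mono[OF this cont inj]
    have "a l < a x \<and> a x < a h \<or> a h < a x \<and> a x < a l" .
    moreover have "a l \<in> {-1..1}" "a h \<in> {-1..1}" using img \<open>l \<le> h\<close> by auto
    ultimately show False using x(2) by auto
  qed
  obtain x1 x2 where x: "x1 \<in> {l..h}" "a x1 = 1" "x2 \<in> {l..h}" "a x2 = -1"
  proof -
    have "1 \<in> a ` {l..h}" "-1 \<in> a ` {l..h}" unfolding img by auto
    then show thesis using that by (metis imageE)
  qed
  have "x1 = l \<or> x1 = h" "x2 = l \<or> x2 = h" "x1 \<noteq> x2" using end1 x by auto
  then have *: "a h = 1 \<and> a l = -1 \<or> a h = -1 \<and> a l = 1" using x by auto
  show ?thesis
  proof (intro exI[of _ "a h"] conjI ballI impI)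
    show "a h = 1 \<or> a h = -1" using * by blast
    fix x assume "x \<in> {l..h}" "\<bar>a x\<bar> = 1"
    then have "x = l \<or> x = h" by (rule end1)
    moreover have "a l = - a h" using * by auto
    ultimately show "x = h \<and> a x = a h \<or> x = l \<and> a x = - a h" by blast
  qed
qed

lemma coord_proj_single: "coord_proj {u} z = axis u (z $ u)"
  by (auto simp: coord_proj_def axis_def vec_eq_iff)

text \<open>The chart of the unstable direction is an arbitrary homeomorphism and may reverse the
  orientation; \<tau> is its value at the upper end of the box.\<close>

lemma block_coords_face:
  fixes D :: "('n::finite, 'z) fs_block_scheme"
  assumes \<kappa>: "block_coords D \<kappa>" and u: "b_unst D = {u}" and ne: "block_box D \<noteq> {}"
  shows "\<exists>\<tau>. (\<tau> = 1 \<or> \<tau> = -1) \<and> (\<forall>x y. fast_coord D x \<in> block_box D \<longrightarrow> \<bar>fst (\<kappa> (x, y)) 0\<bar> = 1 \<longrightarrow>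
    fast_coord D x $ u = b_hi D $ u \<and> fst (\<kappa> (x, y)) 0 = \<tau> \<or> fast_coord D x $ u = b_lo D $ u \<and> fst (\<kappa> (x, y)) 0 = - \<tau>)"
proof -
  obtain \<alpha> \<alpha>' \<beta> \<upsilon> where \<alpha>: "homeomorphism (coord_subspace {u}) (espace 1) \<alpha> \<alpha>'"
      "\<alpha> ` (coord_proj {u} ` block_box D) = ecball 1"
    and \<kappa>': "\<And>x y. \<kappa> (x, y) = (\<alpha> (coord_proj {u} (fast_coord D x)), \<beta> x, \<upsilon> y)"
    using \<kappa> unfolding block_coords_def u by (auto simp: numeral_eq_Suc)
  define a where "a t = \<alpha> (axis u t) 0" for t
  have sub: "axis u t \<in> coord_subspace {u}" for t by (auto simp: coord_subspace_def axis_def)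
  have eq: "(\<lambda>t::real. t *\<^sub>R (axis u 1 :: real^'n)) = axis u" by (auto simp: axis_def vec_eq_iff)
  have "continuous_on UNIV (\<lambda>t::real. t *\<^sub>R (axis u 1 :: real^'n))" by (intro continuous_intros)
  then have "continuous_on UNIV (axis u :: real \<Rightarrow> real^'n)" unfolding eq .
  then have "continuous_on UNIV (\<lambda>t. \<alpha> (axis u t))"
    by (rule continuous_on_compose2[OF homeomorphism_cont1[OF \<alpha>(1)]]) (use sub in blast)
  then have "continuous_on UNIV a" unfolding a_def by (rule continuous_on_apply_coord)
  moreover have "inj a"
  proof (rule injI)
    fix s t assume "a s = a t"
    have "\<alpha> (axis u s) \<in> espace 1" "\<alpha> (axis u t) \<in> espace 1"
      using homeomorphism_image1[OF \<alpha>(1)] sub by blast+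
    then have "\<alpha> (axis u s) = \<alpha> (axis u t)" using espace_1_eq \<open>a s = a t\<close> by (metis One_nat_def a_def)
    then have "axis u s = axis u t" using homeomorphism_apply1[OF \<alpha>(1)] sub by metis
    then show "s = t" by (metis axis_nth)
  qed
  moreover have "a ` {b_lo D $ u..b_hi D $ u} = {-1..1}"
  proof -
    have "(\<lambda>z. z $ u) ` block_box D = {b_lo D $ u..b_hi D $ u}"
    proof (intro equalityI subsetI)
      fix t assume t: "t \<in> {b_lo D $ u..b_hi D $ u}"
      obtain z where "z \<in> block_box D" using ne by blast
      with t have "(\<chi> i. if i = u then t else z $ i) \<in> block_box D" by (auto simp: block_box_def)
      then show "t \<in> (\<lambda>z. z $ u) ` block_box D" by (rule rev_image_eqI) simp
    qed (auto simp: block_box_def)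
    then have "a ` {b_lo D $ u..b_hi D $ u} = a ` (\<lambda>z. z $ u) ` block_box D" by (simp only:)
    also have "\<dots> = (\<lambda>p. p 0) ` \<alpha> ` coord_proj {u} ` block_box D"
      by (simp only: image_image a_def coord_proj_single)
    also have "\<dots> = (\<lambda>p. p 0) ` ecball 1" by (simp only: \<alpha>(2))
    also have "\<dots> = {-1..1}"
    proof (intro equalityI subsetI)
      fix t :: real assume "t \<in> {-1..1}"
      then have "line_pt t \<in> ecball 1" by auto
      then show "t \<in> (\<lambda>p. p 0) ` ecball 1" by (rule rev_image_eqI) simp
    qed (auto simp: ecball_def)
    finally show ?thesis .
  qed
  ultimately obtain \<tau> where \<tau>: "\<tau> = 1 \<or> \<tau> = -1" "\<And>x. x \<in> {b_lo D $ u..b_hi D $ u} \<Longrightarrow> \<bar>a x\<bar> = 1 \<Longrightarrow>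
      x = b_hi D $ u \<and> a x = \<tau> \<or> x = b_lo D $ u \<and> a x = - \<tau>"
    using continuous_inj_interval_ends[of "b_lo D $ u" "b_hi D $ u" a]
    by (meson continuous_on_subset inj_on_subset subset_UNIV)
  have "fst (\<kappa> (x, y)) 0 = a (fast_coord D x $ u)" for x y
    by (simp add: \<kappa>' coord_proj_single a_def)
  with \<tau> show ?thesis by (intro exI[of _ \<tau>]) (auto simp: block_box_def)
qed

text \<open>This replaces the chart of an exit face by an explicit parametrisation: \<open>p\<close>
  moves the slow coordinate through \<open>yF\<close>, and \<open>b\<close> runs over the block box
  with its unstable entry overwritten by \<open>a\<close>. The unknowns of the later equations thus
  become plain coordinates of a box.\<close>

lemma exit_face_chart:
  fixes D :: "('n::finite, 'z) fs_block_scheme"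
  assumes \<kappa>: "block_coords D \<kappa>" and u: "b_unst D = {u}" and face: "is_exit_face D \<kappa> ym yp Ma"
    and inv: "\<And>z. fast_coord D (fast_pos D z) = z"
  obtains a and yF \<upsilon> :: "real \<Rightarrow> real" and \<omega> where "a = b_lo D $ u \<or> a = b_hi D $ u" "continuous_on {-1..1} yF"
    "\<And>p. p \<in> {-1..1} \<Longrightarrow> b_ylo D < yF p \<and> yF p < b_yhi D"
    "continuous_on (block_box D) \<omega>" "\<omega> ` block_box D \<subseteq> ecball (h_s Ma)"
    "\<And>p b. p \<in> {-1..1} \<Longrightarrow> b \<in> block_box D \<Longrightarrow>
      lpos D (\<chi> i. if i = u then a else b $ i, yF p) \<in> h_set Ma \<and>
      inv_into (h_amb Ma) (h_chart Ma) (line_pt p, \<omega> b) = lpos D (\<chi> i. if i = u then a else b $ i, yF p)"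
    "strict_mono \<upsilon>" "surj \<upsilon>" "\<upsilon> (b_ylo D) = 0" "\<upsilon> (b_yhi D) = 1" "\<And>w. snd (snd (\<kappa> w)) = \<upsilon> (snd w)"
    "\<And>p. p \<in> {-1..1} \<Longrightarrow> ym \<le> \<upsilon> (yF p) \<and> \<upsilon> (yF p) \<le> (yp :: real)"
proof -
  obtain \<alpha> \<alpha>' \<beta> \<beta>' \<upsilon> \<upsilon>' where \<alpha>: "homeomorphism (coord_subspace {u}) (espace 1) \<alpha> \<alpha>'"
    and \<beta>: "homeomorphism (coord_subspace (- {u})) (espace (card (- {u}))) \<beta> \<beta>'"
      "\<beta> ` (coord_proj (- {u}) ` block_box D) = ecball (card (- {u}))"
    and \<upsilon>: "homeomorphism UNIV UNIV \<upsilon> \<upsilon>'" "strict_mono \<upsilon>" "\<upsilon> ` {b_ylo D..b_yhi D} = {0..1::real}"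
    and \<kappa>': "\<And>x y. \<kappa> (x, y) = (\<alpha> (coord_proj {u} (fast_coord D x)), \<beta> (coord_proj (- {u}) (fast_coord D x)), \<upsilon> y)"
    using \<kappa> unfolding block_coords_def u by auto
  have yy: "b_ylo D \<le> b_yhi D" using \<upsilon>(3) by (cases "b_ylo D \<le> b_yhi D") auto
  have inv\<upsilon>: "\<upsilon> (\<upsilon>' t) = t" "\<upsilon>' (\<upsilon> t) = t" for t
    using \<upsilon>(1) by (simp_all add: homeomorphism_def)
  have ends: "\<upsilon> (b_ylo D) = 0" "\<upsilon> (b_yhi D) = 1"
  proof -
    have "0 \<in> \<upsilon> ` {b_ylo D..b_yhi D}" "1 \<in> \<upsilon> ` {b_ylo D..b_yhi D}" unfolding \<upsilon>(3) by auto
    then obtain y0 y1 where y: "y0 \<in> {b_ylo D..b_yhi D}" "\<upsilon> y0 = 0" "y1 \<in> {b_ylo D..b_yhi D}" "\<upsilon> y1 = 1"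
      by (metis imageE)
    have "\<upsilon> (b_ylo D) \<in> {0..1}" "\<upsilon> (b_yhi D) \<in> {0..1}" using \<upsilon>(3) yy by auto
    moreover have "\<upsilon> (b_ylo D) \<le> \<upsilon> y0" by (rule iffD2[OF strict_mono_less_eq[OF \<upsilon>(2)]]) (use y in auto)
    moreover have "\<upsilon> y1 \<le> \<upsilon> (b_yhi D)" by (rule iffD2[OF strict_mono_less_eq[OF \<upsilon>(2)]]) (use y in auto)
    ultimately show "\<upsilon> (b_ylo D) = 0" "\<upsilon> (b_yhi D) = 1" using y by auto
  qed
  have ym: "0 < ym" "ym < yp" "yp < 1" and hset: "is_hset Ma" and hs: "h_s Ma = card (- {u})" and hu: "h_u Ma = 1"
    and exit: "h_set Ma \<subseteq> fast_exit D"
    using face unfolding is_exit_face_def u by auto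
  obtain ac where ac: "h_set Ma = {w. \<kappa> w \<in> {ac} \<times> ecball (card (- {u})) \<times> {ym..yp}}"
      "h_amb Ma = {w. fst (\<kappa> w) = ac}"
      "\<And>w. w \<in> h_amb Ma \<Longrightarrow> h_chart Ma w = (case \<kappa> w of (_, b, y) \<Rightarrow>
         ((\<lambda>i. if i = 0 then (2 * y - ym - yp) / (yp - ym) else 0), b))"
    using face unfolding is_exit_face_def u by blast
  \<comment> \<open>The face is nonempty because its model contains the origin. Each of its points
    lies in \<open>fast_exit\<close>, so the unstable coordinate of a chosen one is an end of the
    box; this end is \<open>a\<close>.\<close>
  have "h_chart Ma ` h_set Ma = h_model Ma" using hset by (simp add: is_hset_def)
  moreover have "(line_pt 0, \<lambda>_. 0) \<in> h_model Ma"
    by (simp add: h_model_def hu ecball_def espace_iff enorm_def line_pt_def)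
  ultimately obtain w0 where w0: "w0 \<in> h_set Ma" by (metis image_iff)
  then obtain z0 y0 where z0: "w0 = (fast_pos D z0, y0)" "z0 $ u = b_lo D $ u \<or> z0 $ u = b_hi D $ u"
    using exit unfolding fast_exit_def u by blast
  define a where "a = z0 $ u"
  have ac_eq: "\<alpha> (axis u a) = ac"
    using w0 unfolding ac(1) z0(1) by (auto simp: \<kappa>' inv coord_proj_single a_def)
  \<comment> \<open>The inverse of the affine rescaling of \<open>[ym, yp]\<close> to
    \<open>[-1, 1]\<close> in \<open>is_exit_face\<close>, followed by the inverse of the slow chart
    \<upsilon>.\<close>
  define yF where "yF p = \<upsilon>' ((ym + yp) / 2 + p * (yp - ym) / 2)" for p
  define \<omega> where "\<omega> b = \<beta> (coord_proj (- {u}) b)" for b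
  have \<upsilon>yF: "\<upsilon> (yF p) = (ym + yp) / 2 + p * (yp - ym) / 2" for p by (simp add: yF_def inv\<upsilon>)
  have range: "ym \<le> \<upsilon> (yF p) \<and> \<upsilon> (yF p) \<le> yp" if "p \<in> {-1..1}" for p
  proof -
    have "- 1 * (yp - ym) \<le> p * (yp - ym)" "p * (yp - ym) \<le> 1 * (yp - ym)"
      using that ym by (intro mult_right_mono, auto)+
    then show ?thesis unfolding \<upsilon>yF by (simp add: field_simps)
  qed
  show thesis
  proof (rule that[of a yF \<omega> \<upsilon>])
    show "a = b_lo D $ u \<or> a = b_hi D $ u" using z0 by (simp add: a_def)
    show "continuous_on {-1..1} yF" unfolding yF_def
      by (rule continuous_on_compose2[OF homeomorphism_cont2[OF \<upsilon>(1)]]) (auto intro!: continuous_intros)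
    show "b_ylo D < yF p \<and> yF p < b_yhi D" if "p \<in> {-1..1}" for p
    proof -
      have "\<upsilon> (b_ylo D) < \<upsilon> (yF p)" "\<upsilon> (yF p) < \<upsilon> (b_yhi D)" using range[OF that] ym ends by auto
      then show ?thesis using strict_mono_less[OF \<upsilon>(2)] by blast
    qed
    have cp: "continuous_on S (coord_proj J)" for S and J :: "'n set"
      unfolding coord_proj_def
    proof (rule continuous_on_vec_lambda)
      fix i show "continuous_on S (\<lambda>z::real^'n. if i \<in> J then z $ i else 0)"
        by (cases "i \<in> J") (auto intro!: continuous_intros)
    qed
    show "continuous_on (block_box D) \<omega>" unfolding \<omega>_def
      by (rule continuous_on_compose2[OF homeomorphism_cont1[OF \<beta>(1)] cp]) (auto simp: coord_subspace_def coord_proj_def)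
    show "\<omega> ` block_box D \<subseteq> ecball (h_s Ma)" unfolding hs using \<beta>(2) by (auto simp: \<omega>_def)
    show "strict_mono \<upsilon>" "\<upsilon> (b_ylo D) = 0" "\<upsilon> (b_yhi D) = 1" by (fact \<upsilon> ends)+
    show "surj \<upsilon>" using inv\<upsilon>(1) by (rule surjI)
    show "snd (snd (\<kappa> w)) = \<upsilon> (snd w)" for w by (cases w) (simp add: \<kappa>')
    show "ym \<le> \<upsilon> (yF p) \<and> \<upsilon> (yF p) \<le> yp" if "p \<in> {-1..1}" for p by (rule range[OF that])
    fix p :: real and b assume p: "p \<in> {-1..1}" and b: "b \<in> block_box D"
    let ?w = "lpos D (\<chi> i. if i = u then a else b $ i, yF p)"
    have "coord_proj (- {u}) (\<chi> i. if i = u then a else b $ i) = coord_proj (- {u}) b"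
      by (auto simp: coord_proj_def vec_eq_iff)
    then have \<kappa>w: "\<kappa> ?w = (ac, \<omega> b, \<upsilon> (yF p))"
      by (simp add: lpos_def \<kappa>' inv coord_proj_single ac_eq \<omega>_def)
    have "\<omega> b \<in> ecball (card (- {u}))" using \<beta>(2) b by (auto simp: \<omega>_def)
    then have w: "?w \<in> h_set Ma" "?w \<in> h_amb Ma" unfolding ac using range[OF p] by (auto simp: \<kappa>w)
    have "(2 * \<upsilon> (yF p) - ym - yp) / (yp - ym) = p" unfolding \<upsilon>yF using ym by (simp add: field_simps)
    from ac(3)[OF w(2), unfolded \<kappa>w prod.case this]
    have "h_chart Ma ?w = (line_pt p, \<omega> b)" unfolding line_pt_def .
    moreover obtain d where "homeomorphism (h_amb Ma) (h_space Ma) (h_chart Ma) d"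
      using hset by (auto simp: is_hset_def)
    then have "inj_on (h_chart Ma) (h_amb Ma)" by (metis homeomorphism_apply1 inj_on_inverseI)
    then have "inv_into (h_amb Ma) (h_chart Ma) (h_chart Ma ?w) = ?w" by (rule inv_into_f_f[OF _ w(2)])
    ultimately show "?w \<in> h_set Ma \<and> inv_into (h_amb Ma) (h_chart Ma) (line_pt p, \<omega> b) = ?w"
      using w(1) by simp
  qed
qed

lemma solves_delay:
  assumes "solves V x {0..L}"
  shows "solves V (\<lambda>t. x (t - s)) {s..s + L}"
proof -
  have "(\<lambda>t. t - (- s)) ` {0..L} = {s..s + L}"
    by (auto simp: image_iff intro!: bexI[of _ "_ - s"])
  then show ?thesis using solves_shift[OF assms, of "- s"] by (simp add: add.commute)
qed

section \<open>One covering-exchange step for positive \<open>\<epsilon>\<close>\<close>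

context fs_block_at
begin

text \<open>A degenerate interval would put a point on two opposite faces at once, where
  \<open>face_sign\<close> gives opposite signs.\<close>

lemma lo_less_hi: "b_lo D $ i < b_hi D $ i"
proof (rule ccontr)
  assume "\<not> ?thesis"
  then have eq: "b_lo D $ i = b_hi D $ i" using lo_le_hi(1)[of i] by simp
  define v where "v = lclamp D 0"
  have v: "v \<in> lbox D" unfolding v_def by (rule lclamp_in)
  then have "b_lo D $ i \<le> fst v $ i" "fst v $ i \<le> b_hi D $ i" by (auto simp: lbox_def block_box_def)
  then have "fst v $ i = b_hi D $ i" "fst v $ i = b_lo D $ i" using eq by simp_all
  then show False using face_sign[OF v, of i] by (cases "i \<in> b_unst D") force+
qed

text \<open>If the unstable coordinate were at or beyond an end at some \<open>s < t\<close>, it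
  would be beyond it by at least \<open>c * (t - s)\<close> at time \<open>t\<close>. So the test at
  the final time alone controls this coordinate, and the stable ones cannot leave.\<close>

lemma lflow_in_box:
  assumes u: "b_unst D = {u}" and z: "z \<in> lbox D" and t: "0 \<le> t"
    and a: "fst (lflow t z) $ u \<in> {b_lo D $ u..b_hi D $ u}"
    and y: "\<And>s. s \<in> {0..t} \<Longrightarrow> snd (lflow s z) \<in> {b_ylo D..b_yhi D}"
    and s: "s \<in> {0..t}"
  shows "lflow s z \<in> lbox D"
proof -
  obtain c where c: "c > 0" "\<And>z s t. 0 \<le> s \<Longrightarrow> s \<le> t \<Longrightarrow>
    (b_hi D $ u \<le> fst (lflow s z) $ u \<longrightarrow> b_hi D $ u + c * (t - s) \<le> fst (lflow t z) $ u) \<and>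
    (fst (lflow s z) $ u \<le> b_lo D $ u \<longrightarrow> fst (lflow t z) $ u \<le> b_lo D $ u - c * (t - s))"
    using lflow_unstable_exit[of u] u by auto
  have "b_lo D $ i \<le> fst (lflow s z) $ i \<and> fst (lflow s z) $ i \<le> b_hi D $ i" for i
  proof (cases "i = u")
    case False
    then show ?thesis using lflow_stable_in[of i s z] z s u by (auto simp: lbox_def block_box_def)
  next
    case True
    show ?thesis
    proof (cases "s = t")
      case False
      then have "c * (t - s) > 0" using s c(1) by simp
      then show ?thesis using c(2)[of s t z] s a True by fastforce
    qed (use a True in auto)
  qed
  then show ?thesis using y[OF s] by (simp add: lbox_def block_box_def mem_Times_iff)
qed

text \<open>This turns one covering-exchange step into equations. \<Lambda> measures whether the
  unstable coordinate is at the exit level after the waiting time \<open>t\<close>, and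
  \<open>e\<close> is the end state; both are defined for all parameters, but are tied to an orbit
  of the system only at solutions. At \<open>tmin\<close> and \<open>tmax\<close> the slow
  coordinate is on opposite sides of the whole exit face, which gives the unknown \<open>t\<close>
  an equation of its own.\<close>

lemma transition:
  fixes pos :: "real \<Rightarrow> 'b::real_normed_vector \<Rightarrow> (real^'n) \<times> real" and yF :: "real \<Rightarrow> real"
  assumes pos\<epsilon>: "0 < \<epsilon>" and u: "b_unst D = {u}" and \<kappa>: "block_coords D \<kappa>"
    and q: "q = 1 \<or> q = (-1::real)" and g: "\<And>x y. (x, y) \<in> block_set D \<Longrightarrow> 0 < q * g x y \<epsilon>"
    and T: "0 < T" "\<And>w. w \<in> h_set N \<Longrightarrow> flow_defined (fs_field f g \<epsilon>) T w"
    and cov: "covers N (flow (fs_field f g \<epsilon>) T) (block_hset D \<kappa> \<psi>)"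
    and B: "convex B" "B \<noteq> {}" "continuous_on B \<omega>" "\<omega> ` B \<subseteq> ecball (h_s N)"
    and pos: "\<And>p b. p \<in> {-1..1} \<Longrightarrow> b \<in> B \<Longrightarrow>
      pos p b \<in> h_set N \<and> inv_into (h_amb N) (h_chart N) (line_pt p, \<omega> b) = pos p b"
    and cpos: "continuous_on ({-1..1} \<times> B) (\<lambda>(p, b). pos p b)"
    and a: "a = b_lo D $ u \<or> a = b_hi D $ u"
    and yF: "continuous_on {-1..1} yF" "\<And>p. p \<in> {-1..1} \<Longrightarrow> yF p \<in> {b_ylo D..b_yhi D} \<and> 0 < q * (yF p - yS)"
    and yS: "yS \<in> {b_ylo D..b_yhi D}" "\<And>w. w \<in> h_set N \<Longrightarrow> flow (fs_field f g \<epsilon>) T w \<in> block_set D \<Longrightarrow>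
      q * snd (flow (fs_field f g \<epsilon>) T w) \<le> q * yS"
  obtains \<sigma> tmin tmax :: real and \<Lambda> :: "real \<times> 'b \<times> real \<Rightarrow> real" and e
  where "\<sigma> = 1 \<or> \<sigma> = -1" "0 < tmin" "tmin < tmax"
    "continuous_on ({-1..1} \<times> B \<times> {tmin..tmax}) \<Lambda>" "continuous_on ({-1..1} \<times> B \<times> {tmin..tmax}) e"
    "\<And>b t. b \<in> B \<Longrightarrow> t \<in> {tmin..tmax} \<Longrightarrow> \<Lambda> (1, b, t) = \<sigma> \<and> \<Lambda> (-1, b, t) = - \<sigma>"
    "\<And>p b t i. p \<in> {-1..1} \<Longrightarrow> b \<in> B \<Longrightarrow> t \<in> {tmin..tmax} \<Longrightarrow> i \<noteq> u \<Longrightarrow>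
      b_lo D $ i \<le> fst (e (p, b, t)) $ i \<and> fst (e (p, b, t)) $ i \<le> b_hi D $ i"
    "\<And>p b p'. p \<in> {-1..1} \<Longrightarrow> b \<in> B \<Longrightarrow> p' \<in> {-1..1} \<Longrightarrow>
      q * (snd (e (p, b, tmin)) - yF p') \<le> 0 \<and> 0 \<le> q * (snd (e (p, b, tmax)) - yF p')"
    "\<And>p b t p'. p \<in> {-1..1} \<Longrightarrow> b \<in> B \<Longrightarrow> t \<in> {tmin..tmax} \<Longrightarrow> p' \<in> {-1..1} \<Longrightarrow>
      \<Lambda> (p, b, t) = 0 \<Longrightarrow> snd (e (p, b, t)) = yF p' \<Longrightarrow> fst (e (p, b, t)) $ u = a \<and>
      (\<exists>\<gamma>. solves (fs_field f g \<epsilon>) \<gamma> {0..T + t} \<and> \<gamma> 0 = pos p b \<and> \<gamma> ` {T..T + t} \<subseteq> block_set D \<and>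
        \<gamma> (T + t) = lpos D (e (p, b, t)))"
proof -
  let ?V = "fs_field f g \<epsilon>" and ?M = "block_hset D \<kappa> \<psi>"
  obtain c C where cC: "c > 0" "C > 0" "\<And>z s t. 0 \<le> s \<Longrightarrow> s \<le> t \<Longrightarrow>
    c * (t - s) \<le> q * (snd (lflow t z) - snd (lflow s z)) \<and> q * (snd (lflow t z) - snd (lflow s z)) \<le> C * (t - s)"
    using lflow_slow_drift[OF pos\<epsilon> q g] by metis
  obtain cu where cu: "cu > 0" "\<And>z s t. 0 \<le> s \<Longrightarrow> s \<le> t \<Longrightarrow>
    (b_hi D $ u \<le> fst (lflow s z) $ u \<longrightarrow> b_hi D $ u + cu * (t - s) \<le> fst (lflow t z) $ u) \<and>
    (fst (lflow s z) $ u \<le> b_lo D $ u \<longrightarrow> fst (lflow t z) $ u \<le> b_lo D $ u - cu * (t - s))"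
    using lflow_unstable_exit[of u] u by auto
  have "continuous_on {-1..1} (\<lambda>p. q * (yF p - yS))" by (intro continuous_intros yF(1))
  from continuous_attains_inf[OF _ _ this]
  obtain p0 where p0: "p0 \<in> {-1..1}" "\<And>p. p \<in> {-1..1} \<Longrightarrow> q * (yF p0 - yS) \<le> q * (yF p - yS)" by auto
  \<comment> \<open>The least slow distance from the separating value \<open>yS\<close> to the exit
    face, positive by compactness.\<close>
  define m where "m = q * (yF p0 - yS)"
  have m: "m > 0" "\<And>p. p \<in> {-1..1} \<Longrightarrow> m \<le> q * (yF p - yS)" using yF(2) p0 by (auto simp: m_def)
  \<comment> \<open>Drifting with speed at most \<open>C\<close>, no orbit starting at or before
    \<open>yS\<close> has passed the face by the time \<open>m / C\<close>. With speed at least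
    \<open>c\<close>, an orbit has covered the full slow height of the block after
    \<open>(b_yhi D - b_ylo D) / c\<close>; adding \<open>tmin\<close> makes the interval
    nondegenerate.\<close>
  define tmin tmax where "tmin = m / C" and "tmax = (b_yhi D - b_ylo D) / c + tmin"
  have t: "0 < tmin" "tmin < tmax" using m(1) cC(1,2) lo_le_hi(2) by (auto simp: tmin_def tmax_def)
  \<comment> \<open>An orbit that starts on the exit boundary is at least this far beyond its end of
    the interval at all times from \<open>tmin\<close> on. So the cut-off \<phi> has there the value
    -1 or 1 that \<open>covering_lift\<close> requires.\<close>
  define \<delta> where "\<delta> = cu * tmin"
  have \<delta>: "\<delta> > 0" using cu(1) t(1) by (simp add: \<delta>_def)
  \<comment> \<open>A point of \<open>N\<close> may be mapped outside the block or beyond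
    \<open>yS\<close>. Capping the slow coordinate at \<open>yS\<close> makes the estimate at
    \<open>tmin\<close> valid for all of them, and it changes nothing at points mapped into the
    block, by the second hypothesis on \<open>yS\<close>.\<close>
  define cut where "cut y = (if q = 1 then min y yS else max y yS)" for y :: real
  have ccut: "continuous_on S cut" for S
    unfolding cut_def by (cases "q = 1") (auto intro!: continuous_intros)
  define start where "start w = (clamp_cart (b_lo D) (b_hi D) (fst (lcoord D w)), cut (clamp_real (b_ylo D) (b_yhi D) (snd w)))" for w
  have start_eq: "start w = (fst (lclamp D (lcoord D w)), cut (snd (lclamp D (lcoord D w))))" for w
    by (simp add: start_def lclamp_def lcoord_def case_prod_beta)
  have start_in: "start w \<in> lbox D" "q * snd (start w) \<le> q * yS" for w
    using lclamp_in[of "lcoord D w"] yS(1) q unfolding start_eq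
    by (auto simp: lbox_def mem_Times_iff cut_def)
  have start_id: "start w = lcoord D w" if "w \<in> block_set D" "q * snd w \<le> q * yS" for w
  proof -
    have "lclamp D (lcoord D w) = lcoord D w" using that(1) by (simp add: mem_block_set_iff lclamp_id)
    moreover have "cut (snd w) = snd w" using that(2) q by (auto simp: cut_def)
    moreover have "snd (lcoord D w) = snd w" by (simp add: lcoord_def case_prod_beta)
    ultimately show ?thesis unfolding start_eq by (simp add: prod_eq_iff)
  qed
  have cl: "continuous_on UNIV (lclamp D)"
    by (rule lipschitz_on_continuous_on[of 1]) (auto simp: lipschitz_on_def dist_norm lclamp_dist)
  have "continuous_on UNIV (lcoord D)"
    unfolding lcoord_def case_prod_beta by (intro continuous_on_Pair continuous_on_fast_coord continuous_on_fst continuous_on_snd continuous_on_id)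
  then have c0: "continuous_on UNIV (\<lambda>w. lclamp D (lcoord D w))"
    by (rule continuous_on_compose2[OF cl]) simp
  have cstart: "continuous_on UNIV start" unfolding start_eq[abs_def]
    by (intro continuous_on_Pair continuous_on_fst c0 continuous_on_compose2[OF ccut[of UNIV] continuous_on_snd[OF c0]]) simp
  define \<phi> where "\<phi> = (\<lambda>(w, t). clamp_real (-1) 1 ((fst (lflow t (start w)) $ u - a) / \<delta>))"
  have cend: "continuous_on (UNIV \<times> {tmin..tmax}) (\<lambda>(w, t). lflow t (start w))"
  proof -
    have "continuous_on (UNIV \<times> {tmin..tmax}) (\<lambda>x. (snd x, start (fst x)))"
      by (intro continuous_on_Pair continuous_on_snd continuous_on_id
          continuous_on_compose2[OF cstart continuous_on_fst[OF continuous_on_id]]) simp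
    moreover have "(\<lambda>x. (snd x, start (fst x))) ` (UNIV \<times> {tmin..tmax}) \<subseteq> {0..} \<times> UNIV" using t by auto
    ultimately have "continuous_on (UNIV \<times> {tmin..tmax}) (\<lambda>x. (\<lambda>(t, z). lflow t z) (snd x, start (fst x)))"
      by (rule continuous_on_compose2[OF lflow(3)])
    then show ?thesis by (simp add: case_prod_beta)
  qed
  have c\<phi>: "continuous_on (UNIV \<times> {tmin..tmax}) \<phi>"
    unfolding \<phi>_def clamp_real_def case_prod_beta using cend \<delta>
    by (intro continuous_on_max continuous_on_min continuous_on_const continuous_on_divide continuous_on_diff
        continuous_on_component continuous_on_fst) (auto simp: case_prod_beta)
  obtain \<tau> where \<tau>: "\<tau> = 1 \<or> \<tau> = -1" "\<And>x y. fast_coord D x \<in> block_box D \<Longrightarrow> \<bar>fst (\<kappa> (x, y)) 0\<bar> = 1 \<Longrightarrow>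
    fast_coord D x $ u = b_hi D $ u \<and> fst (\<kappa> (x, y)) 0 = \<tau> \<or> fast_coord D x $ u = b_lo D $ u \<and> fst (\<kappa> (x, y)) 0 = - \<tau>"
    using block_coords_face[OF \<kappa> u box_ne] by blast
  have face: "\<phi> (w, t) = \<tau> * fst (h_chart ?M w) 0"
    if w: "w \<in> h_set ?M" and tt: "t \<in> {tmin..tmax}" and one: "\<bar>fst (h_chart ?M w) 0\<bar> = 1" for w t
  proof -
    obtain x y where xy: "w = (x, y)" by force
    have bx: "fast_coord D x \<in> block_box D" using w by (simp add: xy block_hset_def mem_block_set_iff lcoord_def lbox_def)
    have ch: "fst (h_chart ?M w) = fst (\<kappa> (x, y))" by (simp add: block_hset_def xy case_prod_beta)
    have su: "fst (lflow 0 (start w)) $ u = fast_coord D x $ u"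
      using bx by (simp add: lflow(1) start_def xy lcoord_def clamp_real_id block_box_def)
    have t0: "0 \<le> t" "\<delta> \<le> cu * t" using tt t cu(1) by (auto simp: \<delta>_def)
    from \<tau>(2)[OF bx one[unfolded ch]] show ?thesis
    proof (elim disjE conjE)
      assume hi: "fast_coord D x $ u = b_hi D $ u" "fst (\<kappa> (x, y)) 0 = \<tau>"
      then have "b_hi D $ u + cu * (t - 0) \<le> fst (lflow t (start w)) $ u"
        using cu(2)[OF order_refl t0(1), of "start w"] su by simp
      then have "\<delta> \<le> fst (lflow t (start w)) $ u - a" using a t0(2) lo_le_hi(1)[of u] by auto
      then have "1 \<le> (fst (lflow t (start w)) $ u - a) / \<delta>" using \<delta> by simp
      then show ?thesis using \<tau>(1) by (auto simp: \<phi>_def clamp_real_ge ch hi)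
    next
      assume lo: "fast_coord D x $ u = b_lo D $ u" "fst (\<kappa> (x, y)) 0 = - \<tau>"
      then have "fst (lflow t (start w)) $ u \<le> b_lo D $ u - cu * (t - 0)"
        using cu(2)[OF order_refl t0(1), of "start w"] su by simp
      then have "fst (lflow t (start w)) $ u - a \<le> - 1 * \<delta>" using a t0(2) lo_le_hi(1)[of u] by auto
      then have "(fst (lflow t (start w)) $ u - a) / \<delta> \<le> - 1" using \<delta> by (subst pos_divide_le_eq) auto
      then show ?thesis using \<tau>(1) by (auto simp: \<phi>_def clamp_real_le ch lo)
    qed
  qed
  have bd: "\<bar>\<phi> (w, t)\<bar> \<le> 1" for w t
    using clamp_real_in[of "-1" 1 "(fst (lflow t (start w)) $ u - a) / \<delta>"] by (auto simp: \<phi>_def abs_le_iff)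
  have M: "h_u ?M = 1" "h_amb ?M = UNIV" "h_set ?M = block_set D" by (simp_all add: block_hset_def u)
  have ct: "convex {tmin..tmax}" "{tmin..tmax} \<noteq> {}" using t by (simp_all add: convex_real_interval)
  obtain \<sigma> \<Lambda> where \<sigma>: "\<sigma> = 1 \<or> \<sigma> = (-1::real)" and \<Lambda>: "continuous_on ({-1..1} \<times> B \<times> {tmin..tmax}) \<Lambda>"
    "\<And>b t. b \<in> B \<Longrightarrow> t \<in> {tmin..tmax} \<Longrightarrow> \<Lambda> (1, b, t) = \<sigma> \<and> \<Lambda> (-1, b, t) = - \<sigma>"
    "\<And>p b t. p \<in> {-1..1} \<Longrightarrow> b \<in> B \<Longrightarrow> t \<in> {tmin..tmax} \<Longrightarrow> \<bar>\<Lambda> (p, b, t)\<bar> < 1 \<Longrightarrow>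
      flow ?V T (inv_into (h_amb N) (h_chart N) (line_pt p, \<omega> b)) \<in> h_set ?M \<and>
      \<phi> (flow ?V T (inv_into (h_amb N) (h_chart N) (line_pt p, \<omega> b)), t) = \<Lambda> (p, b, t)"
    by (rule covering_lift[OF cov M(1,2) B ct c\<phi> bd \<tau>(1) face]) (assumption | rule that)+
  define e where "e = (\<lambda>(p, b, t). lflow t (start (flow ?V T (pos p b))))"
  have ce: "continuous_on ({-1..1} \<times> B \<times> {tmin..tmax}) e"
  proof -
    let ?S = "{-1..1::real} \<times> B \<times> {tmin..tmax}"
    have "continuous_on ?S (\<lambda>x. (fst x, fst (snd x)))"
      by (intro continuous_on_Pair continuous_on_fst continuous_on_snd continuous_on_id)
    then have "continuous_on ?S (\<lambda>x. (\<lambda>(p, b). pos p b) (fst x, fst (snd x)))"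
      by (rule continuous_on_compose2[OF cpos]) auto
    then have cp: "continuous_on ?S (\<lambda>x. pos (fst x) (fst (snd x)))" by simp
    have cF: "continuous_on (h_set N) (flow ?V T)" using cov by (simp add: covers_def)
    have "continuous_on ?S (\<lambda>x. flow ?V T (pos (fst x) (fst (snd x))))"
      by (rule continuous_on_compose2[OF cF cp]) (use pos in auto)
    then have "continuous_on ?S (\<lambda>x. (flow ?V T (pos (fst x) (fst (snd x))), snd (snd x)))"
      by (intro continuous_on_Pair continuous_on_snd continuous_on_id)
    then have "continuous_on ?S (\<lambda>x. (\<lambda>(w, t). lflow t (start w)) (flow ?V T (pos (fst x) (fst (snd x))), snd (snd x)))"
      by (rule continuous_on_compose2[OF cend]) auto
    then show ?thesis by (simp add: e_def case_prod_beta)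
  qed
  show thesis
  proof (rule that[OF \<sigma> t \<Lambda>(1) ce \<Lambda>(2)])
    fix p b t i assume *: "p \<in> {-1..1::real}" "b \<in> B" "t \<in> {tmin..tmax}" "i \<noteq> u"
    have "i \<notin> b_unst D" "0 \<le> t" using * \<open>0 < tmin\<close> u by auto
    moreover have "start w \<in> lbox D" for w by (rule start_in)
    ultimately show "b_lo D $ i \<le> fst (e (p, b, t)) $ i \<and> fst (e (p, b, t)) $ i \<le> b_hi D $ i"
      using lflow_stable_in[of i t] by (simp add: e_def lbox_def block_box_def mem_Times_iff)
  next
    fix p b p' assume *: "p \<in> {-1..1::real}" "b \<in> B" "p' \<in> {-1..1::real}"
    let ?z = "start (flow ?V T (pos p b))"
    have "q * (snd (e (p, b, tmin)) - snd ?z) \<le> C * (tmin - 0)"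
      using cC(3)[OF order_refl less_imp_le[OF t(1)], of ?z] by (simp add: e_def lflow(1))
    moreover have "C * tmin = m" using cC(2) by (simp add: tmin_def)
    ultimately have 1: "q * (snd (e (p, b, tmin)) - yF p') \<le> 0"
      using m(2)[OF *(3)] start_in(2)[of "flow ?V T (pos p b)"] by (simp add: algebra_simps)
    have "c * (tmax - 0) \<le> q * (snd (e (p, b, tmax)) - snd ?z)"
      using cC(3)[of 0 tmax ?z] t by (simp add: e_def lflow(1))
    moreover have "b_yhi D - b_ylo D \<le> c * tmax" using cC(1) t(1) by (simp add: tmax_def distrib_left)
    moreover have "q * (yF p' - snd ?z) \<le> b_yhi D - b_ylo D"
      using start_in(1)[of "flow ?V T (pos p b)"] yF(2)[OF *(3)] q by (auto simp: lbox_def mem_Times_iff)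
    ultimately have "0 \<le> q * (snd (e (p, b, tmax)) - yF p')" by (simp add: algebra_simps)
    with 1 show "q * (snd (e (p, b, tmin)) - yF p') \<le> 0 \<and> 0 \<le> q * (snd (e (p, b, tmax)) - yF p')" ..
  next
    fix p b t p' assume *: "p \<in> {-1..1::real}" "b \<in> B" "t \<in> {tmin..tmax}" "p' \<in> {-1..1::real}"
      and zero: "\<Lambda> (p, b, t) = 0" and hit: "snd (e (p, b, t)) = yF p'"
    have t0: "0 \<le> t" using *(3) t by simp
    define Z where "Z = flow ?V T (pos p b)"
    have posN: "pos p b \<in> h_set N" using pos * by blast
    have Z: "Z \<in> block_set D" "\<phi> (Z, t) = 0"
      using \<Lambda>(3)[OF *(1-3)] zero pos[OF *(1,2)] M(3) by (auto simp: Z_def)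
    have sZ: "start Z = lcoord D Z" by (rule start_id[OF Z(1)]) (use yS(2)[OF posN] Z(1) in \<open>simp add: Z_def\<close>)
    have eZ: "e (p, b, t) = lflow t (lcoord D Z)" by (simp add: e_def sZ flip: Z_def)
    have ea: "fst (e (p, b, t)) $ u = a"
    proof -
      have "clamp_real (- 1) 1 ((fst (e (p, b, t)) $ u - a) / \<delta>) = 0" using Z(2) by (simp add: \<phi>_def sZ eZ)
      then have "(fst (e (p, b, t)) $ u - a) / \<delta> = 0" by (auto simp: clamp_real_def max_def min_def split: if_splits)
      then show ?thesis using \<delta> by simp
    qed
    have zin: "lcoord D Z \<in> lbox D" using Z(1) by (simp add: mem_block_set_iff)
    \<comment> \<open>The slow coordinate is monotone and ends at \<open>yF p'\<close>, and the
      unstable one ends at \<open>a\<close>; \<open>lflow_in_box\<close> turns these end conditions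
      into confinement at all earlier times.\<close>
    have inbox: "lflow s (lcoord D Z) \<in> lbox D" if "s \<in> {0..t}" for s
    proof (rule lflow_in_box[OF u zin t0 _ _ that])
      show "fst (lflow t (lcoord D Z)) $ u \<in> {b_lo D $ u..b_hi D $ u}" using ea a lo_le_hi(1)[of u] by (auto simp: eZ)
      fix s assume s: "s \<in> {0..t}"
      then have "0 \<le> c * s" "0 \<le> c * (t - s)" using cC(1) by auto
      have "0 \<le> q * (snd (lflow s (lcoord D Z)) - snd (lcoord D Z))"
        using cC(3)[of 0 s "lcoord D Z"] s \<open>0 \<le> c * s\<close> by (simp add: lflow(1))
      moreover have "0 \<le> q * (yF p' - snd (lflow s (lcoord D Z)))"
        using cC(3)[of s t "lcoord D Z"] s \<open>0 \<le> c * (t - s)\<close> hit unfolding eZ by auto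
      ultimately show "snd (lflow s (lcoord D Z)) \<in> {b_ylo D..b_yhi D}"
        using yF(2)[OF *(4)] zin q by (auto simp: lbox_def mem_Times_iff)
    qed
    obtain x1 where x1: "solves ?V x1 {0..T}" "x1 0 = pos p b" "x1 T = Z"
      using flow_eqI[OF field_lipschitz'[OF \<epsilon>] less_imp_le[OF T(1)] T(2)[OF posN]] by (auto simp: Z_def)
    have x2: "solves ?V (\<lambda>s. lpos D (lflow s (lcoord D Z))) {0..t}"
      by (rule lpos_solves[OF solves_subset[OF lflow(2)] inbox]) auto
    define \<gamma> where "\<gamma> s = (if s \<le> T then x1 s else lpos D (lflow (s - T) (lcoord D Z)))" for s
    have \<gamma>2: "\<gamma> s = lpos D (lflow (s - T) (lcoord D Z))" if "s \<ge> T" for s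
      using that x1(3) by (auto simp: \<gamma>_def lflow(1))
    have "solves ?V (\<lambda>s. lpos D (lflow (s - T) (lcoord D Z))) {T..T + t}"
      by (rule solves_delay[OF x2])
    then have "solves ?V \<gamma> {T..T + t}" by (rule solves_transform[rotated]) (simp add: \<gamma>2)
    moreover have "solves ?V \<gamma> {0..T}" by (rule solves_transform[OF _ x1(1)]) (simp add: \<gamma>_def)
    ultimately have "solves ?V \<gamma> ({0..T} \<union> {T..T + t})" by (intro solves_union) auto
    moreover have "{0..T} \<union> {T..T + t} = {0..T + t}" using T(1) t0 by auto
    moreover have "\<gamma> ` {T..T + t} \<subseteq> block_set D"
      using inbox by (auto simp: \<gamma>2 block_set_eq intro!: imageI)
    moreover have "\<gamma> 0 = pos p b" using T(1) x1(2) by (simp add: \<gamma>_def)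
    moreover have "\<gamma> (T + t) = lpos D (e (p, b, t))" using t0 by (simp add: \<gamma>2 eZ)
    ultimately show "fst (e (p, b, t)) $ u = a \<and>
      (\<exists>\<gamma>. solves ?V \<gamma> {0..T + t} \<and> \<gamma> 0 = pos p b \<and> \<gamma> ` {T..T + t} \<subseteq> block_set D \<and>
        \<gamma> (T + t) = lpos D (e (p, b, t)))"
      using ea by auto
  qed
qed

end

section \<open>Closing a chain of orbit segments\<close>

lemma solves_periodic_extension:
  fixes V :: "'a::real_normed_vector \<Rightarrow> 'a"
  assumes P: "0 < P" and \<gamma>: "solves V \<gamma> {0..P}" and closed: "\<gamma> P = \<gamma> 0"
  shows "\<exists>\<Gamma>. solves V \<Gamma> UNIV \<and> (\<forall>t. \<Gamma> (t + P) = \<Gamma> t) \<and> (\<forall>t\<in>{0..P}. \<Gamma> t = \<gamma> t)"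
proof -
  define \<Gamma> where "\<Gamma> t = \<gamma> (t - P * of_int \<lfloor>t / P\<rfloor>)" for t
  have per: "\<Gamma> (t + P) = \<Gamma> t" for t
  proof -
    have "(t + P) / P = t / P + 1" using P by (simp add: field_simps)
    then show ?thesis by (simp add: \<Gamma>_def algebra_simps)
  qed
  have on: "\<Gamma> t = \<gamma> (t - P * of_int k)" if "t \<in> {P * of_int k..P * of_int (k + 1)}" for t and k :: int
  proof (cases "t = P * of_int (k + 1)")
    case True
    then have "t / P = of_int (k + 1)" using P by simp
    then have "\<lfloor>t / P\<rfloor> = k + 1" by simp
    then show ?thesis using True closed by (simp add: \<Gamma>_def algebra_simps)
  next
    case False
    then have "\<lfloor>t / P\<rfloor> = k"
      using that P by (intro floor_unique) (auto simp: field_simps)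
    then show ?thesis by (simp add: \<Gamma>_def)
  qed
  have piece: "solves V \<Gamma> {P * of_int k..P * of_int (k + 1)}" for k :: int
  proof -
    have "P * of_int (k + 1) = P * of_int k + P" by (simp add: algebra_simps)
    then have "solves V (\<lambda>t. \<gamma> (t - P * of_int k)) {P * of_int k..P * of_int (k + 1)}"
      using solves_delay[OF \<gamma>, of "P * of_int k"] by (simp only:)
    then show ?thesis by (rule solves_transform[rotated]) (simp add: on)
  qed
  have "solves V \<Gamma> UNIV"
    unfolding solves_def
  proof
    fix t :: real
    define k where "k = \<lfloor>t / P\<rfloor>"
    have k: "P * of_int k \<le> t" "t < P * of_int (k + 1)"
      using floor_correct[of "t / P"] P unfolding k_def[symmetric]
      by (simp_all add: pos_le_divide_eq pos_divide_less_eq mult.commute)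
    \<comment> \<open>The time \<open>t\<close> may be the left end of its period; joined with the
      preceding period it becomes an interior point, so that the derivative within the interval is
      the two-sided one.\<close>
    have "solves V \<Gamma> ({P * of_int (k - 1)..P * of_int (k - 1 + 1)} \<union> {P * of_int k..P * of_int (k + 1)})"
      by (intro solves_union piece) auto
    moreover have "{P * of_int (k - 1)..P * of_int (k - 1 + 1)} \<union> {P * of_int k..P * of_int (k + 1)}
        = {P * of_int (k - 1)..P * of_int (k + 1)}"
      using P by (auto simp: algebra_simps)
    ultimately have "solves V \<Gamma> {P * of_int (k - 1)..P * of_int (k + 1)}" by simp
    moreover have "t \<in> {P * of_int (k - 1)<..<P * of_int (k + 1)}"
      using k P by (auto simp: algebra_simps)
    ultimately have "(\<Gamma> has_vector_derivative V (\<Gamma> t)) (at t within {P * of_int (k - 1)..P * of_int (k + 1)})"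
      by (auto simp: solves_def)
    moreover have "at t within {P * of_int (k - 1)..P * of_int (k + 1)} = at t"
      using \<open>t \<in> {P * of_int (k - 1)<..<P * of_int (k + 1)}\<close> by (intro at_within_interior) (simp add: interior_atLeastAtMost_real)
    ultimately show "(\<Gamma> has_vector_derivative V (\<Gamma> t)) (at t)" by simp
  qed
  then show ?thesis using per on[of _ 0] by (intro exI[of _ \<Gamma>]) auto
qed

lemma solves_chain:
  fixes V :: "'a::real_normed_vector \<Rightarrow> 'a" and len :: "nat \<Rightarrow> real"
  assumes len: "\<And>j. j \<le> k \<Longrightarrow> 0 < len j" and \<gamma>: "\<And>j. j \<le> k \<Longrightarrow> solves V (\<gamma> j) {0..len j}"
    and link: "\<And>j. j < k \<Longrightarrow> \<gamma> j (len j) = \<gamma> (Suc j) 0"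
  shows "\<exists>\<Gamma>. solves V \<Gamma> {0..sum len {..k}} \<and>
    (\<forall>j\<le>k. \<forall>t\<in>{0..len j}. \<Gamma> (sum len {..<j} + t) = \<gamma> j t)"
  using assms
proof (induction k)
  case 0
  then show ?case by (intro exI[of _ "\<gamma> 0"]) auto
next
  case (Suc k)
  then obtain \<Gamma> where \<Gamma>: "solves V \<Gamma> {0..sum len {..k}}"
    "\<And>j t. j \<le> k \<Longrightarrow> t \<in> {0..len j} \<Longrightarrow> \<Gamma> (sum len {..<j} + t) = \<gamma> j t" by auto
  define s where "s = sum len {..k}"
  have s: "0 \<le> s" "sum len {..<Suc k} = s" "sum len {..Suc k} = s + len (Suc k)"
  proof -
    show "0 \<le> s" unfolding s_def by (rule sum_nonneg) (use Suc.prems(1) in \<open>simp add: less_imp_le\<close>)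
  qed (simp_all add: s_def lessThan_Suc_atMost)
  have "0 < len (Suc k)" using Suc.prems(1) by simp
  have end_k: "\<Gamma> s = \<gamma> (Suc k) 0"
  proof -
    have "s = sum len {..<k} + len k" by (simp add: s_def flip: lessThan_Suc_atMost)
    then show ?thesis using \<Gamma>(2)[of k "len k"] Suc.prems(1)[of k] Suc.prems(3)[of k] by simp
  qed
  define \<Gamma>' where "\<Gamma>' t = (if t \<le> s then \<Gamma> t else \<gamma> (Suc k) (t - s))" for t
  have \<Gamma>'2: "\<Gamma>' t = \<gamma> (Suc k) (t - s)" if "t \<ge> s" for t using that end_k by (auto simp: \<Gamma>'_def)
  have "solves V (\<lambda>t. \<gamma> (Suc k) (t - s)) {s..s + len (Suc k)}"
    by (rule solves_delay) (use Suc.prems(2) in simp)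
  then have "solves V \<Gamma>' {s..s + len (Suc k)}" by (rule solves_transform[rotated]) (simp add: \<Gamma>'2)
  moreover have "solves V \<Gamma>' {0..s}" by (rule solves_transform[OF _ \<Gamma>(1)[folded s_def]]) (simp add: \<Gamma>'_def)
  ultimately have "solves V \<Gamma>' ({0..s} \<union> {s..s + len (Suc k)})" by (intro solves_union) auto
  moreover have "{0..s} \<union> {s..s + len (Suc k)} = {0..s + len (Suc k)}" using s(1) \<open>0 < len (Suc k)\<close> by auto
  moreover have "\<Gamma>' (sum len {..<j} + t) = \<gamma> j t" if "j \<le> Suc k" "t \<in> {0..len j}" for j t
  proof (cases "j = Suc k")
    case True
    then show ?thesis using that s(2) by (simp add: \<Gamma>'2)
  next
    case False
    then have j: "j \<le> k" using that by simp
    have "sum len {..<j} + len j \<le> s"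
    proof -
      have "sum len {..<Suc j} \<le> sum len {..k}"
        using j Suc.prems(1) by (intro sum_mono2) (auto intro: less_imp_le)
      then show ?thesis by (simp add: s_def)
    qed
    then show ?thesis using \<Gamma>(2)[OF j that(2)] that by (simp add: \<Gamma>'_def)
  qed
  ultimately show ?case unfolding s(3) by (intro exI[of _ \<Gamma>']) auto
qed

section \<open>The periodic orbit\<close>

text \<open>\<open>b\<close> runs over the full block box and its entry \<open>u\<close> is
  overwritten by \<open>a\<close>; in this way the type of the parameter does not depend on which
  direction is unstable.\<close>

definition face_pos :: "('n::finite, 'z) fs_block_scheme \<Rightarrow> 'n \<Rightarrow> real \<Rightarrow> (real \<Rightarrow> real) \<Rightarrow> real \<Rightarrow> real^'n \<Rightarrow> (real^'n) \<times> real" where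
  "face_pos D u a yF p b = lpos D (\<chi> i. if i = u then a else b $ i, yF p)"

definition face_param ::
  "('n::finite, 'z) fs_block_scheme \<Rightarrow> ((real^'n) \<times> real) hset \<Rightarrow> 'n \<Rightarrow> real \<Rightarrow> (real \<Rightarrow> real)
    \<Rightarrow> (real^'n \<Rightarrow> nat \<Rightarrow> real) \<Rightarrow> bool" where
  "face_param D Ma u a yF \<omega> \<longleftrightarrow>
     b_unst D = {u} \<and> (a = b_lo D $ u \<or> a = b_hi D $ u) \<and> continuous_on {-1..1} yF \<and>
     (\<forall>p\<in>{-1..1}. b_ylo D < yF p \<and> yF p < b_yhi D) \<and>
     continuous_on (block_box D) \<omega> \<and> \<omega> ` block_box D \<subseteq> ecball (h_s Ma) \<and>
     (\<forall>p\<in>{-1..1}. \<forall>b\<in>block_box D. face_pos D u a yF p b \<in> h_set Ma \<and>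
        inv_into (h_amb Ma) (h_chart Ma) (line_pt p, \<omega> b) = face_pos D u a yF p b)"

text \<open>The number \<open>yS\<close> separates the slow coordinates of the image of \<open>N\<close> in the block from those of the exit face.\<close>

definition target_data ::
  "(real^'n::finite \<Rightarrow> real \<Rightarrow> real \<Rightarrow> real^'n) \<Rightarrow> (real^'n \<Rightarrow> real \<Rightarrow> real \<Rightarrow> real) \<Rightarrow> real \<Rightarrow> real
    \<Rightarrow> ((real^'n) \<times> real) hset \<Rightarrow> 'n fs_block \<Rightarrow> ((real^'n) \<times> real \<Rightarrow> (nat \<Rightarrow> real) \<times> (nat \<Rightarrow> real) \<times> real)
    \<Rightarrow> ((nat \<Rightarrow> real) \<times> real \<Rightarrow> nat \<Rightarrow> real) \<Rightarrow> real \<Rightarrow> real \<Rightarrow> (real \<Rightarrow> real) \<Rightarrow> bool" where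
  "target_data f g \<epsilon> T N D \<kappa> \<psi> q yS yF \<longleftrightarrow>
     block_coords D \<kappa> \<and> (q = 1 \<or> q = -1) \<and> (\<forall>x y. (x, y) \<in> block_set D \<longrightarrow> 0 < q * g x y \<epsilon>) \<and>
     0 < T \<and> (\<forall>w\<in>h_set N. flow_defined (fs_field f g \<epsilon>) T w) \<and>
     covers N (flow (fs_field f g \<epsilon>) T) (block_hset D \<kappa> \<psi>) \<and>
     (\<forall>p\<in>{-1..1}. yF p \<in> {b_ylo D..b_yhi D} \<and> 0 < q * (yF p - yS)) \<and> yS \<in> {b_ylo D..b_yhi D} \<and>
     (\<forall>w\<in>h_set N. flow (fs_field f g \<epsilon>) T w \<in> block_set D \<longrightarrow> q * snd (flow (fs_field f g \<epsilon>) T w) \<le> q * yS)"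

context fs_system
begin

lemma pair_block:
  assumes \<epsilon>: "\<epsilon> \<in> {0..\<epsilon>0}" and pair: "covering_exchange_pair f g \<epsilon>0 \<epsilon> T N D Ma"
  shows "fs_block_at f g r \<epsilon>0 I D \<epsilon>"
proof unfold_locales
  show "\<epsilon> \<in> {0..\<epsilon>0}" by (rule \<epsilon>)
  show "fast_saddle_block f \<epsilon>0 D" using pair by (simp add: covering_exchange_pair_def)
  obtain \<kappa> where "block_coords D \<kappa>" using pair unfolding covering_exchange_pair_def by (elim conjE exE bexE) (rule that)
  then obtain \<alpha> :: "real^'n \<Rightarrow> nat \<Rightarrow> real"
    where "\<alpha> ` (coord_proj (b_unst D) ` block_box D) = ecball (card (b_unst D))"
    unfolding block_coords_def by (elim conjE exE) (rule that)
  moreover have "(\<lambda>_. 0) \<in> ecball m" for m by (simp add: ecball_def espace_iff enorm_def)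
  ultimately show "block_box D \<noteq> {}" by force
qed

lemma pair_data:
  assumes \<epsilon>: "\<epsilon> \<in> {0..\<epsilon>0}" and pair: "covering_exchange_pair f g \<epsilon>0 \<epsilon> T N D Ma"
  shows "\<exists>u a yF \<omega>. face_param D Ma u a yF \<omega> \<and> (\<exists>\<kappa> \<psi> q yS. target_data f g \<epsilon> T N D \<kappa> \<psi> q yS yF)"
proof -
  interpret fs_block_at f g r \<epsilon>0 I D \<epsilon> by (rule pair_block[OF assms])
  have "card (b_unst D) = 1" using pair by (simp add: covering_exchange_pair_def)
  then obtain u where u: "b_unst D = {u}" by (auto simp: card_1_singleton_iff)
  let ?V = "fs_field f g \<epsilon>"
  define Y where "Y \<kappa> = (\<lambda>w. snd (snd (\<kappa> w))) ` (flow ?V T ` h_set N \<inter> block_set D)"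
    for \<kappa> :: "(real^'n) \<times> real \<Rightarrow> (nat \<Rightarrow> real) \<times> (nat \<Rightarrow> real) \<times> real"
  have T: "0 < T" using pair by (simp add: covering_exchange_pair_def)
  obtain \<kappa> \<psi> ym yp q where q: "q \<in> {1, -1::real}" and \<kappa>: "block_coords D \<kappa>"
    and g: "\<forall>(x, y) \<in> block_set D. q * g x y \<epsilon> > 0"
    and fd: "\<forall>w \<in> h_set N. flow_defined ?V T w" and cov: "covers N (flow ?V T) (block_hset D \<kappa> \<psi>)"
    and face: "is_exit_face D \<kappa> ym yp Ma"
    and Y: "q = 1 \<longrightarrow> Sup (Y \<kappa>) < ym" "q = -1 \<longrightarrow> Inf (Y \<kappa>) > yp"
    using pair unfolding covering_exchange_pair_def Let_def Y_def[symmetric]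
    by (elim conjE exE bexE) (rule that)
  have ymp: "0 < ym" "ym < yp" "yp < 1" using face by (auto simp: is_exit_face_def)
  obtain a and yF \<upsilon> :: "real \<Rightarrow> real" and \<omega> where a: "a = b_lo D $ u \<or> a = b_hi D $ u" and yF: "continuous_on {-1..1} yF"
    "\<And>p. p \<in> {-1..1} \<Longrightarrow> b_ylo D < yF p \<and> yF p < b_yhi D"
    and \<omega>: "continuous_on (block_box D) \<omega>" "\<omega> ` block_box D \<subseteq> ecball (h_s Ma)"
    and pos: "\<And>p b. p \<in> {-1..1} \<Longrightarrow> b \<in> block_box D \<Longrightarrow>
      lpos D (\<chi> i. if i = u then a else b $ i, yF p) \<in> h_set Ma \<and>
      inv_into (h_amb Ma) (h_chart Ma) (line_pt p, \<omega> b) = lpos D (\<chi> i. if i = u then a else b $ i, yF p)"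
    and \<upsilon>: "strict_mono \<upsilon>" "surj \<upsilon>" "\<upsilon> (b_ylo D) = 0" "\<upsilon> (b_yhi D) = 1" "\<And>w. snd (snd (\<kappa> w)) = \<upsilon> (snd w)"
    and rng: "\<And>p. p \<in> {-1..1} \<Longrightarrow> ym \<le> \<upsilon> (yF p) \<and> \<upsilon> (yF p) \<le> yp"
    by (rule exit_face_chart[OF \<kappa> u face fast_coord_pos(1)]) (rule that)
  have fp: "face_param D Ma u a yF \<omega>"
    unfolding face_param_def face_pos_def using u a yF \<omega> pos by blast
  have Yv: "\<upsilon> (snd (flow ?V T w)) \<in> Y \<kappa>" if "w \<in> h_set N" "flow ?V T w \<in> block_set D" for w
    unfolding Y_def \<upsilon>(5)[symmetric] using that by blast
  have less: "\<upsilon> s < \<upsilon> t \<longleftrightarrow> s < t" "\<upsilon> s \<le> \<upsilon> t \<longleftrightarrow> s \<le> t" for s t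
    using strict_mono_less[OF \<upsilon>(1)] strict_mono_less_eq[OF \<upsilon>(1)] by auto
  have Y01: "Y \<kappa> \<subseteq> {0..1}"
  proof
    fix t assume "t \<in> Y \<kappa>"
    then obtain w where "w \<in> block_set D" "t = \<upsilon> (snd w)" by (auto simp: Y_def \<upsilon>(5))
    then have "b_ylo D \<le> snd w" "snd w \<le> b_yhi D" by (auto simp: block_set_def)
    then have "\<upsilon> (b_ylo D) \<le> \<upsilon> (snd w)" "\<upsilon> (snd w) \<le> \<upsilon> (b_yhi D)" by (simp_all only: less)
    then show "t \<in> {0..1}" using \<upsilon>(3,4) \<open>t = \<upsilon> (snd w)\<close> by simp
  qed
  have bdd: "bdd_above (Y \<kappa>)" "bdd_below (Y \<kappa>)"
    using Y01 by (meson atLeastAtMost_iff bdd_aboveI bdd_belowI subsetD)+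
  have "\<exists>yS. yS \<in> {b_ylo D..b_yhi D} \<and> (\<forall>p\<in>{-1..1}. 0 < q * (yF p - yS)) \<and>
    (\<forall>w\<in>h_set N. flow ?V T w \<in> block_set D \<longrightarrow> q * snd (flow ?V T w) \<le> q * yS)"
  proof (cases "q = 1")
    case True
    \<comment> \<open>A chart value halfway between the supremum and the face. The maximum with 0
      matters only when \<open>Y\<close> is empty and its supremum an unspecified number; it keeps
      \<open>yS\<close> in the slow interval of the block.\<close>
    define s where "s = (max (Sup (Y \<kappa>)) 0 + ym) / 2"
    have s: "0 < s" "s < ym" "Sup (Y \<kappa>) \<le> s" using Y True ymp by (auto simp: s_def max_def)
    obtain yS where yS: "\<upsilon> yS = s" using \<upsilon>(2) by (metis surjD)
    have "\<upsilon> (b_ylo D) < \<upsilon> yS" "\<upsilon> yS < \<upsilon> (b_yhi D)" using s ymp \<upsilon>(3,4) yS by auto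
    moreover have "\<upsilon> yS < \<upsilon> (yF p)" if "p \<in> {-1..1}" for p using rng[OF that] s yS by simp
    moreover have "\<upsilon> (snd (flow ?V T w)) \<le> \<upsilon> yS" if "w \<in> h_set N" "flow ?V T w \<in> block_set D" for w
      using cSup_upper[OF Yv[OF that] bdd(1)] s yS by simp
    ultimately show ?thesis unfolding less using True by (intro exI[of _ yS]) auto
  next
    case False
    then have q': "q = -1" using q by simp
    define s where "s = (min (Inf (Y \<kappa>)) 1 + yp) / 2"
    have s: "s < 1" "yp < s" "s \<le> Inf (Y \<kappa>)" using Y q' ymp by (auto simp: s_def min_def)
    obtain yS where yS: "\<upsilon> yS = s" using \<upsilon>(2) by (metis surjD)
    have "\<upsilon> (b_ylo D) < \<upsilon> yS" "\<upsilon> yS < \<upsilon> (b_yhi D)" using s ymp \<upsilon>(3,4) yS by auto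
    moreover have "\<upsilon> (yF p) < \<upsilon> yS" if "p \<in> {-1..1}" for p using rng[OF that] s yS by simp
    moreover have "\<upsilon> yS \<le> \<upsilon> (snd (flow ?V T w))" if "w \<in> h_set N" "flow ?V T w \<in> block_set D" for w
      using cInf_lower[OF Yv[OF that] bdd(2)] s yS by simp
    ultimately show ?thesis unfolding less using q' by (intro exI[of _ yS]) auto
  qed
  then obtain yS where yS: "yS \<in> {b_ylo D..b_yhi D}" "\<forall>p\<in>{-1..1}. 0 < q * (yF p - yS)"
    "\<forall>w\<in>h_set N. flow ?V T w \<in> block_set D \<longrightarrow> q * snd (flow ?V T w) \<le> q * yS" by blast
  have "target_data f g \<epsilon> T N D \<kappa> \<psi> q yS yF"
    unfolding target_data_def using \<kappa> q g T fd cov yS yF(2) by (auto intro: less_imp_le)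
  with fp show ?thesis by blast
qed

end

text \<open>The conclusion of \<open>transition\<close> as a predicate, so that its data can be
  chosen for all \<open>j\<close> at once and handed to \<open>closed_chain\<close>.\<close>

definition trans_ok ::
  "(real^'n::finite \<Rightarrow> real \<Rightarrow> real \<Rightarrow> real^'n) \<Rightarrow> (real^'n \<Rightarrow> real \<Rightarrow> real \<Rightarrow> real) \<Rightarrow> real \<Rightarrow> real
    \<Rightarrow> (real \<Rightarrow> real^'n \<Rightarrow> (real^'n) \<times> real) \<Rightarrow> (real^'n) set \<Rightarrow> 'n fs_block \<Rightarrow> 'n \<Rightarrow> real \<Rightarrow> (real \<Rightarrow> real)
    \<Rightarrow> real \<Rightarrow> real \<Rightarrow> real \<Rightarrow> real \<Rightarrow> (real \<times> (real^'n) \<times> real \<Rightarrow> real) \<Rightarrow> (real \<times> (real^'n) \<times> real \<Rightarrow> (real^'n) \<times> real) \<Rightarrow> bool" where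
  "trans_ok f g \<epsilon> T pos B D u a yF q \<sigma> tmin tmax \<Lambda> e \<longleftrightarrow>
    (\<sigma> = 1 \<or> \<sigma> = -1) \<and> 0 < tmin \<and> tmin < tmax \<and>
    continuous_on ({-1..1} \<times> B \<times> {tmin..tmax}) \<Lambda> \<and> continuous_on ({-1..1} \<times> B \<times> {tmin..tmax}) e \<and>
    (\<forall>b\<in>B. \<forall>t\<in>{tmin..tmax}. \<Lambda> (1, b, t) = \<sigma> \<and> \<Lambda> (-1, b, t) = - \<sigma>) \<and>
    (\<forall>p\<in>{-1..1}. \<forall>b\<in>B. \<forall>t\<in>{tmin..tmax}. \<forall>i. i \<noteq> u \<longrightarrow>
      b_lo D $ i \<le> fst (e (p, b, t)) $ i \<and> fst (e (p, b, t)) $ i \<le> b_hi D $ i) \<and>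
    (\<forall>p\<in>{-1..1}. \<forall>b\<in>B. \<forall>p'\<in>{-1..1}.
      q * (snd (e (p, b, tmin)) - yF p') \<le> 0 \<and> 0 \<le> q * (snd (e (p, b, tmax)) - yF p')) \<and>
    (\<forall>p\<in>{-1..1}. \<forall>b\<in>B. \<forall>t\<in>{tmin..tmax}. \<forall>p'\<in>{-1..1}.
      \<Lambda> (p, b, t) = 0 \<longrightarrow> snd (e (p, b, t)) = yF p' \<longrightarrow> fst (e (p, b, t)) $ u = a \<and>
      (\<exists>\<gamma>. solves (fs_field f g \<epsilon>) \<gamma> {0..T + t} \<and> \<gamma> 0 = pos p b \<and> \<gamma> ` {T..T + t} \<subseteq> block_set D \<and>
        \<gamma> (T + t) = lpos D (e (p, b, t))))"

lemma block_box_convex [simp]: "convex (block_box D)"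
proof -
  have "block_box D = cbox (b_lo D) (b_hi D)" by (auto simp: block_box_def mem_box_cart)
  then show ?thesis by simp
qed

lemma continuous_on_face_pos:
  assumes "continuous_on {-1..1} yF"
  shows "continuous_on ({-1..1} \<times> B) (\<lambda>(p, b). face_pos D u a yF p b)"
proof -
  let ?S = "{-1..1::real} \<times> B"
  have 1: "continuous_on ?S (\<lambda>x. yF (fst x))"
    by (rule continuous_on_compose2[OF assms continuous_on_fst[OF continuous_on_id]]) auto
  have 2: "continuous_on ?S (\<lambda>x. \<chi> i. if i = u then a else snd x $ i)"
  proof (rule continuous_on_vec_lambda)
    fix i show "continuous_on ?S (\<lambda>x. if i = u then a else snd x $ i)"
      by (cases "i = u") (auto intro!: continuous_intros)
  qed
  show ?thesis unfolding face_pos_def lpos_def case_prod_beta fst_conv snd_conv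
    by (intro continuous_on_Pair continuous_on_fast_pos 1 2)
qed

context fs_system
begin

lemma pair_transition:
  assumes eps: "\<epsilon> \<in> {0<..\<epsilon>0}" and block: "fs_block_at f g r \<epsilon>0 I D \<epsilon>" and block': "block_box D' \<noteq> {}"
    and src: "face_param D' N u' a' yF' \<omega>'" and tgt: "face_param D Ma u a yF \<omega>"
    and data: "target_data f g \<epsilon> T N D \<kappa> \<psi> q yS yF"
  shows "\<exists>\<sigma> tmin tmax \<Lambda> e. trans_ok f g \<epsilon> T (face_pos D' u' a' yF') (block_box D') D u a yF q \<sigma> tmin tmax \<Lambda> e"
proof -
  interpret fs_block_at f g r \<epsilon>0 I D \<epsilon> by (rule block)
  have "0 < \<epsilon>" using eps by simp
  have s: "continuous_on (block_box D') \<omega>'" "\<omega>' ` block_box D' \<subseteq> ecball (h_s N)" "continuous_on {-1..1} yF'"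
    "\<And>p b. p \<in> {-1..1} \<Longrightarrow> b \<in> block_box D' \<Longrightarrow> face_pos D' u' a' yF' p b \<in> h_set N \<and>
        inv_into (h_amb N) (h_chart N) (line_pt p, \<omega>' b) = face_pos D' u' a' yF' p b"
    using src unfolding face_param_def by blast+
  have t: "b_unst D = {u}" "a = b_lo D $ u \<or> a = b_hi D $ u" "continuous_on {-1..1} yF"
    using tgt unfolding face_param_def by blast+
  have d: "block_coords D \<kappa>" "q = 1 \<or> q = -1" "\<And>x y. (x, y) \<in> block_set D \<Longrightarrow> 0 < q * g x y \<epsilon>"
     "0 < T" "\<And>w. w \<in> h_set N \<Longrightarrow> flow_defined (fs_field f g \<epsilon>) T w"
     "covers N (flow (fs_field f g \<epsilon>) T) (block_hset D \<kappa> \<psi>)"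
     "\<And>p. p \<in> {-1..1} \<Longrightarrow> yF p \<in> {b_ylo D..b_yhi D} \<and> 0 < q * (yF p - yS)" "yS \<in> {b_ylo D..b_yhi D}"
     "\<And>w. w \<in> h_set N \<Longrightarrow> flow (fs_field f g \<epsilon>) T w \<in> block_set D \<Longrightarrow> q * snd (flow (fs_field f g \<epsilon>) T w) \<le> q * yS"
    using data unfolding target_data_def by blast+
  show ?thesis
  proof (rule transition[OF \<open>0 < \<epsilon>\<close> t(1) d(1,2,3,4,5,6) block_box_convex block' s(1,2,4)
          continuous_on_face_pos[OF s(3)] t(2,3) d(7,8,9)])
    fix \<sigma> tmin tmax :: real and \<Lambda> :: "real \<times> (real^'n) \<times> real \<Rightarrow> real" and e
    let ?B = "block_box D'" and ?pos = "face_pos D' u' a' yF'"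
    assume "\<sigma> = 1 \<or> \<sigma> = -1" "0 < tmin" "tmin < tmax"
      "continuous_on ({-1..1} \<times> ?B \<times> {tmin..tmax}) \<Lambda>" "continuous_on ({-1..1} \<times> ?B \<times> {tmin..tmax}) e"
      and ends: "\<And>b t. b \<in> ?B \<Longrightarrow> t \<in> {tmin..tmax} \<Longrightarrow> \<Lambda> (1, b, t) = \<sigma> \<and> \<Lambda> (-1, b, t) = - \<sigma>"
      and box: "\<And>p b t i. p \<in> {-1..1} \<Longrightarrow> b \<in> ?B \<Longrightarrow> t \<in> {tmin..tmax} \<Longrightarrow> i \<noteq> u \<Longrightarrow>
        b_lo D $ i \<le> fst (e (p, b, t)) $ i \<and> fst (e (p, b, t)) $ i \<le> b_hi D $ i"
      and slow: "\<And>p b p'. p \<in> {-1..1} \<Longrightarrow> b \<in> ?B \<Longrightarrow> p' \<in> {-1..1} \<Longrightarrow>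
        q * (snd (e (p, b, tmin)) - yF p') \<le> 0 \<and> 0 \<le> q * (snd (e (p, b, tmax)) - yF p')"
      and orbit: "\<And>p b t p'. p \<in> {-1..1} \<Longrightarrow> b \<in> ?B \<Longrightarrow> t \<in> {tmin..tmax} \<Longrightarrow> p' \<in> {-1..1} \<Longrightarrow>
        \<Lambda> (p, b, t) = 0 \<Longrightarrow> snd (e (p, b, t)) = yF p' \<Longrightarrow> fst (e (p, b, t)) $ u = a \<and>
        (\<exists>\<gamma>. solves (fs_field f g \<epsilon>) \<gamma> {0..T + t} \<and> \<gamma> 0 = ?pos p b \<and> \<gamma> ` {T..T + t} \<subseteq> block_set D \<and>
          \<gamma> (T + t) = lpos D (e (p, b, t)))"
    then have "trans_ok f g \<epsilon> T ?pos ?B D u a yF q \<sigma> tmin tmax \<Lambda> e"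
      unfolding trans_ok_def using ends box slow orbit by simp
    then show ?thesis by blast
  qed
qed

end

lemma cyc_pred_succ: "j \<le> \<rho> \<Longrightarrow> cyc_pred \<rho> (cyc_succ \<rho> j) = j" "j \<le> \<rho> \<Longrightarrow> cyc_succ \<rho> (cyc_pred \<rho> j) = j"
  "j \<le> \<rho> \<Longrightarrow> cyc_succ \<rho> j \<le> \<rho>" "j \<le> \<rho> \<Longrightarrow> cyc_pred \<rho> j \<le> \<rho>"
  by (auto simp: cyc_pred_def cyc_succ_def)

text \<open>
  The unknowns are, for every \<open>j\<close>, a point of the \<open>j\<close>-th exit face and the time spent in the
  following block.  Every equation has a sign on the two faces of the box of unknowns that belong
  to one of the variables, so Poincare--Miranda applies.
\<close>

lemma closed_chain:
  fixes D :: "nat \<Rightarrow> 'n::finite fs_block" and T :: "nat \<Rightarrow> real"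
    and \<Lambda> :: "nat \<Rightarrow> real \<times> (real^'n) \<times> real \<Rightarrow> real" and e :: "nat \<Rightarrow> real \<times> (real^'n) \<times> real \<Rightarrow> (real^'n) \<times> real"
  assumes lo_hi: "\<And>j i. j \<le> \<rho> \<Longrightarrow> b_lo (D j) $ i < b_hi (D j) $ i"
    and a: "\<And>j. j \<le> \<rho> \<Longrightarrow> a j = b_lo (D j) $ u j \<or> a j = b_hi (D j) $ u j"
    and yF: "\<And>j. j \<le> \<rho> \<Longrightarrow> continuous_on {-1..1} (yF j)" and q: "\<And>j. j \<le> \<rho> \<Longrightarrow> q j = 1 \<or> q j = (-1::real)"
    and trans: "\<And>j. j \<le> \<rho> \<Longrightarrow> trans_ok f g \<epsilon> (T j) (face_pos (D j) (u j) (a j) (yF j)) (block_box (D j))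
      (D (cyc_succ \<rho> j)) (u (cyc_succ \<rho> j)) (a (cyc_succ \<rho> j)) (yF (cyc_succ \<rho> j)) (q (cyc_succ \<rho> j))
      (\<sigma> j) (tmin j) (tmax j) (\<Lambda> j) (e j)"
  shows "\<exists>p b t \<gamma>. \<forall>j\<le>\<rho>. p j \<in> {-1..1} \<and> b j \<in> block_box (D j) \<and> 0 < t j \<and>
    solves (fs_field f g \<epsilon>) (\<gamma> j) {0..T j + t j} \<and>
    \<gamma> j 0 = face_pos (D j) (u j) (a j) (yF j) (p j) (b j) \<and>
    \<gamma> j ` {T j..T j + t j} \<subseteq> block_set (D (cyc_succ \<rho> j)) \<and>
    \<gamma> j (T j + t j) = \<gamma> (cyc_succ \<rho> j) 0"
proof -
  let ?s = "cyc_succ \<rho>" and ?p = "cyc_pred \<rho>"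
  \<comment> \<open>\<open>(j, None)\<close> is the slow parameter on the \<open>j\<close>-th face,
    \<open>(j, Some None)\<close> the waiting time in the block after it, and
    \<open>(j, Some (Some i))\<close> the \<open>i\<close>-th fast coordinate of the face point,
    absent for the unstable direction because that coordinate is fixed on the face.\<close>
  define J :: "(nat \<times> 'n option option) set" where
    "J = ({..\<rho>} \<times> UNIV) - {(j, Some (Some (u j))) | j. j \<le> \<rho>}"
  have "finite J" unfolding J_def by (intro finite_Diff finite_cartesian_product) auto
  have J: "(j, None) \<in> J" "(j, Some None) \<in> J" "i \<noteq> u j \<Longrightarrow> (j, Some (Some i)) \<in> J" if "j \<le> \<rho>" for j i
    using that by (auto simp: J_def)
  define l where "l = (\<lambda>(j, k). case k of None \<Rightarrow> -1 | Some None \<Rightarrow> tmin j | Some (Some i) \<Rightarrow> b_lo (D j) $ i)"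
  define h where "h = (\<lambda>(j, k). case k of None \<Rightarrow> 1 | Some None \<Rightarrow> tmax j | Some (Some i) \<Rightarrow> b_hi (D j) $ i)"
  define Q where "Q = {x :: nat \<times> 'n option option \<Rightarrow> real. \<forall>k\<in>J. x k \<in> {l k..h k}}"
  define bb where "bb j x = (\<chi> i. if i = u j then b_lo (D j) $ i else x (j, Some (Some i)))"
    for j and x :: "nat \<times> 'n option option \<Rightarrow> real"
  define arg where "arg j x = (x (j, None), bb j x, x (j, Some None))" for j and x :: "nat \<times> 'n option option \<Rightarrow> real"
  \<comment> \<open>Each equation belongs to the unknown on whose two faces it has a sign: \<Lambda>
    to the slow parameter; arrival at the slow coordinate of the next face point to the waiting
    time; agreement of a stable coordinate with the arrival from the preceding block to that
    coordinate, since arrivals always lie between its bounds. The factors \<sigma> and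
    \<open>q\<close> orient the signs.\<close>
  define F where "F x = (\<lambda>(j, k). case k of
      None \<Rightarrow> \<sigma> j * \<Lambda> j (arg j x)
    | Some None \<Rightarrow> q (?s j) * (snd (e j (arg j x)) - yF (?s j) (x (?s j, None)))
    | Some (Some i) \<Rightarrow> x (j, Some (Some i)) - fst (e (?p j) (arg (?p j) x)) $ i)"
    for x :: "nat \<times> 'n option option \<Rightarrow> real"
  note tr = trans[unfolded trans_ok_def]
  have tmin: "0 < tmin j" "tmin j < tmax j" "\<sigma> j = 1 \<or> \<sigma> j = -1" if "j \<le> \<rho>" for j using tr[OF that] by auto
  have lh: "l k < h k" if "k \<in> J" for k
  proof -
    from \<open>k \<in> J\<close> obtain j m where k: "k = (j, m)" "j \<le> \<rho>" by (cases k) (auto simp: J_def)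
    then show ?thesis using tmin[OF k(2)] lo_hi[OF k(2)] by (auto simp: l_def h_def split: option.split)
  qed
  have argQ: "x (j, None) \<in> {-1..1}" "bb j x \<in> block_box (D j)" "x (j, Some None) \<in> {tmin j..tmax j}"
    if "x \<in> Q" "j \<le> \<rho>" for x j
  proof -
    have *: "x k \<in> {l k..h k}" if "k \<in> J" for k using \<open>x \<in> Q\<close> that by (simp add: Q_def)
    show "x (j, None) \<in> {-1..1}" using *[OF J(1)[OF that(2)]] by (simp add: l_def h_def)
    show "x (j, Some None) \<in> {tmin j..tmax j}" using *[OF J(2)[OF that(2)]] by (simp add: l_def h_def)
    have "b_lo (D j) $ i \<le> bb j x $ i \<and> bb j x $ i \<le> b_hi (D j) $ i" for i
    proof (cases "i = u j")
      case True
      then show ?thesis using lo_hi[OF that(2), of i] by (simp add: bb_def)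
    next
      case False
      then show ?thesis using *[OF J(3)[OF that(2) False]] by (simp add: bb_def l_def h_def)
    qed
    then show "bb j x \<in> block_box (D j)" by (simp add: block_box_def)
  qed
  have coord: "continuous_on Q (\<lambda>x. x k)" for k :: "nat \<times> 'n option option"
    by (rule continuous_on_apply_coord[OF continuous_on_id])
  have carg: "continuous_on Q (arg j)" for j
  proof -
    have "continuous_on Q (bb j)" unfolding bb_def
    proof (rule continuous_on_vec_lambda)
      fix i show "continuous_on Q (\<lambda>x. if i = u j then b_lo (D j) $ i else x (j, Some (Some i)))"
        by (cases "i = u j") (simp_all add: coord)
    qed
    then show ?thesis unfolding arg_def by (intro continuous_on_Pair coord)
  qed
  have arg_in: "arg j x \<in> {-1..1} \<times> block_box (D j) \<times> {tmin j..tmax j}" if "x \<in> Q" "j \<le> \<rho>" for j x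
    using argQ[OF that] by (simp add: arg_def)
  have ce: "continuous_on Q (\<lambda>x. e j (arg j x))" if "j \<le> \<rho>" for j
  proof (rule continuous_on_compose2[OF _ carg])
    show "continuous_on ({-1..1} \<times> block_box (D j) \<times> {tmin j..tmax j}) (e j)" using tr[OF that] by blast
  qed (use arg_in that in blast)
  have cL: "continuous_on Q (\<lambda>x. \<Lambda> j (arg j x))" if "j \<le> \<rho>" for j
  proof (rule continuous_on_compose2[OF _ carg])
    show "continuous_on ({-1..1} \<times> block_box (D j) \<times> {tmin j..tmax j}) (\<Lambda> j)" using tr[OF that] by blast
  qed (use arg_in that in blast)
  have ends: "\<Lambda> j (1, b, t) = \<sigma> j \<and> \<Lambda> j (-1, b, t) = - \<sigma> j" if "j \<le> \<rho>" "b \<in> block_box (D j)" "t \<in> {tmin j..tmax j}" for j b t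
    using tr[OF that(1)] that(2,3) by blast
  have slow: "q (?s j) * (snd (e j (p, b, tmin j)) - yF (?s j) p') \<le> 0 \<and> 0 \<le> q (?s j) * (snd (e j (p, b, tmax j)) - yF (?s j) p')"
    if "j \<le> \<rho>" "p \<in> {-1..1}" "b \<in> block_box (D j)" "p' \<in> {-1..1}" for j p b p'
    using tr[OF that(1)] that(2,3,4) by blast
  have box: "b_lo (D (?s j)) $ i \<le> fst (e j (arg j x)) $ i \<and> fst (e j (arg j x)) $ i \<le> b_hi (D (?s j)) $ i"
    if "j \<le> \<rho>" "x \<in> Q" "i \<noteq> u (?s j)" for j x i
    using tr[OF that(1)] argQ[OF that(2,1)] that(3) unfolding arg_def by blast
  have "\<exists>x\<in>Q. \<forall>k\<in>J. F x k = 0"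
    unfolding Q_def
  proof (rule poincare_miranda[OF \<open>finite J\<close> lh], unfold Q_def[symmetric])
    fix k assume "k \<in> J"
    then obtain j m where k: "k = (j, m)" "j \<le> \<rho>" by (cases k) (auto simp: J_def)
    show "continuous_on Q (\<lambda>x. F x k)"
    proof (cases m)
      case None
      then show ?thesis unfolding F_def k by (simp add: continuous_on_mult_left cL[OF k(2)])
    next
      case (Some m')
      show ?thesis
      proof (cases m')
        case None
        have "continuous_on Q (\<lambda>x. yF (?s j) (x (?s j, None)))"
          by (rule continuous_on_compose2[OF yF coord]) (use argQ(1) cyc_pred_succ(3) k(2) in blast)+
        then show ?thesis unfolding F_def k Some None
          by (simp add: continuous_on_mult_left continuous_on_diff continuous_on_snd ce[OF k(2)])
      next
        case (Some i)
        then show ?thesis unfolding F_def k \<open>m = Some m'\<close>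
          using ce[of "?p j"] cyc_pred_succ(4)[OF k(2)]
          by (simp add: continuous_on_diff coord continuous_on_component continuous_on_fst)
      qed
    qed
  next
    fix x k assume x: "x \<in> Q" and "k \<in> J" and at: "x k = l k"
    then obtain j m where k: "k = (j, m)" "j \<le> \<rho>" by (cases k) (auto simp: J_def)
    consider "m = None" | "m = Some None" | i where "m = Some (Some i)" by (metis option.exhaust)
    then show "F x k \<le> 0"
    proof cases
      case 1
      then have "arg j x = (-1, bb j x, x (j, Some None))" using at by (simp add: arg_def k l_def)
      then show ?thesis using ends[OF k(2) argQ(2,3)[OF x k(2)]] tmin(3)[OF k(2)] unfolding F_def k 1 by auto
    next
      case 2
      then have "arg j x = (x (j, None), bb j x, tmin j)" using at by (simp add: arg_def k l_def)
      then show ?thesis using slow[OF k(2) argQ(1,2)[OF x k(2)] argQ(1)[OF x cyc_pred_succ(3)[OF k(2)]]]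
        unfolding F_def k 2 by simp
    next
      case 3
      then have "i \<noteq> u j" using \<open>k \<in> J\<close> k by (auto simp: J_def)
      then show ?thesis using box[OF cyc_pred_succ(4)[OF k(2)] x, of i] at
        unfolding F_def k 3 by (simp add: cyc_pred_succ(2)[OF k(2)] l_def)
    qed
  next
    fix x k assume x: "x \<in> Q" and "k \<in> J" and at: "x k = h k"
    then obtain j m where k: "k = (j, m)" "j \<le> \<rho>" by (cases k) (auto simp: J_def)
    consider "m = None" | "m = Some None" | i where "m = Some (Some i)" by (metis option.exhaust)
    then show "0 \<le> F x k"
    proof cases
      case 1
      then have "arg j x = (1, bb j x, x (j, Some None))" using at by (simp add: arg_def k h_def)
      then show ?thesis using ends[OF k(2) argQ(2,3)[OF x k(2)]] tmin(3)[OF k(2)] unfolding F_def k 1 by auto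
    next
      case 2
      then have "arg j x = (x (j, None), bb j x, tmax j)" using at by (simp add: arg_def k h_def)
      then show ?thesis using slow[OF k(2) argQ(1,2)[OF x k(2)] argQ(1)[OF x cyc_pred_succ(3)[OF k(2)]]]
        unfolding F_def k 2 by simp
    next
      case 3
      then have "i \<noteq> u j" using \<open>k \<in> J\<close> k by (auto simp: J_def)
      then show ?thesis using box[OF cyc_pred_succ(4)[OF k(2)] x, of i] at
        unfolding F_def k 3 by (simp add: cyc_pred_succ(2)[OF k(2)] h_def)
    qed
  qed
  then obtain x where x: "x \<in> Q" "\<And>k. k \<in> J \<Longrightarrow> F x k = 0" by blast
  define p b t where "p j = x (j, None)" and "b j = bb j x" and "t j = x (j, Some None)" for j
  have in_dom: "p j \<in> {-1..1}" "b j \<in> block_box (D j)" "t j \<in> {tmin j..tmax j}" if "j \<le> \<rho>" for j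
    using argQ[OF x(1) that] by (auto simp: p_def b_def t_def)
  have arg: "arg j x = (p j, b j, t j)" for j by (simp add: arg_def p_def b_def t_def)
  have eqs: "\<Lambda> j (p j, b j, t j) = 0" "snd (e j (p j, b j, t j)) = yF (?s j) (p (?s j))"
    "i \<noteq> u (?s j) \<Longrightarrow> fst (e j (p j, b j, t j)) $ i = b (?s j) $ i" if j: "j \<le> \<rho>" for j i
  proof -
    show "\<Lambda> j (p j, b j, t j) = 0"
      using x(2)[OF J(1)[OF j]] tmin(3)[OF j] by (auto simp: F_def arg)
    show "snd (e j (p j, b j, t j)) = yF (?s j) (p (?s j))"
      using x(2)[OF J(2)[OF j]] q[OF cyc_pred_succ(3)[OF j]] by (auto simp: F_def arg p_def)
    show "fst (e j (p j, b j, t j)) $ i = b (?s j) $ i" if "i \<noteq> u (?s j)"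
      using x(2)[OF J(3)[OF cyc_pred_succ(3)[OF j] that]] that
      by (simp add: F_def arg cyc_pred_succ(1)[OF j] b_def bb_def)
  qed
  have "\<exists>\<gamma>. fst (e j (p j, b j, t j)) $ u (?s j) = a (?s j) \<and> solves (fs_field f g \<epsilon>) \<gamma> {0..T j + t j} \<and>
      \<gamma> 0 = face_pos (D j) (u j) (a j) (yF j) (p j) (b j) \<and>
      \<gamma> ` {T j..T j + t j} \<subseteq> block_set (D (?s j)) \<and> \<gamma> (T j + t j) = lpos (D (?s j)) (e j (p j, b j, t j))"
    if j: "j \<le> \<rho>" for j
  proof -
    have "\<forall>p\<in>{-1..1}. \<forall>b\<in>block_box (D j). \<forall>t\<in>{tmin j..tmax j}. \<forall>p'\<in>{-1..1}.
      \<Lambda> j (p, b, t) = 0 \<longrightarrow> snd (e j (p, b, t)) = yF (?s j) p' \<longrightarrow> fst (e j (p, b, t)) $ u (?s j) = a (?s j) \<and>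
      (\<exists>\<gamma>. solves (fs_field f g \<epsilon>) \<gamma> {0..T j + t} \<and> \<gamma> 0 = face_pos (D j) (u j) (a j) (yF j) p b \<and>
        \<gamma> ` {T j..T j + t} \<subseteq> block_set (D (?s j)) \<and> \<gamma> (T j + t) = lpos (D (?s j)) (e j (p, b, t)))"
      using tr[OF j] by blast
    from this[rule_format, OF in_dom[OF j] in_dom(1)[OF cyc_pred_succ(3)[OF j]] eqs(1,2)[OF j]]
    show ?thesis by blast
  qed
  then have "\<forall>j. \<exists>\<gamma>. j \<le> \<rho> \<longrightarrow> fst (e j (p j, b j, t j)) $ u (?s j) = a (?s j) \<and> solves (fs_field f g \<epsilon>) \<gamma> {0..T j + t j} \<and>
      \<gamma> 0 = face_pos (D j) (u j) (a j) (yF j) (p j) (b j) \<and>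
      \<gamma> ` {T j..T j + t j} \<subseteq> block_set (D (?s j)) \<and> \<gamma> (T j + t j) = lpos (D (?s j)) (e j (p j, b j, t j))"
    by blast
  from choice[OF this] obtain \<gamma> where \<gamma>: "\<And>j. j \<le> \<rho> \<Longrightarrow> fst (e j (p j, b j, t j)) $ u (?s j) = a (?s j) \<and>
      solves (fs_field f g \<epsilon>) (\<gamma> j) {0..T j + t j} \<and>
      \<gamma> j 0 = face_pos (D j) (u j) (a j) (yF j) (p j) (b j) \<and>
      \<gamma> j ` {T j..T j + t j} \<subseteq> block_set (D (?s j)) \<and> \<gamma> j (T j + t j) = lpos (D (?s j)) (e j (p j, b j, t j))"
    by blast
  have link: "\<gamma> j (T j + t j) = \<gamma> (?s j) 0" if j: "j \<le> \<rho>" for j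
  proof -
    have "fst (e j (p j, b j, t j)) = (\<chi> i. if i = u (?s j) then a (?s j) else b (?s j) $ i)"
      using \<gamma>[OF j] eqs(3)[OF j] by (auto simp: vec_eq_iff)
    then have "e j (p j, b j, t j) = (\<chi> i. if i = u (?s j) then a (?s j) else b (?s j) $ i, yF (?s j) (p (?s j)))"
      using eqs(2)[OF j] by (simp add: prod_eq_iff)
    then show ?thesis using \<gamma>[OF j] \<gamma>[OF cyc_pred_succ(3)[OF j]] by (simp add: face_pos_def)
  qed
  have "0 < t j" if "j \<le> \<rho>" for j using in_dom(3)[OF that] tmin(1)[OF that] by simp
  then show ?thesis using \<gamma> link in_dom by (intro exI[of _ p] exI[of _ b] exI[of _ t] exI[of _ \<gamma>]) simp
qed

context fs_system
begin

lemma periodic_orbit_through_blocks: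
  fixes S :: "nat \<Rightarrow> 'n fs_block" and F :: "nat \<Rightarrow> ((real^'n) \<times> real) hset" and T :: "nat \<Rightarrow> real"
  assumes eps: "\<epsilon> \<in> {0<..\<epsilon>0}" and pairs: "\<And>j. j \<le> \<rho> \<Longrightarrow>
     covering_exchange_pair f g \<epsilon>0 \<epsilon> (T (cyc_pred \<rho> j)) (F (cyc_pred \<rho> j)) (S j) (F j)"
  shows "\<exists>\<Gamma> P (tf :: nat \<Rightarrow> real) (ts :: nat \<Rightarrow> real).
        periodic_orbit (fs_field f g \<epsilon>) \<Gamma> P \<and>
        0 < tf 0 \<and> (\<forall>j<\<rho>. tf j < ts (j + 1) \<and> ts (j + 1) < tf (j + 1)) \<and>
        tf \<rho> < ts 0 \<and> ts 0 = P \<and>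
        \<Gamma> P = \<Gamma> 0 \<and> \<Gamma> 0 \<in> h_set (F 0) \<and>
        (\<forall>j<\<rho>. \<Gamma> ` {tf j..ts (j + 1)} \<subseteq> block_set (S (j + 1)) \<and>
                 \<Gamma> (ts (j + 1)) \<in> h_set (F (j + 1))) \<and>
        \<Gamma> ` {tf \<rho>..P} \<subseteq> block_set (S 0)"
proof -
  let ?s = "cyc_succ \<rho>" and ?p = "cyc_pred \<rho>" and ?V = "fs_field f g \<epsilon>"
  have eps': "\<epsilon> \<in> {0..\<epsilon>0}" using eps by simp
  have block: "fs_block_at f g r \<epsilon>0 I (S j) \<epsilon>" if "j \<le> \<rho>" for j by (rule pair_block[OF eps' pairs[OF that]])
  have "\<forall>j. \<exists>u a yF \<omega> \<kappa> \<psi> q yS. j \<le> \<rho> \<longrightarrow> face_param (S j) (F j) u a yF \<omega> \<and>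
      target_data f g \<epsilon> (T (?p j)) (F (?p j)) (S j) \<kappa> \<psi> q yS yF"
    using pair_data[OF eps' pairs] by blast
  then obtain u a yF \<omega> \<kappa> \<psi> q yS where fp: "\<And>j. j \<le> \<rho> \<Longrightarrow> face_param (S j) (F j) (u j) (a j) (yF j) (\<omega> j)"
    and td: "\<And>j. j \<le> \<rho> \<Longrightarrow> target_data f g \<epsilon> (T (?p j)) (F (?p j)) (S j) (\<kappa> j) (\<psi> j) (q j) (yS j) (yF j)"
    by metis
  have "\<exists>\<sigma> tmin tmax \<Lambda> e. trans_ok f g \<epsilon> (T j) (face_pos (S j) (u j) (a j) (yF j)) (block_box (S j))
      (S (?s j)) (u (?s j)) (a (?s j)) (yF (?s j)) (q (?s j)) \<sigma> tmin tmax \<Lambda> e" if j: "j \<le> \<rho>" for j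
  proof (rule pair_transition[OF eps block[OF cyc_pred_succ(3)[OF j]] _ fp[OF j] fp[OF cyc_pred_succ(3)[OF j]]])
    show "block_box (S j) \<noteq> {}" by (rule fs_block_at.box_ne[OF block[OF j]])
    show "target_data f g \<epsilon> (T j) (F j) (S (?s j)) (\<kappa> (?s j)) (\<psi> (?s j)) (q (?s j)) (yS (?s j)) (yF (?s j))"
      using td[OF cyc_pred_succ(3)[OF j]] unfolding cyc_pred_succ(1)[OF j] .
  qed
  then have "\<forall>j. \<exists>\<sigma> tmin tmax \<Lambda> e. j \<le> \<rho> \<longrightarrow> trans_ok f g \<epsilon> (T j) (face_pos (S j) (u j) (a j) (yF j)) (block_box (S j))
      (S (?s j)) (u (?s j)) (a (?s j)) (yF (?s j)) (q (?s j)) \<sigma> tmin tmax \<Lambda> e" by blast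
  then obtain \<sigma> tmin tmax \<Lambda> e where tr: "\<And>j. j \<le> \<rho> \<Longrightarrow>
      trans_ok f g \<epsilon> (T j) (face_pos (S j) (u j) (a j) (yF j)) (block_box (S j))
      (S (?s j)) (u (?s j)) (a (?s j)) (yF (?s j)) (q (?s j)) (\<sigma> j) (tmin j) (tmax j) (\<Lambda> j) (e j)"
    by metis
  have "\<exists>p b t \<gamma>. \<forall>j\<le>\<rho>. p j \<in> {-1..1} \<and> b j \<in> block_box (S j) \<and> 0 < t j \<and>
    solves ?V (\<gamma> j) {0..T j + t j} \<and>
    \<gamma> j 0 = face_pos (S j) (u j) (a j) (yF j) (p j) (b j) \<and>
    \<gamma> j ` {T j..T j + t j} \<subseteq> block_set (S (?s j)) \<and>
    \<gamma> j (T j + t j) = \<gamma> (?s j) 0"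
  proof (rule closed_chain[where \<rho> = \<rho> and q = q and \<sigma> = \<sigma> and tmin = tmin and tmax = tmax and \<Lambda> = \<Lambda> and e = e])
    show "b_lo (S j) $ i < b_hi (S j) $ i" if "j \<le> \<rho>" for j i
      by (rule fs_block_at.lo_less_hi[OF block[OF that]])
    show "trans_ok f g \<epsilon> (T j) (face_pos (S j) (u j) (a j) (yF j)) (block_box (S j))
      (S (?s j)) (u (?s j)) (a (?s j)) (yF (?s j)) (q (?s j)) (\<sigma> j) (tmin j) (tmax j) (\<Lambda> j) (e j)" if "j \<le> \<rho>" for j
      by (rule tr[OF that])
    show "a j = b_lo (S j) $ u j \<or> a j = b_hi (S j) $ u j" "continuous_on {-1..1} (yF j)" if "j \<le> \<rho>" for j
      using fp[OF that] by (auto simp: face_param_def)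
    show "q j = 1 \<or> q j = -1" if "j \<le> \<rho>" for j
      using td[OF that] by (auto simp: target_data_def)
  qed
  then obtain p b t \<gamma> where \<gamma>: "\<And>j. j \<le> \<rho> \<Longrightarrow> p j \<in> {-1..1} \<and> b j \<in> block_box (S j) \<and> 0 < t j \<and>
    solves ?V (\<gamma> j) {0..T j + t j} \<and> \<gamma> j 0 = face_pos (S j) (u j) (a j) (yF j) (p j) (b j) \<and>
    \<gamma> j ` {T j..T j + t j} \<subseteq> block_set (S (?s j)) \<and> \<gamma> j (T j + t j) = \<gamma> (?s j) 0"
    by blast
  have Tpos: "0 < T j" if "j \<le> \<rho>" for j
    using td[OF cyc_pred_succ(3)[OF that]] unfolding cyc_pred_succ(1)[OF that] by (simp add: target_data_def)
  have start_in: "\<gamma> j 0 \<in> h_set (F j)" if "j \<le> \<rho>" for j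
    using fp[OF that] \<gamma>[OF that] by (auto simp: face_param_def)
  define len where "len j = T j + t j" for j
  have len: "0 < len j" if "j \<le> \<rho>" for j using Tpos[OF that] \<gamma>[OF that] by (simp add: len_def)
  have "\<exists>\<Gamma>. solves ?V \<Gamma> {0..sum len {..\<rho>}} \<and> (\<forall>j\<le>\<rho>. \<forall>t\<in>{0..len j}. \<Gamma> (sum len {..<j} + t) = \<gamma> j t)"
  proof (rule solves_chain[OF len])
    show "solves ?V (\<gamma> j) {0..len j}" if "j \<le> \<rho>" for j using \<gamma>[OF that] by (simp add: len_def)
    show "\<gamma> j (len j) = \<gamma> (Suc j) 0" if "j < \<rho>" for j using \<gamma>[of j] that by (simp add: len_def cyc_succ_def)
  qed
  then obtain \<Gamma>0 where \<Gamma>0: "solves ?V \<Gamma>0 {0..sum len {..\<rho>}}"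
    "\<And>j t. j \<le> \<rho> \<Longrightarrow> t \<in> {0..len j} \<Longrightarrow> \<Gamma>0 (sum len {..<j} + t) = \<gamma> j t" by blast
  define P where "P = sum len {..\<rho>}"
  have Psum: "P = sum len {..<\<rho>} + len \<rho>" by (simp add: P_def flip: lessThan_Suc_atMost)
  have partial: "0 \<le> sum len {..<j}" "sum len {..<j} + len j \<le> P" if "j \<le> \<rho>" for j
  proof -
    show "0 \<le> sum len {..<j}" by (rule sum_nonneg) (use len that in \<open>simp add: less_imp_le\<close>)
    have "sum len {..<Suc j} \<le> sum len {..\<rho>}"
      using that len by (intro sum_mono2) (auto intro: less_imp_le)
    then show "sum len {..<j} + len j \<le> P" by (simp add: P_def)
  qed
  have "0 < P" using Psum partial(1)[of \<rho>] len[of \<rho>] by simp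
  have "\<Gamma>0 0 = \<gamma> 0 0" using \<Gamma>0(2)[of 0 0] len[of 0] by simp
  moreover have "\<Gamma>0 P = \<gamma> 0 0"
    using \<Gamma>0(2)[of \<rho> "len \<rho>"] len[of \<rho>] \<gamma>[of \<rho>] by (simp add: Psum len_def cyc_succ_def)
  ultimately obtain \<Gamma> where \<Gamma>: "solves ?V \<Gamma> UNIV" "\<And>t. \<Gamma> (t + P) = \<Gamma> t" "\<And>t. t \<in> {0..P} \<Longrightarrow> \<Gamma> t = \<Gamma>0 t"
    using solves_periodic_extension[OF \<open>0 < P\<close> \<Gamma>0(1)[folded P_def]] by metis
  have \<Gamma>\<gamma>: "\<Gamma> (sum len {..<j} + s) = \<gamma> j s" if "j \<le> \<rho>" "s \<in> {0..len j}" for j s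
    using \<Gamma>(3)[of "sum len {..<j} + s"] \<Gamma>0(2)[OF that] partial[OF that(1)] that(2) by simp
  \<comment> \<open>At \<open>tf j\<close> the flight of length \<open>T j\<close> from the
    \<open>j\<close>-th face has ended in the next block. \<open>ts j\<close> is the start of the
    \<open>j\<close>-th segment, except that the start of segment 0 is counted one period
    later.\<close>
  define tf where "tf j = sum len {..<j} + T j" for j
  define ts where "ts j = (if j = 0 then P else sum len {..<j})" for j
  have in_block: "\<Gamma> ` {tf j..sum len {..<j} + len j} \<subseteq> block_set (S (?s j))" if "j \<le> \<rho>" for j
  proof
    fix w assume "w \<in> \<Gamma> ` {tf j..sum len {..<j} + len j}"
    then obtain s where s: "s \<in> {tf j..sum len {..<j} + len j}" "w = \<Gamma> s" by blast
    then have "s - sum len {..<j} \<in> {T j..T j + t j}" by (auto simp: tf_def len_def)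
    moreover have "\<Gamma> s = \<gamma> j (s - sum len {..<j})"
      using \<Gamma>\<gamma>[OF that, of "s - sum len {..<j}"] s(1) Tpos[OF that] by (simp add: tf_def)
    ultimately show "w \<in> block_set (S (?s j))" using \<gamma>[OF that] s(2) by blast
  qed
  have start: "\<Gamma> (sum len {..<j}) = \<gamma> j 0" if "j \<le> \<rho>" for j
    using \<Gamma>\<gamma>[OF that, of 0] len[OF that] by simp
  \<comment> \<open>In a block \<open>q * g\<close> is positive, so for positive \<epsilon> the slow
    component of the field does not vanish at \<open>\<Gamma> (tf 0)\<close> and the orbit is not an
    equilibrium.\<close>
  have nonconst: "\<exists>t. \<Gamma> t \<noteq> \<Gamma> 0"
  proof (rule ccontr)
    assume "\<not> ?thesis"
    then have "\<Gamma> = (\<lambda>_. \<Gamma> 0)" by auto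
    then have "(\<Gamma> has_vector_derivative 0) (at (tf 0))" by (metis has_vector_derivative_const)
    moreover have "(\<Gamma> has_vector_derivative ?V (\<Gamma> (tf 0))) (at (tf 0))" using \<Gamma>(1) by (simp add: solves_def)
    ultimately have zero: "?V (\<Gamma> (tf 0)) = 0" using vector_derivative_unique_at by blast
    have "\<Gamma> (tf 0) \<in> block_set (S (?s 0))"
      using in_block[of 0] len[of 0] \<gamma>[of 0] by (auto simp: tf_def len_def)
    moreover obtain x y where xy: "\<Gamma> (tf 0) = (x, y)" by force
    ultimately have "0 < q (?s 0) * g x y \<epsilon>"
      using td[OF cyc_pred_succ(3)[of 0]] by (simp add: target_data_def)
    then show False using zero eps by (simp add: xy fs_field_def zero_prod_def)
  qed
  show ?thesis
  proof (intro exI conjI allI impI)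
    show "periodic_orbit ?V \<Gamma> P" using \<Gamma>(1,2) \<open>0 < P\<close> nonconst by (simp add: periodic_orbit_def)
    show "0 < tf 0" using Tpos[of 0] by (simp add: tf_def)
    show "tf j < ts (j + 1)" "ts (j + 1) < tf (j + 1)" if "j < \<rho>" for j
      using \<gamma>[of j] Tpos[of "j + 1"] that by (simp_all add: tf_def ts_def len_def)
    show "tf \<rho> < ts 0" using \<gamma>[of \<rho>] by (simp add: tf_def ts_def Psum len_def)
    show "ts 0 = P" by (simp add: ts_def)
    show "\<Gamma> P = \<Gamma> 0" using \<Gamma>(2)[of 0] by simp
    show "\<Gamma> 0 \<in> h_set (F 0)" using start[of 0] start_in[of 0] by simp
    show "\<Gamma> ` {tf j..ts (j + 1)} \<subseteq> block_set (S (j + 1))" if "j < \<rho>" for j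
      using in_block[of j] that by (simp add: ts_def cyc_succ_def)
    show "\<Gamma> (ts (j + 1)) \<in> h_set (F (j + 1))" if "j < \<rho>" for j
      using start[of "j + 1"] start_in[of "j + 1"] that by (simp add: ts_def)
    show "\<Gamma> ` {tf \<rho>..P} \<subseteq> block_set (S 0)" using in_block[of \<rho>] by (simp add: Psum cyc_succ_def)
  qed
qed

end

section \<open>Singular values\<close>

lemma inner_transpose_mult:
  fixes M :: "real^'c^'r"
  shows "v \<bullet> ((transpose M ** M) *v w) = (M *v v) \<bullet> (M *v w)"
  proof -
  have "v \<bullet> ((M *v w) v* M) = ((M *v w) v* M) \<bullet> v" by (rule inner_commute)
  also have "\<dots> = (M *v v) \<bullet> (M *v w)" unfolding dot_lmul_matrix by (rule inner_commute)
  finally show ?thesis by (simp add: matrix_vector_mul_assoc[symmetric])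
qed

lemma norm_add_scaleR_square:
  fixes a b :: "'a::real_inner"
  shows "(norm (a + s *\<^sub>R b))\<^sup>2 = (norm a)\<^sup>2 + 2 * s * (b \<bullet> a) + s\<^sup>2 * (norm b)\<^sup>2"
  unfolding power2_norm_eq_inner
  by (simp add: inner_add_left inner_add_right inner_commute power2_eq_square algebra_simps)

text \<open>The first-order condition at the minimum \<open>s = 0\<close> of a quadratic: at
  \<open>s = - b / k\<close>, with \<open>k\<close> positive and above \<open>c\<close>, the value
  would be negative.\<close>

lemma linear_coefficient_zero:
  fixes b c :: real
  assumes "\<And>s. 0 \<le> 2 * s * b + s\<^sup>2 * c"
  shows "b = 0"
proof (rule ccontr)
  assume "b \<noteq> 0"
  define k where "k = \<bar>c\<bar> + 1"
  have k: "k > 0" "c \<le> k" by (auto simp: k_def)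
  have "0 \<le> 2 * (- b / k) * b + (- b / k)\<^sup>2 * c" by (rule assms)
  also have "(- b / k)\<^sup>2 * c \<le> (- b / k)\<^sup>2 * k" using k by (intro mult_left_mono) auto
  also have "2 * (- b / k) * b + (- b / k)\<^sup>2 * k = - (b\<^sup>2 / k)"
    using k by (simp add: power2_eq_square field_simps)
  finally have "b\<^sup>2 / k \<le> 0" by simp
  moreover have "b\<^sup>2 / k > 0" using \<open>b \<noteq> 0\<close> k by simp
  ultimately show False by simp
qed

text \<open>\<open>Max\<close> is informative on finite sets only. Eigenvectors of the symmetric
  matrix for distinct eigenvalues are orthogonal, hence independent, so there are finitely many
  eigenvalues.\<close>

lemma finite_eigenvalues_gram:
  fixes M :: "real^'c^'r"
  shows "finite {\<mu>. \<exists>v. v \<noteq> 0 \<and> (transpose M ** M) *v v = \<mu> *\<^sub>R v}" (is "finite ?A")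
proof -
  let ?G = "transpose M ** M"
  have "\<forall>\<mu>\<in>?A. \<exists>v. v \<noteq> 0 \<and> ?G *v v = \<mu> *\<^sub>R v" by blast
  from bchoice[OF this] obtain v where "\<forall>\<mu>\<in>?A. v \<mu> \<noteq> 0 \<and> ?G *v v \<mu> = \<mu> *\<^sub>R v \<mu>" ..
  note v = bspec[OF this]
  have sym: "x \<bullet> (?G *v y) = y \<bullet> (?G *v x)" for x y by (simp add: inner_transpose_mult inner_commute)
  have orth: "v s \<bullet> v t = 0" if "s \<in> ?A" "t \<in> ?A" "s \<noteq> t" for s t
  proof -
    have "t * (v s \<bullet> v t) = s * (v s \<bullet> v t)"
      using sym[of "v s" "v t"] v[OF that(1)] v[OF that(2)] by (simp add: inner_commute)
    then show ?thesis using that(3) by simp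
  qed
  have "inj_on v ?A"
  proof (rule inj_onI, rule ccontr)
    fix s t assume st: "s \<in> ?A" "t \<in> ?A" "v s = v t" "s \<noteq> t"
    then have "v s \<bullet> v s = 0" using orth[of s t] by simp
    then show False using v[OF st(1)] by simp
  qed
  moreover have "independent (v ` ?A)"
  proof (rule pairwise_orthogonal_independent)
    show "pairwise orthogonal (v ` ?A)"
      unfolding pairwise_image by (rule pairwiseI) (simp only: orthogonal_def orth simp_thms)
    show "0 \<notin> v ` ?A"
    proof (rule notI, erule imageE)
      fix \<mu> assume "0 = v \<mu>" "\<mu> \<in> ?A"
      from v[OF this(2)] have "v \<mu> \<noteq> 0" ..
      with \<open>0 = v \<mu>\<close> show False by simp
    qed
  qed
  then have "finite (v ` ?A)" by (rule independent_bound[THEN conjunct1])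
  ultimately show ?thesis by (rule finite_imageD[rotated])
qed

text \<open>A maximiser of \<open>norm (M *v v)\<close> on the unit sphere is an eigenvector of the
  Gram matrix, so the largest singular value is the operator norm.\<close>

lemma max_singular_value:
  fixes M :: "real^'c^'r"
  shows norm_le_max_singular_value: "norm (M *v v) \<le> max_singular_value M * norm v"
    and max_singular_value_nonneg: "0 \<le> max_singular_value M"
    and max_singular_value_le: "(\<And>v. norm (M *v v) \<le> C * norm v) \<Longrightarrow> max_singular_value M \<le> C"
proof -
  let ?G = "transpose M ** M"
  let ?E = "{sqrt \<mu> | \<mu>. \<exists>v. v \<noteq> 0 \<and> ?G *v v = \<mu> *\<^sub>R v}"
  have "?E = sqrt ` {\<mu>. \<exists>v. v \<noteq> 0 \<and> ?G *v v = \<mu> *\<^sub>R v}" by auto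
  then have fin: "finite ?E" using finite_eigenvalues_gram[of M] by simp
  have "compact (sphere 0 1 :: (real^'c) set)" by simp
  moreover have "sphere 0 1 \<noteq> ({} :: (real^'c) set)" by simp
  moreover have "continuous_on (sphere 0 1) (\<lambda>v. (norm (M *v v))\<^sup>2)"
    by (intro continuous_intros bounded_linear.continuous_on[OF matrix_vector_mul_bounded_linear])
  ultimately obtain v0 where v0: "v0 \<in> sphere 0 1" "\<And>v. v \<in> sphere 0 1 \<Longrightarrow> (norm (M *v v))\<^sup>2 \<le> (norm (M *v v0))\<^sup>2"
    using continuous_attains_sup[of "sphere 0 1 :: (real^'c) set" "\<lambda>v. (norm (M *v v))\<^sup>2"] by blast
  define \<mu> where "\<mu> = (norm (M *v v0))\<^sup>2"
  have le: "(norm (M *v v))\<^sup>2 \<le> \<mu> * (norm v)\<^sup>2" for v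
  proof (cases "v = 0")
    case False
    have "(norm (M *v ((1 / norm v) *\<^sub>R v)))\<^sup>2 \<le> \<mu>"
      unfolding \<mu>_def using False by (intro v0(2)) simp
    then show ?thesis using False
      by (simp add: matrix_vector_mult_scaleR power_mult_distrib power_divide field_simps)
  qed simp
  \<comment> \<open>The form \<open>\<mu> * (norm v)\<^sup>2 - (norm (M *v v))\<^sup>2\<close> is
    nonnegative and vanishes at \<open>v0\<close>, so its derivative there is zero in every
    direction \<open>w\<close>.\<close>
  have "?G *v v0 = \<mu> *\<^sub>R v0"
  proof -
    have "w \<bullet> (\<mu> *\<^sub>R v0 - ?G *v v0) = 0" for w
    proof (rule linear_coefficient_zero)
      fix s :: real
      have 1: "(norm (M *v (v0 + s *\<^sub>R w)))\<^sup>2 = \<mu> + 2 * s * (w \<bullet> (?G *v v0)) + s\<^sup>2 * (norm (M *v w))\<^sup>2"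
        unfolding \<mu>_def inner_transpose_mult matrix_vector_right_distrib matrix_vector_mult_scaleR
        by (rule norm_add_scaleR_square)
      have "norm v0 = 1" using v0(1) by simp
      then have 2: "\<mu> * (norm (v0 + s *\<^sub>R w))\<^sup>2 = \<mu> + 2 * s * (w \<bullet> (\<mu> *\<^sub>R v0)) + s\<^sup>2 * (\<mu> * (norm w)\<^sup>2)"
        unfolding norm_add_scaleR_square by (simp add: algebra_simps)
      show "0 \<le> 2 * s * (w \<bullet> (\<mu> *\<^sub>R v0 - ?G *v v0)) + s\<^sup>2 * (\<mu> * (norm w)\<^sup>2 - (norm (M *v w))\<^sup>2)"
        using le[of "v0 + s *\<^sub>R w"] unfolding 1 2 by (simp add: inner_diff_right algebra_simps)
    qed
    from this[of "\<mu> *\<^sub>R v0 - ?G *v v0"] show ?thesis by simp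
  qed
  moreover have "v0 \<noteq> 0" using v0(1) by auto
  ultimately have "\<exists>v. v \<noteq> 0 \<and> ?G *v v = \<mu> *\<^sub>R v" by blast
  then have "sqrt \<mu> \<in> ?E" by (intro CollectI exI[of _ \<mu>] conjI refl)
  then have max: "sqrt \<mu> \<le> max_singular_value M" unfolding max_singular_value_def by (rule Max_ge[OF fin])
  have "norm (M *v v) \<le> sqrt \<mu> * norm v"
    using real_sqrt_le_mono[OF le[of v]] by (simp add: real_sqrt_mult)
  also have "\<dots> \<le> max_singular_value M * norm v" by (rule mult_right_mono[OF max norm_ge_zero])
  finally show "norm (M *v v) \<le> max_singular_value M * norm v" .
  show "0 \<le> max_singular_value M" by (rule order_trans[OF real_sqrt_ge_zero max]) (simp add: \<mu>_def)
  show "max_singular_value M \<le> C" if C: "\<And>v. norm (M *v v) \<le> C * norm v"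
    unfolding max_singular_value_def
  proof (rule Max.boundedI[OF fin])
    show "?E \<noteq> {}" using \<open>sqrt \<mu> \<in> ?E\<close> by blast
    fix s assume "s \<in> ?E"
    then obtain \<nu> v where v: "s = sqrt \<nu>" "v \<noteq> 0" "?G *v v = \<nu> *\<^sub>R v" by blast
    have "\<nu> * (norm v)\<^sup>2 = (norm (M *v v))\<^sup>2"
      using inner_transpose_mult[of v M v] v(3) by (simp add: power2_norm_eq_inner)
    also have "\<dots> \<le> (C * norm v)\<^sup>2" by (intro power_mono C norm_ge_zero)
    finally have "\<nu> \<le> C\<^sup>2" using v(2) by (simp add: power_mult_distrib)
    moreover have "0 \<le> C" using C[of v] v(2) norm_ge_zero[of "M *v v"]
      by (metis mult_less_cancel_right_disj not_less mult_zero_left norm_eq_zero order_trans zero_less_norm_iff)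
    ultimately show "s \<le> C" unfolding v(1) by (rule real_le_lsqrt[rotated]) 
  qed
qed

text \<open>A crude bound, whose purpose is to make the suprema in the cone conditions
  finite.\<close>

lemma norm_matrix_vector_le_entries:
  fixes M :: "real^'c^'r"
  assumes "\<And>i j. \<bar>M $ i $ j\<bar> \<le> K i j"
  shows "norm (M *v v) \<le> (\<Sum>i\<in>UNIV. \<Sum>j\<in>UNIV. K i j) * norm v"
proof -
  have "norm (M *v v) \<le> (\<Sum>i\<in>UNIV. \<bar>(M *v v) $ i\<bar>)" by (rule norm_le_l1_cart)
  also have "\<dots> \<le> (\<Sum>i\<in>UNIV. \<Sum>j\<in>UNIV. K i j * norm v)"
  proof (rule sum_mono)
    fix i
    have "\<bar>(M *v v) $ i\<bar> \<le> (\<Sum>j\<in>UNIV. \<bar>M $ i $ j * v $ j\<bar>)"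
      by (simp add: matrix_vector_mult_def sum_abs)
    also have "\<dots> \<le> (\<Sum>j\<in>UNIV. K i j * norm v)"
    proof (rule sum_mono)
      fix j
      have "0 \<le> K i j" using assms[of i j] by (metis abs_ge_zero order_trans)
      then show "\<bar>M $ i $ j * v $ j\<bar> \<le> K i j * norm v"
        unfolding abs_mult by (intro mult_mono assms component_le_norm_cart) auto
    qed
    finally show "\<bar>(M *v v) $ i\<bar> \<le> (\<Sum>j\<in>UNIV. K i j * norm v)" .
  qed
  finally show ?thesis by (simp add: sum_distrib_right)
qed

lemma sum_var:
  fixes h :: "'n::finite var \<Rightarrow> 'a::comm_monoid_add"
  shows "(\<Sum>w\<in>UNIV. h w) = (\<Sum>i\<in>UNIV. h (Fast i)) + (h Slow + h Eta)"
proof -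
  have U: "(UNIV :: 'n var set) = range Fast \<union> {Slow, Eta}" by (auto intro: var.exhaust)
  have "inj (Fast :: 'n \<Rightarrow> 'n var)" by (rule injI) simp
  then show ?thesis unfolding U by (subst sum.union_disjoint) (auto simp: sum.reindex)
qed

definition var_vec :: "'n set \<Rightarrow> real^'n \<Rightarrow> real^('n::finite var)" where
  "var_vec S v = (\<chi> w. case w of Fast i \<Rightarrow> if i \<in> S then v $ i else 0 | _ \<Rightarrow> 0)"

lemma norm_var_vec: "norm (var_vec S v) = norm (coord_proj S v)"
proof -
  have "(norm (var_vec S v))\<^sup>2 = (norm (coord_proj S v))\<^sup>2"
    by (simp add: power2_norm_eq_inner inner_vec_def sum_var var_vec_def coord_proj_def)
  then show ?thesis by (simp add: power2_eq_iff_nonneg)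
qed

lemma coord_proj_linear: "linear (coord_proj S)"
  by (rule linearI) (auto simp: coord_proj_def vec_eq_iff)

lemma coord_proj_inner: "coord_proj S v \<bullet> w = coord_proj S v \<bullet> coord_proj S w"
  unfolding inner_vec_def by (rule sum.cong) (simp_all add: coord_proj_def)

lemma norm_le_coord_proj: "norm v \<le> norm (coord_proj S v) + norm (coord_proj (- S) v)"
proof -
  have "v = coord_proj S v + coord_proj (- S) v" by (auto simp: coord_proj_def vec_eq_iff)
  then show ?thesis by (metis norm_triangle_ineq)
qed

lemma norm_coord_proj_le: "norm (coord_proj S v) \<le> norm v"
  by (rule norm_le_componentwise_cart) (simp add: coord_proj_def)

section \<open>The cone estimate\<close>

context fs_block_at
begin

abbreviation LF :: "(real^'n) \<times> real \<times> real \<Rightarrow> (real^'n) \<times> real \<times> real \<Rightarrow> real^'n" where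
  "LF p \<equiv> frechet_derivative (local_F f \<epsilon>0 D) (at p)"

lemma local_dom_eq: "local_dom D = block_box D \<times> {b_ylo D..b_yhi D} \<times> {0..1}"
  by (auto simp: local_dom_def mem_block_set_iff lcoord_def lbox_def)

lemma local_dom_compact: "compact (local_dom D)"
proof -
  have "block_box D = cbox (b_lo D) (b_hi D)" by (auto simp: block_box_def mem_box_cart)
  then show ?thesis unfolding local_dom_eq by (simp add: compact_Times)
qed

lemma local_F_derivative:
  assumes "p \<in> local_dom D"
  shows "(local_F f \<epsilon>0 D has_derivative LF p) (at p)"
    and "LF p (v, s, t) = matrix_inv (b_frame D) *v
      (frechet_derivative (\<lambda>(x, y, \<epsilon>). f x y \<epsilon>) (at (fast_pos D (fst p), fst (snd p), snd (snd p) * \<epsilon>0))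
        (b_frame D *v v, s, t * \<epsilon>0)) - (\<chi> i. b_eig D $ i * v $ i)"
proof -
  let ?h = "\<lambda>(x, y, \<epsilon>). f x y \<epsilon>" and ?A = "\<lambda>p. (fast_pos D (fst p), fst (snd p), snd (snd p) * \<epsilon>0)"
  let ?A' = "\<lambda>v :: (real^'n) \<times> real \<times> real. (b_frame D *v fst v, fst (snd v), snd (snd v) * \<epsilon>0)"
  let ?L = "\<lambda>v. matrix_inv (b_frame D) *v (frechet_derivative ?h (at (?A p)) (?A' v)) - (\<chi> i. b_eig D $ i * fst v $ i)"
  have "snd (snd p) * \<epsilon>0 \<in> {0..\<epsilon>0}" using assms \<epsilon>0
    by (auto simp: local_dom_eq mult_le_cancel_right1)
  then have "?A p \<in> UNIV \<times> UNIV \<times> I" using I by auto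
  then have dh: "(?h has_derivative frechet_derivative ?h (at (?A p))) (at (?A p))"
    by (rule Ck_on_imp_differentiable[OF Ck_f r])
  have "((\<lambda>p. b_frame D *v fst p) has_derivative (\<lambda>v. b_frame D *v fst v)) (at p)"
    by (rule bounded_linear.has_derivative[OF matrix_vector_mul_bounded_linear has_derivative_fst[OF has_derivative_ident]])
  then have "(?A has_derivative ?A') (at p)"
    unfolding fast_pos_def by (auto intro!: derivative_eq_intros)
  from has_derivative_compose[OF this dh]
  have "((\<lambda>p. ?h (?A p)) has_derivative (\<lambda>v. frechet_derivative ?h (at (?A p)) (?A' v))) (at p)" .
  from bounded_linear.has_derivative[OF matrix_vector_mul_bounded_linear this]
  have 1: "((\<lambda>p. matrix_inv (b_frame D) *v ?h (?A p)) has_derivative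
      (\<lambda>v. matrix_inv (b_frame D) *v frechet_derivative ?h (at (?A p)) (?A' v))) (at p)" .
  have "bounded_linear (\<lambda>v :: (real^'n) \<times> real \<times> real. \<chi> i. b_eig D $ i * fst v $ i)"
    by (rule linear_conv_bounded_linear[THEN iffD1], rule linearI) (auto simp: vec_eq_iff algebra_simps)
  then have 2: "((\<lambda>p. \<chi> i. b_eig D $ i * fst p $ i) has_derivative (\<lambda>v. \<chi> i. b_eig D $ i * fst v $ i)) (at p)"
    by (rule bounded_linear_imp_has_derivative)
  have eq: "local_F f \<epsilon>0 D = (\<lambda>p. matrix_inv (b_frame D) *v ?h (?A p) - (\<chi> i. b_eig D $ i * fst p $ i))"
    by (auto simp: local_F_def remainder_def fun_eq_iff)
  have main: "(local_F f \<epsilon>0 D has_derivative ?L) (at p)"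
    unfolding eq by (rule has_derivative_diff[OF 1 2])
  then have LF: "LF p = ?L" by (rule frechet_derivative_at[symmetric])
  show "(local_F f \<epsilon>0 D has_derivative LF p) (at p)" unfolding LF by (rule main)
  show "LF p (v, s, t) = matrix_inv (b_frame D) *v
      (frechet_derivative ?h (at (?A p)) (b_frame D *v v, s, t * \<epsilon>0)) - (\<chi> i. b_eig D $ i * v $ i)"
    by (simp add: LF)
qed

lemma continuous_on_LF: "continuous_on (local_dom D) (\<lambda>p. LF p v)"
proof -
  obtain a s t where v: "v = (a, s, t)" by (metis surj_pair)
  let ?h = "\<lambda>(x, y, \<epsilon>). f x y \<epsilon>" and ?A = "\<lambda>p. (fast_pos D (fst p), fst (snd p), snd (snd p) * \<epsilon>0)"
  have cA: "continuous_on (local_dom D) ?A"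
    by (intro continuous_on_Pair continuous_on_fast_pos continuous_on_fst continuous_on_snd continuous_on_id
        continuous_on_mult_right)
  have "?A ` local_dom D \<subseteq> UNIV \<times> UNIV \<times> I"
  proof
    fix x assume "x \<in> ?A ` local_dom D"
    then obtain p where p: "p \<in> local_dom D" "x = ?A p" by blast
    then have "snd (snd p) * \<epsilon>0 \<in> {0..\<epsilon>0}" using \<epsilon>0 by (auto simp: local_dom_eq mult_le_cancel_right1)
    then show "x \<in> UNIV \<times> UNIV \<times> I" using I p(2) by auto
  qed
  from continuous_on_compose2[OF Ck_on_imp_continuous_derivative[OF Ck_f r] cA this]
  have "continuous_on (local_dom D) (\<lambda>p. frechet_derivative ?h (at (?A p)) (b_frame D *v a, s, t * \<epsilon>0))" .
  then have "continuous_on (local_dom D) (\<lambda>p. matrix_inv (b_frame D) *v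
      (frechet_derivative ?h (at (?A p)) (b_frame D *v a, s, t * \<epsilon>0)) - (\<chi> i. b_eig D $ i * a $ i))"
    by (intro continuous_on_diff continuous_on_const bounded_linear.continuous_on[OF matrix_vector_mul_bounded_linear])
  then show ?thesis unfolding v by (rule continuous_on_eq) (simp add: local_F_derivative(2))
qed

text \<open>The supremum \<open>sup_F\<close> controls the single Jacobians only if it is taken over
  a set bounded above; this follows from continuity of the derivative on the compact
  \<open>local_dom D\<close>.\<close>

lemma sup_F_bound:
  assumes p: "p \<in> local_dom D"
  shows "norm (jac_F f \<epsilon>0 D R C p *v x) \<le> sup_F f \<epsilon>0 D R C * norm x" and "0 \<le> sup_F f \<epsilon>0 D R C"
proof -
  have "\<exists>K. \<forall>p\<in>local_dom D. \<bar>LF p (var_dir w) $ i\<bar> \<le> K" for w i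
  proof -
    have "compact ((\<lambda>p. LF p (var_dir w)) ` local_dom D)"
      by (rule compact_continuous_image[OF continuous_on_LF local_dom_compact])
    then have "bounded ((\<lambda>p. LF p (var_dir w)) ` local_dom D)" by (rule compact_imp_bounded)
    then obtain K where "\<And>p. p \<in> local_dom D \<Longrightarrow> norm (LF p (var_dir w)) \<le> K" by (auto simp: bounded_iff)
    then show ?thesis using component_le_norm_cart order_trans by blast
  qed
  then obtain K where K: "\<And>w i p. p \<in> local_dom D \<Longrightarrow> \<bar>LF p (var_dir w) $ i\<bar> \<le> K w i" by metis
  have "bdd_above ((\<lambda>p. max_singular_value (jac_F f \<epsilon>0 D R C p)) ` local_dom D)"
  proof (rule bdd_aboveI2)
    fix q assume q: "q \<in> local_dom D"
    show "max_singular_value (jac_F f \<epsilon>0 D R C q) \<le> (\<Sum>i\<in>UNIV. \<Sum>w\<in>UNIV. K w i)"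
    proof (rule max_singular_value_le, rule norm_matrix_vector_le_entries)
      fix i w
      have "0 \<le> K w i" using K[OF q, of w i] by (metis abs_ge_zero order_trans)
      then show "\<bar>jac_F f \<epsilon>0 D R C q $ i $ w\<bar> \<le> K w i" using K[OF q, of w i] by (simp add: jac_F_def)
    qed
  qed
  from cSUP_upper[OF p this] have le: "max_singular_value (jac_F f \<epsilon>0 D R C p) \<le> sup_F f \<epsilon>0 D R C"
    by (simp add: sup_F_def)
  then show "0 \<le> sup_F f \<epsilon>0 D R C" using max_singular_value_nonneg order_trans by blast
  have "norm (jac_F f \<epsilon>0 D R C p *v x) \<le> max_singular_value (jac_F f \<epsilon>0 D R C p) * norm x"
    by (rule norm_le_max_singular_value)
  also have "\<dots> \<le> sup_F f \<epsilon>0 D R C * norm x" by (rule mult_right_mono[OF le norm_ge_zero])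
  finally show "norm (jac_F f \<epsilon>0 D R C p *v x) \<le> sup_F f \<epsilon>0 D R C * norm x" .
qed

text \<open>The complementary block also contains the columns \<open>Slow\<close> and
  \<open>Eta\<close>, but a fast direction has no entries there, so this block acts only on the part
  of \<open>v\<close> outside \<open>S\<close>.\<close>

lemma LF_split:
  assumes p: "p \<in> local_dom D"
  shows "norm (coord_proj R (LF p (v, 0, 0))) \<le> sup_F f \<epsilon>0 D R (Fast ` S) * norm (coord_proj S v)
    + sup_F f \<epsilon>0 D R (- (Fast ` S)) * norm (coord_proj (- S) v)"
proof -
  have lin: "linear (LF p)" using local_F_derivative(1)[OF p] by (rule has_derivative_linear)
  have "(v, 0 :: real, 0 :: real) = (\<Sum>k\<in>UNIV. v $ k *\<^sub>R (axis k 1, 0, 0))"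
  proof -
    have "(\<Sum>k\<in>UNIV. v $ k *\<^sub>R (axis k (1::real), 0 :: real, 0 :: real)) = (\<Sum>k\<in>UNIV. v $ k *\<^sub>R axis k 1, 0, 0)"
      by (simp add: sum_prod)
    then show ?thesis using basis_expansion[of v] by (simp add: scalar_mult_eq_scaleR)
  qed
  then have "LF p (v, 0, 0) = (\<Sum>k\<in>UNIV. v $ k *\<^sub>R LF p (axis k 1, 0, 0))"
    by (simp only: linear_sum[OF lin] linear_scale[OF lin])
  then have exp: "LF p (v, 0, 0) $ i = (\<Sum>k\<in>UNIV. v $ k * LF p (axis k 1, 0, 0) $ i)" for i
    by simp
  have "coord_proj R (LF p (v, 0, 0)) = jac_F f \<epsilon>0 D R (Fast ` S) p *v var_vec S v
      + jac_F f \<epsilon>0 D R (- (Fast ` S)) p *v var_vec (- S) v"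
  proof (simp only: vec_eq_iff, rule allI)
    fix i
    have mem: "Fast k \<in> Fast ` S \<longleftrightarrow> k \<in> S" for k by auto
    show "coord_proj R (LF p (v, 0, 0)) $ i = (jac_F f \<epsilon>0 D R (Fast ` S) p *v var_vec S v
      + jac_F f \<epsilon>0 D R (- (Fast ` S)) p *v var_vec (- S) v) $ i"
    proof (cases "i \<in> R")
      case True
      have "(jac_F f \<epsilon>0 D R (Fast ` S) p *v var_vec S v + jac_F f \<epsilon>0 D R (- (Fast ` S)) p *v var_vec (- S) v) $ i
        = (\<Sum>k\<in>UNIV. (if k \<in> S then LF p (axis k 1, 0, 0) $ i * v $ k else 0))
          + (\<Sum>k\<in>UNIV. (if k \<notin> S then LF p (axis k 1, 0, 0) $ i * v $ k else 0))"
        using True by (simp add: matrix_vector_mult_def sum_var jac_F_def var_vec_def mem if_distrib cong: if_cong)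
      also have "\<dots> = (\<Sum>k\<in>UNIV. v $ k * LF p (axis k 1, 0, 0) $ i)"
        unfolding sum.distrib[symmetric] by (rule sum.cong) auto
      finally show ?thesis using True exp[of i] by (simp add: coord_proj_def)
    next
      case False
      then show ?thesis by (simp add: matrix_vector_mult_def jac_F_def coord_proj_def)
    qed
  qed
  also have "norm \<dots> \<le> norm (jac_F f \<epsilon>0 D R (Fast ` S) p *v var_vec S v)
      + norm (jac_F f \<epsilon>0 D R (- (Fast ` S)) p *v var_vec (- S) v)" by (rule norm_triangle_ineq)
  also have "\<dots> \<le> sup_F f \<epsilon>0 D R (Fast ` S) * norm (coord_proj S v)
      + sup_F f \<epsilon>0 D R (- (Fast ` S)) * norm (coord_proj (- S) v)"
    using sup_F_bound(1)[OF p, of R "Fast ` S" "var_vec S v"] sup_F_bound(1)[OF p, of R "- (Fast ` S)" "var_vec (- S) v"]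
    by (simp add: norm_var_vec)
  finally show ?thesis .
qed

text \<open>The derivative of the fast field at \<epsilon> = 0, which is \<eta> = 0 in the extended
  system, as diagonal part plus derivative of the remainder; see
  \<open>G_derivative\<close>.\<close>

definition DG :: "(real^'n) \<times> real \<Rightarrow> (real^'n) \<times> real \<Rightarrow> real^'n" where
  "DG w d = (\<chi> i. b_eig D $ i * fst d $ i) + LF (fst w, snd w, 0) (fst d, snd d, 0)"

text \<open>The diagonal part expands the unstable component by at least \<open>lA\<close> and
  contracts the stable one by at least \<open>\<bar>mB\<bar>\<close>; Cauchy--Schwarz bounds what
  the remainder can take away by \<open>A1\<close>, \<open>A2\<close> and \<open>B1\<close>,
  \<open>B2\<close>. With \<open>\<alpha> = lA - A1\<close>, \<open>A = A2\<close> and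
  \<open>\<beta> = \<bar>mB\<bar> - B1\<close>, \<open>B = B2\<close>, the inequalities
  \<open>A < \<alpha>\<close> and \<open>B < \<beta>\<close> are the first inequalities of the two
  cone conditions.\<close>

lemma cone_estimate:
  assumes sb: "spectral_bounds D lA mB"
    and uc: "unstable_cone_condition f g \<epsilon>0 D lA mB" and sc: "stable_cone_condition f g \<epsilon>0 D lA mB"
  shows "\<exists>\<alpha> A \<beta> B. 0 \<le> A \<and> A < \<alpha> \<and> 0 \<le> B \<and> B < \<beta> \<and> (\<forall>w\<in>lbox D. \<forall>v.
    let a = norm (coord_proj (b_unst D) v); b = norm (coord_proj (- b_unst D) v) in
      \<alpha> * a\<^sup>2 - A * a * b \<le> coord_proj (b_unst D) v \<bullet> DG w (v, 0) \<and>
      coord_proj (- b_unst D) v \<bullet> DG w (v, 0) \<le> B * a * b - \<beta> * b\<^sup>2)"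
proof -
  let ?U = "b_unst D"
  define A1 A2 B1 B2 where "A1 = sup_F f \<epsilon>0 D ?U (Fast ` ?U)" and "A2 = sup_F f \<epsilon>0 D ?U (- (Fast ` ?U))"
    and "B1 = sup_F f \<epsilon>0 D (- ?U) (Fast ` (- ?U))" and "B2 = sup_F f \<epsilon>0 D (- ?U) (- (Fast ` (- ?U)))"
  have c: "A1 + A2 < lA" "B1 + B2 < \<bar>mB\<bar>"
    using uc sc unfolding unstable_cone_condition_def stable_cone_condition_def Let_def A1_def A2_def B1_def B2_def
    by linarith+
  have s: "0 < lA" "\<And>i. i \<in> ?U \<Longrightarrow> lA < b_eig D $ i" "mB < 0" "\<And>i. i \<notin> ?U \<Longrightarrow> b_eig D $ i < mB"
    using sb by (auto simp: spectral_bounds_def)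
  have dom: "(fst w, snd w, 0) \<in> local_dom D" if "w \<in> lbox D" for w
    using that by (auto simp: local_dom_eq lbox_def)
  obtain w0 where "w0 \<in> lbox D" using lclamp_in by blast
  from sup_F_bound(2)[OF dom[OF this]] have nn: "0 \<le> A2" "0 \<le> B2" by (auto simp: A2_def B2_def)
  have "\<forall>w\<in>lbox D. \<forall>v. let a = norm (coord_proj ?U v); b = norm (coord_proj (- ?U) v) in
      (lA - A1) * a\<^sup>2 - A2 * a * b \<le> coord_proj ?U v \<bullet> DG w (v, 0) \<and>
      coord_proj (- ?U) v \<bullet> DG w (v, 0) \<le> B2 * a * b - (\<bar>mB\<bar> - B1) * b\<^sup>2"
  proof (intro ballI allI, unfold Let_def)
    fix w v assume w: "w \<in> lbox D"
    let ?a = "norm (coord_proj ?U v)" and ?b = "norm (coord_proj (- ?U) v)"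
    let ?E = "\<chi> i. b_eig D $ i * v $ i" and ?R = "LF (fst w, snd w, 0) (v, 0, 0)"
    have sq: "(norm (coord_proj S v))\<^sup>2 = (\<Sum>i\<in>UNIV. if i \<in> S then (v $ i)\<^sup>2 else 0)" for S
      unfolding power2_norm_eq_inner inner_vec_def by (rule sum.cong) (auto simp: coord_proj_def power2_eq_square)
    have in_E: "coord_proj S v \<bullet> ?E = (\<Sum>i\<in>UNIV. if i \<in> S then b_eig D $ i * (v $ i)\<^sup>2 else 0)" for S
      unfolding inner_vec_def by (rule sum.cong) (auto simp: coord_proj_def power2_eq_square)
    have 1: "lA * ?a\<^sup>2 \<le> coord_proj ?U v \<bullet> ?E"
      unfolding sq in_E sum_distrib_left by (rule sum_mono) (auto intro!: mult_right_mono[OF less_imp_le[OF s(2)]])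
    have 2: "coord_proj (- ?U) v \<bullet> ?E \<le> mB * ?b\<^sup>2"
      unfolding sq in_E sum_distrib_left by (rule sum_mono) (auto intro!: mult_right_mono[OF less_imp_le[OF s(4)]])
    have "\<bar>coord_proj S v \<bullet> ?R\<bar> \<le> norm (coord_proj S v) * norm (coord_proj S ?R)" for S
      unfolding coord_proj_inner[of S v ?R] by (rule Cauchy_Schwarz_ineq2)
    note cs = this
    have 3: "\<bar>coord_proj ?U v \<bullet> ?R\<bar> \<le> ?a * (A1 * ?a + A2 * ?b)"
      using cs[of ?U] mult_left_mono[OF LF_split[OF dom[OF w], of ?U v ?U] norm_ge_zero[of "coord_proj ?U v"]]
      unfolding A1_def A2_def by linarith
    have 4: "\<bar>coord_proj (- ?U) v \<bullet> ?R\<bar> \<le> ?b * (B1 * ?b + B2 * ?a)"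
      using cs[of "- ?U"] mult_left_mono[OF LF_split[OF dom[OF w], of "- ?U" v "- ?U"] norm_ge_zero[of "coord_proj (- ?U) v"]]
      unfolding B1_def B2_def double_complement by linarith
    have DGv: "DG w (v, 0) = ?E + ?R" by (simp add: DG_def)
    have "(lA - A1) * ?a\<^sup>2 - A2 * ?a * ?b = lA * ?a\<^sup>2 - ?a * (A1 * ?a + A2 * ?b)"
      by (simp add: power2_eq_square algebra_simps)
    moreover have "B2 * ?a * ?b - (\<bar>mB\<bar> - B1) * ?b\<^sup>2 = mB * ?b\<^sup>2 + ?b * (B1 * ?b + B2 * ?a)"
      using s(3) by (simp add: power2_eq_square algebra_simps)
    ultimately show "(lA - A1) * ?a\<^sup>2 - A2 * ?a * ?b \<le> coord_proj ?U v \<bullet> DG w (v, 0) \<and>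
        coord_proj (- ?U) v \<bullet> DG w (v, 0) \<le> B2 * ?a * ?b - (\<bar>mB\<bar> - B1) * ?b\<^sup>2"
      using 1 2 3 4 unfolding DGv inner_add_right by linarith
  qed
  then show ?thesis using c nn by (intro exI[of _ "lA - A1"] exI[of _ A2] exI[of _ "\<bar>mB\<bar> - B1"] exI[of _ B2]) auto
qed

end

section \<open>Normally hyperbolic curves of equilibria\<close>

text \<open>\<open>C1_differentiable_on\<close> asks for two-sided derivatives even at the ends of
  the interval. Integrating the derivative, continued by its end values, extends the curve beyond
  them.\<close>

lemma C1_extension:
  fixes h D :: "real \<Rightarrow> 'a::euclidean_space"
  assumes ab: "a < b" and der: "\<And>t. t \<in> {a..b} \<Longrightarrow> (h has_vector_derivative D t) (at t within {a..b})"
    and cont: "continuous_on {a..b} D"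
  shows "\<exists>k. k C1_differentiable_on {a..b} \<and> (\<forall>t\<in>{a..b}. k t = h t)"
proof -
  define E where "E t = D (clamp_real a b t)" for t
  have E: "continuous_on UNIV E" unfolding E_def
    by (rule continuous_on_compose2[OF cont])
      (use ab in \<open>auto simp: clamp_real_def intro!: continuous_intros\<close>)
  have ED: "E t = D t" if "t \<in> {a..b}" for t using that by (simp add: E_def clamp_real_id)
  have int: "E integrable_on {s..t}" for s t
    by (rule integrable_continuous_real[OF continuous_on_subset[OF E]]) simp
  define k where "k t = h a + (integral {a - 1..t} E - integral {a - 1..a} E)" for t
  have kder: "(k has_vector_derivative E t) (at t)" if "t \<in> {a..b}" for t
  proof -
    have "((\<lambda>u. integral {a - 1..u} E) has_vector_derivative E t) (at t within {a - 1..b + 1})"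
      by (rule integral_has_vector_derivative) (use that in \<open>auto intro: continuous_on_subset[OF E]\<close>)
    moreover have "at t within {a - 1..b + 1} = at t"
      by (rule at_within_interior) (use that in \<open>simp add: interior_atLeastAtMost_real\<close>)
    ultimately have "((\<lambda>u. integral {a - 1..u} E) has_vector_derivative E t) (at t)" by simp
    then have "((\<lambda>u. h a + (integral {a - 1..u} E - integral {a - 1..a} E)) has_vector_derivative 0 + (E t - 0)) (at t)"
      by (intro has_vector_derivative_add has_vector_derivative_diff has_vector_derivative_const)
    then show ?thesis by (simp add: k_def[abs_def])
  qed
  have "k t = h t" if "t \<in> {a..b}" for t
  proof -
    have "(E has_integral (h t - h a)) {a..t}"
    proof (rule fundamental_theorem_of_calculus)
      show "a \<le> t" using that by simp
      fix s assume s: "s \<in> {a..t}"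
      then have "s \<in> {a..b}" using that by auto
      from has_vector_derivative_within_subset[OF der[OF this], of "{a..t}"] ED[OF this]
      show "(h has_vector_derivative E s) (at s within {a..t})" using that by simp
    qed
    then have "integral {a..t} E = h t - h a" by (rule integral_unique)
    moreover have "integral {a - 1..a} E + integral {a..t} E = integral {a - 1..t} E"
      by (rule Henstock_Kurzweil_Integration.integral_combine) (use that int in auto)
    ultimately have "integral {a - 1..t} E - integral {a - 1..a} E = h t - h a" by (metis add_diff_cancel_left')
    then show ?thesis unfolding k_def by simp
  qed
  moreover have "k C1_differentiable_on {a..b}"
    unfolding C1_differentiable_on_def
    by (rule exI[of _ E]) (use kder E in \<open>auto intro: continuous_on_subset\<close>)
  ultimately show ?thesis by blast
qed

lemma poly_det: "poly (det X) l = det (\<chi> i j. poly (X $ i $ j) l)"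
  for X :: "complex poly^'n^'n"
proof -
  have "poly (of_int (sign p) :: complex poly) l = of_int (sign p)" for p :: "'n \<Rightarrow> 'n"
    by (cases "sign p = 1") (auto simp: sign_def)
  then show ?thesis by (simp add: det_def poly_sum poly_prod)
qed

lemma singular_matrix_kernel:
  fixes N :: "complex^'n^'n"
  assumes "det N = 0"
  obtains v where "v \<noteq> 0" "N *v v = 0"
  using assms invertible_det_nz[of N] matrix_left_invertible_ker[of N] invertible_left_inverse[of N] by metis

text \<open>At \<epsilon> = 0 the slow row of the Jacobian vanishes, so that row of the
  characteristic matrix is the indeterminate times a unit vector; pulling it out isolates the
  trivial eigenvalue 0.\<close>

lemma char_polynomial_zero_row:
  fixes M :: "real^('n::finite option)^('n option)"
  assumes "\<And>j. M $ None $ j = 0"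
  shows "char_polynomial M = [:0, 1:] * det (\<chi> i. if i = None then axis None 1
    else (\<chi> j. (if i = j then [:0, 1:] else 0) - [:complex_of_real (M $ i $ j):]))"
proof -
  let ?b = "\<lambda>i. \<chi> j. (if i = j then [:0, 1:] else 0) - [:complex_of_real (M $ i $ j):]"
  have "(\<chi> i j. (if i = j then [:0, 1:] else 0) - [:complex_of_real (M $ i $ j):])
      = (\<chi> i. if i = None then [:0, 1:] *s axis None 1 else ?b i)"
    by (auto simp: vec_eq_iff axis_def assms)
  then show ?thesis unfolding char_polynomial_def using det_row_mul[of None "[:0, 1:]" "\<lambda>_. axis None 1" ?b] by simp
qed

text \<open>
  For \<open>l = i \<omega>\<close> the real and imaginary parts \<open>v\<close>, \<open>w\<close> of an eigenvector satisfy
  \<open>M v = - \<omega> w\<close> and \<open>M w = \<omega> v\<close>.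
\<close>

lemma imaginary_eigenvalue_count:
  fixes M :: "real^('n::finite option)^('n option)"
  assumes M0: "\<And>j. M $ None $ j = 0"
    and no_eig: "\<And>\<omega> v w. (\<And>i. (\<Sum>k\<in>UNIV. M $ Some i $ Some k * v $ k) = - \<omega> * w $ i) \<Longrightarrow>
      (\<And>i. (\<Sum>k\<in>UNIV. M $ Some i $ Some k * w $ k) = \<omega> * v $ i) \<Longrightarrow> v = 0 \<and> (w :: real^'n) = 0"
  shows "(\<Sum>l | Re l = 0 \<and> poly (char_polynomial M) l = 0. Polynomial.order l (char_polynomial M)) = 1"
proof -
  let ?X = "\<chi> i. if i = None then axis None 1
    else (\<chi> j. (if i = j then [:0, 1:] else 0) - [:complex_of_real (M $ i $ j):])"
  define d where "d = det ?X"
  have cp: "char_polynomial M = [:0, 1:] * d" unfolding d_def by (rule char_polynomial_zero_row[OF M0])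
  \<comment> \<open>The cofactor has no root on the imaginary axis, including 0. So 0 is the only
    root of the product there, and it is simple.\<close>
  have dl: "poly d l \<noteq> 0" if l: "Re l = 0" for l
  proof
    assume "poly d l = 0"
    then have "det (\<chi> i j. poly (?X $ i $ j) l) = 0" by (simp add: d_def poly_det)
    then obtain x where x: "x \<noteq> 0" "(\<chi> i j. poly (?X $ i $ j) l) *v x = 0" by (rule singular_matrix_kernel)
    have row: "(\<Sum>j\<in>UNIV. poly (?X $ i $ j) l * x $ j) = 0" for i
      using arg_cong[OF x(2), of "\<lambda>y. y $ i"] by (simp add: matrix_vector_mult_def)
    have sum_opt: "(\<Sum>j\<in>UNIV. h j) = h None + (\<Sum>k\<in>UNIV. h (Some k))" for h :: "'n option \<Rightarrow> complex"
      by (simp add: UNIV_option_conv sum.reindex)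
    have x0: "x $ None = 0" using row[of None] by (simp add: sum_opt axis_def)
    define v w where "v = (\<chi> k. Re (x $ Some k))" and "w = (\<chi> k. Im (x $ Some k))"
    define \<omega> where "\<omega> = Im l"
    have lw: "l = \<i> * of_real \<omega>" using l by (simp add: complex_eq_iff \<omega>_def)
    have eq: "(\<Sum>k\<in>UNIV. complex_of_real (M $ Some i $ Some k) * x $ Some k) = l * x $ Some i" for i
    proof -
      have "0 = (\<Sum>k\<in>UNIV. ((if i = k then l else 0) - complex_of_real (M $ Some i $ Some k)) * x $ Some k)"
      proof -
        have "0 = (\<Sum>k\<in>UNIV. poly (?X $ Some i $ Some k) l * x $ Some k)"
          using row[of "Some i"] x0 by (simp add: sum_opt del: vec_lambda_beta)
        also have "\<dots> = (\<Sum>k\<in>UNIV. ((if i = k then l else 0) - complex_of_real (M $ Some i $ Some k)) * x $ Some k)"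
          by (rule sum.cong) auto
        finally show ?thesis .
      qed
      also have "\<dots> = (\<Sum>k\<in>UNIV. (if i = k then l * x $ Some k else 0)) - (\<Sum>k\<in>UNIV. complex_of_real (M $ Some i $ Some k) * x $ Some k)"
        unfolding sum_subtractf[symmetric] by (rule sum.cong) (auto simp: algebra_simps)
      finally show ?thesis by simp
    qed
    have "v = 0 \<and> w = 0"
    proof (rule no_eig)
      fix i
      show "(\<Sum>k\<in>UNIV. M $ Some i $ Some k * v $ k) = - \<omega> * w $ i"
        using arg_cong[OF eq[of i], of Re] by (simp add: v_def w_def lw)
      show "(\<Sum>k\<in>UNIV. M $ Some i $ Some k * w $ k) = \<omega> * v $ i"
        using arg_cong[OF eq[of i], of Im] by (simp add: v_def w_def lw)
    qed
    then have "x $ Some k = 0" for k by (auto simp: v_def w_def vec_eq_iff complex_eq_iff)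
    then have "x $ j = 0" for j using x0 by (cases j) auto
    then show False using x(1) by (simp add: vec_eq_iff)
  qed
  have "d \<noteq> 0" using dl[of 0] by auto
  have set: "{l. Re l = 0 \<and> poly (char_polynomial M) l = 0} = {0}" using dl by (auto simp: cp)
  have "Polynomial.order 0 (char_polynomial M) = Polynomial.order 0 [:0, 1 :: complex:] + Polynomial.order 0 d"
    unfolding cp by (rule order_mult) (use \<open>d \<noteq> 0\<close> in simp)
  also have "Polynomial.order 0 d = 0" by (rule order_0I) (rule dl, simp)
  also have "Polynomial.order 0 [:0, 1 :: complex:] = 1" using order_power_n_n[of "0::complex" 1] by simp
  finally show ?thesis unfolding set by simp
qed

locale fs_cone_block = fs_block_at f g r \<epsilon>0 I D 0
  for f :: "real^'n::finite \<Rightarrow> real \<Rightarrow> real \<Rightarrow> real^'n" and g r \<epsilon>0 I and D :: "'n fs_block" +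
  fixes lA mB :: real
  assumes sb: "spectral_bounds D lA mB"
    and uc: "unstable_cone_condition f g \<epsilon>0 D lA mB" and sc: "stable_cone_condition f g \<epsilon>0 D lA mB"
begin

definition G :: "(real^'n) \<times> real \<Rightarrow> real^'n" where
  "G w = fst (lfield f g 0 D w)"

abbreviation "P \<equiv> coord_proj (b_unst D)"
abbreviation "Q \<equiv> coord_proj (- b_unst D)"

text \<open>Expansion of the unstable part at rate \<open>m\<close> in the cone where it dominates,
  contraction of the stable part in the other cone. As a relation between \<open>v\<close> and
  \<open>x\<close> it fits both the derivative (\<open>cone_DG\<close>) and differences of the field
  (\<open>cone_G\<close>).\<close>

definition cone_rel :: "real \<Rightarrow> real^'n \<Rightarrow> real^'n \<Rightarrow> bool" where
  "cone_rel m v x \<longleftrightarrow> (norm (Q v) \<le> norm (P v) \<longrightarrow> m * (norm (P v))\<^sup>2 \<le> P v \<bullet> x) \<and>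
     (norm (P v) \<le> norm (Q v) \<longrightarrow> Q v \<bullet> x \<le> - m * (norm (Q v))\<^sup>2)"

text \<open>Cauchy--Schwarz bounds \<open>m\<close> times the dominating part of \<open>v\<close> by
  the norm of \<open>x\<close>, and \<open>v\<close> is at most twice as long as its dominating
  part; hence the constant \<open>m / 2\<close>. It gives injectivity of the field and of its
  derivative in the fast variables.\<close>

lemma cone_rel_norm:
  assumes "cone_rel m v x"
  shows "m / 2 * norm v \<le> norm x"
proof -
  have nv: "norm v \<le> norm (P v) + norm (Q v)" by (rule norm_le_coord_proj)
  have key: "m * s \<le> norm x" if "m * s\<^sup>2 \<le> s * norm x" "0 \<le> s" for s
    using that by (cases "s = 0") (auto simp: power2_eq_square mult.left_commute[of m] mult_le_cancel_left)
  show ?thesis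
  proof (cases "norm (Q v) \<le> norm (P v)")
    case True
    then have "m * (norm (P v))\<^sup>2 \<le> norm (P v) * norm x"
      using assms norm_cauchy_schwarz[of "P v" x] by (simp add: cone_rel_def)
    from key[OF this] have *: "m * norm (P v) \<le> norm x" by simp
    show ?thesis
    proof (cases "m \<ge> 0")
      case m: True
      have "m / 2 * norm v \<le> m / 2 * (2 * norm (P v))" using nv True m by (intro mult_left_mono) auto
      then show ?thesis using * by simp
    next
      case False
      then have "m / 2 * norm v \<le> 0" by (intro mult_nonpos_nonneg) auto
      then show ?thesis using norm_ge_zero[of x] by linarith
    qed
  next
    case False
    then have "m * (norm (Q v))\<^sup>2 \<le> norm (Q v) * norm x"
      using assms Cauchy_Schwarz_ineq2[of "Q v" x] by (simp add: cone_rel_def)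
    from key[OF this] have *: "m * norm (Q v) \<le> norm x" by simp
    show ?thesis
    proof (cases "m \<ge> 0")
      case m: True
      have "m / 2 * norm v \<le> m / 2 * (2 * norm (Q v))" using nv False m by (intro mult_left_mono) auto
      then show ?thesis using * by simp
    next
      case False
      then have "m / 2 * norm v \<le> 0" by (intro mult_nonpos_nonneg) auto
      then show ?thesis using norm_ge_zero[of x] by linarith
    qed
  qed
qed

lemma cone_DG: "\<exists>m>0. \<forall>w\<in>lbox D. \<forall>v. cone_rel m v (DG w (v, 0))"
proof -
  obtain \<alpha> A \<beta> B where c: "0 \<le> A" "A < \<alpha>" "0 \<le> B" "B < \<beta>"
    "\<And>w v. w \<in> lbox D \<Longrightarrow> \<alpha> * (norm (P v))\<^sup>2 - A * norm (P v) * norm (Q v) \<le> P v \<bullet> DG w (v, 0) \<and>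
      Q v \<bullet> DG w (v, 0) \<le> B * norm (P v) * norm (Q v) - \<beta> * (norm (Q v))\<^sup>2"
    using cone_estimate[OF sb uc sc] unfolding Let_def by blast
  \<comment> \<open>In the cone of its dominating part each mixed term is absorbed into the square,
    which leaves the rates \<open>\<alpha> - A\<close> and \<open>\<beta> - B\<close>.\<close>
  define m where "m = min (\<alpha> - A) (\<beta> - B)"
  have m: "0 < m" "m \<le> \<alpha> - A" "m \<le> \<beta> - B" using c by (auto simp: m_def)
  have "cone_rel m v (DG w (v, 0))" if w: "w \<in> lbox D" for w v
    unfolding cone_rel_def
  proof (intro conjI impI)
    assume le: "norm (Q v) \<le> norm (P v)"
    have "A * norm (P v) * norm (Q v) \<le> A * norm (P v) * norm (P v)" using le c(1) by (intro mult_left_mono) auto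
    moreover have "m * (norm (P v))\<^sup>2 \<le> (\<alpha> - A) * (norm (P v))\<^sup>2" using m(2) by (intro mult_right_mono) auto
    ultimately show "m * (norm (P v))\<^sup>2 \<le> P v \<bullet> DG w (v, 0)"
      using c(5)[OF w, of v] by (simp add: power2_eq_square algebra_simps)
  next
    assume le: "norm (P v) \<le> norm (Q v)"
    have "B * norm (P v) * norm (Q v) \<le> B * norm (Q v) * norm (Q v)"
      using le c(3) by (intro mult_right_mono mult_left_mono) auto
    moreover have "m * (norm (Q v))\<^sup>2 \<le> (\<beta> - B) * (norm (Q v))\<^sup>2" using m(3) by (intro mult_right_mono) auto
    ultimately show "Q v \<bullet> DG w (v, 0) \<le> - m * (norm (Q v))\<^sup>2"
      using c(5)[OF w, of v] by (simp add: power2_eq_square algebra_simps)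
  qed
  then show ?thesis using m(1) by blast
qed

lemma zero_dom: "w \<in> lbox D \<Longrightarrow> (fst w, snd w, 0) \<in> local_dom D"
  by (auto simp: local_dom_eq lbox_def)

lemma G_derivative:
  assumes w: "w \<in> lbox D"
  shows "(G has_derivative DG w) (at w)"
proof -
  have eq: "G = (\<lambda>w. (\<chi> i. b_eig D $ i * fst w $ i) + local_F f \<epsilon>0 D (fst w, snd w, 0))"
    by (auto simp: G_def local_F_def vec_eq_iff fun_eq_iff lfield_component)
  have "bounded_linear (\<lambda>v :: (real^'n) \<times> real. \<chi> i. b_eig D $ i * fst v $ i)"
    by (rule linear_conv_bounded_linear[THEN iffD1], rule linearI) (auto simp: vec_eq_iff algebra_simps)
  then have 1: "((\<lambda>p. \<chi> i. b_eig D $ i * fst p $ i) has_derivative (\<lambda>v. \<chi> i. b_eig D $ i * fst v $ i)) (at w)"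
    by (rule bounded_linear_imp_has_derivative)
  have "((\<lambda>w. (fst w, snd w, 0 :: real)) has_derivative (\<lambda>d. (fst d, snd d, 0))) (at w)"
    by (auto intro!: derivative_eq_intros)
  from has_derivative_compose[OF this local_F_derivative(1)[OF zero_dom[OF w]]]
  have 2: "((\<lambda>w. local_F f \<epsilon>0 D (fst w, snd w, 0)) has_derivative (\<lambda>d. LF (fst w, snd w, 0) (fst d, snd d, 0))) (at w)" .
  show ?thesis unfolding eq using has_derivative_add[OF 1 2] by (simp add: DG_def[abs_def])
qed

lemma DG_linear: "w \<in> lbox D \<Longrightarrow> linear (DG w)"
  using G_derivative has_derivative_linear by blast

lemma DG_continuous: "continuous_on (lbox D) (\<lambda>w. DG w d)"
proof -
  have "continuous_on (lbox D) (\<lambda>w. (fst w, snd w, 0 :: real))"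
    by (intro continuous_on_Pair continuous_on_fst continuous_on_snd continuous_on_id continuous_on_const)
  from continuous_on_compose2[OF continuous_on_LF this, of "(fst d, snd d, 0)"]
  have "continuous_on (lbox D) (\<lambda>w. LF (fst w, snd w, 0) (fst d, snd d, 0))" using zero_dom by blast
  then show ?thesis unfolding DG_def by (intro continuous_on_add continuous_on_const)
qed

text \<open>The mean value theorem is applied to the scalar products with \<open>P ?d\<close> and
  with \<open>Q ?d\<close> separately. The two intermediate points differ, which is harmless because
  the halves of \<open>cone_rel\<close> involve one product each and \<open>cone_DG\<close> has one
  rate for the whole box.\<close>

lemma cone_G: "\<exists>m>0. \<forall>z1 z2 y. (z1, y) \<in> lbox D \<longrightarrow> (z2, y) \<in> lbox D \<longrightarrow> cone_rel m (z1 - z2) (G (z1, y) - G (z2, y))"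
proof -
  obtain m where m: "m > 0" "\<And>w v. w \<in> lbox D \<Longrightarrow> cone_rel m v (DG w (v, 0))" using cone_DG by blast
  have "cone_rel m (z1 - z2) (G (z1, y) - G (z2, y))" if z: "(z1, y) \<in> lbox D" "(z2, y) \<in> lbox D" for z1 z2 y
  proof -
    let ?d = "z1 - z2"
    have seg: "(z2 + s *\<^sub>R ?d, y) \<in> lbox D" if "s \<in> {0..1}" for s :: real
    proof -
      have "(1 - s) *\<^sub>R (z2, y) + s *\<^sub>R (z1, y) \<in> lbox D"
        by (rule convexD[OF lbox_convex z(2,1)]) (use that in auto)
      then show ?thesis by (simp add: algebra_simps)
    qed
    have mvt: "\<exists>w\<in>lbox D. R ?d \<bullet> (G (z1, y) - G (z2, y)) = R ?d \<bullet> DG w (?d, 0)" for R :: "real^'n \<Rightarrow> real^'n"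
    proof -
      let ?\<phi> = "\<lambda>s :: real. R ?d \<bullet> G (z2 + s *\<^sub>R ?d, y)"
      have "\<exists>s\<in>{0<..<1}. ?\<phi> 1 - ?\<phi> 0 = (\<lambda>h. R ?d \<bullet> DG (z2 + s *\<^sub>R ?d, y) (h *\<^sub>R ?d, 0)) (1 - 0)"
      proof (rule mvt_simple)
        fix s :: real assume "0 \<le> s" "s \<le> 1"
        then have "(z2 + s *\<^sub>R ?d, y) \<in> lbox D" using seg by simp
        moreover have "((\<lambda>s. (z2 + s *\<^sub>R ?d, y)) has_derivative (\<lambda>h. (h *\<^sub>R ?d, 0))) (at s within {0..1})"
          by (auto intro!: derivative_eq_intros)
        ultimately have "((\<lambda>s. G (z2 + s *\<^sub>R ?d, y)) has_derivative (\<lambda>h. DG (z2 + s *\<^sub>R ?d, y) (h *\<^sub>R ?d, 0))) (at s within {0..1})"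
          using has_derivative_compose G_derivative by blast
        then show "(?\<phi> has_derivative (\<lambda>h. R ?d \<bullet> DG (z2 + s *\<^sub>R ?d, y) (h *\<^sub>R ?d, 0))) (at s within {0..1})"
          by (rule has_derivative_inner_right)
      qed simp
      then obtain s where "s \<in> {0<..<1}" "R ?d \<bullet> (G (z1, y) - G (z2, y)) = R ?d \<bullet> DG (z2 + s *\<^sub>R ?d, y) (?d, 0)"
        by (auto simp: inner_diff_right)
      then show ?thesis using seg[of s] by auto
    qed
    obtain w1 w2 where "w1 \<in> lbox D" "P ?d \<bullet> (G (z1, y) - G (z2, y)) = P ?d \<bullet> DG w1 (?d, 0)"
      "w2 \<in> lbox D" "Q ?d \<bullet> (G (z1, y) - G (z2, y)) = Q ?d \<bullet> DG w2 (?d, 0)" using mvt[of P] mvt[of Q] by blast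
    then show ?thesis using m(2)[of w1 ?d] m(2)[of w2 ?d] by (simp add: cone_rel_def)
  qed
  then show ?thesis using m(1) by blast
qed

lemma equilibrium_exists:
  assumes y: "y \<in> {b_ylo D..b_yhi D}"
  shows "\<exists>z\<in>block_box D. G (z, y) = 0"
proof -
  let ?U = "b_unst D"
  \<comment> \<open>The field points outwards on unstable faces and inwards on stable ones; flipping
    the stable components gives the sign pattern of Poincare--Miranda.\<close>
  define s where "s i = (if i \<in> ?U then 1 else (-1 :: real))" for i
  define X where "X x = (\<chi> i. x i)" for x :: "'n \<Rightarrow> real"
  let ?B = "{x. \<forall>i\<in>UNIV. x i \<in> {b_lo D $ i..b_hi D $ i}}"
  have XB: "(X x, y) \<in> lbox D" if "x \<in> ?B" for x using that y by (auto simp: X_def lbox_def block_box_def)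
  have cont: "continuous_on (lbox D) G"
    using G_derivative by (meson continuous_at_imp_continuous_on has_derivative_continuous)
  have "\<exists>x\<in>?B. \<forall>i\<in>UNIV. s i * G (X x, y) $ i = 0"
  proof (rule poincare_miranda)
    fix i
    have "continuous_on ?B X" unfolding X_def
      by (intro continuous_on_vec_lambda continuous_on_apply_coord[OF continuous_on_id])
    then have "continuous_on ?B (\<lambda>x. (X x, y))" by (intro continuous_on_Pair continuous_on_const)
    then have "continuous_on ?B (\<lambda>x. G (X x, y))"
      by (rule continuous_on_compose2[OF cont]) (use XB in blast)
    then show "continuous_on ?B (\<lambda>x. s i * G (X x, y) $ i)" by (intro continuous_on_mult_left continuous_on_component)
  next
    fix x i assume x: "x \<in> ?B" "x i = b_lo D $ i"
    have "fst (X x, y) $ i = b_lo D $ i" using x(2) by (simp add: X_def)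
    then show "s i * G (X x, y) $ i \<le> 0"
      using face_sign(2,4)[OF XB[OF x(1)], of i] by (cases "i \<in> ?U") (auto simp: s_def G_def intro: less_imp_le)
  next
    fix x i assume x: "x \<in> ?B" "x i = b_hi D $ i"
    have "fst (X x, y) $ i = b_hi D $ i" using x(2) by (simp add: X_def)
    then show "0 \<le> s i * G (X x, y) $ i"
      using face_sign(1,3)[OF XB[OF x(1)], of i] by (cases "i \<in> ?U") (auto simp: s_def G_def intro: less_imp_le)
  qed (auto intro: lo_less_hi)
  then obtain x where x: "x \<in> ?B" "\<And>i. s i * G (X x, y) $ i = 0" by auto
  have "G (X x, y) $ i = 0" for i using x(2)[of i] by (auto simp: s_def split: if_splits)
  then have "G (X x, y) = 0" by (simp add: vec_eq_iff)
  moreover have "X x \<in> block_box D" using XB[OF x(1)] by (simp add: lbox_def)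
  ultimately show ?thesis by blast
qed

definition hz :: "real \<Rightarrow> real^'n" where
  "hz y = (SOME z. z \<in> block_box D \<and> G (z, y) = 0)"

lemma hz:
  assumes "y \<in> {b_ylo D..b_yhi D}"
  shows "(hz y, y) \<in> lbox D" "G (hz y, y) = 0"
proof -
  have "\<exists>z. z \<in> block_box D \<and> G (z, y) = 0" using equilibrium_exists[OF assms] by blast
  from someI_ex[OF this] show "(hz y, y) \<in> lbox D" "G (hz y, y) = 0" using assms by (auto simp: hz_def lbox_def)
qed

lemma hz_unique:
  assumes "(z, y) \<in> lbox D" "G (z, y) = 0"
  shows "z = hz y"
proof -
  have y: "y \<in> {b_ylo D..b_yhi D}" using assms(1) by (simp add: lbox_def)
  obtain m where m: "m > 0" "\<forall>z1 z2 y. (z1, y) \<in> lbox D \<longrightarrow> (z2, y) \<in> lbox D \<longrightarrow> cone_rel m (z1 - z2) (G (z1, y) - G (z2, y))"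
    using cone_G by blast
  have "cone_rel m (z - hz y) (G (z, y) - G (hz y, y))" using m(2) assms(1) hz(1)[OF y] by blast
  from cone_rel_norm[OF this] have "m / 2 * norm (z - hz y) \<le> 0" using hz(2)[OF y] assms(2) by simp
  then show ?thesis using m(1) by (simp add: mult_le_0_iff)
qed

text \<open>Both equilibria are placed over the same slow value \<open>y\<close>, which stays in the
  box because the box is a product. The field at \<open>(hz y', y)\<close> differs from
  \<open>G (hz y', y') = 0\<close> by at most a multiple of the slow distance, and
  \<open>cone_rel_norm\<close> bounds the fast distance by it.\<close>

lemma hz_lipschitz:
  "\<exists>L\<ge>0. \<forall>y\<in>{b_ylo D..b_yhi D}. \<forall>y'\<in>{b_ylo D..b_yhi D}. norm (hz y - hz y') \<le> L * \<bar>y - y'\<bar>"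
proof -
  obtain m where m: "m > 0" "\<And>z1 z2 y. (z1, y) \<in> lbox D \<Longrightarrow> (z2, y) \<in> lbox D \<Longrightarrow> cone_rel m (z1 - z2) (G (z1, y) - G (z2, y))"
    using cone_G by blast
  obtain K where K: "\<And>v w. v \<in> lbox D \<Longrightarrow> w \<in> lbox D \<Longrightarrow> norm (lfield f g 0 D v - lfield f g 0 D w) \<le> K * norm (v - w)" "K \<ge> 0"
    using lfield_lipschitz by blast
  have "norm (hz y - hz y') \<le> (2 * K / m) * \<bar>y - y'\<bar>" if y: "y \<in> {b_ylo D..b_yhi D}" "y' \<in> {b_ylo D..b_yhi D}" for y y'
  proof -
    have mem: "(hz y', y) \<in> lbox D" using hz(1)[OF y(2)] y(1) by (simp add: lbox_def)
    have "m / 2 * norm (hz y - hz y') \<le> norm (G (hz y, y) - G (hz y', y))"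
      by (rule cone_rel_norm[OF m(2)[OF hz(1)[OF y(1)] mem]])
    also have "\<dots> = norm (G (hz y', y) - G (hz y', y'))" using hz(2)[OF y(1)] hz(2)[OF y(2)] by simp
    also have "\<dots> \<le> norm (lfield f g 0 D (hz y', y) - lfield f g 0 D (hz y', y'))"
      unfolding G_def fst_diff[symmetric] by (metis norm_fst_le prod.collapse)
    also have "\<dots> \<le> K * norm ((hz y', y) - (hz y', y'))" by (rule K(1)[OF mem hz(1)[OF y(2)]])
    also have "norm ((hz y', y) - (hz y', y')) = \<bar>y - y'\<bar>" by (simp add: norm_Pair)
    finally have "m / 2 * norm (hz y - hz y') \<le> K * \<bar>y - y'\<bar>" .
    then show ?thesis using m(1) by (simp add: field_simps)
  qed
  moreover have "2 * K / m \<ge> 0" using K(2) m(1) by simp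
  ultimately show ?thesis by blast
qed

text \<open>An implicit function argument on a closed interval, with one-sided derivatives at its
  ends. By the lower bound \<open>coer\<close> the fast part of \<open>DG\<close> is injective,
  hence onto, so there is a slope \<open>W y\<close> with
  \<open>DG (hz y, y) (W y, 1) = 0\<close>.\<close>

lemma hz_derivative:
  "\<exists>W. (\<forall>y\<in>{b_ylo D..b_yhi D}. (hz has_vector_derivative W y) (at y within {b_ylo D..b_yhi D})) \<and>
    continuous_on {b_ylo D..b_yhi D} W"
proof -
  let ?Y = "{b_ylo D..b_yhi D}"
  obtain m where m: "m > 0" "\<And>w v. w \<in> lbox D \<Longrightarrow> cone_rel m v (DG w (v, 0))" using cone_DG by blast
  have coer: "m / 2 * norm v \<le> norm (DG w (v, 0))" if "w \<in> lbox D" for w v by (rule cone_rel_norm[OF m(2)[OF that]])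
  obtain L where L: "L \<ge> 0" "\<And>y y'. y \<in> ?Y \<Longrightarrow> y' \<in> ?Y \<Longrightarrow> norm (hz y - hz y') \<le> L * \<bar>y - y'\<bar>"
    using hz_lipschitz by blast
  have "\<exists>v. DG w (v, 1) = 0" if w: "w \<in> lbox D" for w
  proof -
    have lin: "linear (\<lambda>v. DG w (v, 0))"
      using DG_linear[OF w] by (intro linear_compose[of "\<lambda>v. (v, 0)" "DG w", unfolded o_def]) (auto intro!: linearI)
    have "inj (\<lambda>v. DG w (v, 0))"
      unfolding linear_injective_0[OF lin]
    proof (intro allI impI)
      fix v assume "DG w (v, 0) = 0"
      then have "m / 2 * norm v \<le> 0" using coer[OF w, of v] by simp
      then show "v = 0" using m(1) by (simp add: mult_le_0_iff)
    qed
    then have "surj (\<lambda>v. DG w (v, 0))" by (rule linear_inj_imp_surj[OF lin])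
    from surjD[OF this, of "- DG w (0, 1)"] obtain v where "- DG w (0, 1) = DG w (v, 0)" by (rule exE)
    from this[symmetric] have "DG w (v, 0) + DG w (0, 1) = 0" by simp
    then have "DG w ((v, 0) + (0, 1)) = 0" by (simp only: linear_add[OF DG_linear[OF w]])
    then show ?thesis by auto
  qed
  then have "\<forall>y. \<exists>v. y \<in> ?Y \<longrightarrow> DG (hz y, y) (v, 1) = 0" using hz(1) by blast
  from choice[OF this] obtain W where W: "\<And>y. y \<in> ?Y \<Longrightarrow> DG (hz y, y) (W y, 1) = 0" by blast
  have lipc: "continuous_on ?Y hz"
    by (rule lipschitz_on_continuous_on[of L]) (use L in \<open>auto simp: lipschitz_on_def dist_norm\<close>)
  have der: "(hz has_vector_derivative W y0) (at y0 within ?Y)" if y0: "y0 \<in> ?Y" for y0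
    unfolding has_vector_derivative_def has_derivative_within_alt
  proof (intro conjI allI impI)
    show "bounded_linear (\<lambda>x. x *\<^sub>R W y0)" by (rule bounded_linear_scaleR_left)
    fix e :: real assume e: "e > 0"
    let ?c = "(hz y0, y0)"
    \<comment> \<open>\<open>norm (?w - ?c)\<close> is at most
      \<open>(L + 1) * \<bar>y - y0\<bar>\<close>, and inverting the fast part costs a factor
      \<open>2 / m\<close>; this choice leaves exactly \<open>e\<close>.\<close>
    define e' where "e' = e * m / (2 * (L + 1))"
    have e': "e' > 0" using e m(1) L(1) by (simp add: e'_def)
    from G_derivative[OF hz(1)[OF y0]] obtain \<delta> where \<delta>: "\<delta> > 0"
      "\<And>w. norm (w - ?c) < \<delta> \<Longrightarrow> norm (G w - G ?c - DG ?c (w - ?c)) \<le> e' * norm (w - ?c)"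
      unfolding has_derivative_at_alt using e' by blast
    show "\<exists>d>0. \<forall>y\<in>?Y. norm (y - y0) < d \<longrightarrow> norm (hz y - hz y0 - (y - y0) *\<^sub>R W y0) \<le> e * norm (y - y0)"
    proof (intro exI[of _ "\<delta> / (L + 1)"] conjI ballI impI)
      show "\<delta> / (L + 1) > 0" using \<delta>(1) L(1) by simp
      fix y assume y: "y \<in> ?Y" "norm (y - y0) < \<delta> / (L + 1)"
      let ?w = "(hz y, y)"
      have "norm (?w - ?c) \<le> norm (hz y - hz y0) + \<bar>y - y0\<bar>" using norm_Pair_le[of "hz y - hz y0" "y - y0"] by simp
      also have "\<dots> \<le> (L + 1) * \<bar>y - y0\<bar>" using L(2)[OF y(1) y0] by (simp add: algebra_simps)
      finally have nw: "norm (?w - ?c) \<le> (L + 1) * \<bar>y - y0\<bar>" .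
      moreover have "(L + 1) * \<bar>y - y0\<bar> < \<delta>" using y(2) L(1) by (simp add: field_simps)
      ultimately have "norm (DG ?c (?w - ?c)) \<le> e' * norm (?w - ?c)"
        using \<delta>(2)[of ?w] hz(2)[OF y(1)] hz(2)[OF y0] by simp
      also have "\<dots> \<le> e' * ((L + 1) * \<bar>y - y0\<bar>)" using nw e' by (intro mult_left_mono) auto
      also have "\<dots> = m / 2 * (e * \<bar>y - y0\<bar>)" using L(1) by (simp add: e'_def field_simps)
      finally have 1: "norm (DG ?c (?w - ?c)) \<le> m / 2 * (e * \<bar>y - y0\<bar>)" .
      have "?w - ?c = (hz y - hz y0 - (y - y0) *\<^sub>R W y0, 0) + (y - y0) *\<^sub>R (W y0, 1)" by simp
      then have "DG ?c (?w - ?c) = DG ?c (hz y - hz y0 - (y - y0) *\<^sub>R W y0, 0)"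
        using W[OF y0] DG_linear[OF hz(1)[OF y0]] by (simp only: linear_add linear_scale scaleR_zero_right add_0_right)
      then have "m / 2 * norm (hz y - hz y0 - (y - y0) *\<^sub>R W y0) \<le> m / 2 * (e * \<bar>y - y0\<bar>)"
        using coer[OF hz(1)[OF y0], of "hz y - hz y0 - (y - y0) *\<^sub>R W y0"] 1 by simp
      then show "norm (hz y - hz y0 - (y - y0) *\<^sub>R W y0) \<le> e * norm (y - y0)" using m(1) by simp
    qed
  qed
  have "continuous_on ?Y W"
    unfolding continuous_on_def
  proof
    fix y0 assume y0: "y0 \<in> ?Y"
    have c: "continuous_on ?Y (\<lambda>y. DG (hz y, y) (W y0, 1))"
    proof (rule continuous_on_compose2[OF DG_continuous])
      show "continuous_on ?Y (\<lambda>y. (hz y, y))" by (intro continuous_on_Pair lipc continuous_on_id)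
    qed (use hz(1) in blast)
    then have lim: "((\<lambda>y. 2 / m * norm (DG (hz y, y) (W y0, 1))) \<longlongrightarrow> 0) (at y0 within ?Y)"
    proof -
      have "((\<lambda>y. DG (hz y, y) (W y0, 1)) \<longlongrightarrow> 0) (at y0 within ?Y)"
        using bspec[OF c[unfolded continuous_on_def] y0] W[OF y0] by simp
      then have "((\<lambda>y. 2 / m * norm (DG (hz y, y) (W y0, 1))) \<longlongrightarrow> 2 / m * norm (0 :: real^'n)) (at y0 within ?Y)"
        by (intro tendsto_intros)
      then show ?thesis by simp
    qed
    \<comment> \<open>By linearity \<open>DG (hz y, y) (W y - W y0, 0)\<close> equals
      \<open>- DG (hz y, y) (W y0, 1)\<close>, which tends to 0 by the choice of
      \<open>W y0\<close>; \<open>coer\<close> bounds the increment of \<open>W\<close> by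
      it.\<close>
    have "((\<lambda>y. W y - W y0) \<longlongrightarrow> 0) (at y0 within ?Y)"
    proof (rule Lim_null_comparison[OF _ lim])
      show "\<forall>\<^sub>F y in at y0 within ?Y. norm (W y - W y0) \<le> 2 / m * norm (DG (hz y, y) (W y0, 1))"
        unfolding eventually_at_filter
      proof (rule always_eventually, intro allI impI)
        fix y assume y: "y \<in> ?Y"
        have "DG (hz y, y) ((W y - W y0, 0) + (W y0, 1)) = 0" using W[OF y] by simp
        then have "DG (hz y, y) (W y - W y0, 0) = - DG (hz y, y) (W y0, 1)"
          unfolding linear_add[OF DG_linear[OF hz(1)[OF y]]] by (simp only: eq_neg_iff_add_eq_0)
        then have "m / 2 * norm (W y - W y0) \<le> norm (DG (hz y, y) (W y0, 1))"
          using coer[OF hz(1)[OF y], of "W y - W y0"] by simp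
        then show "norm (W y - W y0) \<le> 2 / m * norm (DG (hz y, y) (W y0, 1))"
          using m(1) by (simp add: field_simps)
      qed
    qed
    then show "(W \<longlongrightarrow> W y0) (at y0 within ?Y)" by (rule LIM_zero_cancel)
  qed
  with der show ?thesis by blast
qed

lemma slow_curve_eq: "slow_curve f D = (\<lambda>y. (fast_pos D (hz y), y)) ` {b_ylo D..b_yhi D}"
proof -
  have f0: "f (fast_pos D z) y 0 = 0 \<longleftrightarrow> G (z, y) = 0" for z y
    by (simp add: G_def lfield_def) (metis frame_inverse(2) matrix_vector_mult_0_right)
  show ?thesis
  proof (intro equalityI subsetI)
    fix w assume "w \<in> slow_curve f D"
    then obtain x y where w: "w = (x, y)" "(x, y) \<in> block_set D" "f x y 0 = 0" by (auto simp: slow_curve_def)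
    have mem: "(fast_coord D x, y) \<in> lbox D" using w(2) by (simp add: mem_block_set_iff lcoord_def)
    moreover have "G (fast_coord D x, y) = 0" using w(3) f0[of "fast_coord D x" y] by simp
    ultimately have "fast_coord D x = hz y" by (rule hz_unique)
    then have "x = fast_pos D (hz y)" by (metis fast_coord_pos(2))
    then show "w \<in> (\<lambda>y. (fast_pos D (hz y), y)) ` {b_ylo D..b_yhi D}" using w(1) mem by (auto simp: lbox_def)
  next
    fix w assume "w \<in> (\<lambda>y. (fast_pos D (hz y), y)) ` {b_ylo D..b_yhi D}"
    then obtain y where y: "y \<in> {b_ylo D..b_yhi D}" "w = (fast_pos D (hz y), y)" by blast
    then have "w \<in> block_set D" using hz(1)[OF y(1)] by (simp add: mem_block_set_iff lcoord_def)
    then show "w \<in> slow_curve f D" using y f0 hz(2)[OF y(1)] by (simp add: slow_curve_def)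
  qed
qed

text \<open>For \<open>R = P\<close> or \<open>R = Q\<close> the two pairings with the images cancel
  in the sum, as an orthogonal projection is symmetric. So the sums \<open>a\<close> and
  \<open>b\<close> of squared norms satisfy \<open>\<alpha> * a \<le> A * ab\<close> and
  \<open>\<beta> * b \<le> B * ab\<close>, where \<open>ab\<close> is at most the larger of
  \<open>a\<close> and \<open>b\<close>. As \<open>A < \<alpha>\<close> and
  \<open>B < \<beta>\<close>, both vanish.\<close>

lemma no_imaginary_eigenvector:
  assumes w: "w \<in> lbox D" and v: "DG w (v1, 0) = - \<omega> *\<^sub>R v2" "DG w (v2, 0) = \<omega> *\<^sub>R v1"
  shows "v1 = 0 \<and> v2 = 0"
proof -
  obtain \<alpha> A \<beta> B where c: "0 \<le> A" "A < \<alpha>" "0 \<le> B" "B < \<beta>"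
    "\<And>v. \<alpha> * (norm (P v))\<^sup>2 - A * norm (P v) * norm (Q v) \<le> P v \<bullet> DG w (v, 0) \<and>
      Q v \<bullet> DG w (v, 0) \<le> B * norm (P v) * norm (Q v) - \<beta> * (norm (Q v))\<^sup>2"
    using cone_estimate[OF sb uc sc] w unfolding Let_def by blast
  let ?a = "(norm (P v1))\<^sup>2 + (norm (P v2))\<^sup>2" and ?b = "(norm (Q v1))\<^sup>2 + (norm (Q v2))\<^sup>2"
  let ?ab = "norm (P v1) * norm (Q v1) + norm (P v2) * norm (Q v2)"
  have zero: "R v1 \<bullet> DG w (v1, 0) + R v2 \<bullet> DG w (v2, 0) = 0" if "R = P \<or> R = Q" for R
  proof -
    have "R v2 \<bullet> v1 = R v1 \<bullet> v2"
      using that coord_proj_inner[of _ v2 v1] coord_proj_inner[of _ v1 v2] by (metis inner_commute)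
    then show ?thesis unfolding v by simp
  qed
  have PQ: "\<alpha> * ?a - A * ?ab \<le> 0" "0 \<le> B * ?ab - \<beta> * ?b"
    using c(5)[of v1] c(5)[of v2] zero[of P] zero[of Q] by (auto simp: algebra_simps)
  have am: "2 * ?ab \<le> ?a + ?b"
    using sum_squares_bound[of "norm (P v1)" "norm (Q v1)"] sum_squares_bound[of "norm (P v2)" "norm (Q v2)"] by simp
  have cs: "?ab\<^sup>2 \<le> ?a * ?b"
  proof -
    have "0 \<le> (norm (P v1) * norm (Q v2) - norm (P v2) * norm (Q v1))\<^sup>2" by simp
    then show ?thesis by (simp add: power2_eq_square algebra_simps)
  qed
  have nn: "0 \<le> ?a" "0 \<le> ?b" "0 \<le> ?ab" by simp_all
  have dbl: "s \<le> a" if "2 * s \<le> a + b" "b \<le> a" for s a b :: real using that by simp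
  have am': "2 * s \<le> b + a" if "2 * s \<le> a + b" for s a b :: real using that by simp
  have "?a = 0 \<and> ?b = 0"
  proof (cases "?b \<le> ?a")
    case True
    have "?ab \<le> ?a" by (rule dbl[OF am True])
    then have "A * ?ab \<le> A * ?a" by (rule mult_left_mono[OF _ c(1)])
    then have "(\<alpha> - A) * ?a \<le> 0" using PQ(1) by (simp only: left_diff_distrib)
    then have "?a \<le> 0" using c(2) by (simp add: mult_le_0_iff)
    then show ?thesis using nn True by linarith
  next
    case False
    have "?ab \<le> ?b" by (rule dbl[OF am'[OF am] linorder_not_le[THEN iffD1, OF False, THEN less_imp_le]])
    then have "B * ?ab \<le> B * ?b" by (rule mult_left_mono[OF _ c(3)])
    then have "(\<beta> - B) * ?b \<le> 0" using PQ(2) by (simp only: left_diff_distrib)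
    then have "?b \<le> 0" using c(4) by (simp add: mult_le_0_iff)
    then show ?thesis using nn False by linarith
  qed
  then have "P v1 = 0" "P v2 = 0" "Q v1 = 0" "Q v2 = 0" by (auto simp: sum_power2_eq_zero_iff)
  then show ?thesis using norm_le_coord_proj[of v1 "b_unst D"] norm_le_coord_proj[of v2 "b_unst D"] by simp
qed

text \<open>The frame conjugates the fast block of the Jacobian to the fast part of
  \<open>DG\<close>, so an imaginary eigenvalue other than the trivial one would give vectors
  excluded by \<open>no_imaginary_eigenvector\<close>.\<close>

lemma normally_hyperbolic:
  assumes w: "w \<in> slow_curve f D"
  shows "normally_hyperbolic_at (fs_field f g 0) w"
proof -
  obtain x y where xy: "w = (x, y)" by force
  have "w \<in> block_set D" using w by (auto simp: slow_curve_def)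
  then have mem: "(fast_coord D x, y) \<in> lbox D" by (simp add: xy mem_block_set_iff lcoord_def)
  let ?h = "\<lambda>(x, y, \<epsilon>). f x y \<epsilon>"
  let ?Df = "frechet_derivative ?h (at (x, y, 0))"
  have field0: "fs_field f g 0 = (\<lambda>w. (f (fst w) (snd w) 0, 0))" by (auto simp: fs_field_def fun_eq_iff)
  have "(x, y, 0) \<in> UNIV \<times> UNIV \<times> I" using I(2) \<epsilon>0 by auto
  then have dh: "(?h has_derivative ?Df) (at (x, y, 0))" by (rule Ck_on_imp_differentiable[OF Ck_f r])
  have lin: "linear ?Df" using dh by (rule has_derivative_linear)
  have e: "((\<lambda>w. (fst w, snd w, 0 :: real)) has_derivative (\<lambda>d. (fst d, snd d, 0))) (at (x, y))"
    by (auto intro!: derivative_eq_intros)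
  have "(?h has_derivative ?Df) (at ((\<lambda>w. (fst w, snd w, 0 :: real)) (x, y)))" using dh by simp
  from has_derivative_compose[OF e this]
  have "((\<lambda>w. f (fst w) (snd w) 0) has_derivative (\<lambda>d. ?Df (fst d, snd d, 0))) (at (x, y))" by simp
  from has_derivative_Pair[OF this has_derivative_const[of "0::real"]]
  have "(fs_field f g 0 has_derivative (\<lambda>d. (?Df (fst d, snd d, 0), 0))) (at (x, y))"
    unfolding field0 .
  then have fd: "frechet_derivative (fs_field f g 0) (at (x, y)) = (\<lambda>d. (?Df (fst d, snd d, 0), 0))"
    by (rule frechet_derivative_at[symmetric])
  let ?M = "jacobian (fs_field f g 0) w"
  have M0: "?M $ None $ j = 0" for j by (simp add: jacobian_def xy fd)
  have M1: "?M $ Some i $ Some k = ?Df (axis k 1, 0, 0) $ i" for i k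
    by (simp add: jacobian_def xy fd inner_axis)
  have sumM: "(\<Sum>k\<in>UNIV. ?M $ Some i $ Some k * v $ k) = ?Df (v, 0, 0) $ i" for i v
  proof -
    have "(v, 0 :: real, 0 :: real) = (\<Sum>k\<in>UNIV. v $ k *\<^sub>R (axis k 1, 0, 0))"
    proof -
      have "(\<Sum>k\<in>UNIV. v $ k *\<^sub>R (axis k (1::real), 0 :: real, 0 :: real)) = (\<Sum>k\<in>UNIV. v $ k *\<^sub>R axis k 1, 0, 0)"
        by (simp add: sum_prod)
      then show ?thesis using basis_expansion[of v] by (simp add: scalar_mult_eq_scaleR)
    qed
    then have "?Df (v, 0, 0) = (\<Sum>k\<in>UNIV. v $ k *\<^sub>R ?Df (axis k 1, 0, 0))"
      by (simp only: linear_sum[OF lin] linear_scale[OF lin])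
    then show ?thesis by (simp add: M1 mult.commute)
  qed
  have DGv: "DG (fast_coord D x, y) (matrix_inv (b_frame D) *v v, 0) = matrix_inv (b_frame D) *v ?Df (v, 0, 0)" for v
    using local_F_derivative(2)[OF zero_dom[OF mem], of "matrix_inv (b_frame D) *v v" 0 0] by (simp add: DG_def)
  have "(\<Sum>l | Re l = 0 \<and> poly (char_polynomial ?M) l = 0. Polynomial.order l (char_polynomial ?M)) = 1"
  proof (rule imaginary_eigenvalue_count[OF M0])
    fix \<omega> and v u :: "real^'n"
    assume 1: "\<And>i. (\<Sum>k\<in>UNIV. ?M $ Some i $ Some k * v $ k) = - \<omega> * u $ i"
      and 2: "\<And>i. (\<Sum>k\<in>UNIV. ?M $ Some i $ Some k * u $ k) = \<omega> * v $ i"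
    let ?i = "(*v) (matrix_inv (b_frame D))"
    have "?Df (v, 0, 0) = - \<omega> *\<^sub>R u" "?Df (u, 0, 0) = \<omega> *\<^sub>R v" using 1 2 by (simp_all add: sumM vec_eq_iff)
    then have "DG (fast_coord D x, y) (?i v, 0) = - \<omega> *\<^sub>R ?i u" "DG (fast_coord D x, y) (?i u, 0) = \<omega> *\<^sub>R ?i v"
      by (simp_all add: DGv linear_neg[OF matrix_vector_mul_linear] matrix_vector_mult_scaleR)
    from no_imaginary_eigenvector[OF mem this] have "?i v = 0" "?i u = 0" by auto
    then show "v = 0 \<and> u = 0" by (metis frame_inverse(2) matrix_vector_mult_0_right)
  qed
  then show ?thesis by (simp add: normally_hyperbolic_at_def Let_def)
qed

lemma normally_hyperbolic_curve: "normally_hyperbolic_slow_curve f g D"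
proof -
  let ?Y = "{b_ylo D..b_yhi D}"
  obtain W where W: "\<And>y. y \<in> ?Y \<Longrightarrow> (hz has_vector_derivative W y) (at y within ?Y)" "continuous_on ?Y W"
    using hz_derivative by blast
  have "((\<lambda>y. fast_pos D (hz y)) has_vector_derivative b_frame D *v W y) (at y within ?Y)" if "y \<in> ?Y" for y
  proof -
    have "((\<lambda>y. b_origin D + b_frame D *v hz y) has_vector_derivative 0 + b_frame D *v W y) (at y within ?Y)"
      by (intro has_vector_derivative_add has_vector_derivative_const
          bounded_linear.has_vector_derivative[OF matrix_vector_mul_bounded_linear W(1)[OF that]])
    then show ?thesis by (simp add: fast_pos_def)
  qed
  moreover have "continuous_on ?Y (\<lambda>y. b_frame D *v W y)"
    by (rule bounded_linear.continuous_on[OF matrix_vector_mul_bounded_linear W(2)])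
  ultimately obtain h where h: "h C1_differentiable_on ?Y" "\<And>y. y \<in> ?Y \<Longrightarrow> h y = fast_pos D (hz y)"
    using C1_extension[OF lo_le_hi(2), of "\<lambda>y. fast_pos D (hz y)" "\<lambda>y. b_frame D *v W y"] by blast
  have "slow_curve f D = (\<lambda>y. (h y, y)) ` ?Y" unfolding slow_curve_eq using h(2) by (intro image_cong) auto
  then show ?thesis using h(1) normally_hyperbolic unfolding normally_hyperbolic_slow_curve_def by blast
qed

end

section \<open>Orbits that stay in a block\<close>

lemma has_real_derivative_inner_self:
  fixes x :: "real \<Rightarrow> 'a::real_inner"
  assumes "(x has_vector_derivative x') (at t within S)"
  shows "((\<lambda>t. x t \<bullet> x t) has_real_derivative 2 * (x t \<bullet> x')) (at t within S)"
proof -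
  have "((\<lambda>t. x t \<bullet> x t) has_derivative (\<lambda>h. x t \<bullet> (h *\<^sub>R x') + (h *\<^sub>R x') \<bullet> x t)) (at t within S)"
    by (rule has_derivative_inner; rule assms[unfolded has_vector_derivative_def])
  then show ?thesis
    unfolding has_field_derivative_def by (rule has_derivative_eq_rhs) (auto simp: inner_commute algebra_simps)
qed

text \<open>
  Either the stable part dominates forever and then decays, or the unstable part dominates at some
  time, hence from then on, and grows without bound.
\<close>

lemma bounded_orbit_in_cones_converges:
  fixes \<delta> X :: "real \<Rightarrow> real^'n::finite" and S :: "'n set"
  defines "P \<equiv> coord_proj S" and "Q \<equiv> coord_proj (- S)"
  assumes der: "\<And>t. 0 \<le> t \<Longrightarrow> (\<delta> has_vector_derivative X t) (at t within {0..})"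
    and bd: "\<And>t. 0 \<le> t \<Longrightarrow> norm (\<delta> t) \<le> R"
    and lip: "\<And>t. 0 \<le> t \<Longrightarrow> norm (X t) \<le> L * norm (\<delta> t)" and m: "0 < m"
    and cu: "\<And>t. 0 \<le> t \<Longrightarrow> norm (Q (\<delta> t)) \<le> norm (P (\<delta> t)) \<Longrightarrow> m * (norm (P (\<delta> t)))\<^sup>2 \<le> P (\<delta> t) \<bullet> X t"
    and cs: "\<And>t. 0 \<le> t \<Longrightarrow> norm (P (\<delta> t)) \<le> norm (Q (\<delta> t)) \<Longrightarrow> Q (\<delta> t) \<bullet> X t \<le> - m * (norm (Q (\<delta> t)))\<^sup>2"
  shows "(\<delta> \<longlongrightarrow> 0) at_top"
proof -
  define a where "a t = (norm (P (\<delta> t)))\<^sup>2" for t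
  define b where "b t = (norm (Q (\<delta> t)))\<^sup>2" for t
  have ab: "norm (Q (\<delta> t)) \<le> norm (P (\<delta> t)) \<longleftrightarrow> b t \<le> a t" "norm (P (\<delta> t)) \<le> norm (Q (\<delta> t)) \<longleftrightarrow> a t \<le> b t" for t
    by (simp_all add: a_def b_def flip: abs_le_square_iff)
  have d: "((\<lambda>t. (norm (coord_proj J (\<delta> t)))\<^sup>2) has_real_derivative 2 * (coord_proj J (\<delta> t) \<bullet> X t)) (at t within {t0..t1})"
    if "0 \<le> t0" "t0 \<le> t" for J and t t0 t1 :: real
  proof -
    have "bounded_linear (coord_proj J :: real^'n \<Rightarrow> real^'n)"
      using coord_proj_linear by (simp add: linear_conv_bounded_linear)
    from bounded_linear.has_vector_derivative[OF this der]
    have "((\<lambda>t. coord_proj J (\<delta> t)) has_vector_derivative coord_proj J (X t)) (at t within {0..})" using that by simp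
    then have "((\<lambda>t. coord_proj J (\<delta> t)) has_vector_derivative coord_proj J (X t)) (at t within {t0..t1})"
      by (rule has_vector_derivative_within_subset) (use that in auto)
    from has_real_derivative_inner_self[OF this]
    show ?thesis unfolding power2_norm_eq_inner coord_proj_inner[of J "\<delta> t" "X t"] .
  qed
  note da = d[of _ _ S, folded P_def, folded a_def] and db = d[of _ _ "- S", folded Q_def, folded b_def]
  have nd: "norm (\<delta> t) \<le> norm (P (\<delta> t)) + norm (Q (\<delta> t))" for t unfolding P_def Q_def by (rule norm_le_coord_proj)
  show ?thesis
  proof (cases "\<forall>t\<ge>0. a t \<le> b t")
    case True
    have dec: "b t * exp (2 * m * t) \<le> b 0" if t: "0 \<le> t" for t
    proof -
      have "b t * exp (2 * m * t) \<le> b 0 * exp (2 * m * 0)"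
      proof (rule within_deriv_nonpos_imp_le[OF t])
        fix s assume s: "s \<in> {0..t}"
        show "((\<lambda>s. b s * exp (2 * m * s)) has_real_derivative
            2 * (Q (\<delta> s) \<bullet> X s) * exp (2 * m * s) + exp (2 * m * s) * (2 * m) * b s) (at s within {0..t})"
          using s by (auto intro!: derivative_eq_intros db)
        have "Q (\<delta> s) \<bullet> X s \<le> - m * b s" using cs[of s] True s ab(2)[of s] by (auto simp: b_def)
        then have "Q (\<delta> s) \<bullet> X s + m * b s \<le> 0" by simp
        then have "2 * (Q (\<delta> s) \<bullet> X s + m * b s) * exp (2 * m * s) \<le> 0" by (intro mult_nonpos_nonneg[OF _ exp_ge_zero]) simp
        then show "2 * (Q (\<delta> s) \<bullet> X s) * exp (2 * m * s) + exp (2 * m * s) * (2 * m) * b s \<le> 0"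
          by (simp add: algebra_simps)
      qed
      then show ?thesis by simp
    qed
    have "norm (\<delta> t) \<le> 2 * norm (Q (\<delta> 0)) * exp (- (m * t))" if t: "0 \<le> t" for t
    proof -
      have "(exp (m * t))\<^sup>2 = exp (2 * m * t)" by (simp add: power2_eq_square flip: exp_add)
      then have "(norm (Q (\<delta> t)) * exp (m * t))\<^sup>2 \<le> (norm (Q (\<delta> 0)))\<^sup>2"
        using dec[OF t] by (simp add: b_def power_mult_distrib)
      then have "norm (Q (\<delta> t)) * exp (m * t) \<le> norm (Q (\<delta> 0))" by (rule power2_le_imp_le) simp
      then have "norm (Q (\<delta> t)) \<le> norm (Q (\<delta> 0)) * exp (- (m * t))"
        by (simp add: exp_minus divide_inverse[symmetric] pos_le_divide_eq)
      moreover have "norm (P (\<delta> t)) \<le> norm (Q (\<delta> t))" using True t ab(2)[of t] by simp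
      ultimately show ?thesis using nd[of t] by simp
    qed
    then have ev: "\<forall>\<^sub>F t in at_top. norm (\<delta> t) \<le> 2 * norm (Q (\<delta> 0)) * exp (- (m * t))"
      by (rule eventually_mono[OF eventually_ge_at_top[of 0]])
    have "filterlim (\<lambda>t. m * t) at_top at_top"
      by (rule filterlim_tendsto_pos_mult_at_top[OF tendsto_const m filterlim_ident])
    then have "filterlim (\<lambda>t. - (m * t)) at_bot at_top" by (simp add: filterlim_uminus_at_top)
    from filterlim_compose[OF exp_at_bot this]
    have "((\<lambda>t. 2 * norm (Q (\<delta> 0)) * exp (- (m * t))) \<longlongrightarrow> 0) at_top" by (rule tendsto_mult_right_zero)
    from Lim_null_comparison[OF ev this] show ?thesis .
  next
    case False
    then obtain t0 where t0: "0 \<le> t0" "b t0 < a t0" by (auto simp: not_le)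
    have \<delta>0: "\<delta> t0 \<noteq> 0"
    proof
      assume "\<delta> t0 = 0"
      then have "a t0 = 0" by (simp add: a_def P_def coord_proj_def vec_eq_iff)
      then show False using t0(2) by (simp add: b_def)
    qed
    \<comment> \<open>Gronwall's inequality along the reversed orbit: a zero at \<open>t\<close>
      would force a zero at \<open>t0\<close>.\<close>
    have nz: "\<delta> t \<noteq> 0" if t: "t0 \<le> t" for t
    proof
      assume z: "\<delta> t = 0"
      have "norm (\<delta> (t - (t - t0))) \<le> exp (L * (t - t0)) * norm (\<delta> (t - 0))"
      proof (rule gronwall_norm)
        fix s assume s: "s \<in> {0..t - t0}"
        have "((\<lambda>s. \<delta> (t - s)) has_vector_derivative (- 1) *\<^sub>R X (t - s)) (at s within {0..t - t0})"
        proof (rule vector_diff_chain_within[of "\<lambda>s. t - s" "- 1" s "{0..t - t0}" \<delta> "X (t - s)", unfolded o_def])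
          show "((-) t has_vector_derivative - 1) (at s within {0..t - t0})"
            by (auto intro!: derivative_eq_intros)
          have "(\<delta> has_vector_derivative X (t - s)) (at (t - s) within {0..})" using s t0(1) by (intro der) auto
          then show "(\<delta> has_vector_derivative X (t - s)) (at (t - s) within (-) t ` {0..t - t0})"
            by (rule has_vector_derivative_within_subset) (use t0(1) in auto)
        qed
        then show "((\<lambda>s. \<delta> (t - s)) has_vector_derivative - X (t - s)) (at s within {0..t - t0})" by simp
        show "norm (- X (t - s)) \<le> L * norm (\<delta> (t - s))" using lip[of "t - s"] s t0(1) by simp
      qed (use t in simp)
      then show False using z \<delta>0 by simp
    qed
    \<comment> \<open>The cone is forward invariant: where \<open>a = b\<close> both are positive,
      since \<delta> does not vanish, and then \<open>a - b\<close> has a positive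
      derivative.\<close>
    have dom: "b t \<le> a t" if t: "t0 \<le> t" for t
    proof -
      have "0 \<le> a t - b t"
      proof (rule stays_above_level[OF t])
        show "0 \<le> a t0 - b t0" using t0 by simp
        have D: "((\<lambda>s. a s - b s) has_real_derivative 2 * (P (\<delta> s) \<bullet> X s) - 2 * (Q (\<delta> s) \<bullet> X s)) (at s within {t0..t})"
          if "s \<in> {t0..t}" for s
          using that t0(1) by (intro DERIV_diff da db) auto
        then show "continuous_on {t0..t} (\<lambda>s. a s - b s)" by (rule DERIV_continuous_on)
        fix s assume s: "s \<in> {t0..<t}" "a s - b s = 0"
        have "0 < norm (\<delta> s)" using nz[of s] s by simp
        then have "a s \<noteq> 0" using nd[of s] s(2) by (auto simp: a_def b_def)
        then have "0 < a s" by (simp add: a_def)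
        moreover have "m * a s \<le> P (\<delta> s) \<bullet> X s" using cu[of s] ab(1)[of s] s t0(1) by (simp add: a_def)
        moreover have "Q (\<delta> s) \<bullet> X s \<le> - m * b s" using cs[of s] ab(2)[of s] s t0(1) by (simp add: b_def)
        moreover have "0 < m * a s" using m \<open>0 < a s\<close> by simp
        ultimately have "0 < 2 * (P (\<delta> s) \<bullet> X s) - 2 * (Q (\<delta> s) \<bullet> X s)" using s(2) by simp
        moreover have "s \<in> {t0..t}" using s by simp
        ultimately show "\<exists>d>0. ((\<lambda>s. a s - b s) has_real_derivative d) (at s within {t0..t})" using D by blast
      qed
      then show ?thesis by simp
    qed
    have grow: "m * a t \<le> P (\<delta> t) \<bullet> X t" if "t0 \<le> t" for t
      using cu[of t] dom[OF that] ab(1)[of t] that t0(1) by (simp add: a_def)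
    have incr: "a t0 + h * (t - t0) \<le> a t" if t: "t0 \<le> t" and h: "\<And>s. t0 \<le> s \<Longrightarrow> h \<le> 2 * m * a s" for t h
    proof -
      have "h * (t - t0) - a t \<le> h * (t0 - t0) - a t0"
      proof (rule within_deriv_nonpos_imp_le[OF t])
        fix s assume s: "s \<in> {t0..t}"
        show "((\<lambda>s. h * (s - t0) - a s) has_real_derivative h - 2 * (P (\<delta> s) \<bullet> X s)) (at s within {t0..t})"
          using s t0(1) by (auto intro!: derivative_eq_intros da)
        show "h - 2 * (P (\<delta> s) \<bullet> X s) \<le> 0" using grow[of s] h[of s] s by simp
      qed
      then show ?thesis by simp
    qed
    have a0: "0 < a t0" using t0(2) by (smt (verit) b_def zero_le_power2)
    have "a t0 \<le> a t" if "t0 \<le> t" for t using incr[OF that, of 0] m by (simp add: a_def)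
    then have "2 * m * a t0 \<le> 2 * m * a s" if "t0 \<le> s" for s using m that by simp
    note lin = incr[OF _ this]
    \<comment> \<open>From \<open>t0\<close> on, \<open>a\<close> grows at least at the constant
      rate \<open>2 * m * a t0\<close>; by this time it has passed \<open>R\<^sup>2\<close>, against
      the bound on \<delta>.\<close>
    define t where "t = t0 + (R\<^sup>2 + 1) / (2 * m * a t0)"
    have pos: "0 < 2 * m * a t0" using m a0 by simp
    have t: "t0 \<le> t" unfolding t_def using pos by simp
    have "2 * m * a t0 * (t - t0) = R\<^sup>2 + 1" using m a0 by (simp add: t_def)
    then have "R\<^sup>2 < a t" using lin[OF t] a0 by simp
    moreover have "norm (P (\<delta> t)) \<le> R" using bd[of t] t t0(1) norm_coord_proj_le[of S "\<delta> t"] unfolding P_def by linarith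
    then have "a t \<le> R\<^sup>2" unfolding a_def by (rule power_mono) simp
    ultimately show ?thesis by simp
  qed
qed

context fs_cone_block
begin

lemma lhat_equilibrium:
  assumes v: "v \<in> lbox D"
  shows "fst (lhat v) = G v - G (hz (snd v), snd v)" "lhat (hz (snd v), snd v) = 0"
proof -
  have y: "snd v \<in> {b_ylo D..b_yhi D}" using v by (auto simp: lbox_def)
  show "fst (lhat v) = G v - G (hz (snd v), snd v)" using hz(2)[OF y] v by (simp add: lhat_eq G_def)
  show "lhat (hz (snd v), snd v) = 0"
    using hz[OF y] by (simp add: lhat_eq prod_eq_iff snd_lfield flip: G_def)
qed

text \<open>The factor \<open>c\<close> treats forward and backward orbits at once. The orbit is
  compared with the constant solution \<open>(hz y, y)\<close>, which has the same slow value, so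
  that \<open>cone_G\<close> applies to the difference.\<close>

lemma trapped_orbit_converges:
  assumes sol: "solves (\<lambda>v. c *\<^sub>R lhat v) \<gamma> {0..}" and c: "c = 1 \<or> c = -1"
    and box: "\<And>t. 0 \<le> t \<Longrightarrow> \<gamma> t \<in> lbox D" and y: "\<And>t. 0 \<le> t \<Longrightarrow> snd (\<gamma> t) = y"
  shows "((\<lambda>t. fst (\<gamma> t)) \<longlongrightarrow> hz y) at_top"
proof -
  obtain L B where L: "\<And>v w. norm (lhat v - lhat w) \<le> L * norm (v - w)" using lhat_lipschitz_bounded by metis
  obtain m where m: "m > 0" "\<And>z1 z2 y. (z1, y) \<in> lbox D \<Longrightarrow> (z2, y) \<in> lbox D \<Longrightarrow> cone_rel m (z1 - z2) (G (z1, y) - G (z2, y))"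
    using cone_G by blast
  have yY: "y \<in> {b_ylo D..b_yhi D}" using box[of 0] y[of 0] by (auto simp: lbox_def)
  have \<gamma>eq: "\<gamma> t = (fst (\<gamma> t), y)" if "0 \<le> t" for t using y[OF that] by (simp add: prod_eq_iff)
  let ?\<delta> = "\<lambda>t. fst (\<gamma> t) - hz y" and ?X = "\<lambda>t. c *\<^sub>R fst (lhat (\<gamma> t))"
  obtain R where R: "\<And>v. v \<in> lbox D \<Longrightarrow> norm v \<le> R"
    using compact_imp_bounded[OF lbox_compact[of D]] by (auto simp: bounded_iff)
  have der: "(?\<delta> has_vector_derivative ?X t) (at t within {0..})" if "0 \<le> t" for t
  proof -
    have "(\<gamma> has_vector_derivative c *\<^sub>R lhat (\<gamma> t)) (at t within {0..})" using sol that by (simp add: solves_def)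
    from bounded_linear.has_vector_derivative[OF bounded_linear_fst this]
    have "((\<lambda>t. fst (\<gamma> t)) has_vector_derivative ?X t) (at t within {0..})" by simp
    from has_vector_derivative_diff[OF this has_vector_derivative_const] show ?thesis by simp
  qed
  have bd: "norm (?\<delta> t) \<le> R + norm (hz y)" if "0 \<le> t" for t
  proof -
    have "norm (fst (\<gamma> t)) \<le> R"
      using R[OF box[OF that]] norm_fst_le[of "fst (\<gamma> t)" "snd (\<gamma> t)"] by simp
    then show ?thesis using norm_triangle_ineq4[of "fst (\<gamma> t)" "hz y"] by linarith
  qed
  define H where "H t = G (fst (\<gamma> t), y) - G (hz y, y)" for t
  have X: "?X t = c *\<^sub>R H t" if "0 \<le> t" for t
    using lhat_equilibrium(1)[OF box[OF that]] unfolding y[OF that] \<gamma>eq[OF that, symmetric] H_def by simp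
  have lip: "norm (?X t) \<le> L * norm (?\<delta> t)" if "0 \<le> t" for t
  proof -
    have "lhat (hz y, y) = 0" using lhat_equilibrium(2)[OF box[OF that]] unfolding y[OF that] .
    then have "norm (lhat (\<gamma> t)) \<le> L * norm (\<gamma> t - (hz y, y))" using L[of "\<gamma> t" "(hz y, y)"] by simp
    moreover have "norm (\<gamma> t - (hz y, y)) = norm (?\<delta> t)" by (subst \<gamma>eq[OF that]) (simp add: norm_Pair)
    moreover have "norm (?X t) \<le> norm (lhat (\<gamma> t))"
      using c norm_fst_le[of "fst (lhat (\<gamma> t))" "snd (lhat (\<gamma> t))"] by auto
    ultimately show ?thesis by simp
  qed
  have cone: "cone_rel m (?\<delta> t) (H t)" if "0 \<le> t" for t
    unfolding H_def by (rule m(2)[OF _ hz(1)[OF yY]]) (use box[OF that] \<gamma>eq[OF that] in simp)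
  \<comment> \<open>Reversal turns contraction of the \<open>Q\<close> part into expansion; for
    \<open>c = -1\<close> the convergence lemma is therefore applied with stable and unstable
    directions exchanged.\<close>
  have rev: "m * (norm (Q (?\<delta> t)))\<^sup>2 \<le> - (Q (?\<delta> t) \<bullet> H t)"
    if "0 \<le> t" "norm (P (?\<delta> t)) \<le> norm (Q (?\<delta> t))" for t
    using cone[OF that(1)] that(2) by (simp add: cone_rel_def)
  have "(?\<delta> \<longlongrightarrow> 0) at_top"
    using c
  proof
    assume c: "c = 1"
    show ?thesis
      by (rule bounded_orbit_in_cones_converges[where S = "b_unst D", OF der bd lip m(1)])
        (use cone X c in \<open>simp_all add: cone_rel_def\<close>)
  next
    assume c: "c = -1"
    show ?thesis
      by (rule bounded_orbit_in_cones_converges[where S = "- b_unst D", OF der bd lip m(1)])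
        (use cone rev X c in \<open>simp_all add: cone_rel_def\<close>)
  qed
  from tendsto_add[OF this tendsto_const[of "hz y"]] show ?thesis by simp
qed

end

section \<open>The heteroclinic orbits\<close>

context fs_block_at
begin

text \<open>The counterpart of \<open>transition\<close> for a frozen slow variable: \<phi> compares
  the unstable coordinate after time \<open>k\<close> with the middle of its interval, and the
  parameter set \<open>C\<close> of \<open>covering_lift\<close> is a single point. The function
  \<Lambda> is returned rather than one of its zeros, because \<open>backward_stay\<close> has
  further equations to solve along with it.\<close>

lemma forward_stay:
  fixes pos :: "real \<Rightarrow> 'b::real_normed_vector \<Rightarrow> (real^'n) \<times> real"
  assumes eps: "\<epsilon> = 0" and u: "b_unst D = {u}" and \<kappa>: "block_coords D \<kappa>"
    and cov: "covers N F (block_hset D \<kappa> \<psi>)"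
    and B: "convex B" "B \<noteq> {}" "continuous_on B \<omega>" "\<omega> ` B \<subseteq> ecball (h_s N)"
    and pos: "\<And>p b. p \<in> {-1..1} \<Longrightarrow> b \<in> B \<Longrightarrow> inv_into (h_amb N) (h_chart N) (line_pt p, \<omega> b) = pos p b"
    and k: "0 \<le> k"
  obtains \<sigma> and \<Lambda> :: "real \<times> 'b \<Rightarrow> real" where "\<sigma> = 1 \<or> \<sigma> = (-1::real)" "continuous_on ({-1..1} \<times> B) \<Lambda>"
    "\<And>b. b \<in> B \<Longrightarrow> \<Lambda> (1, b) = \<sigma> \<and> \<Lambda> (-1, b) = - \<sigma>"
    "\<And>p b s. p \<in> {-1..1} \<Longrightarrow> b \<in> B \<Longrightarrow> \<Lambda> (p, b) = 0 \<Longrightarrow> F (pos p b) \<in> block_set D \<and>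
      (\<forall>s\<in>{0..k}. lflow s (lcoord D (F (pos p b))) \<in> lbox D)"
proof -
  let ?M = "block_hset D \<kappa> \<psi>"
  define mid where "mid = (b_lo D $ u + b_hi D $ u) / 2"
  \<comment> \<open>With half the width as scale, a coordinate at or beyond an end of the interval
    is cut off to exactly -1 or 1, as required on the exit boundary.\<close>
  define half where "half = (b_hi D $ u - b_lo D $ u) / 2"
  have half: "0 < half" using lo_less_hi[of u] by (simp add: half_def)
  have mh: "mid + half = b_hi D $ u" "mid - half = b_lo D $ u" by (simp_all add: mid_def half_def field_simps)
  define e where "e w = (fst (lflow k (lclamp D (lcoord D w))) $ u - mid) / half" for w
  define \<phi> where "\<phi> = (\<lambda>(w, t :: real). clamp_real (-1) 1 (e w))"
  have cl: "continuous_on UNIV (lclamp D)"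
    by (rule lipschitz_on_continuous_on[of 1]) (auto simp: lipschitz_on_def dist_norm lclamp_dist)
  have "continuous_on UNIV (lcoord D)"
    unfolding lcoord_def case_prod_beta by (intro continuous_on_Pair continuous_on_fast_coord continuous_on_fst continuous_on_snd continuous_on_id)
  then have "continuous_on UNIV (\<lambda>w. lclamp D (lcoord D w))" by (rule continuous_on_compose2[OF cl]) simp
  then have "continuous_on UNIV (\<lambda>w. (k, lclamp D (lcoord D w)))" by (intro continuous_on_Pair continuous_on_const)
  then have "continuous_on UNIV (\<lambda>w. (\<lambda>(t, z). lflow t z) (k, lclamp D (lcoord D w)))"
    by (rule continuous_on_compose2[OF lflow(3)]) (use k in auto)
  then have ce: "continuous_on UNIV e" unfolding e_def prod.case using half
    by (intro continuous_on_divide continuous_on_diff continuous_on_component continuous_on_fst continuous_on_const) auto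
  have "continuous_on (UNIV \<times> {0::real}) (\<lambda>x. e (fst x))"
    by (rule continuous_on_compose2[OF ce continuous_on_fst[OF continuous_on_id]]) simp
  then have c\<phi>: "continuous_on (UNIV \<times> {0::real}) \<phi>"
    unfolding \<phi>_def clamp_real_def case_prod_beta
    by (intro continuous_on_max continuous_on_min continuous_on_const)
  have bd: "\<bar>\<phi> (w, t)\<bar> \<le> 1" for w t
    using clamp_real_in[of "-1" 1 "e w"] by (auto simp: \<phi>_def abs_le_iff)
  obtain cu where cu: "cu > 0" "\<And>z s t. 0 \<le> s \<Longrightarrow> s \<le> t \<Longrightarrow>
    (b_hi D $ u \<le> fst (lflow s z) $ u \<longrightarrow> b_hi D $ u + cu * (t - s) \<le> fst (lflow t z) $ u) \<and>
    (fst (lflow s z) $ u \<le> b_lo D $ u \<longrightarrow> fst (lflow t z) $ u \<le> b_lo D $ u - cu * (t - s))"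
    using lflow_unstable_exit[of u] u by auto
  obtain \<tau> where \<tau>: "\<tau> = 1 \<or> \<tau> = -1" "\<And>x y. fast_coord D x \<in> block_box D \<Longrightarrow> \<bar>fst (\<kappa> (x, y)) 0\<bar> = 1 \<Longrightarrow>
    fast_coord D x $ u = b_hi D $ u \<and> fst (\<kappa> (x, y)) 0 = \<tau> \<or> fast_coord D x $ u = b_lo D $ u \<and> fst (\<kappa> (x, y)) 0 = - \<tau>"
    using block_coords_face[OF \<kappa> u box_ne] by blast
  have M: "h_u ?M = 1" "h_amb ?M = UNIV" "h_set ?M = block_set D" by (simp_all add: block_hset_def u)
  have face: "\<phi> (w, t) = \<tau> * fst (h_chart ?M w) 0"
    if w: "w \<in> h_set ?M" and "t \<in> {0}" and one: "\<bar>fst (h_chart ?M w) 0\<bar> = 1" for w t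
  proof -
    obtain x y where xy: "w = (x, y)" by force
    have lb: "lcoord D w \<in> lbox D" using w by (simp add: M mem_block_set_iff)
    then have bx: "fast_coord D x \<in> block_box D" by (simp add: xy lcoord_def lbox_def)
    have ch: "fst (h_chart ?M w) = fst (\<kappa> (x, y))" by (simp add: block_hset_def xy case_prod_beta)
    have su: "fst (lflow 0 (lclamp D (lcoord D w))) $ u = fast_coord D x $ u"
      using lb by (simp add: lflow(1) lclamp_id xy lcoord_def)
    have ck: "0 \<le> cu * k" using cu(1) k by simp
    from \<tau>(2)[OF bx one[unfolded ch]] show ?thesis
    proof (elim disjE conjE)
      assume hi: "fast_coord D x $ u = b_hi D $ u" "fst (\<kappa> (x, y)) 0 = \<tau>"
      then have "b_hi D $ u + cu * (k - 0) \<le> fst (lflow k (lclamp D (lcoord D w))) $ u"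
        using cu(2)[OF order_refl k, of "lclamp D (lcoord D w)"] su by simp
      then have "half \<le> fst (lflow k (lclamp D (lcoord D w))) $ u - mid" using ck mh by simp
      then have "1 \<le> e w" using half by (simp add: e_def)
      then show ?thesis using \<tau>(1) by (auto simp: \<phi>_def clamp_real_ge ch hi)
    next
      assume lo: "fast_coord D x $ u = b_lo D $ u" "fst (\<kappa> (x, y)) 0 = - \<tau>"
      then have "fst (lflow k (lclamp D (lcoord D w))) $ u \<le> b_lo D $ u - cu * (k - 0)"
        using cu(2)[OF order_refl k, of "lclamp D (lcoord D w)"] su by simp
      then have "fst (lflow k (lclamp D (lcoord D w))) $ u - mid \<le> - 1 * half" using ck mh by simp
      then have "e w \<le> - 1" unfolding e_def using half by (subst pos_divide_le_eq) auto
      then show ?thesis using \<tau>(1) by (auto simp: \<phi>_def clamp_real_le ch lo)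
    qed
  qed
  have ct: "convex {0::real}" "{0::real} \<noteq> {}" by simp_all
  obtain \<sigma> \<Lambda> where \<sigma>: "\<sigma> = 1 \<or> \<sigma> = (-1::real)" and \<Lambda>: "continuous_on ({-1..1} \<times> B \<times> {0::real}) \<Lambda>"
    "\<And>b t. b \<in> B \<Longrightarrow> t \<in> {0} \<Longrightarrow> \<Lambda> (1, b, t) = \<sigma> \<and> \<Lambda> (-1, b, t) = - \<sigma>"
    "\<And>p b t. p \<in> {-1..1} \<Longrightarrow> b \<in> B \<Longrightarrow> t \<in> {0} \<Longrightarrow> \<bar>\<Lambda> (p, b, t)\<bar> < 1 \<Longrightarrow>
      F (inv_into (h_amb N) (h_chart N) (line_pt p, \<omega> b)) \<in> h_set ?M \<and>
      \<phi> (F (inv_into (h_amb N) (h_chart N) (line_pt p, \<omega> b)), t) = \<Lambda> (p, b, t)"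
    by (rule covering_lift[OF cov M(1,2) B ct c\<phi> bd \<tau>(1) face]) (assumption | rule that)+
  show thesis
  proof (rule that[OF \<sigma>, of "\<lambda>(p, b). \<Lambda> (p, b, 0)"])
    have "continuous_on ({-1..1} \<times> B) (\<lambda>x. (fst x, snd x, 0 :: real))"
      by (intro continuous_on_Pair continuous_on_fst continuous_on_snd continuous_on_id continuous_on_const)
    note c\<Lambda> = continuous_on_compose2[OF \<Lambda>(1) this]
    show "continuous_on ({-1..1} \<times> B) (\<lambda>(p, b). \<Lambda> (p, b, 0))"
      unfolding case_prod_beta by (rule c\<Lambda>) auto
    show "(case (1, b) of (p, b) \<Rightarrow> \<Lambda> (p, b, 0)) = \<sigma> \<and> (case (- 1, b) of (p, b) \<Rightarrow> \<Lambda> (p, b, 0)) = - \<sigma>" if "b \<in> B" for b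
      using \<Lambda>(2)[OF that, of 0] by simp
    fix p b assume pb: "p \<in> {-1..1::real}" "b \<in> B" and "(case (p, b) of (p, b) \<Rightarrow> \<Lambda> (p, b, 0)) = 0"
    then have z: "\<Lambda> (p, b, 0) = 0" by simp
    let ?z = "lcoord D (F (pos p b))"
    have in_D: "F (pos p b) \<in> block_set D" and "\<phi> (F (pos p b), 0) = 0"
      using \<Lambda>(3)[OF pb, of 0] z by (simp_all add: pos[OF pb] M)
    then have "clamp_real (-1) 1 (e (F (pos p b))) = 0" by (simp add: \<phi>_def)
    then have "e (F (pos p b)) = 0" by (auto simp: clamp_real_def max_def min_def split: if_splits)
    moreover have zb: "?z \<in> lbox D" using in_D by (simp add: mem_block_set_iff)
    ultimately have "fst (lflow k ?z) $ u = mid" using half by (simp add: e_def lclamp_id)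
    then have "fst (lflow k ?z) $ u \<in> {b_lo D $ u..b_hi D $ u}" using mh half by auto
    from lflow_in_box[OF u zb k this]
    have "lflow s ?z \<in> lbox D" if "s \<in> {0..k}" for s
      using that zb lflow_slow_const(1)[OF eps] by (auto simp: lbox_def)
    then show "F (pos p b) \<in> block_set D \<and> (\<forall>s\<in>{0..k}. lflow s ?z \<in> lbox D)" using in_D by blast
  qed
qed

text \<open>Under reversal the unstable coordinate stays in its interval, while the stable ones are
  repelled by their faces. So the stable coordinates of the face point can be tuned until the
  reversed orbit is at mid-height in all of them at time \<open>k\<close>, and then it has not
  crossed a stable face before. The slow parameter is left for the equation
  \<open>\<Lambda> = 0\<close>.\<close>

lemma backward_stay:
  fixes \<Lambda> :: "real \<times> (real^'n) \<Rightarrow> real"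
  assumes eps: "\<epsilon> = 0" and u: "b_unst D = {u}" and a: "a = b_lo D $ u \<or> a = b_hi D $ u"
    and yF: "continuous_on {-1..1} yF" "\<And>p. p \<in> {-1..1} \<Longrightarrow> yF p \<in> {b_ylo D..b_yhi D}"
    and \<Lambda>: "continuous_on ({-1..1} \<times> block_box D) \<Lambda>" "\<And>b. b \<in> block_box D \<Longrightarrow> \<Lambda> (1, b) = \<sigma> \<and> \<Lambda> (-1, b) = - \<sigma>"
    and \<sigma>: "\<sigma> = 1 \<or> \<sigma> = (-1::real)" and k: "0 \<le> k"
  shows "\<exists>p\<in>{-1..1}. \<exists>b\<in>block_box D. \<Lambda> (p, b) = 0 \<and>
    (\<forall>s\<in>{0..k}. lrev s (\<chi> i. if i = u then a else b $ i, yF p) \<in> lbox D)"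
proof -
  define J :: "'n option set" where "J = UNIV - {Some u}"
  define l where "l j = (case j of None \<Rightarrow> -1 | Some i \<Rightarrow> b_lo D $ i)" for j :: "'n option"
  define h where "h j = (case j of None \<Rightarrow> 1 | Some i \<Rightarrow> b_hi D $ i)" for j :: "'n option"
  define X where "X = {x :: 'n option \<Rightarrow> real. \<forall>j\<in>J. x j \<in> {l j..h j}}"
  define bb where "bb x = (\<chi> i. if i = u then b_lo D $ i else x (Some i))" for x :: "'n option \<Rightarrow> real"
  define st where "st p b = (\<chi> i. if i = u then a else b $ i, yF p)" for p and b :: "real^'n"
  define mid where "mid i = (b_lo D $ i + b_hi D $ i) / 2" for i
  define E where "E x j = (case j of None \<Rightarrow> \<sigma> * \<Lambda> (x None, bb x)
    | Some i \<Rightarrow> fst (lrev k (st (x None) (bb x))) $ i - mid i)" for x j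
  have mid: "b_lo D $ i < mid i" "mid i < b_hi D $ i" for i using lo_less_hi[of i] by (simp_all add: mid_def)
  have J: "None \<in> J" "Some i \<in> J \<longleftrightarrow> i \<noteq> u" for i by (auto simp: J_def)
  have XD: "x None \<in> {-1..1}" "bb x \<in> block_box D" if "x \<in> X" for x
  proof -
    have *: "x j \<in> {l j..h j}" if "j \<in> J" for j using \<open>x \<in> X\<close> that by (simp add: X_def)
    show "x None \<in> {-1..1}" using *[OF J(1)] by (simp add: l_def h_def)
    have "b_lo D $ i \<le> bb x $ i \<and> bb x $ i \<le> b_hi D $ i" for i
    proof (cases "i = u")
      case False
      then show ?thesis using *[of "Some i"] by (simp add: J bb_def l_def h_def)
    qed (use lo_le_hi(1)[of i] in \<open>simp add: bb_def\<close>)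
    then show "bb x \<in> block_box D" by (simp add: block_box_def)
  qed
  have stD: "st p b \<in> lbox D" if "p \<in> {-1..1}" "b \<in> block_box D" for p b
    using that yF(2)[OF that(1)] a lo_le_hi(1)[of u] by (auto simp: st_def lbox_def block_box_def)
  have coord: "continuous_on X (\<lambda>x. x j)" for j
    by (rule continuous_on_apply_coord[OF continuous_on_id])
  have cbb: "continuous_on X bb" unfolding bb_def
  proof (rule continuous_on_vec_lambda)
    fix i show "continuous_on X (\<lambda>x. if i = u then b_lo D $ i else x (Some i))"
      by (cases "i = u") (simp_all add: coord)
  qed
  have cL: "continuous_on X (\<lambda>x. \<Lambda> (x None, bb x))"
    by (rule continuous_on_compose2[OF \<Lambda>(1) continuous_on_Pair[OF coord cbb]]) (use XD in auto)
  have cst: "continuous_on X (\<lambda>x. st (x None) (bb x))"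
    unfolding st_def
  proof (rule continuous_on_Pair[OF continuous_on_vec_lambda])
    show "continuous_on X (\<lambda>x. if i = u then a else bb x $ i)" for i
      by (cases "i = u") (simp_all add: continuous_on_component[OF cbb])
    show "continuous_on X (\<lambda>x. yF (x None))"
      by (rule continuous_on_compose2[OF yF(1) coord]) (use XD in auto)
  qed
  have "continuous_on X (\<lambda>x. (\<lambda>(t, z). lrev t z) (k, st (x None) (bb x)))"
    by (rule continuous_on_compose2[OF lrev(3) continuous_on_Pair[OF continuous_on_const cst]]) (use k in auto)
  then have crev: "continuous_on X (\<lambda>x. lrev k (st (x None) (bb x)))" by simp
  have comp: "fst (st p b) $ i = (if i = u then a else b $ i)" for p b i by (simp add: st_def)
  have "\<exists>x\<in>X. \<forall>j\<in>J. E x j = 0"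
    unfolding X_def
  proof (rule poincare_miranda, unfold X_def[symmetric])
    show "finite J" by simp
    show "l j < h j" for j using lo_less_hi by (cases j) (simp_all add: l_def h_def)
    show "continuous_on X (\<lambda>x. E x j)" for j
      by (cases j) (simp_all add: E_def continuous_on_mult_left cL continuous_on_diff continuous_on_component continuous_on_fst crev)
  next
    fix x j assume x: "x \<in> X" "j \<in> J" "x j = l j"
    show "E x j \<le> 0"
    proof (cases j)
      case None
      then have "x None = -1" using x(3) by (simp add: l_def)
      then show ?thesis using \<Lambda>(2)[OF XD(2)[OF x(1)]] \<sigma> by (auto simp: E_def None)
    next
      case (Some i)
      then have "i \<noteq> u" "x (Some i) = b_lo D $ i" using x by (simp_all add: J l_def)
      then have "fst (lrev 0 (st (x None) (bb x))) $ i \<le> b_lo D $ i" by (simp add: lrev(1) comp bb_def)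
      from lrev_stable_exit(2)[OF _ order_refl k this] show ?thesis
        using \<open>i \<noteq> u\<close> u mid(1)[of i] by (simp add: E_def Some)
    qed
  next
    fix x j assume x: "x \<in> X" "j \<in> J" "x j = h j"
    show "0 \<le> E x j"
    proof (cases j)
      case None
      then have "x None = 1" using x(3) by (simp add: h_def)
      then show ?thesis using \<Lambda>(2)[OF XD(2)[OF x(1)]] \<sigma> by (auto simp: E_def None)
    next
      case (Some i)
      then have "i \<noteq> u" "x (Some i) = b_hi D $ i" using x by (simp_all add: J h_def)
      then have "b_hi D $ i \<le> fst (lrev 0 (st (x None) (bb x))) $ i" by (simp add: lrev(1) comp bb_def)
      from lrev_stable_exit(1)[OF _ order_refl k this] show ?thesis
        using \<open>i \<noteq> u\<close> u mid(2)[of i] by (simp add: E_def Some)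
    qed
  qed
  then obtain x where x: "x \<in> X" "\<And>j. j \<in> J \<Longrightarrow> E x j = 0" by blast
  let ?z = "st (x None) (bb x)"
  have z: "?z \<in> lbox D" by (rule stD[OF XD[OF x(1)]])
  have "\<Lambda> (x None, bb x) = 0" using x(2)[OF J(1)] \<sigma> by (auto simp: E_def)
  moreover have "lrev s ?z \<in> lbox D" if s: "s \<in> {0..k}" for s
  proof -
    have "b_lo D $ i \<le> fst (lrev s ?z) $ i \<and> fst (lrev s ?z) $ i \<le> b_hi D $ i" for i
    proof (cases "i = u")
      case True
      then show ?thesis using lrev_unstable_in[of i s ?z] z s u by (auto simp: lbox_def block_box_def)
    next
      case False
      then have end_eq: "fst (lrev k ?z) $ i = mid i" using x(2)[of "Some i"] J by (simp add: E_def)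
      have "i \<notin> b_unst D" "0 \<le> s" "s \<le> k" using False u s by auto
      from lrev_stable_exit[OF this, of ?z] show ?thesis using mid[of i] end_eq by linarith
    qed
    then show ?thesis using lflow_slow_const(2)[OF eps, of s ?z] s z by (auto simp: lbox_def block_box_def mem_Times_iff)
  qed
  ultimately show ?thesis using XD[OF x(1)] unfolding st_def by blast
qed

end

text \<open>At a fixed time \<open>s\<close> all but finitely many of the chosen points satisfy the
  condition, and it passes to the limit because \<open>C\<close> is closed.\<close>

lemma compact_common_point:
  fixes \<Phi> :: "real \<Rightarrow> 'a::metric_space \<Rightarrow> 'b::topological_space"
  assumes K: "compact K" and cont: "\<And>s. 0 \<le> s \<Longrightarrow> continuous_on K (\<Phi> s)" and C: "closed C"
    and ex: "\<And>k::nat. \<exists>x\<in>K. \<forall>s\<in>{0..real k}. \<Phi> s x \<in> C"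
  shows "\<exists>x\<in>K. \<forall>s\<ge>0. \<Phi> s x \<in> C"
proof -
  have "\<forall>k. \<exists>x. x \<in> K \<and> (\<forall>s\<in>{0..real k}. \<Phi> s x \<in> C)" using ex by blast
  from choice[OF this] obtain X where X: "\<And>k. X k \<in> K" "\<And>k s. s \<in> {0..real k} \<Longrightarrow> \<Phi> s (X k) \<in> C" by blast
  obtain x \<theta> where x: "x \<in> K" "strict_mono \<theta>" "(X \<circ> \<theta>) \<longlonglongrightarrow> x"
    using K X(1) unfolding compact_def by blast
  have "\<Phi> s x \<in> C" if s: "0 \<le> s" for s
  proof (rule Lim_in_closed_set[OF C _ sequentially_bot])
    show "(\<lambda>n. \<Phi> s ((X \<circ> \<theta>) n)) \<longlonglongrightarrow> \<Phi> s x"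
      by (rule continuous_on_tendsto_compose[OF cont[OF s] x(3,1)]) (simp add: X(1))
    obtain k where k: "s \<le> real k" using real_arch_simple by blast
    have "\<Phi> s ((X \<circ> \<theta>) n) \<in> C" if "n \<ge> k" for n
    proof -
      have "real k \<le> real (\<theta> n)" using seq_suble[OF x(2), of n] that by simp
      then show ?thesis using X(2)[of s "\<theta> n"] s k by simp
    qed
    then show "\<forall>\<^sub>F n in sequentially. \<Phi> s ((X \<circ> \<theta>) n) \<in> C" by (rule eventually_sequentiallyI)
  qed
  then show ?thesis using x(1) by blast
qed

context fs_system
begin

text \<open>The function \<Lambda> of \<open>forward_stay\<close> is one of the equations solved in
  \<open>backward_stay\<close>, so for each \<open>k\<close> a single point of the face has both
  properties, and so has a limit point for all times.\<close>

lemma trapped_start: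
  assumes s: "fs_block_at f g r \<epsilon>0 I D' 0" and t: "fs_block_at f g r \<epsilon>0 I D 0"
    and src: "face_param D' N u' a' yF' \<omega>'" and u: "b_unst D = {u}"
    and data: "target_data f g 0 T N D \<kappa> \<psi> q yS yF"
  shows "\<exists>w\<in>h_set N. \<forall>s\<ge>0. fs_block_at.lflow f g D 0 s (lcoord D (flow (fs_field f g 0) T w)) \<in> lbox D \<and>
    fs_block_at.lrev f g D' 0 s (lcoord D' w) \<in> lbox D'"
proof -
  interpret s: fs_block_at f g r \<epsilon>0 I D' 0 by (rule s)
  interpret t: fs_block_at f g r \<epsilon>0 I D 0 by (rule t)
  let ?F = "flow (fs_field f g 0) T" and ?K = "{-1..1::real} \<times> block_box D'" and ?pos = "face_pos D' u' a' yF'"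
  have sp: "b_unst D' = {u'}" "a' = b_lo D' $ u' \<or> a' = b_hi D' $ u'" "continuous_on {-1..1} yF'"
    "\<And>p. p \<in> {-1..1} \<Longrightarrow> yF' p \<in> {b_ylo D'..b_yhi D'}"
    "continuous_on (block_box D') \<omega>'" "\<omega>' ` block_box D' \<subseteq> ecball (h_s N)"
    using src by (auto simp: face_param_def intro: less_imp_le)
  have pos: "?pos p b \<in> h_set N" "inv_into (h_amb N) (h_chart N) (line_pt p, \<omega>' b) = ?pos p b"
    if "p \<in> {-1..1}" "b \<in> block_box D'" for p b
    using src that unfolding face_param_def by blast+
  have \<kappa>: "block_coords D \<kappa>" and cov: "covers N ?F (block_hset D \<kappa> \<psi>)"
    using data unfolding target_data_def by blast+
  define \<Phi> where "\<Phi> s x = (t.lflow s (lcoord D (?F (?pos (fst x) (snd x)))), s.lrev s (lcoord D' (?pos (fst x) (snd x))))"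
    for s and x :: "real \<times> (real^'n)"
  have "\<exists>x\<in>?K. \<forall>s\<ge>0. \<Phi> s x \<in> lbox D \<times> lbox D'"
  proof (rule compact_common_point)
    have "block_box D' = cbox (b_lo D') (b_hi D')" by (auto simp: block_box_def mem_box_cart)
    then show "compact ?K" by (intro compact_Times) simp_all
    show "closed (lbox D \<times> lbox D')" by (intro closed_Times compact_imp_closed lbox_compact)
    fix s :: real assume s0: "0 \<le> s"
    have cp: "continuous_on ?K (\<lambda>x. ?pos (fst x) (snd x))"
      using continuous_on_face_pos[OF sp(3)] by (simp add: case_prod_beta)
    have cF: "continuous_on (h_set N) ?F" using cov by (simp add: covers_def)
    have cc: "continuous_on UNIV (lcoord B)" for B :: "'n fs_block"
      unfolding lcoord_def case_prod_beta by (intro continuous_on_Pair continuous_on_fast_coord continuous_on_fst continuous_on_snd continuous_on_id)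
    have c1: "continuous_on ?K (\<lambda>x. lcoord D (?F (?pos (fst x) (snd x))))"
      by (rule continuous_on_compose2[OF cc continuous_on_compose2[OF cF cp]]) (use pos in auto)
    have c2: "continuous_on ?K (\<lambda>x. lcoord D' (?pos (fst x) (snd x)))"
      by (rule continuous_on_compose2[OF cc cp]) simp
    have "continuous_on ?K (\<lambda>x. (\<lambda>(s, z). t.lflow s z) (s, lcoord D (?F (?pos (fst x) (snd x)))))"
      by (rule continuous_on_compose2[OF t.lflow(3) continuous_on_Pair[OF continuous_on_const c1]]) (use s0 in auto)
    moreover have "continuous_on ?K (\<lambda>x. (\<lambda>(s, z). s.lrev s z) (s, lcoord D' (?pos (fst x) (snd x))))"
      by (rule continuous_on_compose2[OF s.lrev(3) continuous_on_Pair[OF continuous_on_const c2]]) (use s0 in auto)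
    ultimately show "continuous_on ?K (\<Phi> s)" unfolding \<Phi>_def[abs_def] prod.case by (rule continuous_on_Pair)
  next
    fix k :: nat
    have k: "0 \<le> real k" by simp
    obtain \<sigma> \<Lambda> where \<Lambda>: "\<sigma> = 1 \<or> \<sigma> = (-1::real)" "continuous_on ?K \<Lambda>"
      "\<And>b. b \<in> block_box D' \<Longrightarrow> \<Lambda> (1, b) = \<sigma> \<and> \<Lambda> (-1, b) = - \<sigma>"
      "\<And>p b s. p \<in> {-1..1} \<Longrightarrow> b \<in> block_box D' \<Longrightarrow> \<Lambda> (p, b) = 0 \<Longrightarrow> ?F (?pos p b) \<in> block_set D \<and>
        (\<forall>s\<in>{0..real k}. t.lflow s (lcoord D (?F (?pos p b))) \<in> lbox D)"
      by (rule t.forward_stay[OF refl u \<kappa> cov block_box_convex s.box_ne sp(5,6) pos(2) k]) (assumption | rule that)+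
    obtain p b where pb: "p \<in> {-1..1}" "b \<in> block_box D'" "\<Lambda> (p, b) = 0"
      "\<forall>s\<in>{0..real k}. s.lrev s (\<chi> i. if i = u' then a' else b $ i, yF' p) \<in> lbox D'"
      using s.backward_stay[OF refl sp(1,2,3,4) \<Lambda>(2,3,1) k] by blast
    have "lcoord D' (?pos p b) = (\<chi> i. if i = u' then a' else b $ i, yF' p)" by (simp add: face_pos_def)
    then show "\<exists>x\<in>?K. \<forall>s\<in>{0..real k}. \<Phi> s x \<in> lbox D \<times> lbox D'"
      using pb \<Lambda>(4)[OF pb(1,2,3)] by (intro bexI[of _ "(p, b)"]) (auto simp: \<Phi>_def)
  qed
  then obtain p b where "p \<in> {-1..1}" "b \<in> block_box D'" "\<And>s. 0 \<le> s \<Longrightarrow> \<Phi> s (p, b) \<in> lbox D \<times> lbox D'"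
    by auto
  then show ?thesis using pos(1) by (intro bexI[of _ "?pos p b"]) (auto simp: \<Phi>_def)
qed

lemma heteroclinic_orbit:
  assumes s: "fs_cone_block f g r \<epsilon>0 I D' lA' mB'" and t: "fs_cone_block f g r \<epsilon>0 I D lA mB"
    and src: "face_param D' N u' a' yF' \<omega>'" and u: "b_unst D = {u}"
    and data: "target_data f g 0 T N D \<kappa> \<psi> q yS yF"
  shows "\<exists>x y p q. solves (\<lambda>z. f z y 0) x UNIV \<and> (x \<longlongrightarrow> p) at_bot \<and> (p, y) \<in> slow_curve f D' \<and>
    (x \<longlongrightarrow> q) at_top \<and> (q, y) \<in> slow_curve f D \<and> range (\<lambda>t. (x t, y)) \<inter> h_set N \<noteq> {}"
proof -
  interpret s: fs_cone_block f g r \<epsilon>0 I D' lA' mB' by (rule s)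
  interpret t: fs_cone_block f g r \<epsilon>0 I D lA mB by (rule t)
  let ?V = "fs_field f g 0" and ?F = "flow (fs_field f g 0) T"
  have T: "0 < T" "\<And>w. w \<in> h_set N \<Longrightarrow> flow_defined ?V T w" using data unfolding target_data_def by blast+
  obtain w where w: "w \<in> h_set N" "\<And>s. 0 \<le> s \<Longrightarrow> t.lflow s (lcoord D (?F w)) \<in> lbox D"
    "\<And>s. 0 \<le> s \<Longrightarrow> s.lrev s (lcoord D' w) \<in> lbox D'"
    using trapped_start[OF s.fs_block_at_axioms t.fs_block_at_axioms src u data] by blast
  define \<beta> where "\<beta> s = s.lrev s (lcoord D' w)" for s
  define \<phi> where "\<phi> s = t.lflow s (lcoord D (?F w))" for s
  have \<beta>: "solves (\<lambda>v. - s.lhat v) \<beta> {0..}" "\<beta> 0 = lcoord D' w" "\<And>s. 0 \<le> s \<Longrightarrow> \<beta> s \<in> lbox D'"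
    "\<And>s. 0 \<le> s \<Longrightarrow> snd (\<beta> s) = snd w"
    using s.lrev(2) w(3) s.lflow_slow_const(2)[OF refl]
    by (simp_all add: \<beta>_def[abs_def] s.lrev(1)) (simp add: lcoord_def case_prod_beta)
  have \<phi>: "solves t.lhat \<phi> {0..}" "\<phi> 0 = lcoord D (?F w)" "\<And>s. 0 \<le> s \<Longrightarrow> \<phi> s \<in> lbox D"
    "\<And>s. 0 \<le> s \<Longrightarrow> snd (\<phi> s) = snd (?F w)"
    using t.lflow(2) w(2) t.lflow_slow_const(1)[OF refl]
    by (simp_all add: \<phi>_def[abs_def] t.lflow(1)) (simp add: lcoord_def case_prod_beta)
  have "(0::real) \<in> {0..\<epsilon>0}" using \<epsilon>0 by simp
  from flow_eqI[OF field_lipschitz'[OF this] less_imp_le[OF T(1)] T(2)[OF w(1)]]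
  obtain \<mu> where \<mu>: "solves ?V \<mu> {0..T}" "\<mu> 0 = w" "\<mu> T = ?F w" by auto
  \<comment> \<open>Time 0 is the point on the exit face: before it the backward orbit in the block
    \<open>D'\<close>, after it the flight of length \<open>T\<close>, then the forward orbit in
    \<open>D\<close>.\<close>
  define \<Gamma> where "\<Gamma> t = (if t \<le> 0 then lpos D' (\<beta> (- t)) else if t \<le> T then \<mu> t else lpos D (\<phi> (t - T)))" for t
  have "solves ?V \<Gamma> {..0}"
  proof (rule solves_transform)
    show "\<Gamma> t = lpos D' (\<beta> (- t))" if "t \<in> {..0}" for t using that by (simp add: \<Gamma>_def)
    have "solves (\<lambda>z. - ?V z) (\<lambda>t. lpos D' (\<beta> t)) {0..}" by (rule s.lpos_solves_rev[OF \<beta>(1)]) (simp add: \<beta>(3))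
    from solves_reverse[OF this] show "solves ?V (\<lambda>t. lpos D' (\<beta> (- t))) {..0}" by simp
  qed
  moreover have "solves ?V \<Gamma> {0..T}"
  proof (rule solves_transform[OF _ \<mu>(1)])
    show "\<Gamma> t = \<mu> t" if "t \<in> {0..T}" for t using that \<mu>(2) \<beta>(2) by (auto simp: \<Gamma>_def)
  qed
  moreover have "solves ?V \<Gamma> {T..}"
  proof (rule solves_transform)
    show "\<Gamma> t = lpos D (\<phi> (t - T))" if "t \<in> {T..}" for t using that \<mu>(3) \<phi>(2) T(1) by (auto simp: \<Gamma>_def)
    have "solves ?V (\<lambda>t. lpos D (\<phi> t)) {0..}" by (rule t.lpos_solves[OF \<phi>(1)]) (simp add: \<phi>(3))
    from solves_shift[OF this, of "- T"] have "solves ?V (\<lambda>t. lpos D (\<phi> (t - T))) ((\<lambda>t. t + T) ` {0..})" by simp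
    moreover have "{T..} \<subseteq> (\<lambda>t. t + T) ` {0..}"
    proof
      fix t assume "t \<in> {T..}"
      then show "t \<in> (\<lambda>t. t + T) ` {0..}" by (intro image_eqI[of _ _ "t - T"]) auto
    qed
    ultimately show "solves ?V (\<lambda>t. lpos D (\<phi> (t - T))) {T..}" by (rule solves_subset)
  qed
  ultimately have "solves ?V \<Gamma> ({..0} \<union> ({0..T} \<union> {T..}))" by (intro solves_union closed_Un) simp_all
  moreover have "{..0} \<union> ({0..T} \<union> {T..}) = UNIV" by auto
  ultimately have sol: "(\<Gamma> has_vector_derivative ?V (\<Gamma> t)) (at t)" for t by (simp add: solves_def)
  define y where "y = snd w"
  define x where "x t = fst (\<Gamma> t)" for t
  have \<Gamma>0: "\<Gamma> 0 = w" using \<beta>(2) by (simp add: \<Gamma>_def)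
  have snd\<Gamma>: "snd (\<Gamma> t) = y" for t
  proof -
    have "((\<lambda>t. snd (\<Gamma> t)) has_real_derivative 0) (at t)" for t
      using bounded_linear.has_vector_derivative[OF bounded_linear_snd sol[of t]]
      by (simp add: fs_field_def case_prod_beta has_real_derivative_iff_has_vector_derivative)
    then have "snd (\<Gamma> t) = snd (\<Gamma> 0)" using DERIV_isconst_all[of "\<lambda>t. snd (\<Gamma> t)" t 0] by blast
    then show ?thesis by (simp add: \<Gamma>0 y_def)
  qed
  have "snd (?F w) = y" using snd\<Gamma>[of T] T(1) \<mu>(3) by (simp add: \<Gamma>_def)
  then have \<phi>y: "snd (\<phi> s) = y" if "0 \<le> s" for s using \<phi>(4)[OF that] by simp
  have "snd (\<phi> 0) \<in> {b_ylo D..b_yhi D}" "snd (\<beta> 0) \<in> {b_ylo D'..b_yhi D'}"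
    using \<phi>(3)[of 0] \<beta>(3)[of 0] by (auto simp: lbox_def)
  then have yY: "y \<in> {b_ylo D..b_yhi D}" "y \<in> {b_ylo D'..b_yhi D'}"
    using \<phi>y[of 0] \<beta>(4)[of 0] by (simp_all add: y_def)
  have xsol: "solves (\<lambda>z. f z y 0) x UNIV"
    unfolding solves_def
  proof
    fix t
    show "(x has_vector_derivative f (x t) y 0) (at t)"
      using bounded_linear.has_vector_derivative[OF bounded_linear_fst sol[of t]]
      by (simp add: fs_field_def case_prod_beta x_def[abs_def] snd\<Gamma>)
  qed
  have cfp: "continuous_on UNIV (fast_pos B)" for B :: "'n fs_block"
    by (rule continuous_on_fast_pos[OF continuous_on_id])
  have fp: "((\<lambda>s. fast_pos B (h s)) \<longlongrightarrow> fast_pos B l) F'" if "(h \<longlongrightarrow> l) F'" for B :: "'n fs_block" and h :: "real \<Rightarrow> real^'n" and l F'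
    by (rule continuous_on_tendsto_compose[OF cfp that]) auto
  have top: "(x \<longlongrightarrow> fast_pos D (t.hz y)) at_top"
  proof -
    have "((\<lambda>s. fst (\<phi> s)) \<longlongrightarrow> t.hz y) at_top"
      by (rule t.trapped_orbit_converges[of 1, OF _ _ \<phi>(3) \<phi>y]) (simp_all add: \<phi>(1))
    moreover have "filterlim (\<lambda>t. t - T) at_top at_top"
      using filterlim_tendsto_add_at_top[OF tendsto_const[of "- T"] filterlim_ident] by simp
    ultimately have "((\<lambda>t. fst (\<phi> (t - T))) \<longlongrightarrow> t.hz y) at_top" by (rule filterlim_compose)
    from fp[OF this] show ?thesis
    proof (rule Lim_transform_eventually)
      show "\<forall>\<^sub>F t in at_top. fast_pos D (fst (\<phi> (t - T))) = x t"
        using eventually_gt_at_top[of T]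
        by (rule eventually_mono) (use T(1) in \<open>simp add: x_def \<Gamma>_def lpos_def case_prod_beta\<close>)
    qed
  qed
  have bot: "(x \<longlongrightarrow> fast_pos D' (s.hz y)) at_bot"
    unfolding filterlim_at_bot_mirror
  proof -
    have "((\<lambda>s. fst (\<beta> s)) \<longlongrightarrow> s.hz y) at_top"
      by (rule s.trapped_orbit_converges[of "-1", OF _ _ \<beta>(3)]) (simp_all add: \<beta>(1) \<beta>(4) y_def)
    from fp[OF this] show "((\<lambda>t. x (- t)) \<longlongrightarrow> fast_pos D' (s.hz y)) at_top"
    proof (rule Lim_transform_eventually)
      show "\<forall>\<^sub>F t in at_top. fast_pos D' (fst (\<beta> t)) = x (- t)"
        using eventually_ge_at_top[of 0]
        by (rule eventually_mono) (simp add: x_def \<Gamma>_def lpos_def case_prod_beta)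
    qed
  qed
  have "(x 0, y) = w" by (simp add: x_def \<Gamma>0 y_def)
  then have "range (\<lambda>t. (x t, y)) \<inter> h_set N \<noteq> {}" using w(1) by (intro ex_in_conv[THEN iffD1] exI[of _ w] IntI range_eqI[of _ _ 0]) simp_all
  moreover have "(fast_pos D' (s.hz y), y) \<in> slow_curve f D'" "(fast_pos D (t.hz y), y) \<in> slow_curve f D"
    using yY by (auto simp: s.slow_curve_eq t.slow_curve_eq)
  ultimately show ?thesis using xsol top bot by blast
qed

lemma pair_cone_block:
  assumes "covering_exchange_pair f g \<epsilon>0 0 T N D Ma"
  shows "\<exists>lA mB. fs_cone_block f g r \<epsilon>0 I D lA mB"
proof -
  have "(0::real) \<in> {0..\<epsilon>0}" using \<epsilon>0 by simp
  from pair_block[OF this assms] have "fs_block_at f g r \<epsilon>0 I D 0" .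
  moreover obtain lA mB where "spectral_bounds D lA mB" "unstable_cone_condition f g \<epsilon>0 D lA mB"
    "stable_cone_condition f g \<epsilon>0 D lA mB"
    using assms unfolding covering_exchange_pair_def by (elim conjE exE) (rule that)
  ultimately show ?thesis unfolding fs_cone_block_def fs_cone_block_axioms_def by blast
qed

lemma heteroclinic_chain:
  fixes S :: "nat \<Rightarrow> 'n fs_block" and F :: "nat \<Rightarrow> ((real^'n) \<times> real) hset" and T :: "nat \<Rightarrow> real"
  assumes pairs: "\<And>j. j \<le> \<rho> \<Longrightarrow>
     covering_exchange_pair f g \<epsilon>0 0 (T (cyc_pred \<rho> j)) (F (cyc_pred \<rho> j)) (S j) (F j)"
  shows "\<exists>(x :: nat \<Rightarrow> real \<Rightarrow> real^'n) (y :: nat \<Rightarrow> real) (p :: nat \<Rightarrow> real^'n) (q :: nat \<Rightarrow> real^'n).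
        \<forall>j\<le>\<rho>.
          solves (\<lambda>z. f z (y j) 0) (x j) UNIV \<and>
          (x j \<longlongrightarrow> p j) at_bot \<and> (p j, y j) \<in> block_set (S j) \<and> f (p j) (y j) 0 = 0 \<and>
          (x j \<longlongrightarrow> q j) at_top \<and> (q j, y j) \<in> block_set (S (cyc_succ \<rho> j)) \<and>
          f (q j) (y j) 0 = 0 \<and>
          range (\<lambda>t. (x j t, y j)) \<inter> h_set (F j) \<noteq> {} \<and>
          normally_hyperbolic_slow_curve f g (S j) \<and>
          (p j, y j) \<in> slow_curve f (S j) \<and>
          (q j, y j) \<in> slow_curve f (S (cyc_succ \<rho> j))"
proof -
  let ?s = "cyc_succ \<rho>"
  have z: "(0::real) \<in> {0..\<epsilon>0}" using \<epsilon>0 by simp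
  define H where "H j x y p q \<longleftrightarrow> solves (\<lambda>z. f z y 0) x UNIV \<and> (x \<longlongrightarrow> p) at_bot \<and> (p, y) \<in> slow_curve f (S j) \<and>
    (x \<longlongrightarrow> q) at_top \<and> (q, y) \<in> slow_curve f (S (?s j)) \<and> range (\<lambda>t. (x t, y)) \<inter> h_set (F j) \<noteq> {}" for j x y p q
  have "\<exists>x y p q. H j x y p q"
    if j: "j \<le> \<rho>" for j
  proof -
    note pr = pairs[OF cyc_pred_succ(3)[OF j], unfolded cyc_pred_succ(1)[OF j]]
    obtain lA' mB' where c': "fs_cone_block f g r \<epsilon>0 I (S j) lA' mB'" using pair_cone_block[OF pairs[OF j]] by blast
    obtain lA mB where c: "fs_cone_block f g r \<epsilon>0 I (S (?s j)) lA mB" using pair_cone_block[OF pr] by blast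
    obtain u' a' yF' \<omega>' where fp': "face_param (S j) (F j) u' a' yF' \<omega>'" using pair_data[OF z pairs[OF j]] by blast
    obtain u a yF \<omega> \<kappa> \<psi> q yS where fp: "face_param (S (?s j)) (F (?s j)) u a yF \<omega>"
      and td: "target_data f g 0 (T j) (F j) (S (?s j)) \<kappa> \<psi> q yS yF" using pair_data[OF z pr] by blast
    have "b_unst (S (?s j)) = {u}" using fp by (simp add: face_param_def)
    from heteroclinic_orbit[OF c' c fp' this td] show ?thesis unfolding H_def .
  qed
  then have "\<forall>j. \<exists>x y p q. j \<le> \<rho> \<longrightarrow> H j x y p q" by blast
  from choice[OF this] obtain x where "\<forall>j. \<exists>y p q. j \<le> \<rho> \<longrightarrow> H j (x j) y p q" by (rule exE)
  from choice[OF this] obtain y where "\<forall>j. \<exists>p q. j \<le> \<rho> \<longrightarrow> H j (x j) (y j) p q" by (rule exE)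
  from choice[OF this] obtain p where "\<forall>j. \<exists>q. j \<le> \<rho> \<longrightarrow> H j (x j) (y j) (p j) q" by (rule exE)
  from choice[OF this] obtain q where H: "\<forall>j. j \<le> \<rho> \<longrightarrow> H j (x j) (y j) (p j) (q j)" by (rule exE)
  have curve: "(z, t) \<in> block_set D" "f z t 0 = 0" if "(z, t) \<in> slow_curve f D" for z t and D :: "'n fs_block"
    using that by (auto simp: slow_curve_def)
  show ?thesis
  proof (rule exI[of _ x], rule exI[of _ y], rule exI[of _ p], rule exI[of _ q], intro allI impI)
    fix j assume j: "j \<le> \<rho>"
    obtain lA mB where "fs_cone_block f g r \<epsilon>0 I (S j) lA mB" using pair_cone_block[OF pairs[OF j]] by blast
    then have nh: "normally_hyperbolic_slow_curve f g (S j)" by (rule fs_cone_block.normally_hyperbolic_curve)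
    have h: "solves (\<lambda>z. f z (y j) 0) (x j) UNIV" "(x j \<longlongrightarrow> p j) at_bot" "(p j, y j) \<in> slow_curve f (S j)"
      "(x j \<longlongrightarrow> q j) at_top" "(q j, y j) \<in> slow_curve f (S (?s j))" "range (\<lambda>t. (x j t, y j)) \<inter> h_set (F j) \<noteq> {}"
      using mp[OF spec[OF H] j] unfolding H_def by - (elim conjE, assumption)+
    show "solves (\<lambda>z. f z (y j) 0) (x j) UNIV \<and>
          (x j \<longlongrightarrow> p j) at_bot \<and> (p j, y j) \<in> block_set (S j) \<and> f (p j) (y j) 0 = 0 \<and>
          (x j \<longlongrightarrow> q j) at_top \<and> (q j, y j) \<in> block_set (S (?s j)) \<and>
          f (q j) (y j) 0 = 0 \<and>
          range (\<lambda>t. (x j t, y j)) \<inter> h_set (F j) \<noteq> {} \<and>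
          normally_hyperbolic_slow_curve f g (S j) \<and>
          (p j, y j) \<in> slow_curve f (S j) \<and>
          (q j, y j) \<in> slow_curve f (S (?s j))"
      by (intro conjI h nh curve[OF h(3)] curve[OF h(5)])
  qed
qed

end

theorem theorem5p1:
  fixes f :: "real^'n::finite \<Rightarrow> real \<Rightarrow> real \<Rightarrow> real^'n"
    and g :: "real^'n \<Rightarrow> real \<Rightarrow> real \<Rightarrow> real"
    and fi :: "nat \<Rightarrow> real^'n \<Rightarrow> real \<Rightarrow> real^'n"
    and gi :: "nat \<Rightarrow> real^'n \<Rightarrow> real \<Rightarrow> real"
    and r m \<rho> :: nat
    and \<epsilon>0 :: real
    and I :: "real set"
    and S :: "real \<Rightarrow> nat \<Rightarrow> 'n fs_block"
    and F :: "real \<Rightarrow> nat \<Rightarrow> ((real^'n) \<times> real) hset"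
    and T :: "real \<Rightarrow> nat \<Rightarrow> real"
  assumes "1 \<le> r"
    and "0 < \<epsilon>0" and "open I" and "{0..\<epsilon>0} \<subseteq> I"
    and "Ck_on r (\<lambda>(x, y, \<epsilon>). f x y \<epsilon>) (UNIV \<times> UNIV \<times> I)"
    and "Ck_on r (\<lambda>(x, y, \<epsilon>). g x y \<epsilon>) (UNIV \<times> UNIV \<times> I)"
    and "\<And>x y. (\<lambda>\<epsilon>. norm (f x y \<epsilon> - (fi 0 x y + (\<Sum>i=1..m. \<epsilon> ^ i *\<^sub>R fi i x y))))
           \<in> o[at_right 0](\<lambda>\<epsilon>. \<epsilon> ^ m)"
    and "\<And>x y. (\<lambda>\<epsilon>. g x y \<epsilon> - (gi 0 x y + (\<Sum>i=1..m. \<epsilon> ^ i * gi i x y)))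
           \<in> o[at_right 0](\<lambda>\<epsilon>. \<epsilon> ^ m)"
    and "\<exists>x y. fi 0 x y \<noteq> 0" and "\<exists>x y. gi 0 x y \<noteq> 0"
    and "\<And>\<epsilon> j. \<epsilon> \<in> {0..\<epsilon>0} \<Longrightarrow> j \<le> \<rho> \<Longrightarrow>
           covering_exchange_pair f g \<epsilon>0 \<epsilon>
             (T \<epsilon> (cyc_pred \<rho> j)) (F \<epsilon> (cyc_pred \<rho> j)) (S \<epsilon> j) (F \<epsilon> j)"
  shows
    "(\<forall>\<epsilon> \<in> {0<..\<epsilon>0}. \<exists>\<Gamma> P (tf :: nat \<Rightarrow> real) (ts :: nat \<Rightarrow> real).
        periodic_orbit (fs_field f g \<epsilon>) \<Gamma> P \<and>
        0 < tf 0 \<and> (\<forall>j<\<rho>. tf j < ts (j + 1) \<and> ts (j + 1) < tf (j + 1)) \<and>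
        tf \<rho> < ts 0 \<and> ts 0 = P \<and>
        \<Gamma> P = \<Gamma> 0 \<and> \<Gamma> 0 \<in> h_set (F \<epsilon> 0) \<and>
        (\<forall>j<\<rho>. \<Gamma> ` {tf j..ts (j + 1)} \<subseteq> block_set (S \<epsilon> (j + 1)) \<and>
                 \<Gamma> (ts (j + 1)) \<in> h_set (F \<epsilon> (j + 1))) \<and>
        \<Gamma> ` {tf \<rho>..P} \<subseteq> block_set (S \<epsilon> 0))
     \<and>
     (\<exists>(x :: nat \<Rightarrow> real \<Rightarrow> real^'n) (y :: nat \<Rightarrow> real) (p :: nat \<Rightarrow> real^'n) (q :: nat \<Rightarrow> real^'n).
        \<forall>j\<le>\<rho>.
          solves (\<lambda>z. f z (y j) 0) (x j) UNIV \<and>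
          (x j \<longlongrightarrow> p j) at_bot \<and> (p j, y j) \<in> block_set (S 0 j) \<and> f (p j) (y j) 0 = 0 \<and>
          (x j \<longlongrightarrow> q j) at_top \<and> (q j, y j) \<in> block_set (S 0 (cyc_succ \<rho> j)) \<and>
          f (q j) (y j) 0 = 0 \<and>
          range (\<lambda>t. (x j t, y j)) \<inter> h_set (F 0 j) \<noteq> {} \<and>
          normally_hyperbolic_slow_curve f g (S 0 j) \<and>
          (p j, y j) \<in> slow_curve f (S 0 j) \<and>
          (q j, y j) \<in> slow_curve f (S 0 (cyc_succ \<rho> j)))"
proof -
  interpret fs_system f g r \<epsilon>0 I by unfold_locales (use assms(1-6) in auto)
  show ?thesis
  proof (intro conjI ballI)
    fix \<epsilon> assume eps: "\<epsilon> \<in> {0<..\<epsilon>0}"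
    then have "\<epsilon> \<in> {0..\<epsilon>0}" by simp
    from periodic_orbit_through_blocks[OF eps, of \<rho> "T \<epsilon>" "F \<epsilon>" "S \<epsilon>", OF assms(11)[OF this]]
    show "\<exists>\<Gamma> P (tf :: nat \<Rightarrow> real) (ts :: nat \<Rightarrow> real).
        periodic_orbit (fs_field f g \<epsilon>) \<Gamma> P \<and>
        0 < tf 0 \<and> (\<forall>j<\<rho>. tf j < ts (j + 1) \<and> ts (j + 1) < tf (j + 1)) \<and>
        tf \<rho> < ts 0 \<and> ts 0 = P \<and>
        \<Gamma> P = \<Gamma> 0 \<and> \<Gamma> 0 \<in> h_set (F \<epsilon> 0) \<and>
        (\<forall>j<\<rho>. \<Gamma> ` {tf j..ts (j + 1)} \<subseteq> block_set (S \<epsilon> (j + 1)) \<and>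
                 \<Gamma> (ts (j + 1)) \<in> h_set (F \<epsilon> (j + 1))) \<and>
        \<Gamma> ` {tf \<rho>..P} \<subseteq> block_set (S \<epsilon> 0)" .
  qed (rule heteroclinic_chain[of \<rho> "T 0" "F 0" "S 0"], rule assms(11), use \<epsilon>0 in auto)
qed

end
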